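(* Let $E\to M$ be a vector bundle, $m=\dim M$, $n=m+1$, and let $\mathcal{E}=\mathfrak{D}E\oplus\mathfrak{J}_{m+1}E$ be the higher omni-Lie algebroid of $E$. Let $Z$ be a section of $\wedge^mTM\otimes\operatorname{Hom}(\wedge^2E,E)$ and denote by $B_Z:\mathfrak{J}_{m+1}E\to\mathfrak{D}E$ the associated vector bundle map. Then the graph $$L=\{B_Z(\mu)+\mu:\mu\in\mathfrak{J}_{m+1}E\}\subset\mathcal{E}$$ is a maximal isotropic subbundle of $\mathcal{E}$, and every isotropic subbundle of $\mathcal{E}$ projecting isomorphically onto $\mathfrak{J}_{m+1}E$ arises in this way (for some section of $\wedge^mTM\otimes\operatorname{Hom}(\wedge^2E,E)$). Additionally, $L$ is involutive, hence a higher Dirac-Jacobi structure, if and only if $Z$ is a volume with values Lie algebras.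
   Context: Let $E\to M$ be a (smooth, real) vector bundle. A derivation of $E$ is an $\mathbb{R}$-linear operator $\mathfrak{d}:\Gamma(E)\to\Gamma(E)$ with $\mathfrak{d}(fu)=\sigma(\mathfrak{d})(f)\,u+f\,\mathfrak{d}u$ for all $f\in C^\infty(M)$, $u\in\Gamma(E)$, for some (unique) vector field $\sigma(\mathfrak{d})$, its symbol. Derivations are the sections of a vector bundle $\mathfrak{D}E\to M$, a Lie algebroid (the gauge algebroid) with bracket the commutator $[-,-]_{\mathfrak{D}}$ and surjective anchor $\sigma:\mathfrak{D}E\to TM$, whose kernel is $\mathfrak{gl}(E)$, the bundle of endomorphisms of $E$. Let $\Omega^k(\mathfrak{D}E,E)=\Gamma(\operatorname{Hom}(\wedge^k\mathfrak{D}E,E))$, with differential $$d_{\mathfrak D}\mu(\mathfrak{d}_0,\dots,\mathfrak{d}_k)=\sum_i(-1)^i\mathfrak{d}_i\big(\mu(\mathfrak{d}_0,\dots,\widehat{\mathfrak{d}_i},\dots,\mathfrak{d}_k)\big)+\sum_{i<j}(-1)^{i+j}\mu([\mathfrak{d}_i,\mathfrak{d}_j]_{\mathfrak D},\dots,\widehat{\mathfrak{d}_i},\dots,\widehat{\mathfrak{d}_j},\dots,\mathfrak{d}_k).$$ $\iota_{\mathfrak d}$ is contraction (insertion in the first slot) and $\mathcal{L}_{\mathfrak d}=\iota_{\mathfrak d}d_{\mathfrak D}+d_{\mathfrak D}\iota_{\mathfrak d}$ is the Lie derivative. For $\lambda\in\operatorname{Hom}(\wedge^kTM,E)$ put $\sigma^*\lambda=\lambda(\sigma-,\dots,\sigma-)$.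 $\mathfrak{J}_kE\subset\operatorname{Hom}(\wedge^k\mathfrak{D}E,E)$ is the subbundle of those $\mu$ for which there is (a necessarily unique) $\lambda_\mu\in\operatorname{Hom}(\wedge^{k-1}TM,E)$ with $\iota_\Phi\mu=\Phi\circ\sigma^*\lambda_\mu$ for all $\Phi\in\mathfrak{gl}(E)$ (so $\mathfrak{J}_0E=E$). The spaces $\Gamma(\mathfrak{J}_kE)$ are preserved by $d_{\mathfrak D}$, $\iota_{\mathfrak d}$ and $\mathcal{L}_{\mathfrak d}$. For a positive integer $n$, the higher omni-Lie algebroid is $\mathcal{E}=\mathfrak{D}E\oplus\mathfrak{J}_nE$ with the bracket on sections $$\{\mathfrak{d}+\mu,\mathfrak{r}+\nu\}=[\mathfrak{d},\mathfrak{r}]_{\mathfrak D}+\mathcal{L}_{\mathfrak d}\nu-\iota_{\mathfrak r}d_{\mathfrak D}\mu$$ and the $\mathfrak{J}_{n-1}E$-valued symmetric bilinear pairing $(\mathfrak{d}+\mu,\mathfrak{r}+\nu)_+=\tfrac12(\iota_{\mathfrak d}\nu+\iota_{\mathfrak r}\mu)$. A subbundle $L\subset\mathcal{E}$ is isotropic if $(e_1,e_2)_+=0$ for all $e_1,e_2\in L$; involutive if $\{e_1,e_2\}\in\Gamma(L)$ for all $e_1,e_2\in\Gamma(L)$. A maximal isotropic (with respect to inclusion among isotropic subbundles) and involutive subbundle is a higher Dirac-Jacobi structure. "Projecting isomorphically onto $\mathfrak{J}_nE$" means that the restriction to $L$ of the projection $\mathcal{E}\to\mathfrak{J}_nE$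 is a vector bundle isomorphism. The map $\Omega^m(M,E)\to\Gamma(\mathfrak{J}_{m+1}E)$, $\lambda\mapsto d_{\mathfrak D}\sigma^*\lambda$, is a $C^\infty(M)$-linear isomorphism (with inverse $\mu\mapsto\lambda_\mu$), hence comes from a vector bundle isomorphism $\wedge^mT^*M\otimes E\cong\mathfrak{J}_{m+1}E$. A section $Z$ of $\wedge^mTM\otimes\operatorname{Hom}(\wedge^2E,E)$ defines, for every top form $\Omega$ on $M$, a skew-symmetric bilinear bundle map $\langle\Omega,Z\rangle:\wedge^2E\to E$. The associated map $B_Z:\mathfrak{J}_{m+1}E\to\mathfrak{D}E$ is the one which, under the vector bundle isomorphism $\wedge^mT^*M\otimes E\cong\mathfrak{J}_{m+1}E$ given on sections by $\lambda\mapsto d_{\mathfrak D}\sigma^*\lambda$, sends $\Omega\otimes e\in\wedge^mT^*M\otimes E$ to the endomorphism $e'\mapsto\langle\Omega,Z\rangle(e,e')$, an element of $\mathfrak{gl}(E)\subset\mathfrak{D}E$. $Z$ is called a volume with values Lie algebras if, for every top form $\Omega\in\Omega^m(M)$, $\langle\Omega,Z\rangle$ gives $E$ the structure of a bundle of Lie algebras, i.e. it restricts to a Lie bracket on every fiber of $E$. *)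

theory Defs
  imports "HOL-Analysis.Analysis" "HOL-Library.Function_Algebras"
begin

section \<open>Linear algebra on carrier sets\<close>

text \<open>
  Tangent vectors, derivations at a point and forms at a point are functions, so their fibres are
  subspaces of function spaces with the pointwise operations. To make fibres honest sets of
  functions, all of them are extended by 0 outside their domain of definition.
\<close>

instantiation "fun" :: (type, real_vector) real_vector
begin

definition scaleR_fun :: "real \<Rightarrow> ('a \<Rightarrow> 'b) \<Rightarrow> 'a \<Rightarrow> 'b"
  where "scaleR_fun c f = (\<lambda>x. c *\<^sub>R f x)"

instance
  by standard
    (auto simp: scaleR_fun_def plus_fun_def scaleR_add_right scaleR_add_left)

end

definition linear_map_on :: "'a::real_vector set \<Rightarrow> ('a \<Rightarrow> 'b::real_vector) \<Rightarrow> bool"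
  where "linear_map_on S f \<longleftrightarrow>
    (\<forall>x\<in>S. \<forall>y\<in>S. \<forall>a b. f (a *\<^sub>R x + b *\<^sub>R y) = a *\<^sub>R f x + b *\<^sub>R f y)"

definition tuples :: "nat \<Rightarrow> 'a set \<Rightarrow> 'a list set"
  where "tuples k S = {xs. length xs = k \<and> set xs \<subseteq> S}"

text \<open>\<open>Hom(\<Lambda>\<^sup>k S, W)\<close> for subspaces \<open>S\<close> and \<open>W\<close>, as alternating multilinear maps; a
  \<open>k\<close>-tuple of arguments is a list of length \<open>k\<close>. For \<open>k = 0\<close> this is \<open>W\<close>, via \<open>\<mu> \<mapsto> \<mu> []\<close>.\<close>

definition alt_maps ::
    "nat \<Rightarrow> 'a::real_vector set \<Rightarrow> 'b::real_vector set \<Rightarrow> ('a list \<Rightarrow> 'b) set"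
  where "alt_maps k S W = {\<mu>.
    (\<forall>xs. xs \<notin> tuples k S \<longrightarrow> \<mu> xs = 0) \<and>
    (\<forall>xs\<in>tuples k S. \<mu> xs \<in> W) \<and>
    (\<forall>xs ys. set xs \<subseteq> S \<and> set ys \<subseteq> S \<and> length xs + 1 + length ys = k
       \<longrightarrow> linear_map_on S (\<lambda>x. \<mu> (xs @ x # ys))) \<and>
    (\<forall>xs\<in>tuples k S. \<not> distinct xs \<longrightarrow> \<mu> xs = 0)}"

definition skew_bilinear_on :: "'v::real_vector set \<Rightarrow> ('v \<Rightarrow> 'v \<Rightarrow> 'v) \<Rightarrow> bool"
  where "skew_bilinear_on V br \<longleftrightarrow>
    (\<forall>a\<in>V. \<forall>b\<in>V. br a b \<in> V) \<and>
    (\<forall>a\<in>V. linear_map_on V (br a)) \<and>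
    (\<forall>b\<in>V. linear_map_on V (\<lambda>a. br a b)) \<and>
    (\<forall>a\<in>V. \<forall>b\<in>V. br a b = - br b a)"

definition lie_bracket_on :: "'v::real_vector set \<Rightarrow> ('v \<Rightarrow> 'v \<Rightarrow> 'v) \<Rightarrow> bool"
  where "lie_bracket_on V br \<longleftrightarrow> skew_bilinear_on V br \<and>
    (\<forall>a\<in>V. \<forall>b\<in>V. \<forall>c\<in>V. br a (br b c) + br b (br c a) + br c (br a b) = 0)"


section \<open>Smooth manifolds\<close>

text \<open>\<open>C\<^sup>k\<close> functions on an open subset \<open>V\<close> of \<open>\<real>\<^sup>m\<close>, by continuous iterated partial derivatives.
  Here \<open>\<real>\<^sup>m\<close> is the topspace of \<^const>\<open>Euclidean_space\<close> \<open>m\<close>, which allows \<open>m = 0\<close>.\<close>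

primrec C_k_on :: "nat \<Rightarrow> nat \<Rightarrow> (nat \<Rightarrow> real) set \<Rightarrow> ((nat \<Rightarrow> real) \<Rightarrow> real) \<Rightarrow> bool"
  where
    "C_k_on 0 m V f \<longleftrightarrow> continuous_on V f"
  | "C_k_on (Suc k) m V f \<longleftrightarrow> continuous_on V f \<and>
      (\<forall>i<m. \<exists>g. C_k_on k m V g \<and>
        (\<forall>x\<in>V. ((\<lambda>t. f (x(i := t))) has_real_derivative g x) (at (x i))))"

definition smooth_on_Rm :: "nat \<Rightarrow> (nat \<Rightarrow> real) set \<Rightarrow> ((nat \<Rightarrow> real) \<Rightarrow> real) \<Rightarrow> bool"
  where "smooth_on_Rm m V f \<longleftrightarrow> (\<forall>k. C_k_on k m V f)"

text \<open>The underlying space of a manifold is a whole type, required to be Hausdorff and second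
  countable through its type class. A chart is a pair of its domain and the coordinate map.\<close>

record 'p mfd =
  mdim :: nat
  charts :: "('p set \<times> ('p \<Rightarrow> nat \<Rightarrow> real)) set"

definition smooth_manifold :: "('p::{t2_space,second_countable_topology}, 'z) mfd_scheme \<Rightarrow> bool"
  where "smooth_manifold M \<longleftrightarrow>
    \<Union> (fst ` charts M) = UNIV \<and>
    (\<forall>(U, \<phi>)\<in>charts M. open U \<and> openin (Euclidean_space (mdim M)) (\<phi> ` U) \<and>
       homeomorphic_map (top_of_set U) (subtopology (Euclidean_space (mdim M)) (\<phi> ` U)) \<phi>) \<and>
    (\<forall>(U, \<phi>)\<in>charts M. \<forall>(V, \<psi>)\<in>charts M. \<forall>i<mdim M.
       smooth_on_Rm (mdim M) (\<phi> ` (U \<inter> V)) (\<lambda>y. \<psi> (inv_into U \<phi> y) i))"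

definition smooth_fun :: "('p::topological_space, 'z) mfd_scheme \<Rightarrow> 'p set \<Rightarrow> ('p \<Rightarrow> real) set"
  where "smooth_fun M W = {f. \<forall>(U, \<phi>)\<in>charts M.
    smooth_on_Rm (mdim M) (\<phi> ` (U \<inter> W)) (\<lambda>y. f (inv_into U \<phi> y))}"

abbreviation C_inf :: "('p::topological_space, 'z) mfd_scheme \<Rightarrow> ('p \<Rightarrow> real) set"
  where "C_inf M \<equiv> smooth_fun M UNIV"

definition tangent_space ::
    "('p::topological_space, 'z) mfd_scheme \<Rightarrow> 'p \<Rightarrow> (('p \<Rightarrow> real) \<Rightarrow> real) set"
  where "tangent_space M x = {X.
    (\<forall>f. f \<notin> C_inf M \<longrightarrow> X f = 0) \<and> linear_map_on (C_inf M) X \<and>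
    (\<forall>f\<in>C_inf M. \<forall>g\<in>C_inf M. X (\<lambda>y. f y * g y) = X f * g x + f x * X g)}"

text \<open>The value at \<open>x\<close> of a vector field or of a derivation, both of which are operators
  on functions or sections.\<close>

definition at_pt :: "('u \<Rightarrow> 'p \<Rightarrow> 'w) \<Rightarrow> 'p \<Rightarrow> 'u \<Rightarrow> 'w"
  where "at_pt D x = (\<lambda>u. D u x)"

definition vector_fields ::
    "('p::topological_space, 'z) mfd_scheme \<Rightarrow> (('p \<Rightarrow> real) \<Rightarrow> 'p \<Rightarrow> real) set"
  where "vector_fields M = {X.
    (\<forall>x. at_pt X x \<in> tangent_space M x) \<and> (\<forall>f\<in>C_inf M. X f \<in> C_inf M)}"

definition diff_forms ::
    "('p::topological_space, 'z) mfd_scheme \<Rightarrow> nat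
       \<Rightarrow> ('p \<Rightarrow> (('p \<Rightarrow> real) \<Rightarrow> real) list \<Rightarrow> real) set"
  where "diff_forms M k = {\<omega>.
    (\<forall>x. \<omega> x \<in> alt_maps k (tangent_space M x) UNIV) \<and>
    (\<forall>Xs\<in>tuples k (vector_fields M). (\<lambda>x. \<omega> x (map (\<lambda>X. at_pt X x) Xs)) \<in> C_inf M)}"


section \<open>Vector bundles\<close>

text \<open>The fibres are subspaces of one real vector space \<open>'v\<close>, which carries no topology. The smooth
  structure is given by a family of local frames, i.e. of local trivializations, with smooth
  transition functions; the rank is the length of the frame and so is locally constant.\<close>

record ('p, 'v) vbundle = "'p mfd" +
  fibre :: "'p \<Rightarrow> 'v set"
  frames :: "('p set \<times> ('p \<Rightarrow> 'v) list) set"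

definition smooth_combination ::
    "('p::topological_space, 'v::real_vector) vbundle \<Rightarrow> 'p set \<Rightarrow> ('p \<Rightarrow> 'v) list
       \<Rightarrow> ('p \<Rightarrow> 'v) \<Rightarrow> bool"
  where "smooth_combination E W es s \<longleftrightarrow> (\<exists>c.
    (\<forall>j<length es. c j \<in> smooth_fun E W) \<and>
    (\<forall>x\<in>W. s x = (\<Sum>j<length es. c j x *\<^sub>R (es ! j) x)))"

definition is_basis :: "'a::real_vector list \<Rightarrow> 'a set \<Rightarrow> bool"
  where "is_basis bs V \<longleftrightarrow> distinct bs \<and> independent (set bs) \<and> span (set bs) = V"

definition smooth_vector_bundle ::
    "('p::{t2_space,second_countable_topology}, 'v::real_vector) vbundle \<Rightarrow> bool"
  where "smooth_vector_bundle E \<longleftrightarrow>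
    smooth_manifold E \<and>
    (\<forall>x. subspace (fibre E x)) \<and>
    \<Union> (fst ` frames E) = UNIV \<and>
    (\<forall>(U, es)\<in>frames E. open U \<and> (\<forall>x\<in>U. is_basis (map (\<lambda>s. s x) es) (fibre E x))) \<and>
    (\<forall>(U, es)\<in>frames E. \<forall>(V, fs)\<in>frames E. \<forall>s\<in>set es. smooth_combination E (U \<inter> V) fs s)"

definition sections_on ::
    "('p::topological_space, 'v::real_vector) vbundle \<Rightarrow> 'p set \<Rightarrow> ('p \<Rightarrow> 'v) set"
  where "sections_on E W = {s. (\<forall>x\<in>W. s x \<in> fibre E x) \<and>
    (\<forall>(U, es)\<in>frames E. smooth_combination E (U \<inter> W) es s)}"

abbreviation Gam :: "('p::topological_space, 'v::real_vector) vbundle \<Rightarrow> ('p \<Rightarrow> 'v) set"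
  where "Gam E \<equiv> sections_on E UNIV"


section \<open>The gauge algebroid\<close>

definition is_symbol_at ::
    "('p::topological_space, 'v::real_vector) vbundle \<Rightarrow> 'p \<Rightarrow> (('p \<Rightarrow> 'v) \<Rightarrow> 'v)
       \<Rightarrow> (('p \<Rightarrow> real) \<Rightarrow> real) \<Rightarrow> bool"
  where "is_symbol_at E x \<delta> X \<longleftrightarrow> X \<in> tangent_space E x \<and>
    (\<forall>f\<in>C_inf E. \<forall>u\<in>Gam E. \<delta> (\<lambda>y. f y *\<^sub>R u y) = X f *\<^sub>R u x + f x *\<^sub>R \<delta> u)"

text \<open>The fibre of \<open>\<DD>E\<close> at \<open>x\<close>.\<close>

definition gauge_fibre ::
    "('p::topological_space, 'v::real_vector) vbundle \<Rightarrow> 'p \<Rightarrow> (('p \<Rightarrow> 'v) \<Rightarrow> 'v) set"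
  where "gauge_fibre E x = {\<delta>.
    (\<forall>u. u \<notin> Gam E \<longrightarrow> \<delta> u = 0) \<and> (\<forall>u\<in>Gam E. \<delta> u \<in> fibre E x) \<and>
    linear_map_on (Gam E) \<delta> \<and> (\<exists>X. is_symbol_at E x \<delta> X)}"

text \<open>The symbol is unique where the fibre of \<open>E\<close> is nonzero.\<close>

definition symbol_at ::
    "('p::topological_space, 'v::real_vector) vbundle \<Rightarrow> 'p \<Rightarrow> (('p \<Rightarrow> 'v) \<Rightarrow> 'v)
       \<Rightarrow> ('p \<Rightarrow> real) \<Rightarrow> real"
  where "symbol_at E x \<delta> = (THE X. is_symbol_at E x \<delta> X)"

definition derivations ::
    "('p::topological_space, 'v::real_vector) vbundle \<Rightarrow> (('p \<Rightarrow> 'v) \<Rightarrow> 'p \<Rightarrow> 'v) set"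
  where "derivations E = {D.
    (\<forall>u. u \<notin> Gam E \<longrightarrow> D u = 0) \<and> (\<forall>u\<in>Gam E. D u \<in> Gam E) \<and>
    linear_map_on (Gam E) D \<and>
    (\<exists>X\<in>vector_fields E. \<forall>f\<in>C_inf E. \<forall>u\<in>Gam E.
       D (\<lambda>y. f y *\<^sub>R u y) = (\<lambda>y. X f y *\<^sub>R u y + f y *\<^sub>R D u y))}"

definition commutator ::
    "(('p \<Rightarrow> 'v) \<Rightarrow> 'p \<Rightarrow> 'v::real_vector) \<Rightarrow> (('p \<Rightarrow> 'v) \<Rightarrow> 'p \<Rightarrow> 'v) \<Rightarrow> ('p \<Rightarrow> 'v) \<Rightarrow> 'p \<Rightarrow> 'v"
  where "commutator D D' = (\<lambda>u. D (D' u) - D' (D u))"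

text \<open>Local sections of \<open>\<DD>E\<close>, as families of derivations at the points of \<open>W\<close>. The global ones
  are the families \<open>at_pt D\<close> for \<open>D\<close> in \<^const>\<open>derivations\<close>.\<close>

definition gauge_sections_on ::
    "('p::topological_space, 'v::real_vector) vbundle \<Rightarrow> 'p set
       \<Rightarrow> ('p \<Rightarrow> ('p \<Rightarrow> 'v) \<Rightarrow> 'v) set"
  where "gauge_sections_on E W = {d. (\<forall>x\<in>W. d x \<in> gauge_fibre E x) \<and>
    (\<forall>u\<in>Gam E. (\<lambda>x. d x u) \<in> sections_on E W)}"

definition endos :: "('p, 'v::real_vector) vbundle \<Rightarrow> 'p \<Rightarrow> ('v \<Rightarrow> 'v) set"
  where "endos E x = {\<Phi>. linear_map_on (fibre E x) \<Phi> \<and> (\<forall>e\<in>fibre E x. \<Phi> e \<in> fibre E x)}"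

text \<open>The inclusion of \<open>\<gg>\<ll>(E)\<close> in \<open>\<DD>E\<close>.\<close>

definition endo_incl ::
    "('p::topological_space, 'v::real_vector) vbundle \<Rightarrow> 'p \<Rightarrow> ('v \<Rightarrow> 'v) \<Rightarrow> ('p \<Rightarrow> 'v) \<Rightarrow> 'v"
  where "endo_incl E x \<Phi> = (\<lambda>u. if u \<in> Gam E then \<Phi> (u x) else 0)"


section \<open>Forms on the gauge algebroid\<close>

type_synonym ('p, 'v) gform = "(('p \<Rightarrow> 'v) \<Rightarrow> 'v) list \<Rightarrow> 'v"

definition gform_fibre ::
    "('p::topological_space, 'v::real_vector) vbundle \<Rightarrow> nat \<Rightarrow> 'p \<Rightarrow> ('p, 'v) gform set"
  where "gform_fibre E k x = alt_maps k (gauge_fibre E x) (fibre E x)"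

text \<open>The section \<open>\<mu>(D\<^sub>1, \<dots>, D\<^sub>k)\<close> of \<open>E\<close>.\<close>

definition apply_form ::
    "('p \<Rightarrow> ('p, 'v) gform) \<Rightarrow> (('p \<Rightarrow> 'v) \<Rightarrow> 'p \<Rightarrow> 'v) list \<Rightarrow> 'p \<Rightarrow> 'v"
  where "apply_form \<mu> Ds = (\<lambda>x. \<mu> x (map (\<lambda>D. at_pt D x) Ds))"

definition gforms_on ::
    "('p::topological_space, 'v::real_vector) vbundle \<Rightarrow> nat \<Rightarrow> 'p set
       \<Rightarrow> ('p \<Rightarrow> ('p, 'v) gform) set"
  where "gforms_on E k W = {\<mu>. (\<forall>x\<in>W. \<mu> x \<in> gform_fibre E k x) \<and>
    (\<forall>Ds\<in>tuples k (derivations E). apply_form \<mu> Ds \<in> sections_on E W)}"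

definition omit_nth :: "nat \<Rightarrow> 'a list \<Rightarrow> 'a list"
  where "omit_nth i xs = take i xs @ drop (Suc i) xs"

definition koszul ::
    "nat \<Rightarrow> ('p \<Rightarrow> ('p, 'v::real_vector) gform) \<Rightarrow> (('p \<Rightarrow> 'v) \<Rightarrow> 'p \<Rightarrow> 'v) list \<Rightarrow> 'p \<Rightarrow> 'v"
  where "koszul k \<mu> Ds =
    (\<Sum>i\<le>k. (-1) ^ i *\<^sub>R (Ds ! i) (apply_form \<mu> (omit_nth i Ds))) +
    (\<Sum>j\<le>k. \<Sum>i<j. (-1) ^ (i + j) *\<^sub>R
       apply_form \<mu> (commutator (Ds ! i) (Ds ! j) # omit_nth i (omit_nth j Ds)))"

text \<open>The Koszul formula only prescribes \<open>d\<mu>\<close> on sections of \<open>\<DD>E\<close>; \<open>d\<mu>\<close> is the form which it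
  determines.\<close>

definition dD ::
    "('p::topological_space, 'v::real_vector) vbundle \<Rightarrow> nat \<Rightarrow> ('p \<Rightarrow> ('p, 'v) gform)
       \<Rightarrow> 'p \<Rightarrow> ('p, 'v) gform"
  where "dD E k \<mu> = (THE \<omega>. \<omega> \<in> gforms_on E (Suc k) UNIV \<and>
    (\<forall>Ds\<in>tuples (Suc k) (derivations E). apply_form \<omega> Ds = koszul k \<mu> Ds))"

definition insert_at :: "(('p \<Rightarrow> 'v) \<Rightarrow> 'v) \<Rightarrow> ('p, 'v) gform \<Rightarrow> ('p, 'v) gform"
  where "insert_at \<delta> \<mu> = (\<lambda>\<delta>s. \<mu> (\<delta> # \<delta>s))"

definition insertion ::
    "(('p \<Rightarrow> 'v) \<Rightarrow> 'p \<Rightarrow> 'v) \<Rightarrow> ('p \<Rightarrow> ('p, 'v) gform) \<Rightarrow> 'p \<Rightarrow> ('p, 'v) gform"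
  where "insertion D \<mu> = (\<lambda>x. insert_at (at_pt D x) (\<mu> x))"

definition lie_deriv ::
    "('p::topological_space, 'v::real_vector) vbundle \<Rightarrow> nat \<Rightarrow> (('p \<Rightarrow> 'v) \<Rightarrow> 'p \<Rightarrow> 'v)
       \<Rightarrow> ('p \<Rightarrow> ('p, 'v) gform) \<Rightarrow> 'p \<Rightarrow> ('p, 'v) gform"
  where "lie_deriv E k D \<mu> = insertion D (dD E k \<mu>) + dD E (k - 1) (insertion D \<mu>)"

definition symbol_pullback ::
    "('p::topological_space, 'v::real_vector) vbundle \<Rightarrow> 'p
       \<Rightarrow> ((('p \<Rightarrow> real) \<Rightarrow> real) list \<Rightarrow> 'v) \<Rightarrow> ('p, 'v) gform"
  where "symbol_pullback E x \<eta> = (\<lambda>\<delta>s.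
    if set \<delta>s \<subseteq> gauge_fibre E x then \<eta> (map (symbol_at E x) \<delta>s) else 0)"

text \<open>The fibre of \<open>\<JJ>\<^sub>kE\<close> at \<open>x\<close>.\<close>

definition jet_fibre ::
    "('p::topological_space, 'v::real_vector) vbundle \<Rightarrow> nat \<Rightarrow> 'p \<Rightarrow> ('p, 'v) gform set"
  where "jet_fibre E k x = {\<mu> \<in> gform_fibre E k x. k > 0 \<longrightarrow>
    (\<exists>\<eta>\<in>alt_maps (k - 1) (tangent_space E x) (fibre E x).
      \<forall>\<Phi>\<in>endos E x. \<forall>\<delta>s\<in>tuples (k - 1) (gauge_fibre E x).
        insert_at (endo_incl E x \<Phi>) \<mu> \<delta>s = \<Phi> (symbol_pullback E x \<eta> \<delta>s))}"

definition jet_sections_on ::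
    "('p::topological_space, 'v::real_vector) vbundle \<Rightarrow> nat \<Rightarrow> 'p set
       \<Rightarrow> ('p \<Rightarrow> ('p, 'v) gform) set"
  where "jet_sections_on E k W = {\<mu> \<in> gforms_on E k W. \<forall>x\<in>W. \<mu> x \<in> jet_fibre E k x}"


section \<open>The higher omni-Lie algebroid\<close>

type_synonym ('p, 'v) omni = "(('p \<Rightarrow> 'v) \<Rightarrow> 'v) \<times> ('p, 'v) gform"
type_synonym ('p, 'v) omni_section =
  "(('p \<Rightarrow> 'v) \<Rightarrow> 'p \<Rightarrow> 'v) \<times> ('p \<Rightarrow> ('p, 'v) gform)"

definition omni_fibre ::
    "('p::topological_space, 'v::real_vector) vbundle \<Rightarrow> nat \<Rightarrow> 'p \<Rightarrow> ('p, 'v) omni set"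
  where "omni_fibre E n x = gauge_fibre E x \<times> jet_fibre E n x"

definition omni_sections_on ::
    "('p::topological_space, 'v::real_vector) vbundle \<Rightarrow> nat \<Rightarrow> 'p set
       \<Rightarrow> ('p \<Rightarrow> ('p, 'v) omni) set"
  where "omni_sections_on E n W = {e.
    (\<lambda>x. fst (e x)) \<in> gauge_sections_on E W \<and> (\<lambda>x. snd (e x)) \<in> jet_sections_on E n W}"

definition omni_bracket ::
    "('p::topological_space, 'v::real_vector) vbundle \<Rightarrow> nat \<Rightarrow> ('p, 'v) omni_section
       \<Rightarrow> ('p, 'v) omni_section \<Rightarrow> ('p, 'v) omni_section"
  where "omni_bracket E n e e' = (case (e, e') of ((D, \<mu>), (R, \<nu>)) \<Rightarrow>
    (commutator D R, lie_deriv E n D \<nu> - insertion R (dD E n \<mu>)))"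

definition omni_pairing ::
    "('p, 'v::real_vector) omni \<Rightarrow> ('p, 'v) omni \<Rightarrow> ('p, 'v) gform"
  where "omni_pairing e e' = (case (e, e') of ((\<delta>, \<mu>), (\<rho>, \<nu>)) \<Rightarrow>
    (1 / 2) *\<^sub>R (insert_at \<delta> \<nu> + insert_at \<rho> \<mu>))"

definition subbundle ::
    "('p::topological_space, 'v::real_vector) vbundle \<Rightarrow> nat \<Rightarrow> ('p \<Rightarrow> ('p, 'v) omni set) \<Rightarrow> bool"
  where "subbundle E n L \<longleftrightarrow>
    (\<forall>x. subspace (L x) \<and> L x \<subseteq> omni_fibre E n x) \<and>
    (\<forall>p. \<exists>U es. open U \<and> p \<in> U \<and> set es \<subseteq> omni_sections_on E n U \<and>
       (\<forall>x\<in>U. is_basis (map (\<lambda>s. s x) es) (L x)))"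

definition isotropic :: "('p \<Rightarrow> ('p, 'v::real_vector) omni set) \<Rightarrow> bool"
  where "isotropic L \<longleftrightarrow> (\<forall>x. \<forall>e\<in>L x. \<forall>e'\<in>L x. omni_pairing e e' = 0)"

definition maximal_isotropic ::
    "('p::topological_space, 'v::real_vector) vbundle \<Rightarrow> nat \<Rightarrow> ('p \<Rightarrow> ('p, 'v) omni set) \<Rightarrow> bool"
  where "maximal_isotropic E n L \<longleftrightarrow> subbundle E n L \<and> isotropic L \<and>
    (\<forall>L'. subbundle E n L' \<and> isotropic L' \<and> (\<forall>x. L x \<subseteq> L' x) \<longrightarrow> L' = L)"

definition subbundle_sections ::
    "('p::topological_space, 'v::real_vector) vbundle \<Rightarrow> nat \<Rightarrow> ('p \<Rightarrow> ('p, 'v) omni set)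
       \<Rightarrow> ('p, 'v) omni_section set"
  where "subbundle_sections E n L = {(D, \<mu>). D \<in> derivations E \<and> \<mu> \<in> jet_sections_on E n UNIV \<and>
    (\<forall>x. (at_pt D x, \<mu> x) \<in> L x)}"

definition involutive ::
    "('p::topological_space, 'v::real_vector) vbundle \<Rightarrow> nat \<Rightarrow> ('p \<Rightarrow> ('p, 'v) omni set) \<Rightarrow> bool"
  where "involutive E n L \<longleftrightarrow> (\<forall>e\<in>subbundle_sections E n L. \<forall>e'\<in>subbundle_sections E n L.
    omni_bracket E n e e' \<in> subbundle_sections E n L)"

definition higher_dirac_jacobi ::
    "('p::topological_space, 'v::real_vector) vbundle \<Rightarrow> nat \<Rightarrow> ('p \<Rightarrow> ('p, 'v) omni set) \<Rightarrow> bool"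
  where "higher_dirac_jacobi E n L \<longleftrightarrow> maximal_isotropic E n L \<and> involutive E n L"

text \<open>The projection \<open>L \<rightarrow> \<JJ>\<^sub>nE\<close> is always a bundle map; it is an isomorphism iff it is bijective
  on fibres and its inverse is smooth, i.e. maps smooth local sections to smooth local sections.\<close>

definition projects_isomorphically ::
    "('p::topological_space, 'v::real_vector) vbundle \<Rightarrow> nat \<Rightarrow> ('p \<Rightarrow> ('p, 'v) omni set) \<Rightarrow> bool"
  where "projects_isomorphically E n L \<longleftrightarrow>
    (\<forall>x. bij_betw snd (L x) (jet_fibre E n x)) \<and>
    (\<forall>W. open W \<longrightarrow> (\<forall>\<mu>\<in>jet_sections_on E n W.
       (\<lambda>x. inv_into (L x) snd (\<mu> x)) \<in> omni_sections_on E n W))"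


section \<open>Volumes with values in brackets\<close>

text \<open>Sections \<open>Z\<close> of \<open>\<Lambda>\<^sup>mTM \<otimes> Hom(\<Lambda>\<^sup>2E, E)\<close>, for \<open>m\<close> the dimension. The tensor product
  is rendered by the canonically isomorphic \<open>Hom(\<Lambda>\<^sup>mT\<^sup>*M, Hom(\<Lambda>\<^sup>2E, E))\<close>, and \<open>Z x \<Omega>\<close> is \<open>\<langle>\<Omega>, Z\<rangle>\<close> at \<open>x\<close>.\<close>

type_synonym ('p, 'v) volume =
  "'p \<Rightarrow> ((('p \<Rightarrow> real) \<Rightarrow> real) list \<Rightarrow> real) \<Rightarrow> 'v \<Rightarrow> 'v \<Rightarrow> 'v"

definition top_covectors ::
    "('p::topological_space, 'z) mfd_scheme \<Rightarrow> 'p \<Rightarrow> ((('p \<Rightarrow> real) \<Rightarrow> real) list \<Rightarrow> real) set"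
  where "top_covectors M x = alt_maps (mdim M) (tangent_space M x) UNIV"

definition volume_sections ::
    "('p::topological_space, 'v::real_vector) vbundle \<Rightarrow> ('p, 'v) volume set"
  where "volume_sections E = {Z.
    (\<forall>x. linear_map_on (top_covectors E x) (Z x) \<and>
      (\<forall>\<Omega>\<in>top_covectors E x. skew_bilinear_on (fibre E x) (Z x \<Omega>)) \<and>
      (\<forall>\<Omega> e e'. \<Omega> \<notin> top_covectors E x \<or> e \<notin> fibre E x \<or> e' \<notin> fibre E x \<longrightarrow> Z x \<Omega> e e' = 0)) \<and>
    (\<forall>\<Omega>\<in>diff_forms E (mdim E). \<forall>u\<in>Gam E. \<forall>v\<in>Gam E. (\<lambda>x. Z x (\<Omega> x) (u x) (v x)) \<in> Gam E)}"

definition volume_lie :: "('p::topological_space, 'v::real_vector) vbundle \<Rightarrow> ('p, 'v) volume \<Rightarrow> bool"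
  where "volume_lie E Z \<longleftrightarrow>
    (\<forall>\<Omega>\<in>diff_forms E (mdim E). \<forall>x. lie_bracket_on (fibre E x) (Z x (\<Omega> x)))"

text \<open>The section \<open>d(\<sigma>\<^sup>*(\<Omega> \<otimes> u))\<close> of \<open>\<JJ>\<^sub>m\<^sub>+\<^sub>1E\<close>.\<close>

definition d_sigma ::
    "('p::topological_space, 'v::real_vector) vbundle
       \<Rightarrow> ('p \<Rightarrow> (('p \<Rightarrow> real) \<Rightarrow> real) list \<Rightarrow> real) \<Rightarrow> ('p \<Rightarrow> 'v) \<Rightarrow> 'p \<Rightarrow> ('p, 'v) gform"
  where "d_sigma E \<Omega> u =
    dD E (mdim E) (\<lambda>x. symbol_pullback E x (\<lambda>Xs. \<Omega> x Xs *\<^sub>R u x))"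

text \<open>\<open>B\<^sub>Z\<close> at \<open>x\<close> is the linear map determined by \<open>d(\<sigma>\<^sup>*(\<Omega> \<otimes> u)) \<mapsto> \<langle>\<Omega>, Z\<rangle>(u, -)\<close>, since the values
  at \<open>x\<close> of the sections on the left span the fibre of \<open>\<JJ>\<^sub>m\<^sub>+\<^sub>1E\<close>.\<close>

definition B_map ::
    "('p::topological_space, 'v::real_vector) vbundle \<Rightarrow> ('p, 'v) volume \<Rightarrow> 'p
       \<Rightarrow> ('p, 'v) gform \<Rightarrow> ('p \<Rightarrow> 'v) \<Rightarrow> 'v"
  where "B_map E Z x = (THE b.
    linear_map_on (jet_fibre E (mdim E + 1) x) b \<and>
    (\<forall>\<mu>. \<mu> \<notin> jet_fibre E (mdim E + 1) x \<longrightarrow> b \<mu> = 0) \<and>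
    (\<forall>\<mu>\<in>jet_fibre E (mdim E + 1) x. b \<mu> \<in> gauge_fibre E x) \<and>
    (\<forall>\<Omega>\<in>diff_forms E (mdim E). \<forall>u\<in>Gam E.
       b (d_sigma E \<Omega> u x) = endo_incl E x (Z x (\<Omega> x) (u x))))"

definition graph_of ::
    "('p::topological_space, 'v::real_vector) vbundle \<Rightarrow> ('p, 'v) volume \<Rightarrow> 'p \<Rightarrow> ('p, 'v) omni set"
  where "graph_of E Z x = {(B_map E Z x \<mu>, \<mu>) | \<mu>. \<mu> \<in> jet_fibre E (mdim E + 1) x}"

end

theory Submission
  imports Defs
begin

text \<open>
  Let \<open>m\<close> be the dimension of \<open>M\<close>. The proof rests on one fact about the top degree \<open>m + 1\<close>: a jet
  \<open>\<mu>\<close> at \<open>x\<close> is determined by \<open>\<lambda>\<^sub>\<mu> \<in> \<Lambda>\<^sup>mT\<^sup>*M \<otimes> E\<close>, and \<open>\<Lambda>\<^sup>mT\<^sup>*M\<close> is a line. So once a volume form is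
  chosen near a point, a jet is a vector \<open>a\<close> of \<open>E\<close> (\<open>jet_eqI\<close>, \<open>jet_symbol_part\<close>), and \<open>B\<^sub>Z\<close> sends
  it to the endomorphism \<open>a \<cdot> -\<close> for the product which \<open>Z\<close> defines with that volume form
  (\<open>B_map_eq\<close>). The reason is that modulo the endomorphisms of \<open>E\<close> only \<open>m\<close> directions are left in
  \<open>\<DD>E\<close>, so that a form of degree greater than \<open>m\<close> which vanishes on endomorphisms is \<open>0\<close>
  (\<open>zero_if_killed_by_endos\<close>).

  In these terms the pairing of two elements of the graph over \<open>a\<close> and \<open>b\<close> is \<open>ab + ba\<close> times the
  volume form, so isotropy is skew symmetry of the product. The graph is maximal because an element
  of \<open>\<DD>E\<close> on which all jets vanish is \<open>0\<close> (\<open>gauge_zero_if_jets_vanish\<close>). Conversely, a subbundle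
  projecting isomorphically is the graph of a linear map \<open>b\<close>, isotropy forces the symbol of \<open>b(\<mu>)\<close>
  to vanish, and then \<open>b(\<mu>)\<close> is multiplication with \<open>\<mu>\<close> for a skew product (\<open>volume_at_point\<close>).

  For involutivity, every section \<open>\<mu>\<close> of the jet bundle in top degree satisfies \<open>d\<mu> = 0\<close>
  (\<open>jet_section_closed\<close>): \<open>d\<mu>\<close> has degree \<open>m + 2\<close>, so it is enough to insert two endomorphisms. The
  bracket of \<open>D + \<mu>\<close> and \<open>R + \<nu>\<close> is therefore \<open>[D, R] + d \<iota>\<^sub>D \<nu>\<close>. If \<open>D\<close> and \<open>R\<close> are the multiplications
  with \<open>a\<close> and \<open>b\<close>, then \<open>d \<iota>\<^sub>D \<nu>\<close> corresponds to \<open>ab\<close>, and the bracket lies in the graph iff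
  \<open>a(bc) - b(ac) = (ab)c\<close>, which is the Jacobi identity (\<open>graph_bracket\<close>, \<open>involutive_iff\<close>).

  Most of the text builds what this uses: bump functions and Hadamard's lemma on manifolds with an
  arbitrary atlas, hence coordinate vector fields and a frame of \<open>\<DD>E\<close> by global derivations
  (\<open>gauge_frame_exists\<close>), hence the extension of derivations at a point, and the fact that the Koszul
  formula is tensorial and so defines a form (\<open>dD\<close>).
\<close>

section \<open>Smooth functions on open subsets of Euclidean space\<close>

lemma openin_Euclidean_space_iff:
  "openin (Euclidean_space m) V \<longleftrightarrow> (\<exists>T. open T \<and> V = T \<inter> {x. \<forall>i\<ge>m. x i = 0})"
  by (auto simp: Euclidean_space_def openin_subtopology euclidean_product_topology)

lemma mem_Euclidean_space: "openin (Euclidean_space m) V \<Longrightarrow> x \<in> V \<Longrightarrow> i \<ge> m \<Longrightarrow> x i = 0"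
  by (auto simp: openin_Euclidean_space_iff)

lemma continuous_on_fun_upd: "continuous_on S (\<lambda>t::real. (x::nat \<Rightarrow> real)(i := t))"
proof (intro continuous_on_coordinatewise_then_product)
  show "continuous_on S (\<lambda>t. (x(i := t)) j)" for j
    by (cases "j = i") simp_all
qed

lemma continuous_on_coord: "continuous_on S (\<lambda>x. (x::'a \<Rightarrow> real) i)"
  by (rule continuous_on_subset[OF continuous_on_product_coordinates]) simp

text \<open>A partial derivative at a point only sees a neighbourhood of that point on a coordinate
  line; this is what makes the iterated-derivative definition of smoothness local.\<close>

lemma slice_neighbourhood:
  assumes "openin (Euclidean_space m) V" "x \<in> V" "i < m"
  obtains S where "open S" "x i \<in> S" "\<And>t. t \<in> S \<Longrightarrow> x(i := t) \<in> V"
proof -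
  obtain T where T: "open T" "V = T \<inter> {x. \<forall>i\<ge>m. x i = 0}"
    using assms(1) by (auto simp: openin_Euclidean_space_iff)
  have "open ((\<lambda>t. x(i := t)) -` T)"
    using T(1) continuous_on_fun_upd[of UNIV x i] by (auto intro: open_vimage)
  moreover have "x(i := t) \<in> V" if "t \<in> (\<lambda>t. x(i := t)) -` T" for t
    using that T(2) assms by auto
  ultimately show thesis
    using assms T(2) by (intro that[of "(\<lambda>t. x(i := t)) -` T"]) auto
qed

lemma partial_derivative_cong:
  assumes "openin (Euclidean_space m) V" "x \<in> V" "i < m" and "\<And>y. y \<in> V \<Longrightarrow> f y = g y"
    and "((\<lambda>t. f (x(i := t))) has_real_derivative d) (at (x i))"
  shows "((\<lambda>t. g (x(i := t))) has_real_derivative d) (at (x i))"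
proof -
  obtain S where S: "open S" "x i \<in> S" "\<And>t. t \<in> S \<Longrightarrow> x(i := t) \<in> V"
    using slice_neighbourhood assms(1-3) by metis
  show ?thesis
    by (rule has_field_derivative_transform_within_open[OF assms(5) S(1,2)]) (use S assms in auto)
qed

lemma C_k_on_continuous: "C_k_on k m V f \<Longrightarrow> continuous_on V f"
  by (cases k) auto

lemma C_k_on_subset: "C_k_on k m V f \<Longrightarrow> W \<subseteq> V \<Longrightarrow> C_k_on k m W f"
proof (induction k arbitrary: f)
  case (Suc k)
  then show ?case by (auto intro: continuous_on_subset) (meson subsetD)
qed (auto intro: continuous_on_subset)

lemma C_k_on_Suc_D: "C_k_on (Suc k) m V f \<Longrightarrow> C_k_on k m V f"
proof (induction k arbitrary: f)
  case (Suc k)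
  have "\<exists>g. C_k_on k m V g \<and> (\<forall>x\<in>V. ((\<lambda>t. f (x(i := t))) has_real_derivative g x) (at (x i)))"
    if i: "i < m" for i
  proof -
    obtain g where g: "C_k_on (Suc k) m V g"
      "\<forall>x\<in>V. ((\<lambda>t. f (x(i := t))) has_real_derivative g x) (at (x i))"
      using Suc.prems i unfolding C_k_on.simps(2)[of "Suc k"] by blast
    then show ?thesis using Suc.IH[OF g(1)] by blast
  qed
  with C_k_on_continuous[OF Suc.prems] show ?case by simp
qed auto

lemma C_k_on_cong:
  assumes "openin (Euclidean_space m) V" "\<And>y. y \<in> V \<Longrightarrow> f y = g y" "C_k_on k m V f"
  shows "C_k_on k m V g"
proof (cases k)
  case 0
  then show ?thesis using assms by (auto cong: continuous_on_cong)
next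
  case (Suc l)
  have "continuous_on V g"
    using C_k_on_continuous[OF assms(3)] assms(2) by (auto cong: continuous_on_cong)
  moreover have "\<exists>h. C_k_on l m V h \<and> (\<forall>x\<in>V. ((\<lambda>t. g (x(i := t))) has_real_derivative h x) (at (x i)))"
    if i: "i < m" for i
  proof -
    obtain h where h: "C_k_on l m V h"
      "\<forall>x\<in>V. ((\<lambda>t. f (x(i := t))) has_real_derivative h x) (at (x i))"
      using assms(3) i unfolding Suc C_k_on.simps by blast
    have "((\<lambda>t. g (x(i := t))) has_real_derivative h x) (at (x i))" if x: "x \<in> V" for x
      by (rule partial_derivative_cong[OF assms(1) x i, where f=f]) (use assms(2) h(2) x in auto)
    with h(1) show ?thesis by blast
  qed
  ultimately show ?thesis by (simp add: Suc)
qed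

text \<open>Derivatives are unique, so the locally given ones glue to a function on all of \<open>V\<close>.\<close>

lemma C_k_on_local:
  assumes "\<And>x. x \<in> V \<Longrightarrow> \<exists>W. x \<in> W \<and> openin (Euclidean_space m) W \<and> C_k_on k m W f"
    and "openin (Euclidean_space m) V"
  shows "C_k_on k m V f"
  using assms(1)
proof (induction k arbitrary: f)
  case (0 f)
  have ex: "\<exists>T. open T \<and> x \<in> T \<and> continuous_on (V \<inter> T) f" if x: "x \<in> V" for x
  proof -
    obtain W where W: "x \<in> W" "openin (Euclidean_space m) W" "continuous_on W f"
      using 0[OF x] by auto
    obtain T where T: "open T" "W = T \<inter> {x. \<forall>i\<ge>m. x i = 0}"
      using W(2) by (auto simp: openin_Euclidean_space_iff)
    have "V \<inter> T \<subseteq> W" using T mem_Euclidean_space[OF assms(2)] by auto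
    with W T show ?thesis using continuous_on_subset by blast
  qed
  then have "continuous (at x within V) f" if x: "x \<in> V" for x
  proof -
    obtain T where T: "open T" "x \<in> T" "continuous_on (V \<inter> T) f"
      using ex[OF x] by blast
    have "at x within V = at x within (V \<inter> T)"
      using T by (intro at_within_nhd[of x T]) auto
    with T x show ?thesis by (simp add: continuous_on_eq_continuous_within)
  qed
  then show ?case by (simp add: continuous_on_eq_continuous_within)
next
  case (Suc k f)
  have 0: "C_k_on k m V f"
  proof (rule Suc.IH)
    fix x assume "x \<in> V"
    then obtain W where "x \<in> W" "openin (Euclidean_space m) W" "C_k_on (Suc k) m W f"
      using Suc.prems by blast
    then show "\<exists>W. x \<in> W \<and> openin (Euclidean_space m) W \<and> C_k_on k m W f"
      using C_k_on_Suc_D by blast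
  qed
  define g where "g i x = deriv (\<lambda>t. f (x(i := t))) (x i)" for i x
  have g: "\<exists>W. x \<in> W \<and> openin (Euclidean_space m) W \<and> C_k_on k m W (g i) \<and>
      ((\<lambda>t. f (x(i := t))) has_real_derivative g i x) (at (x i))" if x: "x \<in> V" and i: "i < m" for x i
  proof -
    obtain W where W: "x \<in> W" "openin (Euclidean_space m) W" "C_k_on (Suc k) m W f"
      using Suc.prems[OF x] by blast
    obtain h where h: "C_k_on k m W h"
      "\<And>y. y \<in> W \<Longrightarrow> ((\<lambda>t. f (y(i := t))) has_real_derivative h y) (at (y i))"
      using W(3) i unfolding C_k_on.simps by blast
    have eq: "h y = g i y" if "y \<in> W" for y
      using h(2)[OF that] by (simp add: g_def DERIV_imp_deriv)
    then show ?thesis using C_k_on_cong[OF W(2) eq h(1)] W h(2)[OF W(1)] by auto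
  qed
  have "C_k_on k m V (g i)" if "i < m" for i
    by (rule Suc.IH) (use g that in blast)
  moreover have "((\<lambda>t. f (x(i := t))) has_real_derivative g i x) (at (x i))" if "x \<in> V" "i < m" for x i
    using g that by blast
  ultimately show ?case using C_k_on_continuous[OF 0] by auto
qed

lemma C_k_on_const: "C_k_on k m V (\<lambda>x. c)"
  by (induction k arbitrary: c) (auto intro!: exI[of _ "\<lambda>x. 0"])

lemma C_k_on_coord: "C_k_on k m V (\<lambda>x. x i)"
proof (cases k)
  case (Suc l)
  have "\<exists>g. C_k_on l m V g \<and> (\<forall>x\<in>V. ((\<lambda>t. (x(j := t)) i) has_real_derivative g x) (at (x j)))" for j
    by (rule exI[of _ "\<lambda>x. if i = j then 1 else 0"]) (auto simp: C_k_on_const)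
  then show ?thesis by (simp add: Suc continuous_on_coord)
qed (simp add: continuous_on_coord)

lemma C_k_on_add:
  assumes "C_k_on k m V f" "C_k_on k m V g"
  shows "C_k_on k m V (\<lambda>x. f x + g x)"
  using assms
proof (induction k arbitrary: f g)
  case 0
  then show ?case by (auto intro: continuous_on_add)
next
  case (Suc k)
  have "\<exists>h. C_k_on k m V h \<and>
      (\<forall>x\<in>V. ((\<lambda>t. f (x(i := t)) + g (x(i := t))) has_real_derivative h x) (at (x i)))"
    if i: "i < m" for i
  proof -
    obtain f' g' where "C_k_on k m V f'" "C_k_on k m V g'"
      "\<forall>x\<in>V. ((\<lambda>t. f (x(i := t))) has_real_derivative f' x) (at (x i))"
      "\<forall>x\<in>V. ((\<lambda>t. g (x(i := t))) has_real_derivative g' x) (at (x i))"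
      using Suc.prems i unfolding C_k_on.simps by blast
    then show ?thesis
      using Suc.IH[of f' g'] by (intro exI[of _ "\<lambda>x. f' x + g' x"]) (auto intro!: DERIV_add)
  qed
  with Suc.prems show ?case by (auto intro: continuous_on_add)
qed

lemma C_k_on_mult:
  assumes "C_k_on k m V f" "C_k_on k m V g"
  shows "C_k_on k m V (\<lambda>x. f x * g x)"
  using assms
proof (induction k arbitrary: f g)
  case 0
  then show ?case by (auto intro: continuous_on_mult)
next
  case (Suc k)
  have "\<exists>h. C_k_on k m V h \<and>
      (\<forall>x\<in>V. ((\<lambda>t. f (x(i := t)) * g (x(i := t))) has_real_derivative h x) (at (x i)))"
    if i: "i < m" for i
  proof -
    obtain f' g' where *: "C_k_on k m V f'" "C_k_on k m V g'"
      "\<forall>x\<in>V. ((\<lambda>t. f (x(i := t))) has_real_derivative f' x) (at (x i))"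
      "\<forall>x\<in>V. ((\<lambda>t. g (x(i := t))) has_real_derivative g' x) (at (x i))"
      using Suc.prems i unfolding C_k_on.simps by blast
    have "C_k_on k m V (\<lambda>x. f' x * g x + g' x * f x)"
      using *(1,2) Suc.prems[THEN C_k_on_Suc_D] by (intro C_k_on_add Suc.IH)
    moreover have "((\<lambda>t. f (x(i := t)) * g (x(i := t))) has_real_derivative f' x * g x + g' x * f x) (at (x i))"
      if "x \<in> V" for x
      using DERIV_mult[OF *(3)[rule_format, OF that] *(4)[rule_format, OF that]] by simp
    ultimately show ?thesis by blast
  qed
  with Suc.prems show ?case by (auto intro: continuous_on_mult)
qed

lemma C_k_on_inverse:
  assumes "C_k_on k m V f" "\<And>x. x \<in> V \<Longrightarrow> f x \<noteq> 0"
  shows "C_k_on k m V (\<lambda>x. inverse (f x))"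
  using assms
proof (induction k)
  case 0
  then show ?case by (auto intro: continuous_on_inverse)
next
  case (Suc k)
  have inv: "C_k_on k m V (\<lambda>x. inverse (f x))"
    using Suc C_k_on_Suc_D by blast
  have "\<exists>h. C_k_on k m V h \<and>
      (\<forall>x\<in>V. ((\<lambda>t. inverse (f (x(i := t)))) has_real_derivative h x) (at (x i)))"
    if i: "i < m" for i
  proof -
    obtain f' where *: "C_k_on k m V f'"
      "\<forall>x\<in>V. ((\<lambda>t. f (x(i := t))) has_real_derivative f' x) (at (x i))"
      using Suc.prems i unfolding C_k_on.simps by blast
    have "C_k_on k m V (\<lambda>x. (-1) * (inverse (f x) * f' x * inverse (f x)))"
      using * inv by (intro C_k_on_mult C_k_on_const)
    moreover have "((\<lambda>t. inverse (f (x(i := t)))) has_real_derivative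
        (-1) * (inverse (f x) * f' x * inverse (f x))) (at (x i))" if "x \<in> V" for x
      using DERIV_inverse'[OF *(2)[rule_format, OF that]] Suc.prems(2)[OF that] by simp
    ultimately show ?thesis by blast
  qed
  with C_k_on_continuous[OF inv] show ?case by simp
qed

lemma smooth_on_Rm_const: "smooth_on_Rm m V (\<lambda>x. c)"
  and smooth_on_Rm_coord: "smooth_on_Rm m V (\<lambda>x. x i)"
  and smooth_on_Rm_add:
    "smooth_on_Rm m V f \<Longrightarrow> smooth_on_Rm m V g \<Longrightarrow> smooth_on_Rm m V (\<lambda>x. f x + g x)"
  and smooth_on_Rm_mult:
    "smooth_on_Rm m V f \<Longrightarrow> smooth_on_Rm m V g \<Longrightarrow> smooth_on_Rm m V (\<lambda>x. f x * g x)"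
  and smooth_on_Rm_inverse:
    "smooth_on_Rm m V f \<Longrightarrow> (\<And>x. x \<in> V \<Longrightarrow> f x \<noteq> 0) \<Longrightarrow> smooth_on_Rm m V (\<lambda>x. inverse (f x))"
  by (simp_all add: smooth_on_Rm_def C_k_on_const C_k_on_coord C_k_on_add C_k_on_mult C_k_on_inverse)

lemma smooth_on_Rm_diff:
  "smooth_on_Rm m V f \<Longrightarrow> smooth_on_Rm m V g \<Longrightarrow> smooth_on_Rm m V (\<lambda>x. f x - g x)"
  using smooth_on_Rm_add[OF _ smooth_on_Rm_mult[OF smooth_on_Rm_const[of m V "-1"]], of f g] by simp

lemma smooth_on_Rm_sum:
  "(\<And>a. a \<in> A \<Longrightarrow> smooth_on_Rm m V (f a)) \<Longrightarrow> smooth_on_Rm m V (\<lambda>x. \<Sum>a\<in>A. f a x)"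
  by (induction A rule: infinite_finite_induct) (auto intro: smooth_on_Rm_add smooth_on_Rm_const)

lemma smooth_on_Rm_continuous: "smooth_on_Rm m V f \<Longrightarrow> continuous_on V f"
  using C_k_on_continuous unfolding smooth_on_Rm_def by blast

lemma smooth_on_Rm_subset: "smooth_on_Rm m V f \<Longrightarrow> W \<subseteq> V \<Longrightarrow> smooth_on_Rm m W f"
  using C_k_on_subset unfolding smooth_on_Rm_def by blast

lemma smooth_on_Rm_cong:
  assumes "openin (Euclidean_space m) V" "\<And>y. y \<in> V \<Longrightarrow> f y = g y" "smooth_on_Rm m V f"
  shows "smooth_on_Rm m V g"
  using C_k_on_cong[OF assms(1,2)] assms(3) by (auto simp: smooth_on_Rm_def)

lemma smooth_on_Rm_local:
  assumes "\<And>x. x \<in> V \<Longrightarrow> \<exists>W. x \<in> W \<and> openin (Euclidean_space m) W \<and> smooth_on_Rm m W f"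
    and "openin (Euclidean_space m) V"
  shows "smooth_on_Rm m V f"
  unfolding smooth_on_Rm_def
  using assms(1) by (intro allI C_k_on_local[OF _ assms(2)]) (fastforce simp: smooth_on_Rm_def)

definition partial_deriv :: "nat \<Rightarrow> ((nat \<Rightarrow> real) \<Rightarrow> real) \<Rightarrow> (nat \<Rightarrow> real) \<Rightarrow> real"
  where "partial_deriv i f x = deriv (\<lambda>t. f (x(i := t))) (x i)"

lemma smooth_on_Rm_partial:
  assumes "smooth_on_Rm m V f" "openin (Euclidean_space m) V" "i < m"
  shows "smooth_on_Rm m V (partial_deriv i f)"
    and "x \<in> V \<Longrightarrow> ((\<lambda>t. f (x(i := t))) has_real_derivative partial_deriv i f x) (at (x i))"
proof -
  have *: "\<exists>g. C_k_on k m V g \<and> (\<forall>x\<in>V. ((\<lambda>t. f (x(i := t))) has_real_derivative g x) (at (x i)))" for k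
    using assms(1,3) unfolding smooth_on_Rm_def by (metis C_k_on.simps(2))
  have eq: "g x = partial_deriv i f x"
    if "\<forall>x\<in>V. ((\<lambda>t. f (x(i := t))) has_real_derivative g x) (at (x i))" "x \<in> V" for g x
    using that by (auto simp: partial_deriv_def DERIV_imp_deriv)
  show "x \<in> V \<Longrightarrow> ((\<lambda>t. f (x(i := t))) has_real_derivative partial_deriv i f x) (at (x i))"
    using *[of 0] eq by metis
  show "smooth_on_Rm m V (partial_deriv i f)"
    unfolding smooth_on_Rm_def
  proof
    fix k
    obtain g where g: "C_k_on k m V g"
      "\<forall>x\<in>V. ((\<lambda>t. f (x(i := t))) has_real_derivative g x) (at (x i))"
      using *[of k] by blast
    show "C_k_on k m V (partial_deriv i f)"
      using C_k_on_cong[OF assms(2) eq[OF g(2)] g(1)] by simp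
  qed
qed

subsection \<open>Hadamard's lemma and the chain rule\<close>

definition Rm_box :: "nat \<Rightarrow> (nat \<Rightarrow> real) \<Rightarrow> real \<Rightarrow> (nat \<Rightarrow> real) set"
  where "Rm_box m y \<epsilon> = {z. (\<forall>i\<ge>m. z i = 0) \<and> (\<forall>i<m. \<bar>z i - y i\<bar> < \<epsilon>)}"

lemma openin_Rm_box: "openin (Euclidean_space m) (Rm_box m y \<epsilon>)"
proof -
  have "open {z::nat \<Rightarrow> real. \<forall>i\<in>{..<m}. z i \<in> {t. \<bar>t - y i\<bar> < \<epsilon>}}"
    by (rule product_topology_basis'[where x="\<lambda>i. i"])
      (auto intro!: open_Collect_less continuous_intros)
  then show ?thesis
    unfolding openin_Euclidean_space_iff Rm_box_def by (intro exI conjI) auto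
qed

lemma Rm_box_subset:
  assumes "openin (Euclidean_space m) V" "y \<in> V"
  obtains \<epsilon> where "\<epsilon> > 0" "Rm_box m y \<epsilon> \<subseteq> V"
proof -
  obtain T where T: "open T" "V = T \<inter> {x. \<forall>i\<ge>m. x i = 0}"
    using assms(1) by (auto simp: openin_Euclidean_space_iff)
  have "y \<in> T" using T assms by auto
  then obtain X where X: "y \<in> Pi\<^sub>E UNIV X" "\<And>i. open (X i)" "Pi\<^sub>E UNIV X \<subseteq> T"
    using T(1) product_topology_open_contains_basis[of "\<lambda>i. euclidean" UNIV T y]
    by (auto simp: open_fun_def)
  have "\<exists>e>0. \<forall>t. \<bar>t - y i\<bar> < e \<longrightarrow> t \<in> X i" for i
    using X(1) X(2)[of i] unfolding open_dist by (auto simp: dist_real_def PiE_iff)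
  then obtain e where e: "\<And>i. e i > 0" "\<And>i t. \<bar>t - y i\<bar> < e i \<Longrightarrow> t \<in> X i" by metis
  define \<epsilon> where "\<epsilon> = Min (insert 1 (e ` {..<m}))"
  have "\<epsilon> > 0" using e(1) by (auto simp: \<epsilon>_def)
  moreover have "Rm_box m y \<epsilon> \<subseteq> V"
  proof
    fix z assume z: "z \<in> Rm_box m y \<epsilon>"
    have "z i \<in> X i" for i
    proof (cases "i < m")
      case True
      then have "\<epsilon> \<le> e i" by (auto simp: \<epsilon>_def)
      with z True show ?thesis by (intro e(2)) (auto simp: Rm_box_def)
    next
      case False
      then have "z i = y i" using z assms mem_Euclidean_space by (auto simp: Rm_box_def)
      with X(1) show ?thesis by (simp add: PiE_iff)
    qed
    with X(3) have "z \<in> T" by (auto simp: PiE_iff)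
    with T z show "z \<in> V" by (auto simp: Rm_box_def)
  qed
  ultimately show thesis by (rule that)
qed

text \<open>Hadamard's lemma is usually proved by integrating along the segment from \<open>y\<close> to \<open>z\<close>, which
  presupposes the chain rule. Here the coordinates are moved one at a time, so that only partial
  derivatives occur: \<open>stair i t\<close> has the first \<open>i\<close> coordinates at \<open>z\<close>, the \<open>i\<close>th one at time \<open>t\<close> on
  its way, and the others at \<open>y\<close>. The chain rule is a corollary.\<close>

definition stair :: "(nat \<Rightarrow> real) \<Rightarrow> nat \<Rightarrow> real \<Rightarrow> (nat \<Rightarrow> real) \<Rightarrow> nat \<Rightarrow> real"
  where "stair y i t z = (\<lambda>j. if j < i then z j else if j = i then y i + t * (z i - y i) else y j)"

lemma stair_in_box:
  assumes "z \<in> Rm_box m y \<epsilon>" "y \<in> Rm_box m y \<epsilon>" "i < m" "t \<in> {0..1}"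
  shows "stair y i t z \<in> Rm_box m y \<epsilon>"
proof -
  have "\<bar>t * (z i - y i)\<bar> \<le> \<bar>z i - y i\<bar>"
    using assms(4) by (auto simp: abs_mult intro: mult_left_le_one_le)
  moreover have "\<bar>z i - y i\<bar> < \<epsilon>" using assms by (auto simp: Rm_box_def)
  ultimately show ?thesis using assms by (auto simp: Rm_box_def stair_def)
qed

lemma continuous_on_stair:
  "continuous_on S (\<lambda>p. stair y i (snd p) (fst p))"
proof (rule continuous_on_coordinatewise_then_product)
  fix j
  have *: "continuous_on S (\<lambda>p. fst p l)" for l
    by (rule continuous_on_product_then_coordinatewise) (intro continuous_intros)
  show "continuous_on S (\<lambda>p. stair y i (snd p) (fst p) j)"
  proof (cases j i rule: linorder_cases)
    case equal
    then show ?thesis by (simp add: stair_def) (intro continuous_intros *)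
  qed (use * in \<open>auto simp: stair_def\<close>)
qed

lemma C_k_on_stair_integral:
  assumes "smooth_on_Rm m (Rm_box m y \<epsilon>) f" "y \<in> Rm_box m y \<epsilon>" "i < m" "continuous_on {0..1} w"
  shows "C_k_on k m (Rm_box m y \<epsilon>) (\<lambda>z. integral {0..1} (\<lambda>t. w t * f (stair y i t z)))"
  using assms(1,4)
proof (induction k arbitrary: f w)
  case (0 f w)
  let ?B = "Rm_box m y \<epsilon>"
  have "continuous_on (?B \<times> cbox 0 1) (\<lambda>(z, t). w t * f (stair y i t z))"
    unfolding split_beta
    using 0(2) stair_in_box assms(2,3)
    by (intro continuous_on_mult continuous_on_compose2[OF smooth_on_Rm_continuous[OF 0(1)] continuous_on_stair]
        continuous_on_compose2[OF 0(2), where f=snd] continuous_intros) auto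
  then show ?case
    using integral_continuous_on_param by (fastforce simp: box_real)
next
  case (Suc k f w)
  let ?B = "Rm_box m y \<epsilon>"
  have "\<exists>g. C_k_on k m ?B g \<and> (\<forall>x\<in>?B. ((\<lambda>s. integral {0..1} (\<lambda>t. w t * f (stair y i t (x(j := s)))))
      has_real_derivative g x) (at (x j)))" if j: "j < m" for j
  proof -
    let ?f = "partial_deriv j f"
    define c where "c t = (if j < i then 1 else if j = i then t else 0)" for t :: real
    note f = smooth_on_Rm_partial[OF Suc.prems(1) openin_Rm_box j]
    have c: "continuous_on {0..1} (\<lambda>t. w t * c t)"
      using Suc.prems(2)
      by (cases j i rule: linorder_cases) (auto simp: c_def intro!: continuous_on_mult continuous_on_id)
    have "((\<lambda>s. integral {0..1} (\<lambda>t. w t * f (stair y i t (x(j := s)))))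
      has_real_derivative integral {0..1} (\<lambda>t. w t * c t * ?f (stair y i t x))) (at (x j))"
      if x: "x \<in> ?B" for x
    proof -
      define U where "U = {y j - \<epsilon><..<y j + \<epsilon>}"
      have U: "x(j := s) \<in> ?B" if "s \<in> U" for s
        using x that j by (auto simp: Rm_box_def U_def)
      have xU: "x j \<in> U" using x j by (auto simp: Rm_box_def U_def abs_less_iff)
      have st: "stair y i t (x(j := s)) \<in> ?B" if "s \<in> U" "t \<in> {0..1}" for s t
        using stair_in_box U that assms by blast
      have *: "((\<lambda>s. integral (cbox 0 1) (\<lambda>t. w t * f (stair y i t (x(j := s)))))
        has_real_derivative integral (cbox 0 1) (\<lambda>t. w t * c t * ?f (stair y i t (x(j := x j))))) (at (x j) within U)"
      proof (rule leibniz_rule_field_derivative)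
        fix s t :: real assume st': "s \<in> U" "t \<in> cbox 0 1"
        define q where "q s = stair y i t (x(j := s)) j" for s
        have upd: "stair y i t (x(j := s')) = (stair y i t (x(j := s)))(j := q s')" for s'
          by (auto simp: stair_def q_def fun_eq_iff)
        have "((\<lambda>r. f ((stair y i t (x(j := s)))(j := r))) has_real_derivative
            ?f (stair y i t (x(j := s)))) (at (q s))"
          unfolding q_def by (rule f(2)[OF st]) (use st' in auto)
        moreover have "(q has_real_derivative c t) (at s)"
          by (auto simp: q_def[abs_def] stair_def c_def intro!: derivative_eq_intros)
        ultimately have "((\<lambda>s'. f ((stair y i t (x(j := s)))(j := q s'))) has_real_derivative
            ?f (stair y i t (x(j := s))) * c t) (at s)"
          by (rule DERIV_chain2)
        then have "((\<lambda>s'. f (stair y i t (x(j := s')))) has_real_derivative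
            ?f (stair y i t (x(j := s))) * c t) (at s)"
          unfolding upd[symmetric] .
        from has_field_derivative_at_within[OF DERIV_cmult[OF this, of "w t"], of U]
        show "((\<lambda>s. w t * f (stair y i t (x(j := s)))) has_real_derivative
            w t * c t * ?f (stair y i t (x(j := s)))) (at s within U)"
          by (simp only: mult_ac)
      next
        fix s assume s: "s \<in> U"
        show "(\<lambda>t. w t * f (stair y i t (x(j := s)))) integrable_on cbox 0 1"
          using st[OF s] Suc.prems(2)
          by (intro integrable_continuous continuous_on_mult continuous_on_compose2[OF smooth_on_Rm_continuous[OF Suc.prems(1)]]
              continuous_on_compose2[OF continuous_on_stair[of UNIV], where f="\<lambda>t. (x(j := s), t)", simplified] continuous_intros) auto
      next
        show "continuous_on (U \<times> cbox 0 1) (\<lambda>(s, t). w t * c t * ?f (stair y i t (x(j := s))))"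
          unfolding split_beta
          using st c
          by (intro continuous_on_mult[OF continuous_on_compose2[OF c, where f=snd]] continuous_on_compose2[OF smooth_on_Rm_continuous[OF f(1)]]
              continuous_on_compose2[OF continuous_on_stair[of UNIV], where f="\<lambda>p. (x(j := fst p), snd p)", simplified]
              continuous_on_compose2[OF continuous_on_fun_upd[of UNIV]] continuous_intros) auto
      qed (use xU in \<open>auto simp: U_def\<close>)
      moreover have "at (x j) within U = at (x j)"
        using xU by (intro at_within_open) (auto simp: U_def)
      ultimately show ?thesis by simp
    qed
    with Suc.IH[OF f(1) c] show ?thesis by blast
  qed
  moreover have "continuous_on ?B (\<lambda>z. integral {0..1} (\<lambda>t. w t * f (stair y i t z)))"
    using Suc.IH[OF Suc.prems] C_k_on_continuous by blast
  ultimately show ?case by simp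
qed

text \<open>The functions \<open>g\<^sub>i\<close> serve twice: they give the chain rule, and they describe tangent vectors
  through their values on coordinates.\<close>

lemma hadamard:
  assumes "smooth_on_Rm m V f" "openin (Euclidean_space m) V" "y \<in> V"
  obtains B g where "openin (Euclidean_space m) B" "y \<in> B" "B \<subseteq> V"
    "\<And>i. i < m \<Longrightarrow> smooth_on_Rm m B (g i)"
    "\<And>z. z \<in> B \<Longrightarrow> f z = f y + (\<Sum>i<m. (z i - y i) * g i z)"
    "\<And>i. i < m \<Longrightarrow> g i y = partial_deriv i f y"
proof -
  obtain \<epsilon> where \<epsilon>: "\<epsilon> > 0" "Rm_box m y \<epsilon> \<subseteq> V"
    using Rm_box_subset[OF assms(2,3)] by blast
  let ?B = "Rm_box m y \<epsilon>"
  have yB: "y \<in> ?B" using \<epsilon>(1) mem_Euclidean_space[OF assms(2,3)] by (auto simp: Rm_box_def)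
  note f = smooth_on_Rm_subset[OF assms(1) \<epsilon>(2)]
  note pf = smooth_on_Rm_partial[OF f openin_Rm_box]
  define g where "g i z = integral {0..1} (\<lambda>t. 1 * partial_deriv i f (stair y i t z))" for i z
  show thesis
  proof
    show "openin (Euclidean_space m) ?B" "y \<in> ?B" "?B \<subseteq> V"
      using openin_Rm_box yB \<epsilon> by auto
    show "smooth_on_Rm m ?B (g i)" if "i < m" for i
      unfolding g_def[abs_def] smooth_on_Rm_def
      by (intro allI C_k_on_stair_integral pf(1) yB that continuous_on_const)
    have "stair y i t y = y" for i t by (auto simp: stair_def fun_eq_iff)
    then show "g i y = partial_deriv i f y" for i by (simp add: g_def)
    fix z assume z: "z \<in> ?B"
    define Q where "Q i = (\<lambda>j. if j < i then z j else y j)" for i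
    have step: "f (Q (Suc i)) - f (Q i) = (z i - y i) * g i z" if i: "i < m" for i
    proof -
      have "((\<lambda>t. f (stair y i t z)) has_vector_derivative (z i - y i) * partial_deriv i f (stair y i t z))
          (at t within {0..1})" if t: "t \<in> {0..1}" for t
      proof -
        have upd: "(stair y i t z)(i := y i + s * (z i - y i)) = stair y i s z" for s
          by (auto simp: stair_def fun_eq_iff)
        have "((\<lambda>r. f ((stair y i t z)(i := r))) has_real_derivative partial_deriv i f (stair y i t z))
            (at (stair y i t z i))"
          by (rule pf(2)[OF i stair_in_box[OF z yB i t]])
        then have "((\<lambda>r. f ((stair y i t z)(i := r))) has_real_derivative partial_deriv i f (stair y i t z))
            (at (y i + t * (z i - y i)))" by (simp add: stair_def)
        moreover have "((\<lambda>s. y i + s * (z i - y i)) has_real_derivative (z i - y i)) (at t)"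
          by (auto intro!: derivative_eq_intros)
        ultimately have "((\<lambda>s. f ((stair y i t z)(i := y i + s * (z i - y i)))) has_real_derivative
            partial_deriv i f (stair y i t z) * (z i - y i)) (at t)"
          by (rule DERIV_chain2)
        then have "((\<lambda>s. f (stair y i s z)) has_real_derivative
            partial_deriv i f (stair y i t z) * (z i - y i)) (at t)" unfolding upd .
        then show ?thesis
          by (simp add: has_real_derivative_iff_has_vector_derivative mult.commute has_vector_derivative_at_within)
      qed
      then have "((\<lambda>t. (z i - y i) * partial_deriv i f (stair y i t z)) has_integral
          f (stair y i 1 z) - f (stair y i 0 z)) {0..1}"
        by (intro fundamental_theorem_of_calculus) auto
      moreover have "stair y i 1 z = Q (Suc i)" "stair y i 0 z = Q i"
        by (auto simp: stair_def Q_def fun_eq_iff less_Suc_eq)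
      ultimately show ?thesis
        by (auto simp: g_def dest!: integral_unique)
    qed
    have "f (Q m) - f (Q 0) = (\<Sum>i<m. (z i - y i) * g i z)"
      using sum_lessThan_telescope[of "\<lambda>i. f (Q i)" m] step by simp
    moreover have "Q m = z" using z yB by (auto simp: Q_def Rm_box_def fun_eq_iff)
    moreover have "Q 0 = y" by (auto simp: Q_def)
    ultimately show "f z = f y + (\<Sum>i<m. (z i - y i) * g i z)" by simp
  qed
qed

text \<open>Caratheodory's argument: by Hadamard's lemma the difference quotient of \<open>f \<circ> \<gamma>\<close> is
  \<open>\<Sum>\<^sub>i g\<^sub>i(\<gamma>(t)) (\<gamma>\<^sub>i(t) - \<gamma>\<^sub>i(t\<^sub>0)) / (t - t\<^sub>0)\<close> with continuous \<open>g\<^sub>i\<close>.\<close>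

lemma has_derivative_along_curve:
  assumes "smooth_on_Rm m V f" "openin (Euclidean_space m) V"
    and "open S" "t0 \<in> S" "\<And>t. t \<in> S \<Longrightarrow> \<gamma> t \<in> V" "continuous_on S \<gamma>"
    and "\<And>i. i < m \<Longrightarrow> ((\<lambda>t. \<gamma> t i) has_real_derivative \<gamma>' i) (at t0)"
  shows "((\<lambda>t. f (\<gamma> t)) has_real_derivative (\<Sum>i<m. \<gamma>' i * partial_deriv i f (\<gamma> t0))) (at t0)"
proof -
  obtain B g where B: "openin (Euclidean_space m) B" "\<gamma> t0 \<in> B" "B \<subseteq> V"
    "\<And>i. i < m \<Longrightarrow> smooth_on_Rm m B (g i)"
    "\<And>z. z \<in> B \<Longrightarrow> f z = f (\<gamma> t0) + (\<Sum>i<m. (z i - \<gamma> t0 i) * g i z)"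
    "\<And>i. i < m \<Longrightarrow> g i (\<gamma> t0) = partial_deriv i f (\<gamma> t0)"
    using hadamard[OF assms(1,2), of "\<gamma> t0"] assms(4,5) by blast
  obtain T where T: "open T" "B = T \<inter> {x. \<forall>i\<ge>m. x i = 0}"
    using B(1) by (auto simp: openin_Euclidean_space_iff)
  obtain S' where S': "open S'" "S' \<inter> S = \<gamma> -` T \<inter> S"
    using continuous_on_open_invariant[THEN iffD1, OF assms(6)] T(1) by blast
  define U where "U = S' \<inter> S"
  have U: "open U" unfolding U_def using S'(1) assms(3) by (rule open_Int)
  have U0: "t0 \<in> U" unfolding U_def S'(2) using assms(4) B(2) T(2) by auto
  have UB: "\<gamma> t \<in> B" if "t \<in> U" for t
  proof -
    have "\<gamma> t \<in> T" "\<gamma> t \<in> V" using that S'(2) assms(5) by (auto simp: U_def)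
    with mem_Euclidean_space[OF assms(2)] show ?thesis using T(2) by auto
  qed
  have "((\<lambda>t. \<Sum>i<m. ((\<gamma> t i - \<gamma> t0 i) / (t - t0)) * g i (\<gamma> t)) \<longlongrightarrow>
      (\<Sum>i<m. \<gamma>' i * partial_deriv i f (\<gamma> t0))) (at t0)"
  proof (intro tendsto_sum tendsto_mult)
    fix i assume i: "i \<in> {..<m}"
    show "((\<lambda>t. (\<gamma> t i - \<gamma> t0 i) / (t - t0)) \<longlongrightarrow> \<gamma>' i) (at t0)"
      using assms(7)[of i] i by (simp add: has_field_derivative_iff)
    have "continuous_on U (\<lambda>t. g i (\<gamma> t))"
      by (rule continuous_on_compose2[OF smooth_on_Rm_continuous[OF B(4)]])
        (use i UB continuous_on_subset[OF assms(6)] in \<open>auto simp: U_def\<close>)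
    then have "isCont (\<lambda>t. g i (\<gamma> t)) t0"
      using U U0 continuous_on_eq_continuous_at by blast
    then show "((\<lambda>t. g i (\<gamma> t)) \<longlongrightarrow> partial_deriv i f (\<gamma> t0)) (at t0)"
      using B(6)[of i] i by (simp add: isCont_def)
  qed
  then have "((\<lambda>t. (f (\<gamma> t) - f (\<gamma> t0)) / (t - t0)) \<longlongrightarrow>
      (\<Sum>i<m. \<gamma>' i * partial_deriv i f (\<gamma> t0))) (at t0)"
  proof (rule Lim_transform_within_open[OF _ U U0])
    fix t assume t: "t \<in> U"
    show "(\<Sum>i<m. (\<gamma> t i - \<gamma> t0 i) / (t - t0) * g i (\<gamma> t)) = (f (\<gamma> t) - f (\<gamma> t0)) / (t - t0)"
      unfolding B(5)[OF UB[OF t]] by (simp add: sum_divide_distrib)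
  qed
  then show ?thesis by (simp add: has_field_derivative_iff)
qed

text \<open>The induction is on the order of differentiability for all smooth \<open>f\<close> at once, because the chain
  rule leads to compositions with the partial derivatives of \<open>f\<close>.\<close>

lemma smooth_on_Rm_compose:
  assumes f: "smooth_on_Rm m V f" "openin (Euclidean_space m) V"
    and G: "\<And>i. i < m \<Longrightarrow> smooth_on_Rm m' W (\<lambda>x. G x i)" "openin (Euclidean_space m') W"
      "\<And>x. x \<in> W \<Longrightarrow> G x \<in> V"
  shows "smooth_on_Rm m' W (\<lambda>x. f (G x))"
proof -
  have contG: "continuous_on W G"
  proof (rule continuous_on_coordinatewise_then_product)
    fix i
    have "continuous_on W (\<lambda>x. G x i)" if "\<not> i < m"
    proof (rule continuous_on_eq[OF continuous_on_const[of W 0]])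
      fix x assume "x \<in> W"
      then show "0 = G x i" using mem_Euclidean_space[OF f(2) G(3)] that by simp
    qed
    then show "continuous_on W (\<lambda>x. G x i)"
      using G(1) smooth_on_Rm_continuous by (cases "i < m") auto
  qed
  have "C_k_on k m' W (\<lambda>x. f (G x))" for k
    using f(1)
  proof (induction k arbitrary: f)
    case (0 f)
    then show ?case
      using continuous_on_compose2[OF smooth_on_Rm_continuous contG] G(3) by auto
  next
    case (Suc k f)
    have "\<exists>h. C_k_on k m' W h \<and> (\<forall>x\<in>W. ((\<lambda>t. f (G (x(j := t)))) has_real_derivative h x) (at (x j)))"
      if j: "j < m'" for j
    proof (intro exI conjI ballI)
      note pG = smooth_on_Rm_partial[OF G(1,2) j]
      let ?h = "\<lambda>x. \<Sum>i<m. partial_deriv j (\<lambda>x. G x i) x * partial_deriv i f (G x)"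
      have "C_k_on k m' W (\<lambda>x. \<Sum>i\<in>A. partial_deriv j (\<lambda>x. G x i) x * partial_deriv i f (G x))"
        if "finite A" "A \<subseteq> {..<m}" for A
        using that
      proof (induction A rule: finite_induct)
        case (insert i A)
        then have "i < m" by simp
        have "C_k_on k m' W (partial_deriv j (\<lambda>x. G x i))"
          using pG(1)[OF \<open>i < m\<close>] unfolding smooth_on_Rm_def by blast
        moreover have "C_k_on k m' W (\<lambda>x. partial_deriv i f (G x))"
          by (rule Suc.IH[OF smooth_on_Rm_partial(1)[OF Suc.prems f(2) \<open>i < m\<close>]])
        ultimately show ?case using insert by (simp add: C_k_on_add C_k_on_mult)
      qed (simp add: C_k_on_const)
      then show "C_k_on k m' W ?h" by simp
      fix x assume x: "x \<in> W"
      obtain S where S: "open S" "x j \<in> S" "\<And>t. t \<in> S \<Longrightarrow> x(j := t) \<in> W"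
        using slice_neighbourhood[OF G(2) x j] by blast
      have "continuous_on S (\<lambda>t. G (x(j := t)))"
        by (rule continuous_on_compose2[OF contG continuous_on_fun_upd]) (use S in auto)
      then have "((\<lambda>t. f (G (x(j := t)))) has_real_derivative
         (\<Sum>i<m. partial_deriv j (\<lambda>x. G x i) x * partial_deriv i f (G (x(j := x j))))) (at (x j))"
        by (intro has_derivative_along_curve[OF Suc.prems f(2) S(1,2)]) (use S G(3) pG(2) x in auto)
      then show "((\<lambda>t. f (G (x(j := t)))) has_real_derivative ?h x) (at (x j))" by simp
    qed
    moreover have "continuous_on W (\<lambda>x. f (G x))"
      using continuous_on_compose2[OF smooth_on_Rm_continuous[OF Suc.prems] contG] G(3) by auto
    ultimately show ?case by simp
  qed
  then show ?thesis by (simp add: smooth_on_Rm_def)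
qed


subsection \<open>Bump functions on Euclidean space\<close>

text \<open>The functions \<open>p(1/t) e\<^sup>-\<^sup>1\<^sup>/\<^sup>t\<close>, continued by \<open>0\<close> to \<open>t \<le> 0\<close>, for polynomials \<open>p\<close>. Allowing all
  \<open>p\<close> makes this class closed under differentiation, which gives smoothness.\<close>

definition flat :: "real poly \<Rightarrow> real \<Rightarrow> real"
  where "flat p t = (if t > 0 then poly p (1 / t) * exp (- (1 / t)) else 0)"

lemma poly_times_exp_tendsto_0: "((\<lambda>s. poly p s * exp (- s)) \<longlongrightarrow> (0::real)) at_top"
proof -
  have "((\<lambda>s. \<Sum>i\<le>degree p. coeff p i * (s ^ i / exp s)) \<longlongrightarrow> (\<Sum>i\<le>degree p. coeff p i * 0)) at_top"
    by (intro tendsto_sum tendsto_mult tendsto_const tendsto_power_div_exp_0)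
  then show ?thesis
    by (simp add: poly_altdef exp_minus sum_distrib_left divide_inverse mult_ac)
qed

lemma flat_has_derivative:
  "(flat p has_real_derivative flat ([:0, 0, 1:] * (p - pderiv p)) t) (at t)"
proof (cases t "0::real" rule: linorder_cases)
  case less
  have "((\<lambda>t. 0) has_real_derivative 0) (at t)" by simp
  from has_field_derivative_transform_within_open[OF this, of "{..<0}" "flat p"] less
  show ?thesis by (simp add: flat_def)
next
  case greater
  have "((\<lambda>t. poly p (1 / t) * exp (- (1 / t))) has_real_derivative
      (poly (pderiv p) (1 / t) * (- 1 / t\<^sup>2)) * exp (- (1 / t)) + (exp (- (1 / t)) * (1 / t\<^sup>2)) * poly p (1 / t)) (at t)"
    using greater
    by (intro DERIV_mult DERIV_chain2[OF poly_DERIV] DERIV_chain2[OF DERIV_exp])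
      (auto intro!: derivative_eq_intros simp: power2_eq_square)
  also have "(poly (pderiv p) (1 / t) * (- 1 / t\<^sup>2)) * exp (- (1 / t)) + (exp (- (1 / t)) * (1 / t\<^sup>2)) * poly p (1 / t)
      = flat ([:0, 0, 1:] * (p - pderiv p)) t"
    using greater by (simp add: flat_def field_simps power2_eq_square)
  finally show ?thesis
    by (rule has_field_derivative_transform_within_open[where S="{0<..}"]) (use greater in \<open>auto simp: flat_def\<close>)
next
  case equal
  have "((\<lambda>t. (flat p t - flat p 0) / (t - 0)) \<longlongrightarrow> 0) (at 0)"
  proof (rule filterlim_split_at)
    have ev: "\<forall>\<^sub>F t::real in at_left 0. (flat p t - flat p 0) / (t - 0) = 0"
      by (rule eventually_at_leftI[of "-1"]) (auto simp: flat_def)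
    show "((\<lambda>t. (flat p t - flat p 0) / (t - 0)) \<longlongrightarrow> 0) (at_left 0)"
      using tendsto_cong[OF ev] by simp
    have "((\<lambda>t. poly ([:0, 1:] * p) (inverse t) * exp (- inverse t)) \<longlongrightarrow> 0) (at_right (0::real))"
      by (rule filterlim_compose[OF poly_times_exp_tendsto_0 filterlim_inverse_at_top_right])
    moreover have ev: "\<forall>\<^sub>F t::real in at_right 0.
        (flat p t - flat p 0) / (t - 0) = poly ([:0, 1:] * p) (inverse t) * exp (- inverse t)"
      by (rule eventually_at_rightI[of _ 1]) (auto simp: flat_def divide_inverse)
    ultimately show "((\<lambda>t. (flat p t - flat p 0) / (t - 0)) \<longlongrightarrow> 0) (at_right 0)"
      using tendsto_cong[OF ev] by simp
  qed
  then show ?thesis using equal by (simp add: has_field_derivative_iff flat_def)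
qed

lemma smooth_on_Rm_flat:
  assumes "smooth_on_Rm m V q" "openin (Euclidean_space m) V"
  shows "smooth_on_Rm m V (\<lambda>z. flat p (q z))"
proof -
  have cont: "continuous_on UNIV (flat p)" for p
    using flat_has_derivative by (intro continuous_at_imp_continuous_on ballI DERIV_isCont) 
  have cont: "continuous_on V (\<lambda>z. flat p (q z))" for p
    by (rule continuous_on_compose2[OF cont smooth_on_Rm_continuous[OF assms(1)]]) auto
  have "C_k_on k m V (\<lambda>z. flat p (q z))" for k
  proof (induction k arbitrary: p)
    case (Suc k)
    have "\<exists>h. C_k_on k m V h \<and> (\<forall>x\<in>V. ((\<lambda>t. flat p (q (x(i := t)))) has_real_derivative h x) (at (x i)))"
      if i: "i < m" for i
    proof -
      note pq = smooth_on_Rm_partial[OF assms i]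
      let ?h = "\<lambda>x. flat ([:0, 0, 1:] * (p - pderiv p)) (q x) * partial_deriv i q x"
      have "C_k_on k m V (partial_deriv i q)" using pq(1) unfolding smooth_on_Rm_def by blast
      then have "C_k_on k m V ?h" by (rule C_k_on_mult[OF Suc.IH])
      moreover have "((\<lambda>t. flat p (q (x(i := t)))) has_real_derivative ?h x) (at (x i))" if "x \<in> V" for x
        using DERIV_chain2[OF flat_has_derivative pq(2)[OF that]] by simp
      ultimately show ?thesis by blast
    qed
    with cont show ?case by simp
  qed (simp add: cont)
  then show ?thesis by (simp add: smooth_on_Rm_def)
qed

lemma flat_1_pos: "t > 0 \<Longrightarrow> flat 1 t > 0" and flat_nonpos: "t \<le> 0 \<Longrightarrow> flat p t = 0"
  and flat_1_nonneg: "flat 1 t \<ge> 0"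
  by (auto simp: flat_def)

text \<open>With \<open>\<psi>\<close> for \<^term>\<open>flat 1\<close> and \<open>r\<close> for the squared distance from \<open>y\<close>, the bump function is
  \<open>\<psi>(\<delta>\<^sup>2 - r) / (\<psi>(\<delta>\<^sup>2 - r) + \<psi>(r - \<delta>\<^sup>2/4))\<close>: one of the two summands is always positive.\<close>

lemma bump_function_Rm:
  assumes "openin (Euclidean_space m) V" "y \<in> V"
  obtains \<beta> K W where "smooth_on_Rm m V \<beta>" "compact K" "K \<subseteq> V" "openin (Euclidean_space m) W"
    "y \<in> W" "W \<subseteq> K" "\<And>z. z \<in> W \<Longrightarrow> \<beta> z = (1::real)" "\<And>z. z \<in> V - K \<Longrightarrow> \<beta> z = 0"
proof -
  obtain \<epsilon> where \<epsilon>: "\<epsilon> > 0" "Rm_box m y \<epsilon> \<subseteq> V"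
    using Rm_box_subset[OF assms] by blast
  define \<delta> where "\<delta> = \<epsilon> / 2"
  define r where "r z = (\<Sum>i<m. (z i - y i) * (z i - y i))" for z :: "nat \<Rightarrow> real"
  have r: "smooth_on_Rm m S r" for S
    unfolding r_def[abs_def]
    by (intro smooth_on_Rm_sum smooth_on_Rm_mult smooth_on_Rm_diff smooth_on_Rm_coord smooth_on_Rm_const)
  have r_cont: "continuous_on S r" for S using r by (rule smooth_on_Rm_continuous)
  define \<beta> where "\<beta> z = flat 1 (\<delta>\<^sup>2 - r z) * inverse (flat 1 (\<delta>\<^sup>2 - r z) + flat 1 (r z - \<delta>\<^sup>2 / 4))" for z
  have \<delta>: "\<delta> > 0" "\<delta> < \<epsilon>" using \<epsilon> by (auto simp: \<delta>_def)
  define K where "K = {z. (\<forall>i\<ge>m. z i = 0) \<and> r z \<le> \<delta>\<^sup>2}"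
  define W where "W = {z. r z < \<delta>\<^sup>2 / 4} \<inter> {z. \<forall>i\<ge>m. z i = 0}"
  have K_le: "\<bar>z i - y i\<bar> \<le> \<delta>" if "z \<in> K" "i < m" for z i
  proof -
    have "(z i - y i) * (z i - y i) \<le> r z"
      unfolding r_def using that by (intro member_le_sum) auto
    then have "(z i - y i)\<^sup>2 \<le> \<delta>\<^sup>2" using that by (simp add: K_def power2_eq_square)
    then show ?thesis using \<delta> by (simp add: abs_le_square_iff[symmetric])
  qed
  show thesis
  proof
    have pos: "flat 1 (\<delta>\<^sup>2 - r z) + flat 1 (r z - \<delta>\<^sup>2 / 4) > 0" for z
    proof (cases "\<delta>\<^sup>2 - r z > 0")
      case True
      then show ?thesis using flat_1_pos flat_1_nonneg add_pos_nonneg by metis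
    next
      case False
      moreover have "\<delta>\<^sup>2 > 0" using \<delta> by (intro zero_less_power)
      ultimately have "r z - \<delta>\<^sup>2 / 4 > 0" by linarith
      then show ?thesis using flat_1_pos flat_1_nonneg add_nonneg_pos by metis
    qed
    show "smooth_on_Rm m V \<beta>"
      unfolding \<beta>_def[abs_def]
      by (intro smooth_on_Rm_mult smooth_on_Rm_inverse smooth_on_Rm_add smooth_on_Rm_flat
          smooth_on_Rm_diff smooth_on_Rm_const r assms(1))
        (metis less_irrefl pos)
    show "openin (Euclidean_space m) W"
      unfolding openin_Euclidean_space_iff W_def
      by (rule exI[of _ "{z. r z < \<delta>\<^sup>2 / 4}"])
        (intro conjI refl open_Collect_less r_cont continuous_on_const)
    show "y \<in> W" using \<delta> mem_Euclidean_space[OF assms] by (auto simp: W_def r_def)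
    have "r z \<le> \<delta>\<^sup>2" if "r z < \<delta>\<^sup>2 / 4" for z
      using that zero_less_power[OF \<delta>(1), of 2] by linarith
    then show "W \<subseteq> K" by (auto simp: W_def K_def)
    show "K \<subseteq> V"
    proof
      fix z assume z: "z \<in> K"
      have "\<bar>z i - y i\<bar> < \<epsilon>" if "i < m" for i using K_le[OF z that] \<delta>(2) by linarith
      with z have "z \<in> Rm_box m y \<epsilon>" by (simp add: K_def Rm_box_def)
      with \<epsilon>(2) show "z \<in> V" by blast
    qed
    show "\<beta> z = 0" if "z \<in> V - K" for z
      using that mem_Euclidean_space[OF assms(1)] by (auto simp: \<beta>_def K_def intro!: flat_nonpos)
    show "\<beta> z = 1" if "z \<in> W" for z
    proof -
      have "flat 1 (r z - \<delta>\<^sup>2 / 4) = 0" using that by (intro flat_nonpos) (auto simp: W_def)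
      with pos[of z] show ?thesis by (simp add: \<beta>_def)
    qed
    let ?P = "Pi\<^sub>E UNIV (\<lambda>i. if i < m then {y i - \<delta>..y i + \<delta>} else {0})"
    have "compactin (product_topology (\<lambda>i::nat. euclidean) UNIV) ?P"
      by (subst compactin_PiE) auto
    then have "compact ?P" by (simp add: euclidean_product_topology)
    moreover have "closed K"
    proof -
      have "closed (\<Inter>i\<in>{m..}. {z::nat \<Rightarrow> real. z i = 0})"
        by (intro closed_INT ballI closed_Collect_eq continuous_on_coord continuous_on_const)
      moreover have "closed {z. r z \<le> \<delta>\<^sup>2}"
        by (intro closed_Collect_le r_cont continuous_on_const)
      ultimately have "closed ((\<Inter>i\<in>{m..}. {z::nat \<Rightarrow> real. z i = 0}) \<inter> {z. r z \<le> \<delta>\<^sup>2})" by (rule closed_Int)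
      moreover have "(\<Inter>i\<in>{m..}. {z::nat \<Rightarrow> real. z i = 0}) \<inter> {z. r z \<le> \<delta>\<^sup>2} = K" by (auto simp: K_def)
      ultimately show ?thesis by simp
    qed
    moreover have "K \<subseteq> ?P"
    proof
      fix z assume z: "z \<in> K"
      have "z i \<in> {y i - \<delta>..y i + \<delta>}" if "i < m" for i using K_le[OF z that] by (auto simp: abs_le_iff)
      with z show "z \<in> ?P" by (simp add: K_def PiE_iff)
    qed
    ultimately show "compact K" using compact_Int_closed[of ?P K] by (simp add: Int_absorb1)
  qed
qed

section \<open>Smooth functions and tangent vectors on manifolds\<close>

locale manifold =
  fixes M :: "('p::{t2_space,second_countable_topology}, 'z) mfd_scheme"
  assumes smooth_manifold: "smooth_manifold M"
begin

lemma chart_exists: obtains U \<phi> where "(U, \<phi>) \<in> charts M" "p \<in> U"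
proof -
  have "p \<in> \<Union> (fst ` charts M)" using smooth_manifold by (simp add: smooth_manifold_def)
  then show thesis using that by auto
qed

lemma chart_open: "(U, \<phi>) \<in> charts M \<Longrightarrow> open U"
  using smooth_manifold by (auto simp: smooth_manifold_def)

lemma transition_smooth:
  assumes "(U, \<phi>) \<in> charts M" "(V, \<psi>) \<in> charts M" "i < mdim M"
  shows "smooth_on_Rm (mdim M) (\<phi> ` (U \<inter> V)) (\<lambda>y. \<psi> (inv_into U \<phi> y) i)"
  using smooth_manifold assms unfolding smooth_manifold_def by fast

context
  fixes U \<phi> assumes chart: "(U, \<phi>) \<in> charts M"
begin

lemma chart_homeomorphic:
  "homeomorphic_map (top_of_set U) (subtopology (Euclidean_space (mdim M)) (\<phi> ` U)) \<phi>"
  and chart_image_open: "openin (Euclidean_space (mdim M)) (\<phi> ` U)"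
  using smooth_manifold chart by (auto simp: smooth_manifold_def)

lemma chart_inj: "inj_on \<phi> U"
  using homeomorphic_imp_injective_map[OF chart_homeomorphic] by simp

lemma chart_inverse: "x \<in> U \<Longrightarrow> inv_into U \<phi> (\<phi> x) = x"
  using chart_inj by simp

lemma chart_openin:
  assumes "open W"
  shows "openin (Euclidean_space (mdim M)) (\<phi> ` (U \<inter> W))"
proof -
  have "openin (top_of_set U) (U \<inter> W)" using assms by (auto simp: openin_open)
  then have "openin (subtopology (Euclidean_space (mdim M)) (\<phi> ` U)) (\<phi> ` (U \<inter> W))"
    using homeomorphic_imp_open_map[OF chart_homeomorphic] by (simp add: open_map_def)
  with chart_image_open show ?thesis using openin_trans_full by blast
qed

lemma chart_continuous: "continuous_on U \<phi>"
  using homeomorphic_imp_continuous_map[OF chart_homeomorphic]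
  by (auto simp: Euclidean_space_def continuous_map_in_subtopology subtopology_subtopology euclidean_product_topology)

lemma chart_inverse_continuous: "continuous_on (\<phi> ` U) (inv_into U \<phi>)"
proof -
  have sub: "\<phi> ` U \<subseteq> {x. \<forall>i\<ge>mdim M. x i = 0}"
    using chart_image_open by (auto simp: openin_Euclidean_space_iff)
  obtain g where g: "homeomorphic_maps (top_of_set U) (subtopology (Euclidean_space (mdim M)) (\<phi> ` U)) \<phi> g"
    using chart_homeomorphic homeomorphic_map_maps by blast
  have "subtopology (Euclidean_space (mdim M)) (\<phi> ` U) = top_of_set (\<phi> ` U)"
    using sub by (simp add: Euclidean_space_def subtopology_subtopology euclidean_product_topology Int_absorb1)
  with g have "continuous_on (\<phi> ` U) g" and gU: "\<And>x. x \<in> U \<Longrightarrow> g (\<phi> x) = x"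
    by (auto simp: homeomorphic_maps_def)
  moreover have "g y = inv_into U \<phi> y" if "y \<in> \<phi> ` U" for y
    using that gU chart_inverse by auto
  ultimately show ?thesis using continuous_on_cong by (metis (no_types, lifting))
qed

end

lemma smooth_fun_const: "(\<lambda>x. c) \<in> smooth_fun M W"
  and smooth_fun_add: "f \<in> smooth_fun M W \<Longrightarrow> g \<in> smooth_fun M W \<Longrightarrow> (\<lambda>x. f x + g x) \<in> smooth_fun M W"
  and smooth_fun_diff: "f \<in> smooth_fun M W \<Longrightarrow> g \<in> smooth_fun M W \<Longrightarrow> (\<lambda>x. f x - g x) \<in> smooth_fun M W"
  and smooth_fun_mult: "f \<in> smooth_fun M W \<Longrightarrow> g \<in> smooth_fun M W \<Longrightarrow> (\<lambda>x. f x * g x) \<in> smooth_fun M W"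
  and smooth_fun_sum: "(\<And>a. a \<in> A \<Longrightarrow> k a \<in> smooth_fun M W) \<Longrightarrow> (\<lambda>x. \<Sum>a\<in>A. k a x) \<in> smooth_fun M W"
  unfolding smooth_fun_def
  by (auto intro!: smooth_on_Rm_const smooth_on_Rm_add smooth_on_Rm_diff smooth_on_Rm_mult smooth_on_Rm_sum)

lemma smooth_fun_prod: "finite A \<Longrightarrow> (\<And>a. a \<in> A \<Longrightarrow> k a \<in> smooth_fun M W) \<Longrightarrow> (\<lambda>x. \<Prod>a\<in>A. k a x) \<in> smooth_fun M W"
  by (induction A rule: finite_induct) (auto intro: smooth_fun_const smooth_fun_mult)

lemma smooth_fun_subset: "f \<in> smooth_fun M W \<Longrightarrow> W' \<subseteq> W \<Longrightarrow> f \<in> smooth_fun M W'"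
  unfolding smooth_fun_def
proof clarify
  fix U \<phi>
  assume "\<forall>(U, \<phi>)\<in>charts M. smooth_on_Rm (mdim M) (\<phi> ` (U \<inter> W)) (\<lambda>y. f (inv_into U \<phi> y))"
    and "(U, \<phi>) \<in> charts M" and "W' \<subseteq> W"
  then show "smooth_on_Rm (mdim M) (\<phi> ` (U \<inter> W')) (\<lambda>y. f (inv_into U \<phi> y))"
    by (intro smooth_on_Rm_subset[of _ "\<phi> ` (U \<inter> W)" _ "\<phi> ` (U \<inter> W')"]) auto
qed

lemma smooth_fun_cong:
  assumes "f \<in> smooth_fun M W" "open W" "\<And>x. x \<in> W \<Longrightarrow> f x = g x"
  shows "g \<in> smooth_fun M W"
  unfolding smooth_fun_def
proof clarify
  fix U \<phi> assume c: "(U, \<phi>) \<in> charts M"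
  show "smooth_on_Rm (mdim M) (\<phi> ` (U \<inter> W)) (\<lambda>y. g (inv_into U \<phi> y))"
  proof (rule smooth_on_Rm_cong[OF chart_openin[OF c assms(2)]])
    show "smooth_on_Rm (mdim M) (\<phi> ` (U \<inter> W)) (\<lambda>y. f (inv_into U \<phi> y))"
      using assms(1) c by (auto simp: smooth_fun_def)
  qed (auto simp: chart_inverse[OF c] assms(3))
qed

lemma smooth_fun_local:
  assumes "open W" "\<And>x. x \<in> W \<Longrightarrow> \<exists>N. open N \<and> x \<in> N \<and> f \<in> smooth_fun M N"
  shows "f \<in> smooth_fun M W"
  unfolding smooth_fun_def
proof clarify
  fix U \<phi> assume c: "(U, \<phi>) \<in> charts M"
  show "smooth_on_Rm (mdim M) (\<phi> ` (U \<inter> W)) (\<lambda>y. f (inv_into U \<phi> y))"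
  proof (rule smooth_on_Rm_local[OF _ chart_openin[OF c assms(1)]])
    fix y assume "y \<in> \<phi> ` (U \<inter> W)"
    then obtain x where x: "x \<in> U" "x \<in> W" "y = \<phi> x" by auto
    then obtain N where N: "open N" "x \<in> N" "f \<in> smooth_fun M N" using assms(2) by blast
    have "smooth_on_Rm (mdim M) (\<phi> ` (U \<inter> N)) (\<lambda>y. f (inv_into U \<phi> y))"
      using N(3) c by (auto simp: smooth_fun_def)
    then show "\<exists>V. y \<in> V \<and> openin (Euclidean_space (mdim M)) V \<and>
        smooth_on_Rm (mdim M) V (\<lambda>y. f (inv_into U \<phi> y))"
      using x N(2) chart_openin[OF c N(1)] by (intro exI[of _ "\<phi> ` (U \<inter> N)"] conjI) auto
  qed
qed

lemma smooth_fun_chart: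
  assumes c: "(U, \<phi>) \<in> charts M" and "W \<subseteq> U" "open W" "smooth_on_Rm (mdim M) (\<phi> ` W) g"
  shows "(\<lambda>x. g (\<phi> x)) \<in> smooth_fun M W"
  unfolding smooth_fun_def
proof clarify
  fix V \<psi> assume c': "(V, \<psi>) \<in> charts M"
  have "openin (Euclidean_space (mdim M)) (\<phi> ` W)"
    using chart_openin[OF c assms(3)] assms(2) by (simp add: Int_absorb1)
  then show "smooth_on_Rm (mdim M) (\<psi> ` (V \<inter> W)) (\<lambda>y. g (\<phi> (inv_into V \<psi> y)))"
  proof (rule smooth_on_Rm_compose[OF assms(4)])
    show "smooth_on_Rm (mdim M) (\<psi> ` (V \<inter> W)) (\<lambda>x. \<phi> (inv_into V \<psi> x) i)" if "i < mdim M" for i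
      by (rule smooth_on_Rm_subset[OF transition_smooth[OF c' c that]]) (use assms(2) in auto)
    show "\<And>x. x \<in> \<psi> ` (V \<inter> W) \<Longrightarrow> \<phi> (inv_into V \<psi> x) \<in> \<phi> ` W"
      by (auto simp: chart_inverse[OF c'])
  qed (rule chart_openin[OF c' assms(3)])
qed

text \<open>The product is smooth on \<open>V \<inter> W\<close> and zero on the complement of \<open>C\<close>, and these two open sets
  cover \<open>V\<close>.\<close>

lemma smooth_fun_cutoff:
  assumes "f \<in> smooth_fun M (V \<inter> W)" "open V" "open W" "h \<in> C_inf M" "closed C" "C \<subseteq> W"
    and "\<And>x. x \<notin> C \<Longrightarrow> h x = 0"
  shows "(\<lambda>x. if x \<in> W then h x * f x else 0) \<in> smooth_fun M V"
proof (rule smooth_fun_local[OF assms(2)])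
  fix x assume x: "x \<in> V"
  let ?g = "\<lambda>x. if x \<in> W then h x * f x else 0"
  show "\<exists>N. open N \<and> x \<in> N \<and> ?g \<in> smooth_fun M N"
  proof (cases "x \<in> W")
    case True
    have "(\<lambda>x. h x * f x) \<in> smooth_fun M (V \<inter> W)"
      by (rule smooth_fun_mult[OF smooth_fun_subset[OF assms(4)] assms(1)]) simp
    then have "?g \<in> smooth_fun M (V \<inter> W)"
      by (rule smooth_fun_cong) (use assms in auto)
    with True x assms(2,3) show ?thesis by (intro exI[of _ "V \<inter> W"]) auto
  next
    case False
    have "?g \<in> smooth_fun M (- C)"
      by (rule smooth_fun_cong[OF smooth_fun_const[of 0]]) (use assms in auto)
    with False x assms(5,6) show ?thesis by (intro exI[of _ "- C"]) auto
  qed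
qed

text \<open>The Hausdorff property enters here: the compact support of a bump function in a chart domain
  is closed in the whole manifold, so that continuation by \<open>0\<close> is smooth.\<close>

lemma bump_function:
  assumes "open W" "p \<in> W"
  obtains h C N where "h \<in> C_inf M" "closed C" "C \<subseteq> W" "open N" "p \<in> N" "N \<subseteq> C"
    "\<And>x. x \<in> N \<Longrightarrow> h x = 1" "\<And>x. x \<notin> C \<Longrightarrow> h x = 0"
proof -
  obtain U \<phi> where c: "(U, \<phi>) \<in> charts M" "p \<in> U" by (rule chart_exists)
  let ?V = "\<phi> ` (U \<inter> W)"
  have V: "openin (Euclidean_space (mdim M)) ?V" "\<phi> p \<in> ?V"
    using chart_openin[OF c(1) assms(1)] c assms by auto
  obtain b K B where b: "smooth_on_Rm (mdim M) ?V b" "compact K" "K \<subseteq> ?V"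
    "openin (Euclidean_space (mdim M)) B" "\<phi> p \<in> B" "B \<subseteq> K"
    "\<And>z. z \<in> B \<Longrightarrow> b z = 1" "\<And>z. z \<in> ?V - K \<Longrightarrow> b z = 0"
    by (rule bump_function_Rm[OF V]) (rule that)
  obtain T where T: "open T" "B = T \<inter> {x. \<forall>i\<ge>mdim M. x i = 0}"
    using b(4) by (auto simp: openin_Euclidean_space_iff)
  note inv = chart_inverse[OF c(1)]
  let ?C = "inv_into U \<phi> ` K" and ?N = "\<phi> -` T \<inter> (U \<inter> W)"
  let ?h = "\<lambda>x. if x \<in> U \<inter> W then b (\<phi> x) else 0"
  show thesis
  proof
    have "continuous_on K (inv_into U \<phi>)"
      by (rule continuous_on_subset[OF chart_inverse_continuous[OF c(1)]]) (use b(3) in auto)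
    then show C: "closed ?C" using b(2) compact_continuous_image compact_imp_closed by blast
    show CW: "?C \<subseteq> W" using b(3) by (auto simp: inv)
    have CU: "?C \<subseteq> U" using b(3) by (auto simp: inv)
    show "open ?N"
      using continuous_on_open_vimage[of "U \<inter> W" \<phi>] continuous_on_subset[OF chart_continuous[OF c(1)], of "U \<inter> W"]
        chart_open[OF c(1)] assms(1) T(1) by blast
    show "p \<in> ?N" using c assms b(5) T by auto
    have NB: "\<phi> x \<in> B" if "x \<in> ?N" for x
      using that T mem_Euclidean_space[OF V(1)] by auto
    show "?N \<subseteq> ?C"
    proof
      fix x assume x: "x \<in> ?N"
      then have "inv_into U \<phi> (\<phi> x) = x" using inv by blast
      moreover have "\<phi> x \<in> K" using NB[OF x] b(6) by blast
      ultimately show "x \<in> ?C" by (metis image_eqI)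
    qed
    show "\<And>x. x \<in> ?N \<Longrightarrow> ?h x = 1" using NB b(7) by auto
    show h0: "?h x = 0" if "x \<notin> ?C" for x
    proof (cases "x \<in> U \<inter> W")
      case True
      then have "inv_into U \<phi> (\<phi> x) = x" using inv by blast
      then have "\<phi> x \<notin> K" using that by (metis image_eqI)
      with True b(8) show ?thesis by auto
    qed auto
    show "?h \<in> C_inf M"
    proof (rule smooth_fun_local)
      fix x
      show "\<exists>N. open N \<and> x \<in> N \<and> ?h \<in> smooth_fun M N"
      proof (cases "x \<in> U \<inter> W")
        case True
        have "?h \<in> smooth_fun M (U \<inter> W)"
          by (rule smooth_fun_cong[OF smooth_fun_chart[OF c(1) _ _ b(1)]]) (use chart_open[OF c(1)] assms(1) in auto)
        with True chart_open[OF c(1)] assms(1) show ?thesis by (intro exI[of _ "U \<inter> W"]) auto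
      next
        case False
        have "?h \<in> smooth_fun M (- ?C)"
          by (rule smooth_fun_cong[OF smooth_fun_const[of 0]]) (use C h0 in auto)
        with False C CU CW show ?thesis by (intro exI[of _ "- ?C"]) auto
      qed
    qed simp
  qed
qed

end

context manifold
begin

lemma C_inf_linear: "f \<in> C_inf M \<Longrightarrow> g \<in> C_inf M \<Longrightarrow> a *\<^sub>R f + b *\<^sub>R g \<in> C_inf M"
  using smooth_fun_add[OF smooth_fun_mult[OF smooth_fun_const] smooth_fun_mult[OF smooth_fun_const], of f UNIV g a b]
  by (simp add: scaleR_fun_def plus_fun_def)

context
  fixes x X assumes X: "X \<in> tangent_space M x"
begin

lemma tangent_outside: "f \<notin> C_inf M \<Longrightarrow> X f = 0"
  and tangent_product: "f \<in> C_inf M \<Longrightarrow> g \<in> C_inf M \<Longrightarrow> X (\<lambda>y. f y * g y) = X f * g x + f x * X g"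
  using X by (auto simp: tangent_space_def)

lemma tangent_linear:
  assumes "f \<in> C_inf M" "g \<in> C_inf M"
  shows "X (\<lambda>y. a * f y + b * g y) = a * X f + b * X g"
proof -
  have "X (a *\<^sub>R f + b *\<^sub>R g) = a *\<^sub>R X f + b *\<^sub>R X g"
    using X assms by (simp add: tangent_space_def linear_map_on_def)
  then show ?thesis by (simp add: scaleR_fun_def plus_fun_def)
qed

lemma tangent_add: "f \<in> C_inf M \<Longrightarrow> g \<in> C_inf M \<Longrightarrow> X (\<lambda>y. f y + g y) = X f + X g"
  using tangent_linear[of f g 1 1] by simp

lemma tangent_diff: "f \<in> C_inf M \<Longrightarrow> g \<in> C_inf M \<Longrightarrow> X (\<lambda>y. f y - g y) = X f - X g"
  using tangent_linear[of f g 1 "-1"] by simp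

lemma tangent_const: "X (\<lambda>y. c) = 0"
proof -
  have 1: "X (\<lambda>y. 1) = 0"
    using tangent_product[OF smooth_fun_const smooth_fun_const, of 1 1] by simp
  show ?thesis
    using tangent_linear[OF smooth_fun_const smooth_fun_const, of c 1 0 1] 1 by simp
qed

lemma tangent_sum:
  "(\<And>a. a \<in> A \<Longrightarrow> f a \<in> C_inf M) \<Longrightarrow> X (\<lambda>y. \<Sum>a\<in>A. f a y) = (\<Sum>a\<in>A. X (f a))"
proof (induction A rule: infinite_finite_induct)
  case (insert a A)
  then have "X (\<lambda>y. f a y + (\<Sum>a\<in>A. f a y)) = X (f a) + (\<Sum>a\<in>A. X (f a))"
    by (subst tangent_add) (auto intro: smooth_fun_sum)
  with insert show ?case by simp
qed (simp_all add: tangent_const)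

text \<open>Multiply \<open>f - g\<close> by a bump function supported where \<open>f = g\<close> and apply the Leibniz rule.\<close>

lemma tangent_local:
  assumes "f \<in> C_inf M" "g \<in> C_inf M" "open N" "x \<in> N" "\<And>y. y \<in> N \<Longrightarrow> f y = g y"
  shows "X f = X g"
proof -
  obtain h C N' where h: "h \<in> C_inf M" "C \<subseteq> N" "x \<in> N'" "\<And>y. y \<in> N' \<Longrightarrow> h y = 1" "\<And>y. y \<notin> C \<Longrightarrow> h y = 0"
    using bump_function[OF assms(3,4)] by metis
  have fg: "(\<lambda>y. f y - g y) \<in> C_inf M" by (intro smooth_fun_diff assms)
  have "(\<lambda>y. h y * (f y - g y)) = (\<lambda>y. 0)" using h assms(5) by (auto simp: fun_eq_iff)
  then have "X h * (f x - g x) + h x * X (\<lambda>y. f y - g y) = 0"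
    using tangent_product[OF h(1) fg] tangent_const by simp
  then show ?thesis using assms h by (simp add: tangent_diff)
qed

end

lemma partial_deriv_linear:
  assumes "smooth_on_Rm m V f" "smooth_on_Rm m V g" "openin (Euclidean_space m) V" "x \<in> V" "i < m"
  shows "partial_deriv i (\<lambda>y. a * f y + b * g y) x = a * partial_deriv i f x + b * partial_deriv i g x"
  unfolding partial_deriv_def[of i "\<lambda>y. a * f y + b * g y"]
  by (intro DERIV_imp_deriv DERIV_add DERIV_cmult smooth_on_Rm_partial(2)[OF _ assms(3,5,4)] assms)

lemma partial_deriv_product:
  assumes "smooth_on_Rm m V f" "smooth_on_Rm m V g" "openin (Euclidean_space m) V" "x \<in> V" "i < m"
  shows "partial_deriv i (\<lambda>y. f y * g y) x = partial_deriv i f x * g x + f x * partial_deriv i g x"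
proof -
  have "((\<lambda>t. f (x(i := t)) * g (x(i := t))) has_real_derivative
      partial_deriv i f x * g (x(i := x i)) + partial_deriv i g x * f (x(i := x i))) (at (x i))"
    by (intro DERIV_mult smooth_on_Rm_partial(2)[OF _ assms(3,5,4)] assms)
  then show ?thesis
    unfolding partial_deriv_def[of i "\<lambda>y. f y * g y"] by (simp add: DERIV_imp_deriv mult.commute)
qed

text \<open>By Hadamard's lemma, near a point \<open>y\<close> every function is \<open>f(y) + \<Sum>\<^sub>i (F\<^sub>i - F\<^sub>i(y)) g\<^sub>i\<close> with
  smooth \<open>g\<^sub>i\<close>, so that the Leibniz rule determines a tangent vector from its values on the
  coordinates. Cut off by a bump function, the coordinates and the coordinate fields are global.\<close>

lemma coordinate_frame:
  obtains N F V where "open N" "p \<in> N"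
    "\<And>i. i < mdim M \<Longrightarrow> F i \<in> C_inf M" "\<And>i. i < mdim M \<Longrightarrow> V i \<in> vector_fields M"
    "\<And>y i j. y \<in> N \<Longrightarrow> i < mdim M \<Longrightarrow> j < mdim M \<Longrightarrow> V i (F j) y = (if i = j then 1 else 0)"
    "\<And>y X f. y \<in> N \<Longrightarrow> X \<in> tangent_space M y \<Longrightarrow> f \<in> C_inf M \<Longrightarrow> X f = (\<Sum>i<mdim M. X (F i) * V i f y)"
proof -
  let ?m = "mdim M"
  obtain U \<phi> where c: "(U, \<phi>) \<in> charts M" "p \<in> U" by (rule chart_exists)
  note U = chart_open[OF c(1)] and inv = chart_inverse[OF c(1)] and op = chart_image_open[OF c(1)]
  obtain h C N where h: "h \<in> C_inf M" "closed C" "C \<subseteq> U" "open N" "p \<in> N" "N \<subseteq> C"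
    "\<And>x. x \<in> N \<Longrightarrow> h x = 1" "\<And>x. x \<notin> C \<Longrightarrow> h x = 0"
    using bump_function[OF U c(2)] by metis
  define loc where "loc f z = (f (inv_into U \<phi> z) :: real)" for f z
  have loc: "smooth_on_Rm ?m (\<phi> ` U) (loc f)" if "f \<in> C_inf M" for f
    using that c(1) by (auto simp: loc_def[abs_def] smooth_fun_def)
  define F where "F i x = (if x \<in> U then h x * \<phi> x i else 0)" for i x
  define V where "V i f = (if f \<in> C_inf M then
    (\<lambda>x. if x \<in> U then h x * partial_deriv i (loc f) (\<phi> x) else 0) else (\<lambda>x. 0))" for i f
  have cut: "(\<lambda>x. if x \<in> U then h x * g (\<phi> x) else 0) \<in> C_inf M" if "smooth_on_Rm ?m (\<phi> ` U) g" for g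
    using smooth_fun_cutoff[OF _ open_UNIV U h(1,2,3,8), of "\<lambda>x. g (\<phi> x)"]
      smooth_fun_chart[OF c(1) order_refl U that] by simp
  have F: "F i \<in> C_inf M" for i
    using cut[OF smooth_on_Rm_coord, of i] by (simp add: F_def[abs_def])
  have Vsm: "V i f \<in> C_inf M" if "i < ?m" for i f
    using cut[OF smooth_on_Rm_partial(1)[OF loc op that]] smooth_fun_const
    by (auto simp: V_def)
  have V: "V i \<in> vector_fields M" if i: "i < ?m" for i
    unfolding vector_fields_def
  proof (intro CollectI conjI allI ballI Vsm i)
    fix x
    show "at_pt (V i) x \<in> tangent_space M x"
      unfolding tangent_space_def
    proof (intro CollectI conjI allI impI ballI)
      show "f \<notin> C_inf M \<Longrightarrow> at_pt (V i) x f = 0" for f by (simp add: at_pt_def V_def)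
      have "V i (a *\<^sub>R f + b *\<^sub>R g) x = a * V i f x + b * V i g x" if "f \<in> C_inf M" "g \<in> C_inf M" for f g a b
      proof -
        have "loc (a *\<^sub>R f + b *\<^sub>R g) = (\<lambda>z. a * loc f z + b * loc g z)"
          by (simp add: loc_def fun_eq_iff scaleR_fun_def)
        then show ?thesis
          using that C_inf_linear[OF that] partial_deriv_linear[OF loc loc op _ i, of f g "\<phi> x" a b]
          by (simp add: V_def algebra_simps)
      qed
      then show "linear_map_on (C_inf M) (at_pt (V i) x)"
        by (simp add: linear_map_on_def at_pt_def)
      fix f g assume fg: "f \<in> C_inf M" "g \<in> C_inf M"
      have "loc (\<lambda>y. f y * g y) = (\<lambda>z. loc f z * loc g z)" by (simp add: loc_def fun_eq_iff)
      moreover have "loc k (\<phi> x) = k x" if "x \<in> U" for k using that inv by (simp add: loc_def)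
      ultimately show "at_pt (V i) x (\<lambda>y. f y * g y) = at_pt (V i) x f * g x + f x * at_pt (V i) x g"
        using fg smooth_fun_mult[OF fg] partial_deriv_product[OF loc loc op _ i, of f g "\<phi> x"]
        by (simp add: V_def at_pt_def algebra_simps)
    qed
  qed
  have NU: "N \<subseteq> U" using h by blast
  show thesis
  proof (rule that[of N F V])
    show "open N" "p \<in> N" by fact+
    show "\<And>i. i < ?m \<Longrightarrow> F i \<in> C_inf M" "\<And>i. i < ?m \<Longrightarrow> V i \<in> vector_fields M" using F V by auto
    show "V i (F j) y = (if i = j then 1 else 0)" if y: "y \<in> N" and ij: "i < ?m" "j < ?m" for y i j
    proof -
      have "openin (Euclidean_space ?m) (\<phi> ` N)"
        using chart_openin[OF c(1) h(4)] NU by (simp add: Int_absorb1)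
      then have "((\<lambda>t. loc (F j) ((\<phi> y)(i := t))) has_real_derivative (if i = j then 1 else 0)) (at (\<phi> y i))"
      proof (rule partial_derivative_cong[where f="\<lambda>z. z j"])
        show "\<phi> y \<in> \<phi> ` N" "i < ?m" using y ij by auto
        show "z j = loc (F j) z" if "z \<in> \<phi> ` N" for z
          using that NU h(7) by (auto simp: loc_def F_def inv subset_iff)
        show "((\<lambda>t. ((\<phi> y)(i := t)) j) has_real_derivative (if i = j then 1 else 0)) (at (\<phi> y i))"
          by auto
      qed
      then have "partial_deriv i (loc (F j)) (\<phi> y) = (if i = j then 1 else 0)"
        unfolding partial_deriv_def by (rule DERIV_imp_deriv)
      then show ?thesis using F y NU h(7)[OF y] by (auto simp: V_def)
    qed
    fix y X f assume y: "y \<in> N" and X: "X \<in> tangent_space M y" and f: "f \<in> C_inf M"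
    have yU: "y \<in> U" using y NU by blast
    obtain B g where B: "openin (Euclidean_space ?m) B" "\<phi> y \<in> B" "B \<subseteq> \<phi> ` U"
      "\<And>i. i < ?m \<Longrightarrow> smooth_on_Rm ?m B (g i)"
      "\<And>z. z \<in> B \<Longrightarrow> loc f z = loc f (\<phi> y) + (\<Sum>i<?m. (z i - \<phi> y i) * g i z)"
      "\<And>i. i < ?m \<Longrightarrow> g i (\<phi> y) = partial_deriv i (loc f) (\<phi> y)"
      by (rule hadamard[OF loc[OF f] op, of "\<phi> y"]) (use yU in blast, rule that)
    obtain T where T: "open T" "B = T \<inter> {x. \<forall>i\<ge>?m. x i = 0}"
      using B(1) by (auto simp: openin_Euclidean_space_iff)
    define W where "W = (\<phi> -` T \<inter> U) \<inter> N"
    have "open (\<phi> -` T \<inter> U)"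
      using continuous_on_open_vimage[OF U] chart_continuous[OF c(1)] T(1) by blast
    then have W: "open W" "y \<in> W" using h(4) T B(2) y yU by (auto simp: W_def)
    have WB: "\<phi> x \<in> B" if "x \<in> W" for x
      using that T mem_Euclidean_space[OF op, of "\<phi> x"] by (auto simp: W_def)
    have WU: "W \<subseteq> U" "W \<subseteq> N" by (auto simp: W_def)
    obtain k K N' where k: "k \<in> C_inf M" "closed K" "K \<subseteq> W" "open N'" "y \<in> N'" "N' \<subseteq> K"
      "\<And>x. x \<in> N' \<Longrightarrow> k x = 1" "\<And>x. x \<notin> K \<Longrightarrow> k x = 0"
      using bump_function[OF W] by metis
    have ky: "k y = 1" using k by blast
    define G where "G i x = (if x \<in> W then k x * g i (\<phi> x) else 0)" for i x
    have G: "G i \<in> C_inf M" if "i < ?m" for i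
    proof -
      have "(\<lambda>x. g i (\<phi> x)) \<in> smooth_fun M W"
        by (rule smooth_fun_chart[OF c(1) WU(1) W(1) smooth_on_Rm_subset[OF B(4)[OF that]]]) (use WB in auto)
      then show ?thesis
        using smooth_fun_cutoff[OF _ open_UNIV W(1) k(1,2,3,8), of "\<lambda>x. g i (\<phi> x)"] by (simp add: G_def[abs_def])
    qed
    have kf: "(\<lambda>x. k x * (f x - f y)) = (\<lambda>x. \<Sum>i<?m. (F i x - F i y) * G i x)"
    proof
      fix x
      show "k x * (f x - f y) = (\<Sum>i<?m. (F i x - F i y) * G i x)"
      proof (cases "x \<in> W")
        case True
        then have xU: "x \<in> U" "h x = 1" using WU h(7) by auto
        have "f x = f y + (\<Sum>i<?m. (\<phi> x i - \<phi> y i) * g i (\<phi> x))"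
          using B(5)[OF WB[OF True]] xU yU by (simp add: loc_def inv)
        then show ?thesis
          using True xU yU h(7)[OF y] by (simp add: F_def G_def sum_distrib_left mult_ac)
      next
        case False
        then have "k x = 0" using k by blast
        with False show ?thesis by (simp add: G_def)
      qed
    qed
    have fm: "(\<lambda>x. f x - f y) \<in> C_inf M" by (intro smooth_fun_diff f smooth_fun_const)
    have Fm: "(\<lambda>x. F i x - F i y) \<in> C_inf M" for i by (intro smooth_fun_diff F smooth_fun_const)
    have "X (\<lambda>x. k x * (f x - f y)) = X f"
      using tangent_product[OF X k(1) fm] tangent_diff[OF X f smooth_fun_const] tangent_const[OF X] ky by simp
    moreover have "X (\<lambda>x. \<Sum>i<?m. (F i x - F i y) * G i x) = (\<Sum>i<?m. X (\<lambda>x. (F i x - F i y) * G i x))"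
      by (rule tangent_sum[OF X]) (use smooth_fun_mult[OF Fm G] in auto)
    moreover have "X (\<lambda>x. (F i x - F i y) * G i x) = X (F i) * V i f y" if i: "i < ?m" for i
      using tangent_product[OF X Fm G[OF i]] tangent_diff[OF X F smooth_fun_const] tangent_const[OF X]
        W(2) ky B(6)[OF i] f yU h(7)[OF y] by (simp add: G_def V_def)
    ultimately show "X f = (\<Sum>i<?m. X (F i) * V i f y)" using kf by simp
  qed
qed

end

section \<open>Linear maps on subspaces\<close>

lemma sum_fun_apply: "(\<Sum>a\<in>A. f a) x = (\<Sum>a\<in>A. f a x)"
  for f :: "'a \<Rightarrow> 'b \<Rightarrow> 'c::comm_monoid_add"
  by (induction A rule: infinite_finite_induct) auto

lemma scaleR_fun_apply [simp]: "(c *\<^sub>R f) x = c *\<^sub>R f x"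
  by (simp add: scaleR_fun_def)

context
  fixes S :: "'a::real_vector set" and f :: "'a \<Rightarrow> 'b::real_vector"
  assumes lin: "linear_map_on S f" and S: "subspace S"
begin

lemma linear_map_on_combination:
  "x \<in> S \<Longrightarrow> y \<in> S \<Longrightarrow> f (a *\<^sub>R x + b *\<^sub>R y) = a *\<^sub>R f x + b *\<^sub>R f y"
  using lin by (simp add: linear_map_on_def)

lemma linear_map_on_add: "x \<in> S \<Longrightarrow> y \<in> S \<Longrightarrow> f (x + y) = f x + f y"
  using linear_map_on_combination[of x y 1 1] by simp

lemma linear_map_on_zero: "f 0 = 0"
  using linear_map_on_combination[of 0 0 0 0] S by (simp add: subspace_0)

lemma linear_map_on_scale: "x \<in> S \<Longrightarrow> f (a *\<^sub>R x) = a *\<^sub>R f x"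
  using linear_map_on_combination[of x x a 0] by simp

lemma linear_map_on_minus: "x \<in> S \<Longrightarrow> f (- x) = - f x"
  using linear_map_on_scale[of x "-1"] by simp

lemma linear_map_on_sum:
  "(\<And>a. a \<in> A \<Longrightarrow> g a \<in> S) \<Longrightarrow> f (\<Sum>a\<in>A. c a *\<^sub>R g a) = (\<Sum>a\<in>A. c a *\<^sub>R f (g a))"
proof (induction A rule: infinite_finite_induct)
  case (insert a A)
  have "(\<Sum>a\<in>A. c a *\<^sub>R g a) \<in> S"
    using insert by (intro subspace_sum[OF S] subspace_scale[OF S]) auto
  with insert show ?case by (simp add: linear_map_on_add linear_map_on_scale subspace_scale[OF S])
qed (simp_all add: linear_map_on_zero)

end

lemma basis_coordinates:
  assumes "is_basis bs V"
  obtains k where "\<And>j. linear_map_on V (k j)"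
    "\<And>i j. i < length bs \<Longrightarrow> j < length bs \<Longrightarrow> k j (bs ! i) = (if i = j then 1 else (0::real))"
    "\<And>v. v \<in> V \<Longrightarrow> v = (\<Sum>j<length bs. k j v *\<^sub>R bs ! j)"
proof -
  have bs: "distinct bs" "independent (set bs)" "span (set bs) = V"
    using assms by (auto simp: is_basis_def)
  define k where "k j v = representation (set bs) v (bs ! j)" for j v
  show thesis
  proof
    show "linear_map_on V (k j)" for j
      using bs by (auto simp: linear_map_on_def k_def representation_add representation_scale span_scale)
    show "k j (bs ! i) = (if i = j then 1 else 0)" if "i < length bs" "j < length bs" for i j
      using bs that by (auto simp: k_def representation_basis nth_eq_iff_index_eq)
    fix v assume "v \<in> V"
    then have "v = (\<Sum>b\<in>set bs. representation (set bs) v b *\<^sub>R b)"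
      using bs sum_representation_eq[of "set bs" v "set bs"] by simp
    also have "\<dots> = (\<Sum>j<length bs. k j v *\<^sub>R bs ! j)"
      unfolding k_def using bs(1)
      by (intro sum.reindex_bij_betw[symmetric, where h="\<lambda>j. bs ! j"]) (auto simp: bij_betw_def inj_on_nth set_conv_nth)
    finally show "v = (\<Sum>j<length bs. k j v *\<^sub>R bs ! j)" .
  qed
qed


section \<open>Sections of vector bundles\<close>

locale vector_bundle =
  fixes E :: "('p::{t2_space,second_countable_topology}, 'v::real_vector) vbundle"
  assumes smooth_bundle: "smooth_vector_bundle E"
begin

sublocale manifold E
  by unfold_locales (use smooth_bundle in \<open>simp add: smooth_vector_bundle_def\<close>)

lemma fibre_subspace: "subspace (fibre E x)"
  using smooth_bundle by (simp add: smooth_vector_bundle_def)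

lemma frame_exists: obtains U es where "(U, es) \<in> frames E" "p \<in> U"
proof -
  have "p \<in> \<Union> (fst ` frames E)" using smooth_bundle by (simp add: smooth_vector_bundle_def)
  then show thesis using that by auto
qed

lemma frame_open: "(U, es) \<in> frames E \<Longrightarrow> open U"
  and frame_basis: "(U, es) \<in> frames E \<Longrightarrow> x \<in> U \<Longrightarrow> is_basis (map (\<lambda>s. s x) es) (fibre E x)"
  using smooth_bundle by (auto simp: smooth_vector_bundle_def)

lemma frame_transition:
  "(U, es) \<in> frames E \<Longrightarrow> (V, fs) \<in> frames E \<Longrightarrow> s \<in> set es \<Longrightarrow> smooth_combination E (U \<inter> V) fs s"
  using smooth_bundle unfolding smooth_vector_bundle_def by fast

lemma section_in_fibre: "s \<in> sections_on E W \<Longrightarrow> x \<in> W \<Longrightarrow> s x \<in> fibre E x"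
  by (simp add: sections_on_def)

lemma section_combination:
  "s \<in> sections_on E W \<Longrightarrow> (U, es) \<in> frames E \<Longrightarrow> smooth_combination E (U \<inter> W) es s"
  by (auto simp: sections_on_def)

lemma sections_on_subset:
  assumes "s \<in> sections_on E W" "W' \<subseteq> W"
  shows "s \<in> sections_on E W'"
  unfolding sections_on_def
proof (intro CollectI conjI ballI, goal_cases)
  case (1 x)
  then show ?case using assms section_in_fibre by blast
next
  case (2 Ues)
  obtain U es where Ues: "Ues = (U, es)" by force
  obtain c where "\<forall>j<length es. c j \<in> smooth_fun E (U \<inter> W)"
    "\<forall>x\<in>U \<inter> W. s x = (\<Sum>j<length es. c j x *\<^sub>R (es ! j) x)"
    using section_combination[OF assms(1)] 2 Ues unfolding smooth_combination_def by blast
  moreover have "U \<inter> W' \<subseteq> U \<inter> W" using assms(2) by blast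
  ultimately have "smooth_combination E (U \<inter> W') es s"
    unfolding smooth_combination_def using smooth_fun_subset by (intro exI[of _ c]) blast
  then show ?case using Ues by simp
qed

lemma sections_on_zero: "(\<lambda>x. 0) \<in> sections_on E W"
  using subspace_0[OF fibre_subspace]
  by (auto simp: sections_on_def smooth_combination_def intro!: exI[of _ "\<lambda>j x. 0"] smooth_fun_const)

lemma sections_on_add:
  assumes "s \<in> sections_on E W" "t \<in> sections_on E W"
  shows "(\<lambda>x. s x + t x) \<in> sections_on E W"
  unfolding sections_on_def
proof (intro CollectI conjI ballI, goal_cases)
  case (1 x)
  then show ?case using assms section_in_fibre subspace_add[OF fibre_subspace] by blast
next
  case (2 Ues)
  obtain U es where Ues: "Ues = (U, es)" by force
  obtain c where c: "\<forall>j<length es. c j \<in> smooth_fun E (U \<inter> W)"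
    "\<forall>x\<in>U \<inter> W. s x = (\<Sum>j<length es. c j x *\<^sub>R (es ! j) x)"
    using section_combination[OF assms(1)] 2 Ues unfolding smooth_combination_def by blast
  obtain d where "\<forall>j<length es. d j \<in> smooth_fun E (U \<inter> W)"
    "\<forall>x\<in>U \<inter> W. t x = (\<Sum>j<length es. d j x *\<^sub>R (es ! j) x)"
    using section_combination[OF assms(2)] 2 Ues unfolding smooth_combination_def by blast
  with c have "smooth_combination E (U \<inter> W) es (\<lambda>x. s x + t x)"
    unfolding smooth_combination_def
    by (intro exI[of _ "\<lambda>j x. c j x + d j x"]) (simp add: smooth_fun_add scaleR_add_left sum.distrib)
  then show ?case using Ues by simp
qed

lemma sections_on_mult:
  assumes "f \<in> smooth_fun E W" "s \<in> sections_on E W"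
  shows "(\<lambda>x. f x *\<^sub>R s x) \<in> sections_on E W"
  unfolding sections_on_def
proof (intro CollectI conjI ballI, goal_cases)
  case (1 x)
  then show ?case using assms section_in_fibre subspace_scale[OF fibre_subspace] by blast
next
  case (2 Ues)
  obtain U es where Ues: "Ues = (U, es)" by force
  obtain c where "\<forall>j<length es. c j \<in> smooth_fun E (U \<inter> W)"
    "\<forall>x\<in>U \<inter> W. s x = (\<Sum>j<length es. c j x *\<^sub>R (es ! j) x)"
    using section_combination[OF assms(2)] 2 Ues unfolding smooth_combination_def by blast
  moreover have "f \<in> smooth_fun E (U \<inter> W)" using smooth_fun_subset[OF assms(1)] by simp
  ultimately have "smooth_combination E (U \<inter> W) es (\<lambda>x. f x *\<^sub>R s x)"
    unfolding smooth_combination_def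
    by (intro exI[of _ "\<lambda>j x. f x * c j x"]) (simp add: smooth_fun_mult scaleR_sum_right)
  then show ?case using Ues by simp
qed

lemma sections_on_sum:
  "(\<And>a. a \<in> A \<Longrightarrow> s a \<in> sections_on E W) \<Longrightarrow> (\<lambda>x. \<Sum>a\<in>A. s a x) \<in> sections_on E W"
  by (induction A rule: infinite_finite_induct) (auto intro: sections_on_zero sections_on_add)

lemma sections_on_scale: "s \<in> sections_on E W \<Longrightarrow> (\<lambda>x. c *\<^sub>R s x) \<in> sections_on E W"
  using sections_on_mult[OF smooth_fun_const] .

lemma subspace_Gam: "subspace (Gam E)"
  by (rule subspaceI)
    (auto simp: zero_fun_def plus_fun_def scaleR_fun_def sections_on_zero sections_on_add sections_on_scale)

lemma section_cutoff:
  assumes "s \<in> sections_on E W" "open W" "h \<in> C_inf E" "closed C" "C \<subseteq> W" "\<And>x. x \<notin> C \<Longrightarrow> h x = 0"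
  shows "(\<lambda>x. if x \<in> W then h x *\<^sub>R s x else 0) \<in> Gam E"
  unfolding sections_on_def
proof (intro CollectI conjI ballI, goal_cases)
  case (1 x)
  then show ?case
    using assms section_in_fibre[OF assms(1)] subspace_scale[OF fibre_subspace] subspace_0[OF fibre_subspace] by auto
next
  case (2 Ues)
  obtain U es where Ues: "Ues = (U, es)" by force
  then have fr: "(U, es) \<in> frames E" using 2 by simp
  obtain c where c: "\<forall>j<length es. c j \<in> smooth_fun E (U \<inter> W)"
    "\<forall>x\<in>U \<inter> W. s x = (\<Sum>j<length es. c j x *\<^sub>R (es ! j) x)"
    using section_combination[OF assms(1)] 2 Ues unfolding smooth_combination_def by blast
  have "smooth_combination E U es (\<lambda>x. if x \<in> W then h x *\<^sub>R s x else 0)"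
    unfolding smooth_combination_def
    using smooth_fun_cutoff[OF _ frame_open[OF fr] assms(2-6)] c
    by (intro exI[of _ "\<lambda>j x. if x \<in> W then h x * c j x else 0"]) (auto simp: scaleR_sum_right)
  then show ?case using Ues by simp
qed

lemma frame_section:
  assumes "(U, es) \<in> frames E" "s \<in> set es"
  shows "s \<in> sections_on E U"
  unfolding sections_on_def
proof (intro CollectI conjI ballI, goal_cases)
  case (1 x)
  have "s x \<in> span (set (map (\<lambda>s. s x) es))" by (intro span_base) (use assms in auto)
  then show ?case using frame_basis[OF assms(1) 1] by (simp add: is_basis_def)
next
  case (2 Ues)
  then show ?case using frame_transition[OF assms(1) _ assms(2)] by (auto simp: Int_commute)
qed

text \<open>A local frame cut off by a bump function \<open>h\<close>, together with the dual coordinates cut off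
  as well. Both are global, at the price that they only reconstruct \<open>q u\<close> for \<open>q = h\<^sup>2\<close>.\<close>

lemma bundle_frame:
  obtains N e k q and r :: nat where "open N" "p \<in> N" "\<And>j. j < r \<Longrightarrow> e j \<in> Gam E"
    "\<And>j u. j < r \<Longrightarrow> u \<in> Gam E \<Longrightarrow> (\<lambda>x. k j x (u x)) \<in> C_inf E"
    "\<And>j x. j < r \<Longrightarrow> linear_map_on (fibre E x) (k j x)"
    "q \<in> C_inf E" "\<And>x. x \<in> N \<Longrightarrow> q x = 1"
    "\<And>x v. v \<in> fibre E x \<Longrightarrow> (\<Sum>j<r. k j x v *\<^sub>R e j x) = q x *\<^sub>R v"
    "\<And>y i j. y \<in> N \<Longrightarrow> i < r \<Longrightarrow> j < r \<Longrightarrow> k j y (e i y) = (if i = j then 1 else 0)"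
proof -
  obtain U es where fr: "(U, es) \<in> frames E" "p \<in> U" by (rule frame_exists)
  note U = frame_open[OF fr(1)]
  obtain h C N where h: "h \<in> C_inf E" "closed C" "C \<subseteq> U" "open N" "p \<in> N" "N \<subseteq> C"
    "\<And>x. x \<in> N \<Longrightarrow> h x = 1" "\<And>x. x \<notin> C \<Longrightarrow> h x = 0"
    using bump_function[OF U fr(2)] by metis
  define r where "r = length es"
  define coords where "coords x k \<longleftrightarrow> (\<forall>j. linear_map_on (fibre E x) (k j)) \<and>
    (\<forall>i<r. \<forall>j<r. k j ((es ! i) x) = (if i = j then 1 else (0::real))) \<and>
    (\<forall>v\<in>fibre E x. v = (\<Sum>j<r. k j v *\<^sub>R (es ! j) x))" for x and k :: "nat \<Rightarrow> 'v \<Rightarrow> real"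
  define c where "c x = (SOME k. coords x k)" for x
  have coords: "coords x (c x)" if x: "x \<in> U" for x
    unfolding c_def
    by (rule basis_coordinates[OF frame_basis[OF fr(1) x]], rule_tac a = k in someI2)
      (simp_all add: r_def coords_def)
  have c: "linear_map_on (fibre E x) (c x j)"
    "i < r \<Longrightarrow> j < r \<Longrightarrow> c x j ((es ! i) x) = (if i = j then 1 else (0::real))"
    "v \<in> fibre E x \<Longrightarrow> v = (\<Sum>j<r. c x j v *\<^sub>R (es ! j) x)" if x: "x \<in> U" for x i j v
    using coords[OF x] unfolding coords_def by blast+
  define e where "e j x = (if x \<in> U then h x *\<^sub>R (es ! j) x else 0)" for j x
  define k where "k j x v = (if x \<in> U then h x * c x j v else 0)" for j x v
  have NU: "N \<subseteq> U" using h by blast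
  show thesis
  proof (rule that[of N r e k "\<lambda>x. h x * h x"])
    show "open N" "p \<in> N" by fact+
    show "e j \<in> Gam E" if "j < r" for j
      using section_cutoff[OF frame_section[OF fr(1)] U h(1,2,3,8), of "es ! j"] that by (simp add: e_def[abs_def] r_def)
    show "(\<lambda>x. h x * h x) \<in> C_inf E" by (intro smooth_fun_mult h)
    show "\<And>x. x \<in> N \<Longrightarrow> h x * h x = 1" using h by simp
    show "linear_map_on (fibre E x) (k j x)" for j x
      using c(1)[of x j] by (auto simp: linear_map_on_def k_def algebra_simps)
    show "(\<Sum>j<r. k j x v *\<^sub>R e j x) = (h x * h x) *\<^sub>R v" if v: "v \<in> fibre E x" for x v
    proof (cases "x \<in> U")
      case True
      have "(\<Sum>j<r. k j x v *\<^sub>R e j x) = (h x * h x) *\<^sub>R (\<Sum>j<r. c x j v *\<^sub>R (es ! j) x)"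
        using True by (simp add: k_def e_def scaleR_sum_right mult_ac)
      then show ?thesis using c(3)[OF True v] by simp
    next
      case False
      then show ?thesis using h by (auto simp: k_def)
    qed
    show "k j y (e i y) = (if i = j then 1 else 0)" if "y \<in> N" "i < r" "j < r" for y i j
      using that NU c(2)[of y i j] h(7) by (auto simp: k_def e_def)
    fix j u assume j: "j < r" and u: "u \<in> Gam E"
    obtain d where d: "\<forall>j<r. d j \<in> smooth_fun E U" "\<forall>x\<in>U. u x = (\<Sum>j<r. d j x *\<^sub>R (es ! j) x)"
      using section_combination[OF u fr(1)] unfolding smooth_combination_def r_def by auto
    have dc: "d j x = c x j (u x)" if x: "x \<in> U" for x
    proof -
      have "c x j (u x) = (\<Sum>i<r. d i x *\<^sub>R c x j ((es ! i) x))"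
        unfolding d(2)[rule_format, OF x]
        using section_in_fibre[OF frame_section[OF fr(1)] x]
        by (intro linear_map_on_sum[OF c(1)[OF x] fibre_subspace]) (auto simp: r_def)
      also have "\<dots> = (\<Sum>i<r. if i = j then d i x else 0)"
        by (intro sum.cong) (use c(2)[OF x _ j] in auto)
      finally show ?thesis using j by simp
    qed
    have "(\<lambda>x. c x j (u x)) \<in> smooth_fun E (UNIV \<inter> U)"
      by (rule smooth_fun_cong[of "d j"]) (use d(1) j U dc in auto)
    from smooth_fun_cutoff[OF this open_UNIV U h(1,2,3,8)]
    show "(\<lambda>x. k j x (u x)) \<in> C_inf E" by (simp add: k_def)
  qed
qed

lemma extend_to_section:
  assumes "v \<in> fibre E p"
  obtains u where "u \<in> Gam E" "u p = v"
proof -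
  obtain N e k q and r :: nat where f: "p \<in> N" "\<And>j. j < r \<Longrightarrow> e j \<in> Gam E"
    "\<And>x. x \<in> N \<Longrightarrow> q x = (1::real)" "\<And>x v. v \<in> fibre E x \<Longrightarrow> (\<Sum>j<r. k j x v *\<^sub>R e j x) = q x *\<^sub>R v"
    by (rule bundle_frame[of p]) (rule that)
  show thesis
  proof
    show "(\<lambda>x. \<Sum>j<r. k j p v *\<^sub>R e j x) \<in> Gam E"
      using f(2) by (intro sections_on_sum sections_on_scale) auto
  qed (use f assms in simp)
qed

end

section \<open>The structure of the gauge algebroid\<close>

lemma subspace_combinationI:
  assumes "0 \<in> S" "\<And>x y a b. x \<in> S \<Longrightarrow> y \<in> S \<Longrightarrow> a *\<^sub>R x + b *\<^sub>R y \<in> S"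
  shows "subspace S"
  using assms(1) assms(2)[of _ _ 1 1] assms(2)[of _ 0 _ 0] by (intro subspaceI) auto

context vector_bundle
begin

lemma vector_field_scale:
  assumes "f \<in> C_inf E" "X \<in> vector_fields E"
  shows "(\<lambda>g x. f x * X g x) \<in> vector_fields E"
  unfolding vector_fields_def
proof (intro CollectI conjI allI ballI)
  have X: "\<And>x. at_pt X x \<in> tangent_space E x" "\<And>f. f \<in> C_inf E \<Longrightarrow> X f \<in> C_inf E"
    using assms(2) by (auto simp: vector_fields_def)
  show "\<And>g. g \<in> C_inf E \<Longrightarrow> (\<lambda>x. f x * X g x) \<in> C_inf E"
    by (intro smooth_fun_mult assms X)
  show "at_pt (\<lambda>g x. f x * X g x) x \<in> tangent_space E x" for x
    using X(1)[of x] by (auto simp: tangent_space_def at_pt_def linear_map_on_def algebra_simps)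
qed

lemma vector_field_zero: "(\<lambda>g x. 0) \<in> vector_fields E"
  by (auto simp: vector_fields_def tangent_space_def at_pt_def linear_map_on_def smooth_fun_const)

lemma subspace_tangent: "subspace (tangent_space E x)"
  by (rule subspaceI) (auto simp: tangent_space_def linear_map_on_def algebra_simps)

lemma gauge_outside: "\<delta> \<in> gauge_fibre E x \<Longrightarrow> u \<notin> Gam E \<Longrightarrow> \<delta> u = 0"
  and gauge_in_fibre: "\<delta> \<in> gauge_fibre E x \<Longrightarrow> u \<in> Gam E \<Longrightarrow> \<delta> u \<in> fibre E x"
  and gauge_linear: "\<delta> \<in> gauge_fibre E x \<Longrightarrow> linear_map_on (Gam E) \<delta>"
  by (auto simp: gauge_fibre_def)

lemma is_symbol_at_combination:
  assumes "is_symbol_at E x \<delta> X" "is_symbol_at E x \<rho> Y"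
  shows "is_symbol_at E x (a *\<^sub>R \<delta> + b *\<^sub>R \<rho>) (a *\<^sub>R X + b *\<^sub>R Y)"
  using assms subspace_add[OF subspace_tangent] subspace_scale[OF subspace_tangent]
  by (auto simp: is_symbol_at_def algebra_simps)

lemma gauge_combination:
  assumes "\<delta> \<in> gauge_fibre E x" "\<rho> \<in> gauge_fibre E x"
  shows "a *\<^sub>R \<delta> + b *\<^sub>R \<rho> \<in> gauge_fibre E x"
proof -
  obtain X Y where "is_symbol_at E x \<delta> X" "is_symbol_at E x \<rho> Y"
    using assms by (auto simp: gauge_fibre_def)
  from is_symbol_at_combination[OF this] have "\<exists>X. is_symbol_at E x (a *\<^sub>R \<delta> + b *\<^sub>R \<rho>) X" by blast
  moreover have "linear_map_on (Gam E) (a *\<^sub>R \<delta> + b *\<^sub>R \<rho>)"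
    using gauge_linear[OF assms(1)] gauge_linear[OF assms(2)] by (auto simp: linear_map_on_def algebra_simps)
  moreover have "(a *\<^sub>R \<delta> + b *\<^sub>R \<rho>) u \<in> fibre E x" if "u \<in> Gam E" for u
    using gauge_in_fibre[OF assms(1) that] gauge_in_fibre[OF assms(2) that]
    by (auto intro!: subspace_add[OF fibre_subspace] subspace_scale[OF fibre_subspace])
  ultimately show ?thesis
    using assms by (auto simp: gauge_fibre_def)
qed

lemma zero_in_gauge: "0 \<in> gauge_fibre E x"
proof -
  have "is_symbol_at E x 0 0" using subspace_0[OF subspace_tangent] by (auto simp: is_symbol_at_def)
  then show ?thesis using subspace_0[OF fibre_subspace]
    by (auto simp: gauge_fibre_def linear_map_on_def)
qed

lemma subspace_gauge: "subspace (gauge_fibre E x)"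
  by (intro subspace_combinationI zero_in_gauge gauge_combination)

definition symbol_of :: "(('p \<Rightarrow> 'v) \<Rightarrow> 'p \<Rightarrow> 'v) \<Rightarrow> (('p \<Rightarrow> real) \<Rightarrow> 'p \<Rightarrow> real) \<Rightarrow> bool"
  where "symbol_of D X \<longleftrightarrow> X \<in> vector_fields E \<and> (\<forall>f\<in>C_inf E. \<forall>u\<in>Gam E.
       D (\<lambda>y. f y *\<^sub>R u y) = (\<lambda>y. X f y *\<^sub>R u y + f y *\<^sub>R D u y))"

lemma derivations_iff: "D \<in> derivations E \<longleftrightarrow> (\<forall>u. u \<notin> Gam E \<longrightarrow> D u = 0) \<and>
    (\<forall>u\<in>Gam E. D u \<in> Gam E) \<and> linear_map_on (Gam E) D \<and> (\<exists>X. symbol_of D X)"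
  by (auto simp: derivations_def symbol_of_def)

lemma derivation_outside: "D \<in> derivations E \<Longrightarrow> u \<notin> Gam E \<Longrightarrow> D u = 0"
  and derivation_section: "D \<in> derivations E \<Longrightarrow> u \<in> Gam E \<Longrightarrow> D u \<in> Gam E"
  and derivation_linear: "D \<in> derivations E \<Longrightarrow> linear_map_on (Gam E) D"
  by (auto simp: derivations_def)

lemma vector_field_at: "X \<in> vector_fields E \<Longrightarrow> at_pt X x \<in> tangent_space E x"
  and vector_field_smooth: "X \<in> vector_fields E \<Longrightarrow> f \<in> C_inf E \<Longrightarrow> X f \<in> C_inf E"
  by (auto simp: vector_fields_def)

lemma is_symbol_at_derivation: "symbol_of D X \<Longrightarrow> is_symbol_at E x (at_pt D x) (at_pt X x)"
  by (auto simp: symbol_of_def is_symbol_at_def vector_field_at) (simp add: at_pt_def)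

lemma derivation_at:
  assumes D: "D \<in> derivations E"
  shows "at_pt D x \<in> gauge_fibre E x"
proof -
  obtain X where "symbol_of D X" using D by (auto simp: derivations_iff)
  from is_symbol_at_derivation[OF this, of x]
  have "\<exists>X. is_symbol_at E x (at_pt D x) X" by blast
  moreover have "linear_map_on (Gam E) (at_pt D x)"
    using derivation_linear[OF D] by (auto simp: linear_map_on_def at_pt_def)
  ultimately show ?thesis
    using derivation_outside[OF D] section_in_fibre[OF derivation_section[OF D]]
    by (simp add: gauge_fibre_def) (simp add: at_pt_def)
qed

lemma derivation_eqI: "(\<And>x. at_pt D x = at_pt D' x) \<Longrightarrow> D = D'"
  by (auto simp: at_pt_def fun_eq_iff)

lemma symbol_of_scale:
  assumes "f \<in> C_inf E" "symbol_of D X"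
  shows "symbol_of (\<lambda>u x. f x *\<^sub>R D u x) (\<lambda>g x. f x * X g x)"
  using assms vector_field_scale by (auto simp: symbol_of_def fun_eq_iff algebra_simps)

lemma derivation_scale:
  assumes "f \<in> C_inf E" "D \<in> derivations E"
  shows "(\<lambda>u x. f x *\<^sub>R D u x) \<in> derivations E"
proof -
  obtain X where "symbol_of D X" using assms(2) by (auto simp: derivations_iff)
  from symbol_of_scale[OF assms(1) this] have "\<exists>X. symbol_of (\<lambda>u x. f x *\<^sub>R D u x) X" by blast
  then show ?thesis
    using assms(2) sections_on_mult[OF assms(1)]
    by (auto simp: derivations_iff linear_map_on_def fun_eq_iff algebra_simps)
qed

lemma symbol_of_combination:
  assumes "symbol_of D X" "symbol_of D' Y"
  shows "symbol_of (a *\<^sub>R D + b *\<^sub>R D') (a *\<^sub>R X + b *\<^sub>R Y)"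
proof -
  have "at_pt (a *\<^sub>R X + b *\<^sub>R Y) x = a *\<^sub>R at_pt X x + b *\<^sub>R at_pt Y x" for x
    by (simp add: at_pt_def fun_eq_iff)
  then have "a *\<^sub>R X + b *\<^sub>R Y \<in> vector_fields E"
    using assms subspace_add[OF subspace_tangent subspace_scale[OF subspace_tangent] subspace_scale[OF subspace_tangent]]
    by (simp add: symbol_of_def vector_fields_def C_inf_linear)
  then show ?thesis using assms by (auto simp: symbol_of_def fun_eq_iff algebra_simps)
qed

lemma subspace_derivations: "subspace (derivations E)"
proof (rule subspace_combinationI)
  have "symbol_of 0 (\<lambda>g x. 0)" using vector_field_zero by (auto simp: symbol_of_def)
  then have "\<exists>X. symbol_of 0 X" by blast
  then show "0 \<in> derivations E"
    using subspace_0[OF subspace_Gam] by (auto simp: derivations_iff linear_map_on_def)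
  fix D D' a b assume D: "D \<in> derivations E" "D' \<in> derivations E"
  obtain X Y where "symbol_of D X" "symbol_of D' Y" using D by (auto simp: derivations_iff)
  from symbol_of_combination[OF this] have "\<exists>X. symbol_of (a *\<^sub>R D + b *\<^sub>R D') X" by blast
  then show "a *\<^sub>R D + b *\<^sub>R D' \<in> derivations E"
    using D by (auto simp: derivations_iff linear_map_on_def fun_eq_iff algebra_simps
      intro!: subspace_add[OF subspace_Gam] subspace_scale[OF subspace_Gam])
qed

end

text \<open>Where the fibre is not zero, the Leibniz rule for a section with a nonzero value at the point
  determines the symbol of a derivation.\<close>

locale nonzero_vector_bundle = vector_bundle E
  for E :: "('p::{t2_space,second_countable_topology}, 'v::real_vector) vbundle" +
  assumes fibre_nonzero: "fibre E x \<noteq> {0}"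
begin

lemma nonzero_vector: obtains v where "v \<in> fibre E x" "v \<noteq> 0"
  using fibre_nonzero[of x] subspace_0[OF fibre_subspace, of x] by auto

lemma symbol_at_eq:
  assumes "is_symbol_at E x \<delta> X"
  shows "symbol_at E x \<delta> = X"
  unfolding symbol_at_def
proof (rule the_equality[of "is_symbol_at E x \<delta>", OF assms])
  fix Y assume Y: "is_symbol_at E x \<delta> Y"
  obtain v where v: "v \<in> fibre E x" "v \<noteq> 0" by (rule nonzero_vector)
  obtain u where u: "u \<in> Gam E" "u x = v" using extend_to_section[OF v(1)] by blast
  show "Y = X"
  proof
    fix f
    show "Y f = X f"
    proof (cases "f \<in> C_inf E")
      case True
      then have "X f *\<^sub>R u x + f x *\<^sub>R \<delta> u = Y f *\<^sub>R u x + f x *\<^sub>R \<delta> u"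
        using assms Y u(1) unfolding is_symbol_at_def by metis
      then show ?thesis using u v by simp
    next
      case False
      then show ?thesis using assms Y by (auto simp: is_symbol_at_def tangent_outside)
    qed
  qed
qed

lemma symbol_at: "\<delta> \<in> gauge_fibre E x \<Longrightarrow> is_symbol_at E x \<delta> (symbol_at E x \<delta>)"
  using symbol_at_eq by (auto simp: gauge_fibre_def)

lemma symbol_at_tangent: "\<delta> \<in> gauge_fibre E x \<Longrightarrow> symbol_at E x \<delta> \<in> tangent_space E x"
  using symbol_at by (simp add: is_symbol_at_def)

lemma symbol_at_linear: "linear_map_on (gauge_fibre E x) (symbol_at E x)"
  unfolding linear_map_on_def by (intro ballI allI symbol_at_eq is_symbol_at_combination symbol_at)

lemma symbol_at_derivation: "symbol_of D X \<Longrightarrow> symbol_at E x (at_pt D x) = at_pt X x"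
  by (rule symbol_at_eq[OF is_symbol_at_derivation])

text \<open>An endomorphism is linear over functions, so the zero vector is its symbol.\<close>

lemma is_symbol_at_endo:
  assumes "\<Phi> \<in> endos E x"
  shows "is_symbol_at E x (endo_incl E x \<Phi>) 0"
  unfolding is_symbol_at_def endo_incl_def
proof (intro conjI ballI)
  show "0 \<in> tangent_space E x" by (rule subspace_0[OF subspace_tangent])
  fix f u assume fu: "f \<in> C_inf E" "u \<in> Gam E"
  have "\<Phi> (f x *\<^sub>R u x) = f x *\<^sub>R \<Phi> (u x)"
    using assms section_in_fibre[OF fu(2)] by (intro linear_map_on_scale[OF _ fibre_subspace]) (auto simp: endos_def)
  then show "(if (\<lambda>y. f y *\<^sub>R u y) \<in> Gam E then \<Phi> (f x *\<^sub>R u x) else 0) =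
      0 f *\<^sub>R u x + f x *\<^sub>R (if u \<in> Gam E then \<Phi> (u x) else 0)"
    using fu sections_on_mult[OF fu] by simp
qed

lemma endo_in_gauge:
  assumes "\<Phi> \<in> endos E x"
  shows "endo_incl E x \<Phi> \<in> gauge_fibre E x"
proof -
  have "\<exists>X. is_symbol_at E x (endo_incl E x \<Phi>) X" using is_symbol_at_endo[OF assms] by blast
  moreover have "linear_map_on (Gam E) (endo_incl E x \<Phi>)"
    using assms section_in_fibre subspace_add[OF subspace_Gam subspace_scale[OF subspace_Gam] subspace_scale[OF subspace_Gam]]
    by (simp add: linear_map_on_def endo_incl_def endos_def)
  ultimately show ?thesis
    using assms section_in_fibre by (simp add: gauge_fibre_def) (simp add: endo_incl_def endos_def)
qed

lemma symbol_at_endo: "\<Phi> \<in> endos E x \<Longrightarrow> symbol_at E x (endo_incl E x \<Phi>) = 0"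
  by (rule symbol_at_eq[OF is_symbol_at_endo])

end

context vector_bundle
begin

definition matrix_unit :: "(nat \<Rightarrow> 'p \<Rightarrow> 'v) \<Rightarrow> (nat \<Rightarrow> 'p \<Rightarrow> 'v \<Rightarrow> real) \<Rightarrow> nat \<Rightarrow> nat \<Rightarrow> ('p \<Rightarrow> 'v) \<Rightarrow> 'p \<Rightarrow> 'v"
  where "matrix_unit e k j l u = (if u \<in> Gam E then (\<lambda>x. k j x (u x) *\<^sub>R e l x) else 0)"

end

text \<open>A local frame of the gauge algebroid by global derivations: horizontal lifts \<open>H\<^sub>i\<close> of
  coordinate fields \<open>W\<^sub>i\<close> with coordinates \<open>F\<^sub>i\<close>, and the matrix units of a frame \<open>e\<^sub>j\<close> of \<open>E\<close>
  with dual coordinates \<open>k\<^sub>j\<close>. The last assumption is the resulting decomposition.\<close>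

locale gauge_frame = nonzero_vector_bundle E
  for E :: "('p::{t2_space,second_countable_topology}, 'v::real_vector) vbundle" +
  fixes N :: "'p set" and F :: "nat \<Rightarrow> 'p \<Rightarrow> real" and W :: "nat \<Rightarrow> ('p \<Rightarrow> real) \<Rightarrow> 'p \<Rightarrow> real"
    and H :: "nat \<Rightarrow> ('p \<Rightarrow> 'v) \<Rightarrow> 'p \<Rightarrow> 'v" and e :: "nat \<Rightarrow> 'p \<Rightarrow> 'v"
    and k :: "nat \<Rightarrow> 'p \<Rightarrow> 'v \<Rightarrow> real" and r :: nat
  assumes N_open: "open N"
    and F_smooth: "i < mdim E \<Longrightarrow> F i \<in> C_inf E"
    and H_derivation: "i < mdim E \<Longrightarrow> H i \<in> derivations E"
    and H_symbol: "i < mdim E \<Longrightarrow> symbol_of (H i) (W i)"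
    and W_F: "y \<in> N \<Longrightarrow> i < mdim E \<Longrightarrow> j < mdim E \<Longrightarrow> W i (F j) y = (if i = j then 1 else 0)"
    and tangent_expansion: "y \<in> N \<Longrightarrow> X \<in> tangent_space E y \<Longrightarrow> f \<in> C_inf E \<Longrightarrow>
      X f = (\<Sum>i<mdim E. X (F i) * W i f y)"
    and e_section: "j < r \<Longrightarrow> e j \<in> Gam E"
    and k_smooth: "j < r \<Longrightarrow> u \<in> Gam E \<Longrightarrow> (\<lambda>x. k j x (u x)) \<in> C_inf E"
    and k_linear: "j < r \<Longrightarrow> linear_map_on (fibre E x) (k j x)"
    and e_expansion: "y \<in> N \<Longrightarrow> v \<in> fibre E y \<Longrightarrow> v = (\<Sum>j<r. k j y v *\<^sub>R e j y)"
    and k_e: "y \<in> N \<Longrightarrow> i < r \<Longrightarrow> j < r \<Longrightarrow> k j y (e i y) = (if i = j then 1 else 0)"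
    and matrix_unit_derivation: "j < r \<Longrightarrow> l < r \<Longrightarrow> matrix_unit e k j l \<in> derivations E"
    and matrix_unit_symbol: "j < r \<Longrightarrow> l < r \<Longrightarrow> symbol_of (matrix_unit e k j l) (\<lambda>g x. 0)"
    and gauge_expansion: "y \<in> N \<Longrightarrow> \<delta> \<in> gauge_fibre E y \<Longrightarrow>
      \<delta> = (\<Sum>i<mdim E. symbol_at E y \<delta> (F i) *\<^sub>R at_pt (H i) y) +
        (\<Sum>j<r. \<Sum>l<r. k l y (\<delta> (e j)) *\<^sub>R at_pt (matrix_unit e k j l) y)"

context nonzero_vector_bundle
begin

text \<open>Write \<open>V\<^sub>i\<close> for the coordinate fields, and \<open>q u = \<Sum>\<^sub>j k\<^sub>j(u) e\<^sub>j\<close>. Differentiating the coordinates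
  \<open>k\<^sub>j(u)\<close> gives a global derivation \<open>H\<^sub>i u = \<Sum>\<^sub>j V\<^sub>i(k\<^sub>j(u)) e\<^sub>j\<close> with symbol \<open>q V\<^sub>i\<close>. For the decomposition
  of \<open>\<delta>\<close> at \<open>y\<close>, note that \<open>\<delta> u = \<delta>(q u)\<close> as \<open>q = 1\<close> near \<open>y\<close>, and apply the Leibniz rule to the sum.\<close>

lemma gauge_frame_exists:
  obtains N F W H e k r where "gauge_frame E N F W H e k r" "p \<in> N"
proof -
  let ?m = "mdim E"
  obtain N1 F V where V: "open N1" "p \<in> N1"
    "\<And>i. i < ?m \<Longrightarrow> F i \<in> C_inf E" "\<And>i. i < ?m \<Longrightarrow> V i \<in> vector_fields E"
    "\<And>y i j. y \<in> N1 \<Longrightarrow> i < ?m \<Longrightarrow> j < ?m \<Longrightarrow> V i (F j) y = (if i = j then 1 else 0)"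
    "\<And>y X f. y \<in> N1 \<Longrightarrow> X \<in> tangent_space E y \<Longrightarrow> f \<in> C_inf E \<Longrightarrow> X f = (\<Sum>i<?m. X (F i) * V i f y)"
    by (rule coordinate_frame[of p]) (rule that)
  obtain N2 e k q and r :: nat where e: "open N2" "p \<in> N2" "\<And>j. j < r \<Longrightarrow> e j \<in> Gam E"
    "\<And>j u. j < r \<Longrightarrow> u \<in> Gam E \<Longrightarrow> (\<lambda>x. k j x (u x)) \<in> C_inf E"
    "\<And>j x. j < r \<Longrightarrow> linear_map_on (fibre E x) (k j x)"
    "q \<in> C_inf E" "\<And>x. x \<in> N2 \<Longrightarrow> q x = 1"
    "\<And>x v. v \<in> fibre E x \<Longrightarrow> (\<Sum>j<r. k j x v *\<^sub>R e j x) = q x *\<^sub>R v"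
    "\<And>y i j. y \<in> N2 \<Longrightarrow> i < r \<Longrightarrow> j < r \<Longrightarrow> k j y (e i y) = (if i = j then 1 else 0)"
    by (rule bundle_frame[of p]) (rule that)
  let ?N = "N1 \<inter> N2"
  define H where "H i u = (if u \<in> Gam E then (\<lambda>x. \<Sum>j<r. V i (\<lambda>y. k j y (u y)) x *\<^sub>R e j x) else 0)" for i u
  define W where "W i g x = q x * V i g x" for i g x
  have k_mult: "k j x (f x *\<^sub>R u x) = f x * k j x (u x)" if "j < r" "u \<in> Gam E" for j u and x :: 'p and f :: "'p \<Rightarrow> real"
    using linear_map_on_scale[OF e(5)[OF that(1)] fibre_subspace section_in_fibre[OF that(2)]] by simp
  have k_comb: "k j x (a *\<^sub>R u x + b *\<^sub>R v x) = a * k j x (u x) + b * k j x (v x)"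
    if "j < r" "u \<in> Gam E" "v \<in> Gam E" for j x u v a b
    using linear_map_on_combination[OF e(5)[OF that(1)] fibre_subspace
      section_in_fibre[OF that(2)] section_in_fibre[OF that(3)]] by simp
  have Gcomb: "(\<lambda>x. a *\<^sub>R u x + b *\<^sub>R v x) \<in> Gam E" if "u \<in> Gam E" "v \<in> Gam E" for a b u v
    using that by (intro sections_on_add sections_on_scale)
  have H_sym: "symbol_of (H i) (W i)" if i: "i < ?m" for i
    unfolding symbol_of_def
  proof (intro conjI ballI)
    show "W i \<in> vector_fields E"
      unfolding W_def[abs_def] using vector_field_scale[OF e(6) V(4)[OF i]] .
    fix f u assume fu: "f \<in> C_inf E" "u \<in> Gam E"
    show "H i (\<lambda>y. f y *\<^sub>R u y) = (\<lambda>y. W i f y *\<^sub>R u y + f y *\<^sub>R H i u y)"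
    proof
      fix x
      have "V i (\<lambda>y. k j y (f y *\<^sub>R u y)) x = V i f x * k j x (u x) + f x * V i (\<lambda>y. k j y (u y)) x"
        if j: "j < r" for j
        using tangent_product[OF vector_field_at[OF V(4)[OF i]] fu(1) e(4)[OF j fu(2)], of x]
        by (simp add: k_mult[OF j fu(2)] at_pt_def)
      then have "H i (\<lambda>y. f y *\<^sub>R u y) x =
          (\<Sum>j<r. V i f x *\<^sub>R (k j x (u x) *\<^sub>R e j x) + f x *\<^sub>R (V i (\<lambda>y. k j y (u y)) x *\<^sub>R e j x))"
        using sections_on_mult[OF fu] by (simp add: H_def scaleR_add_left)
      also have "\<dots> = V i f x *\<^sub>R (q x *\<^sub>R u x) + f x *\<^sub>R H i u x"
        unfolding e(8)[OF section_in_fibre[OF fu(2) UNIV_I], symmetric]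
        using fu(2) by (simp add: H_def sum.distrib scaleR_sum_right)
      finally show "H i (\<lambda>y. f y *\<^sub>R u y) x = W i f x *\<^sub>R u x + f x *\<^sub>R H i u x"
        by (simp add: W_def mult.commute)
    qed
  qed
  have H_der: "H i \<in> derivations E" if i: "i < ?m" for i
    unfolding derivations_iff
  proof (intro conjI allI impI ballI)
    show "\<exists>X. symbol_of (H i) X" using H_sym[OF i] by blast
    show "u \<notin> Gam E \<Longrightarrow> H i u = 0" for u by (simp add: H_def)
    show "H i u \<in> Gam E" if "u \<in> Gam E" for u
      using that by (simp add: H_def) (intro sections_on_sum sections_on_mult vector_field_smooth[OF V(4)[OF i]] e, auto)
    show "linear_map_on (Gam E) (H i)"
      unfolding linear_map_on_def
    proof (intro ballI allI ext)
      fix u v a b x assume uv: "u \<in> Gam E" "v \<in> Gam E"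
      have "V i (\<lambda>y. k j y (a *\<^sub>R u y + b *\<^sub>R v y)) x = a * V i (\<lambda>y. k j y (u y)) x + b * V i (\<lambda>y. k j y (v y)) x"
        if j: "j < r" for j
        using tangent_linear[OF vector_field_at[OF V(4)[OF i]] e(4)[OF j uv(1)] e(4)[OF j uv(2)], of x a b]
        by (simp add: k_comb[OF j uv] at_pt_def)
      then show "H i (a *\<^sub>R u + b *\<^sub>R v) x = (a *\<^sub>R H i u + b *\<^sub>R H i v) x"
        using uv Gcomb[OF uv, of a b]
        by (simp add: H_def plus_fun_def scaleR_fun_def scaleR_add_left sum.distrib scaleR_sum_right)
    qed
  qed
  have M_sym: "symbol_of (matrix_unit e k j l) (\<lambda>g x. 0)" if "j < r" "l < r" for j l
    using that k_mult[OF that(1)] by (simp add: symbol_of_def vector_field_zero matrix_unit_def sections_on_mult)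
  have M_der: "matrix_unit e k j l \<in> derivations E" if jl: "j < r" "l < r" for j l
    unfolding derivations_iff
  proof (intro conjI allI impI ballI)
    show "\<exists>X. symbol_of (matrix_unit e k j l) X" using M_sym[OF jl] by blast
    show "u \<notin> Gam E \<Longrightarrow> matrix_unit e k j l u = 0" for u by (simp add: matrix_unit_def)
    show "matrix_unit e k j l u \<in> Gam E" if "u \<in> Gam E" for u
      using that jl sections_on_mult[OF e(4) e(3)] by (simp add: matrix_unit_def)
    show "linear_map_on (Gam E) (matrix_unit e k j l)"
      unfolding linear_map_on_def
      by (intro ballI allI ext)
        (use Gcomb k_comb[OF jl(1)] in \<open>simp add: matrix_unit_def plus_fun_def scaleR_fun_def scaleR_add_left\<close>)
  qed
  have W_eq: "W i g y = V i g y" if "y \<in> ?N" for i g y using that e(7) by (simp add: W_def)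
  have expansion: "\<delta> = (\<Sum>i<?m. symbol_at E y \<delta> (F i) *\<^sub>R at_pt (H i) y) +
        (\<Sum>j<r. \<Sum>l<r. k l y (\<delta> (e j)) *\<^sub>R at_pt (matrix_unit e k j l) y)"
    if y: "y \<in> ?N" and \<delta>: "\<delta> \<in> gauge_fibre E y" for y \<delta>
  proof
    fix u
    let ?X = "symbol_at E y \<delta>"
    show "\<delta> u = ((\<Sum>i<?m. ?X (F i) *\<^sub>R at_pt (H i) y) +
        (\<Sum>j<r. \<Sum>l<r. k l y (\<delta> (e j)) *\<^sub>R at_pt (matrix_unit e k j l) y)) u"
    proof (cases "u \<in> Gam E")
      case False
      then show ?thesis
        using gauge_outside[OF \<delta>] by (simp add: sum_fun_apply at_pt_def H_def matrix_unit_def)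
    next
      case True
      have X: "?X \<in> tangent_space E y" by (rule symbol_at_tangent[OF \<delta>])
      have leib: "\<delta> (\<lambda>y. f y *\<^sub>R u y) = ?X f *\<^sub>R u y + f y *\<^sub>R \<delta> u" if "f \<in> C_inf E" "u \<in> Gam E" for f u
        using symbol_at[OF \<delta>] that by (simp add: is_symbol_at_def)
      have "?X q = ?X (\<lambda>x. 1)"
        by (rule tangent_local[OF X e(6) smooth_fun_const e(1)]) (use y e(7) in auto)
      then have "\<delta> u = \<delta> (\<lambda>x. q x *\<^sub>R u x)"
        using leib[OF e(6) True] y e(7) by (simp add: tangent_const[OF X])
      also have "(\<lambda>x. q x *\<^sub>R u x) = (\<Sum>j<r. 1 *\<^sub>R (\<lambda>x. k j x (u x) *\<^sub>R e j x))"
        using e(8)[OF section_in_fibre[OF True]] by (simp add: fun_eq_iff sum_fun_apply)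
      also have "\<delta> \<dots> = (\<Sum>j<r. 1 *\<^sub>R \<delta> (\<lambda>x. k j x (u x) *\<^sub>R e j x))"
        by (rule linear_map_on_sum[OF gauge_linear[OF \<delta>] subspace_Gam])
          (use sections_on_mult[OF e(4)[OF _ True] e(3)] in auto)
      also have "\<dots> = (\<Sum>j<r. ?X (\<lambda>x. k j x (u x)) *\<^sub>R e j y + k j y (u y) *\<^sub>R \<delta> (e j))"
        using leib[OF e(4)[OF _ True] e(3)] by simp
      also have "\<dots> = (\<Sum>j<r. ?X (\<lambda>x. k j x (u x)) *\<^sub>R e j y) + (\<Sum>j<r. k j y (u y) *\<^sub>R \<delta> (e j))"
        by (rule sum.distrib)
      also have "(\<Sum>j<r. ?X (\<lambda>x. k j x (u x)) *\<^sub>R e j y) =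
          (\<Sum>j<r. \<Sum>i<?m. ?X (F i) *\<^sub>R (V i (\<lambda>x. k j x (u x)) y *\<^sub>R e j y))"
        using V(6)[OF _ X e(4)[OF _ True]] y by (simp add: scaleR_sum_left)
      also have "\<dots> = (\<Sum>i<?m. ?X (F i) *\<^sub>R at_pt (H i) y u)"
        using True by (subst sum.swap) (simp add: H_def at_pt_def scaleR_sum_right)
      also have "(\<Sum>j<r. k j y (u y) *\<^sub>R \<delta> (e j)) =
          (\<Sum>j<r. \<Sum>l<r. k l y (\<delta> (e j)) *\<^sub>R at_pt (matrix_unit e k j l) y u)"
      proof (rule sum.cong[OF refl])
        fix j assume "j \<in> {..<r}"
        then have "\<delta> (e j) = (\<Sum>l<r. k l y (\<delta> (e j)) *\<^sub>R e l y)"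
          using e(8)[OF gauge_in_fibre[OF \<delta> e(3)], of j] y e(7) by simp
        then have "k j y (u y) *\<^sub>R \<delta> (e j) = k j y (u y) *\<^sub>R (\<Sum>l<r. k l y (\<delta> (e j)) *\<^sub>R e l y)" by simp
        then show "k j y (u y) *\<^sub>R \<delta> (e j) = (\<Sum>l<r. k l y (\<delta> (e j)) *\<^sub>R at_pt (matrix_unit e k j l) y u)"
          using True by (simp add: at_pt_def matrix_unit_def scaleR_sum_right mult.commute)
      qed
      finally show ?thesis by (simp add: sum_fun_apply)
    qed
  qed
  have "gauge_frame E ?N F W H e k r"
  proof (intro gauge_frame.intro gauge_frame_axioms.intro nonzero_vector_bundle_axioms)
    show "open ?N" using V(1) e(1) by blast
    show "v = (\<Sum>j<r. k j y v *\<^sub>R e j y)" if "y \<in> ?N" "v \<in> fibre E y" for y v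
      using e(8)[OF that(2)] e(7) that by simp
    show "X f = (\<Sum>i<?m. X (F i) * W i f y)" if "y \<in> ?N" "X \<in> tangent_space E y" "f \<in> C_inf E" for y X f
      using V(6)[of y X f] W_eq[OF that(1)] that by simp
    show "W i (F j) y = (if i = j then 1 else 0)" if "y \<in> ?N" "i < ?m" "j < ?m" for y i j
      using V(5)[of y i j] W_eq[OF that(1)] that by simp
    show "k j y (e i y) = (if i = j then 1 else 0)" if "y \<in> ?N" "i < r" "j < r" for y i j
      using e(9) that by blast
  qed (fact V(3) H_der H_sym e(3-5) M_sym M_der expansion)+
  with V(2) e(2) show thesis using that by blast
qed

end

subsection \<open>Extension of derivations and vertical derivations\<close>

context nonzero_vector_bundle
begin

text \<open>These are the sections of \<open>\<gg>\<ll>(E)\<close>, regarded as derivations.\<close>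

definition vertical :: "(('p \<Rightarrow> 'v) \<Rightarrow> 'p \<Rightarrow> 'v) set"
  where "vertical = {P \<in> derivations E. symbol_of P (\<lambda>g x. 0)}"

lemma subspace_vertical: "subspace vertical"
proof (rule subspace_combinationI)
  show "0 \<in> vertical"
    using subspace_0[OF subspace_derivations] vector_field_zero by (auto simp: vertical_def symbol_of_def)
  fix P Q a b assume "P \<in> vertical" "Q \<in> vertical"
  then have PQ: "P \<in> derivations E" "Q \<in> derivations E" "symbol_of P (\<lambda>g x. 0)" "symbol_of Q (\<lambda>g x. 0)"
    by (auto simp: vertical_def)
  have zero: "a *\<^sub>R (\<lambda>g x. 0) + b *\<^sub>R (\<lambda>g x. 0) = (\<lambda>(g::'p \<Rightarrow> real) (x::'p). 0::real)"
    by (simp add: fun_eq_iff)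
  have "symbol_of (a *\<^sub>R P + b *\<^sub>R Q) (\<lambda>g x. 0)"
    using symbol_of_combination[OF PQ(3,4), of a b] unfolding zero .
  moreover have "a *\<^sub>R P + b *\<^sub>R Q \<in> derivations E"
    using PQ(1,2) by (intro subspace_add[OF subspace_derivations] subspace_scale[OF subspace_derivations])
  ultimately show "a *\<^sub>R P + b *\<^sub>R Q \<in> vertical" unfolding vertical_def by blast
qed

lemma vertical_derivation: "P \<in> vertical \<Longrightarrow> P \<in> derivations E"
  by (simp add: vertical_def)

lemma symbol_at_vertical: "P \<in> vertical \<Longrightarrow> symbol_at E x (at_pt P x) = 0"
  using symbol_at_derivation[of P "\<lambda>g x. 0" x] by (simp add: vertical_def at_pt_def zero_fun_def)

lemma at_pt_combination: "at_pt (a *\<^sub>R D + b *\<^sub>R D') x = a *\<^sub>R at_pt D x + b *\<^sub>R at_pt D' x"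
  and at_pt_add: "at_pt (D + D') x = at_pt D x + at_pt D' x"
  and at_pt_scale: "at_pt (a *\<^sub>R D) x = a *\<^sub>R at_pt D x"
  and at_pt_sum: "at_pt (\<Sum>i\<in>A. G i) x = (\<Sum>i\<in>A. at_pt (G i) x)"
  by (auto simp: at_pt_def fun_eq_iff sum_fun_apply)

text \<open>Take the decomposition of \<open>\<delta>\<close> in the frame with constant coefficients.\<close>

lemma extend_gauge:
  assumes \<delta>: "\<delta> \<in> gauge_fibre E x"
  obtains D where "D \<in> derivations E" "at_pt D x = \<delta>" "symbol_at E x \<delta> = 0 \<Longrightarrow> D \<in> vertical"
proof -
  obtain N F W H e k r where "gauge_frame E N F W H e k r" and x: "x \<in> N"
    by (rule gauge_frame_exists)
  then interpret gauge_frame E N F W H e k r by simp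
  define D1 where "D1 = (\<Sum>i<mdim E. symbol_at E x \<delta> (F i) *\<^sub>R H i)"
  define D2 where "D2 = (\<Sum>j<r. \<Sum>l<r. k l x (\<delta> (e j)) *\<^sub>R matrix_unit e k j l)"
  have D1: "D1 \<in> derivations E"
    unfolding D1_def using H_derivation
    by (intro subspace_sum[OF subspace_derivations] subspace_scale[OF subspace_derivations]) auto
  have D2: "D2 \<in> vertical"
    unfolding D2_def using matrix_unit_derivation matrix_unit_symbol
    by (intro subspace_sum[OF subspace_vertical] subspace_scale[OF subspace_vertical]) (auto simp: vertical_def)
  show thesis
  proof
    show "D1 + D2 \<in> derivations E"
      using D1 vertical_derivation[OF D2] by (rule subspace_add[OF subspace_derivations])
    show "at_pt (D1 + D2) x = \<delta>"
      using gauge_expansion[OF x \<delta>] by (simp add: D1_def D2_def at_pt_add at_pt_sum at_pt_scale)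
    show "D1 + D2 \<in> vertical" if "symbol_at E x \<delta> = 0"
      using D2 that by (simp add: D1_def)
  qed
qed

lemma extend_endo:
  assumes "\<Phi> \<in> endos E x"
  obtains P where "P \<in> vertical" "at_pt P x = endo_incl E x \<Phi>"
  using extend_gauge[OF endo_in_gauge[OF assms]] symbol_at_endo[OF assms] by metis

text \<open>By the decomposition in a frame, \<open>\<delta> u\<close> depends on \<open>u\<close> only through its value at \<open>x\<close>.\<close>

lemma symbol_zero_endo:
  assumes \<delta>: "\<delta> \<in> gauge_fibre E x" "symbol_at E x \<delta> = 0"
  obtains \<Phi> where "\<Phi> \<in> endos E x" "\<delta> = endo_incl E x \<Phi>"
proof -
  obtain N F W H e k r where "gauge_frame E N F W H e k r" and x: "x \<in> N"
    by (rule gauge_frame_exists)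
  then interpret gauge_frame E N F W H e k r by simp
  define \<Phi> where "\<Phi> v = (\<Sum>j<r. \<Sum>l<r. k l x (\<delta> (e j)) *\<^sub>R k j x v *\<^sub>R e l x)" for v
  show thesis
  proof
    have "linear_map_on (fibre E x) \<Phi>"
      unfolding linear_map_on_def \<Phi>_def
      using linear_map_on_combination[OF k_linear fibre_subspace]
      by (simp add: scaleR_sum_right algebra_simps sum.distrib)
    moreover have "\<Phi> v \<in> fibre E x" for v
      unfolding \<Phi>_def using section_in_fibre[OF e_section]
      by (intro subspace_sum[OF fibre_subspace] subspace_scale[OF fibre_subspace]) auto
    ultimately show "\<Phi> \<in> endos E x" by (simp add: endos_def)
    show "\<delta> = endo_incl E x \<Phi>"
    proof
      fix u
      show "\<delta> u = endo_incl E x \<Phi> u"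
      proof (cases "u \<in> Gam E")
        case True
        have "\<delta> u = ((\<Sum>i<mdim E. symbol_at E x \<delta> (F i) *\<^sub>R at_pt (H i) x) +
          (\<Sum>j<r. \<Sum>l<r. k l x (\<delta> (e j)) *\<^sub>R at_pt (matrix_unit e k j l) x)) u"
          using gauge_expansion[OF x \<delta>(1)] by (rule arg_cong[of _ _ "\<lambda>\<delta>. \<delta> u"])
        with \<delta>(2) True show ?thesis
          by (simp add: endo_incl_def \<Phi>_def sum_fun_apply at_pt_def matrix_unit_def)
      qed (simp add: endo_incl_def gauge_outside[OF \<delta>(1)])
    qed
  qed
qed

lemma vertical_endo:
  assumes "P \<in> vertical"
  obtains \<Phi> where "\<Phi> \<in> endos E x" "at_pt P x = endo_incl E x \<Phi>"
  using symbol_zero_endo[OF derivation_at[OF vertical_derivation[OF assms]] symbol_at_vertical[OF assms]] by metis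

lemma symbol_of_commutator:
  assumes D: "D \<in> derivations E" "D' \<in> derivations E" "symbol_of D X" "symbol_of D' Y"
  shows "symbol_of (commutator D D') (\<lambda>f x. X (Y f) x - Y (X f) x)"
  unfolding symbol_of_def
proof (intro conjI ballI)
  have X: "X \<in> vector_fields E" and Y: "Y \<in> vector_fields E" using D by (auto simp: symbol_of_def)
  note sm = vector_field_smooth[OF X] vector_field_smooth[OF Y]
  have lin: "V (\<lambda>y. a * f y + b * g y) x = a * V f x + b * V g x"
    "V (\<lambda>y. f y + g y) x = V f x + V g x"
    "V (\<lambda>y. f y * g y) x = V f x * g x + f x * V g x"
    if "V \<in> vector_fields E" "f \<in> C_inf E" "g \<in> C_inf E" for V f g a b x
    using tangent_linear[OF vector_field_at[OF that(1)] that(2,3), of x a b]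
      tangent_add[OF vector_field_at[OF that(1)] that(2,3), of x]
      tangent_product[OF vector_field_at[OF that(1)] that(2,3), of x]
    by (simp_all add: at_pt_def)
  show "(\<lambda>f x. X (Y f) x - Y (X f) x) \<in> vector_fields E"
    unfolding vector_fields_def
  proof (intro CollectI conjI allI ballI)
    show "\<And>f. f \<in> C_inf E \<Longrightarrow> (\<lambda>x. X (Y f) x - Y (X f) x) \<in> C_inf E"
      by (intro smooth_fun_diff sm)
    fix x
    show "at_pt (\<lambda>f x. X (Y f) x - Y (X f) x) x \<in> tangent_space E x"
      unfolding tangent_space_def
    proof (intro CollectI conjI allI impI ballI)
      fix f assume f: "f \<notin> C_inf E"
      have "X f = (\<lambda>x. 0)" "Y f = (\<lambda>x. 0)"
        using tangent_outside[OF vector_field_at[OF X] f] tangent_outside[OF vector_field_at[OF Y] f]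
        by (auto simp: at_pt_def)
      moreover have "X (\<lambda>x. 0) = (\<lambda>x. 0)" "Y (\<lambda>x. 0) = (\<lambda>x. 0)"
        using tangent_const[OF vector_field_at[OF X]] tangent_const[OF vector_field_at[OF Y]]
        by (auto simp: at_pt_def)
      ultimately show "at_pt (\<lambda>f x. X (Y f) x - Y (X f) x) x f = 0" by (simp add: at_pt_def)
    next
      show "linear_map_on (C_inf E) (at_pt (\<lambda>f x. X (Y f) x - Y (X f) x) x)"
        unfolding linear_map_on_def
      proof (intro ballI allI)
        fix f g a b assume fg: "f \<in> C_inf E" "g \<in> C_inf E"
        have "X (\<lambda>y. a * f y + b * g y) = (\<lambda>y. a * X f y + b * X g y)"
          "Y (\<lambda>y. a * f y + b * g y) = (\<lambda>y. a * Y f y + b * Y g y)"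
          using lin(1)[OF X fg] lin(1)[OF Y fg] by (auto simp: fun_eq_iff)
        then show "at_pt (\<lambda>f x. X (Y f) x - Y (X f) x) x (a *\<^sub>R f + b *\<^sub>R g) =
          a *\<^sub>R at_pt (\<lambda>f x. X (Y f) x - Y (X f) x) x f + b *\<^sub>R at_pt (\<lambda>f x. X (Y f) x - Y (X f) x) x g"
          using lin(1)[OF X sm(2)[OF fg(1)] sm(2)[OF fg(2)], of a b x] lin(1)[OF Y sm(1)[OF fg(1)] sm(1)[OF fg(2)], of a b x]
          by (simp add: at_pt_def plus_fun_def scaleR_fun_def algebra_simps)
      qed
    next
      fix f g assume fg: "f \<in> C_inf E" "g \<in> C_inf E"
      have "X (\<lambda>y. f y * g y) = (\<lambda>y. X f y * g y + f y * X g y)"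
        "Y (\<lambda>y. f y * g y) = (\<lambda>y. Y f y * g y + f y * Y g y)"
        using lin(3)[OF X fg] lin(3)[OF Y fg] by (auto simp: fun_eq_iff)
      then show "at_pt (\<lambda>f x. X (Y f) x - Y (X f) x) x (\<lambda>y. f y * g y) =
          at_pt (\<lambda>f x. X (Y f) x - Y (X f) x) x f * g x + f x * at_pt (\<lambda>f x. X (Y f) x - Y (X f) x) x g"
        using lin(2)[OF X smooth_fun_mult[OF sm(2)[OF fg(1)] fg(2)] smooth_fun_mult[OF fg(1) sm(2)[OF fg(2)]], of x]
          lin(2)[OF Y smooth_fun_mult[OF sm(1)[OF fg(1)] fg(2)] smooth_fun_mult[OF fg(1) sm(1)[OF fg(2)]], of x]
          lin(3)[OF X sm(2)[OF fg(1)] fg(2), of x] lin(3)[OF X fg(1) sm(2)[OF fg(2)], of x]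
          lin(3)[OF Y sm(1)[OF fg(1)] fg(2), of x] lin(3)[OF Y fg(1) sm(1)[OF fg(2)], of x]
        by (simp add: at_pt_def algebra_simps)
    qed
  qed
  fix f u assume fu: "f \<in> C_inf E" "u \<in> Gam E"
  have add: "G (\<lambda>y. s y + t y) = (\<lambda>y. G s y + G t y)" if "G \<in> derivations E" "s \<in> Gam E" "t \<in> Gam E" for G s t
    using linear_map_on_add[OF derivation_linear[OF that(1)] subspace_Gam that(2,3)] by (simp add: plus_fun_def)
  have leib: "D (\<lambda>y. f y *\<^sub>R u y) = (\<lambda>y. X f y *\<^sub>R u y + f y *\<^sub>R D u y)"
    "D' (\<lambda>y. f y *\<^sub>R u y) = (\<lambda>y. Y f y *\<^sub>R u y + f y *\<^sub>R D' u y)" if "f \<in> C_inf E" "u \<in> Gam E" for f u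
    using D(3,4) that unfolding symbol_of_def by blast+
  note DG = derivation_section[OF D(1)] derivation_section[OF D(2)]
  show "commutator D D' (\<lambda>y. f y *\<^sub>R u y) =
      (\<lambda>x. (X (Y f) x - Y (X f) x) *\<^sub>R u x + f x *\<^sub>R commutator D D' u x)"
    using fu
    by (simp add: commutator_def leib add[OF D(1)] add[OF D(2)] sections_on_mult sm DG fun_eq_iff algebra_simps)
qed

lemma commutator_derivation:
  assumes "D \<in> derivations E" "D' \<in> derivations E"
  shows "commutator D D' \<in> derivations E"
proof -
  obtain X Y where "symbol_of D X" "symbol_of D' Y" using assms by (auto simp: derivations_iff)
  from symbol_of_commutator[OF assms this]
  have "\<exists>X. symbol_of (commutator D D') X" by blast
  moreover have "D 0 = 0" "D' 0 = 0"
    using linear_map_on_zero[OF derivation_linear subspace_Gam] assms by auto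
  moreover have "linear_map_on (Gam E) (commutator D D')"
    unfolding linear_map_on_def commutator_def
    using derivation_section[OF assms(1)] derivation_section[OF assms(2)]
    by (simp add: linear_map_on_combination[OF derivation_linear[OF assms(1)] subspace_Gam]
      linear_map_on_combination[OF derivation_linear[OF assms(2)] subspace_Gam] algebra_simps)
  moreover have "commutator D D' u \<in> Gam E" if "u \<in> Gam E" for u
    using that derivation_section[OF assms(1)] derivation_section[OF assms(2)]
    by (simp add: commutator_def subspace_diff[OF subspace_Gam])
  ultimately show ?thesis
    using assms by (auto simp: derivations_iff commutator_def)
qed

lemma commutator_vertical:
  assumes "P \<in> vertical" "D \<in> derivations E"
  shows "commutator P D \<in> vertical"
proof -
  obtain Y where Y: "symbol_of D Y" using assms by (auto simp: derivations_iff)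
  have P: "P \<in> derivations E" "symbol_of P (\<lambda>g x. 0)" using assms by (auto simp: vertical_def)
  have "Y (\<lambda>x. 0) x = 0" for x
    using tangent_const[OF vector_field_at, of Y x 0] Y by (simp add: symbol_of_def at_pt_def)
  with symbol_of_commutator[OF P(1) assms(2) P(2) Y] show ?thesis
    using commutator_derivation[OF P(1) assms(2)] by (simp add: vertical_def)
qed

lemma commutator_antisym: "commutator D D' = - commutator D' D"
  by (simp add: commutator_def fun_eq_iff)

definition func_scale :: "('p \<Rightarrow> real) \<Rightarrow> (('p \<Rightarrow> 'v) \<Rightarrow> 'p \<Rightarrow> 'v) \<Rightarrow> ('p \<Rightarrow> 'v) \<Rightarrow> 'p \<Rightarrow> 'v"
  where "func_scale f D = (\<lambda>u x. f x *\<^sub>R D u x)"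

lemma func_scale_derivation: "f \<in> C_inf E \<Longrightarrow> D \<in> derivations E \<Longrightarrow> func_scale f D \<in> derivations E"
  unfolding func_scale_def by (rule derivation_scale)

lemma at_pt_func_scale: "at_pt (func_scale f D) x = f x *\<^sub>R at_pt D x"
  by (simp add: at_pt_def func_scale_def fun_eq_iff)

lemma commutator_func_scale:
  assumes "D \<in> derivations E" "D' \<in> derivations E" "symbol_of D X" "f \<in> C_inf E"
  shows "commutator D (func_scale f D') = func_scale f (commutator D D') + func_scale (X f) D'"
proof
  fix u
  show "commutator D (func_scale f D') u = (func_scale f (commutator D D') + func_scale (X f) D') u"
  proof (cases "u \<in> Gam E")
    case True
    then have "D (\<lambda>y. f y *\<^sub>R D' u y) = (\<lambda>y. X f y *\<^sub>R D' u y + f y *\<^sub>R D (D' u) y)"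
      using assms derivation_section[OF assms(2)] by (simp add: symbol_of_def)
    then show ?thesis by (simp add: commutator_def func_scale_def fun_eq_iff algebra_simps)
  next
    case False
    have "X f \<in> C_inf E" using assms(3,4) vector_field_smooth by (auto simp: symbol_of_def)
    then have "func_scale f (commutator D D') u = 0" "func_scale (X f) D' u = 0"
      "commutator D (func_scale f D') u = 0"
      using assms by (auto intro!: derivation_outside[OF _ False] func_scale_derivation commutator_derivation)
    then show ?thesis by simp
  qed
qed

lemma commutator_add:
  assumes "D \<in> derivations E" "D' \<in> derivations E" "D'' \<in> derivations E"
  shows "commutator D (D' + D'') = commutator D D' + commutator D D''"
proof
  fix u
  show "commutator D (D' + D'') u = (commutator D D' + commutator D D'') u"
  proof (cases "u \<in> Gam E")
    case True
    then show ?thesis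
      using linear_map_on_add[OF derivation_linear[OF assms(1)] subspace_Gam] derivation_section assms
      by (simp add: commutator_def)
  next
    case False
    then have "commutator D (D' + D'') u = 0" "commutator D D' u = 0" "commutator D D'' u = 0"
      using assms subspace_add[OF subspace_derivations]
      by (auto intro!: derivation_outside[OF _ False] commutator_derivation)
    then show ?thesis by simp
  qed
qed

end

section \<open>The differential on forms of the gauge algebroid\<close>

text \<open>The Koszul formula is a recursion in disguise: inserting the first argument gives Cartan's
  \<open>\<iota>\<^sub>D d = L\<^sub>D - d \<iota>\<^sub>D\<close>. In this form its tensoriality and antisymmetry reduce to those of the Lie
  derivative, and sums over pairs of indices disappear. The forms are replaced by their values on
  lists of derivations, which is all that the Koszul formula uses.\<close>

context nonzero_vector_bundle
begin

text \<open>The sum over all positions of \<open>c\<close> with the argument \<open>B\<close> replaced by \<open>[A, B]\<close>.\<close>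

primrec lie_correction :: "(('p \<Rightarrow> 'v) \<Rightarrow> 'p \<Rightarrow> 'v) \<Rightarrow> (('p \<Rightarrow> 'v) \<Rightarrow> 'p \<Rightarrow> 'v) list \<Rightarrow>
    ((('p \<Rightarrow> 'v) \<Rightarrow> 'p \<Rightarrow> 'v) list \<Rightarrow> 'p \<Rightarrow> 'v) \<Rightarrow> 'p \<Rightarrow> 'v"
  where
    "lie_correction A [] c = 0"
  | "lie_correction A (B # Bs) c = c (commutator A B # Bs) + lie_correction A Bs (\<lambda>Es. c (B # Es))"

definition cochain_lie :: "(('p \<Rightarrow> 'v) \<Rightarrow> 'p \<Rightarrow> 'v) \<Rightarrow> ((('p \<Rightarrow> 'v) \<Rightarrow> 'p \<Rightarrow> 'v) list \<Rightarrow> 'p \<Rightarrow> 'v) \<Rightarrow>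
    (('p \<Rightarrow> 'v) \<Rightarrow> 'p \<Rightarrow> 'v) list \<Rightarrow> 'p \<Rightarrow> 'v"
  where "cochain_lie A c Bs = A (c Bs) - lie_correction A Bs c"

primrec cochain_d :: "(('p \<Rightarrow> 'v) \<Rightarrow> 'p \<Rightarrow> 'v) list \<Rightarrow>
    ((('p \<Rightarrow> 'v) \<Rightarrow> 'p \<Rightarrow> 'v) list \<Rightarrow> 'p \<Rightarrow> 'v) \<Rightarrow> 'p \<Rightarrow> 'v"
  where
    "cochain_d [] c = 0"
  | "cochain_d (A # As) c = cochain_lie A c As - cochain_d As (\<lambda>Es. c (A # Es))"

text \<open>What remains of a form of degree \<open>n\<close> when it is known on global derivations only: multilinearity over
  the functions and antisymmetry under exchange of neighbours.\<close>

definition cochain :: "nat \<Rightarrow> ((('p \<Rightarrow> 'v) \<Rightarrow> 'p \<Rightarrow> 'v) list \<Rightarrow> 'p \<Rightarrow> 'v) \<Rightarrow> bool"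
  where "cochain n c \<longleftrightarrow>
    (\<forall>Ds\<in>tuples n (derivations E). c Ds \<in> Gam E) \<and>
    (\<forall>As D D' Bs. set As \<subseteq> derivations E \<and> set Bs \<subseteq> derivations E \<and> D \<in> derivations E \<and> D' \<in> derivations E \<and>
       length As + length Bs + 1 = n \<longrightarrow> c (As @ (D + D') # Bs) = c (As @ D # Bs) + c (As @ D' # Bs)) \<and>
    (\<forall>As D f Bs. set As \<subseteq> derivations E \<and> set Bs \<subseteq> derivations E \<and> D \<in> derivations E \<and> f \<in> C_inf E \<and>
       length As + length Bs + 1 = n \<longrightarrow> c (As @ func_scale f D # Bs) = (\<lambda>x. f x *\<^sub>R c (As @ D # Bs) x)) \<and>
    (\<forall>As D D' Bs. set As \<subseteq> derivations E \<and> set Bs \<subseteq> derivations E \<and> D \<in> derivations E \<and> D' \<in> derivations E \<and>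
       length As + length Bs + 2 = n \<longrightarrow> c (As @ D # D' # Bs) = - c (As @ D' # D # Bs))"

lemma cochain_value: "cochain n c \<Longrightarrow> set Ds \<subseteq> derivations E \<Longrightarrow> length Ds = n \<Longrightarrow> c Ds \<in> Gam E"
  by (auto simp: cochain_def tuples_def)

lemma cochain_add:
  "cochain n c \<Longrightarrow> set As \<subseteq> derivations E \<Longrightarrow> set Bs \<subseteq> derivations E \<Longrightarrow> D \<in> derivations E \<Longrightarrow> D' \<in> derivations E \<Longrightarrow>
    length As + length Bs + 1 = n \<Longrightarrow> c (As @ (D + D') # Bs) = c (As @ D # Bs) + c (As @ D' # Bs)"
  unfolding cochain_def by blast

lemma cochain_scale:
  "cochain n c \<Longrightarrow> set As \<subseteq> derivations E \<Longrightarrow> set Bs \<subseteq> derivations E \<Longrightarrow> D \<in> derivations E \<Longrightarrow> f \<in> C_inf E \<Longrightarrow>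
    length As + length Bs + 1 = n \<Longrightarrow> c (As @ func_scale f D # Bs) = (\<lambda>x. f x *\<^sub>R c (As @ D # Bs) x)"
  unfolding cochain_def by blast

lemma cochain_swap:
  "cochain n c \<Longrightarrow> set As \<subseteq> derivations E \<Longrightarrow> set Bs \<subseteq> derivations E \<Longrightarrow> D \<in> derivations E \<Longrightarrow> D' \<in> derivations E \<Longrightarrow>
    length As + length Bs + 2 = n \<Longrightarrow> c (As @ D # D' # Bs) = - c (As @ D' # D # Bs)"
  unfolding cochain_def by blast

lemma cochain_insert:
  assumes c: "cochain (Suc n) c" and A: "A \<in> derivations E"
  shows "cochain n (\<lambda>Es. c (A # Es))"
  unfolding cochain_def
proof (intro conjI ballI allI impI; (elim conjE)?)
  show "c (A # Ds) \<in> Gam E" if "Ds \<in> tuples n (derivations E)" for Ds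
    using cochain_value[OF c, of "A # Ds"] that A by (simp add: tuples_def)
next
  fix As D D' Bs
  assume "set As \<subseteq> derivations E" "set Bs \<subseteq> derivations E" "D \<in> derivations E" "D' \<in> derivations E"
    "length As + length Bs + 1 = n"
  then show "c (A # As @ (D + D') # Bs) = c (A # As @ D # Bs) + c (A # As @ D' # Bs)"
    using cochain_add[OF c, of "A # As" Bs D D'] A by simp
next
  fix As D f Bs
  assume "set As \<subseteq> derivations E" "set Bs \<subseteq> derivations E" "D \<in> derivations E" "f \<in> C_inf E"
    "length As + length Bs + 1 = n"
  then show "c (A # As @ func_scale f D # Bs) = (\<lambda>x. f x *\<^sub>R c (A # As @ D # Bs) x)"
    using cochain_scale[OF c, of "A # As" Bs D f] A by simp
next
  fix As D D' Bs
  assume "set As \<subseteq> derivations E" "set Bs \<subseteq> derivations E" "D \<in> derivations E" "D' \<in> derivations E"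
    "length As + length Bs + 2 = n"
  then show "c (A # As @ D # D' # Bs) = - c (A # As @ D' # D # Bs)"
    using cochain_swap[OF c, of "A # As" Bs D D'] A by simp
qed

lemma derivation_add: "A \<in> derivations E \<Longrightarrow> s \<in> Gam E \<Longrightarrow> t \<in> Gam E \<Longrightarrow> A (s + t) = A s + A t"
  by (rule linear_map_on_add[OF derivation_linear subspace_Gam])

lemma derivation_minus: "A \<in> derivations E \<Longrightarrow> s \<in> Gam E \<Longrightarrow> A (- s) = - A s"
  by (rule linear_map_on_minus[OF derivation_linear subspace_Gam])

context
  fixes A X assumes A: "A \<in> derivations E" and X: "symbol_of A X"
begin

lemma lie_correction_value:
  "cochain n c \<Longrightarrow> set Bs \<subseteq> derivations E \<Longrightarrow> length Bs = n \<Longrightarrow> lie_correction A Bs c \<in> Gam E"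
proof (induction Bs arbitrary: n c)
  case Nil
  show ?case unfolding lie_correction.simps by (rule subspace_0[OF subspace_Gam])
next
  case (Cons B Bs)
  then obtain n' where n: "n = Suc n'" by (cases n) auto
  have "lie_correction A Bs (\<lambda>Es. c (B # Es)) \<in> Gam E"
    using Cons.prems n by (intro Cons.IH[of n'] cochain_insert) auto
  moreover have "c (commutator A B # Bs) \<in> Gam E"
    using Cons.prems commutator_derivation[OF A] by (intro cochain_value[OF Cons.prems(1)]) auto
  ultimately show ?case unfolding lie_correction.simps by (intro subspace_add[OF subspace_Gam])
qed

lemma lie_correction_add:
  "cochain n c \<Longrightarrow> set As \<subseteq> derivations E \<Longrightarrow> set Bs \<subseteq> derivations E \<Longrightarrow> D \<in> derivations E \<Longrightarrow> D' \<in> derivations E \<Longrightarrow>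
    length As + length Bs + 1 = n \<Longrightarrow>
    lie_correction A (As @ (D + D') # Bs) c = lie_correction A (As @ D # Bs) c + lie_correction A (As @ D' # Bs) c"
proof (induction As arbitrary: n c)
  case Nil
  have sum: "lie_correction A Bs c = lie_correction A Bs c1 + lie_correction A Bs c2"
    if "set Bs \<subseteq> derivations E" "\<And>Es. set Es \<subseteq> derivations E \<Longrightarrow> length Es = length Bs \<Longrightarrow> c Es = c1 Es + c2 Es" for Bs c c1 c2
    using that
  proof (induction Bs arbitrary: c c1 c2)
    case (Cons B Bs)
    have "lie_correction A Bs (\<lambda>Es. c (B # Es)) = lie_correction A Bs (\<lambda>Es. c1 (B # Es)) + lie_correction A Bs (\<lambda>Es. c2 (B # Es))"
      using Cons.prems by (intro Cons.IH) auto
    moreover have "c (commutator A B # Bs) = c1 (commutator A B # Bs) + c2 (commutator A B # Bs)"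
      using Cons.prems commutator_derivation[OF A] by auto
    ultimately show ?case by (simp only: lie_correction.simps add_ac)
  qed (simp only: lie_correction.simps add_0)
  have "lie_correction A Bs (\<lambda>Es. c ((D + D') # Es)) = lie_correction A Bs (\<lambda>Es. c (D # Es)) + lie_correction A Bs (\<lambda>Es. c (D' # Es))"
    using Nil by (intro sum cochain_add[OF Nil(1), of "[]", simplified]) auto
  moreover have "c (commutator A (D + D') # Bs) = c (commutator A D # Bs) + c (commutator A D' # Bs)"
    unfolding commutator_add[OF A Nil(4,5)]
    using Nil commutator_derivation[OF A] by (intro cochain_add[OF Nil(1), of "[]", simplified]) auto
  ultimately show ?case by (simp only: append_Nil append_Cons lie_correction.simps add_ac)
next
  case (Cons B As)
  obtain n' where n: "n = Suc n'" using Cons.prems by (cases n) auto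
  have "lie_correction A (As @ (D + D') # Bs) (\<lambda>Es. c (B # Es)) =
      lie_correction A (As @ D # Bs) (\<lambda>Es. c (B # Es)) + lie_correction A (As @ D' # Bs) (\<lambda>Es. c (B # Es))"
    using Cons.prems n by (intro Cons.IH[of n'] cochain_insert) auto
  moreover have "c (commutator A B # As @ (D + D') # Bs) =
      c (commutator A B # As @ D # Bs) + c (commutator A B # As @ D' # Bs)"
    using Cons.prems commutator_derivation[OF A] cochain_add[OF Cons.prems(1), of "commutator A B # As" Bs D D'] by simp
  ultimately show ?case by (simp only: append_Nil append_Cons lie_correction.simps add_ac)
qed

lemma lie_correction_scale:
  "cochain n c \<Longrightarrow> set As \<subseteq> derivations E \<Longrightarrow> set Bs \<subseteq> derivations E \<Longrightarrow> D \<in> derivations E \<Longrightarrow> f \<in> C_inf E \<Longrightarrow>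
    length As + length Bs + 1 = n \<Longrightarrow>
    lie_correction A (As @ func_scale f D # Bs) c =
      (\<lambda>x. f x *\<^sub>R lie_correction A (As @ D # Bs) c x + X f x *\<^sub>R c (As @ D # Bs) x)"
proof (induction As arbitrary: n c)
  case Nil
  have sm: "X f \<in> C_inf E" using X Nil vector_field_smooth by (auto simp: symbol_of_def)
  have mult: "lie_correction A Bs c = (\<lambda>x. f x *\<^sub>R lie_correction A Bs c' x)"
    if "set Bs \<subseteq> derivations E" "\<And>Es. set Es \<subseteq> derivations E \<Longrightarrow> length Es = length Bs \<Longrightarrow> c Es = (\<lambda>x. f x *\<^sub>R c' Es x)" for Bs c c'
    using that
  proof (induction Bs arbitrary: c c')
    case (Cons B Bs)
    have "lie_correction A Bs (\<lambda>Es. c (B # Es)) = (\<lambda>x. f x *\<^sub>R lie_correction A Bs (\<lambda>Es. c' (B # Es)) x)"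
      using Cons.prems by (intro Cons.IH) auto
    moreover have "c (commutator A B # Bs) = (\<lambda>x. f x *\<^sub>R c' (commutator A B # Bs) x)"
      using Cons.prems commutator_derivation[OF A] by auto
    ultimately show ?case by (simp only: lie_correction.simps) (simp add: fun_eq_iff algebra_simps)
  qed (simp add: fun_eq_iff)
  have "lie_correction A Bs (\<lambda>Es. c (func_scale f D # Es)) = (\<lambda>x. f x *\<^sub>R lie_correction A Bs (\<lambda>Es. c (D # Es)) x)"
    using Nil by (intro mult cochain_scale[OF Nil(1), of "[]", simplified]) auto
  moreover have "c (commutator A (func_scale f D) # Bs) = c (func_scale f (commutator A D) # Bs) + c (func_scale (X f) D # Bs)"
    unfolding commutator_func_scale[OF A Nil(4) X Nil(5)]
    using Nil sm commutator_derivation[OF A] func_scale_derivation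
    by (intro cochain_add[OF Nil(1), of "[]", simplified]) auto
  moreover have "c (func_scale f (commutator A D) # Bs) = (\<lambda>x. f x *\<^sub>R c (commutator A D # Bs) x)"
    "c (func_scale (X f) D # Bs) = (\<lambda>x. X f x *\<^sub>R c (D # Bs) x)"
    using Nil sm commutator_derivation[OF A] by (auto intro!: cochain_scale[OF Nil(1), of "[]", simplified])
  ultimately show ?case
    by (simp only: append_Nil append_Cons lie_correction.simps) (simp add: fun_eq_iff algebra_simps)
next
  case (Cons B As)
  obtain n' where n: "n = Suc n'" using Cons.prems by (cases n) auto
  have "lie_correction A (As @ func_scale f D # Bs) (\<lambda>Es. c (B # Es)) =
      (\<lambda>x. f x *\<^sub>R lie_correction A (As @ D # Bs) (\<lambda>Es. c (B # Es)) x + X f x *\<^sub>R c (B # As @ D # Bs) x)"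
    using Cons.prems n by (intro Cons.IH[of n'] cochain_insert) auto
  moreover have "c (commutator A B # As @ func_scale f D # Bs) = (\<lambda>x. f x *\<^sub>R c (commutator A B # As @ D # Bs) x)"
    using Cons.prems commutator_derivation[OF A] cochain_scale[OF Cons.prems(1), of "commutator A B # As" Bs D f] by simp
  ultimately show ?case
    by (simp only: append_Nil append_Cons lie_correction.simps) (simp add: fun_eq_iff algebra_simps)
qed

lemma lie_correction_minus:
  assumes "set Bs \<subseteq> derivations E"
    and "\<And>Es. set Es \<subseteq> derivations E \<Longrightarrow> length Es = length Bs \<Longrightarrow> c Es = - c' Es"
  shows "lie_correction A Bs c = - lie_correction A Bs c'"
  using assms
proof (induction Bs arbitrary: c c')
  case (Cons B Bs)
  have "lie_correction A Bs (\<lambda>Es. c (B # Es)) = - lie_correction A Bs (\<lambda>Es. c' (B # Es))"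
    using Cons.prems by (intro Cons.IH) auto
  moreover have "c (commutator A B # Bs) = - c' (commutator A B # Bs)"
    using Cons.prems commutator_derivation[OF A] by auto
  ultimately show ?case by (simp only: lie_correction.simps minus_add_distrib)
qed (simp only: lie_correction.simps minus_zero)

lemma lie_correction_swap:
  "cochain n c \<Longrightarrow> set As \<subseteq> derivations E \<Longrightarrow> set Bs \<subseteq> derivations E \<Longrightarrow> D \<in> derivations E \<Longrightarrow> D' \<in> derivations E \<Longrightarrow>
    length As + length Bs + 2 = n \<Longrightarrow>
    lie_correction A (As @ D # D' # Bs) c = - lie_correction A (As @ D' # D # Bs) c"
proof (induction As arbitrary: n c)
  case Nil
  have "lie_correction A Bs (\<lambda>Es. c (D # D' # Es)) = - lie_correction A Bs (\<lambda>Es. c (D' # D # Es))"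
    using Nil by (intro lie_correction_minus cochain_swap[OF Nil(1), of "[]", simplified]) auto
  moreover have "c (commutator A D # D' # Bs) = - c (D' # commutator A D # Bs)"
    "c (D # commutator A D' # Bs) = - c (commutator A D' # D # Bs)"
    using Nil commutator_derivation[OF A] by (auto intro!: cochain_swap[OF Nil(1), of "[]", simplified])
  ultimately show ?case
    by (simp only: append_Nil append_Cons lie_correction.simps minus_add_distrib minus_minus add_ac)
next
  case (Cons B As)
  obtain n' where n: "n = Suc n'" using Cons.prems by (cases n) auto
  have "lie_correction A (As @ D # D' # Bs) (\<lambda>Es. c (B # Es)) = - lie_correction A (As @ D' # D # Bs) (\<lambda>Es. c (B # Es))"
    using Cons.prems n by (intro Cons.IH[of n'] cochain_insert) auto
  moreover have "c (commutator A B # As @ D # D' # Bs) = - c (commutator A B # As @ D' # D # Bs)"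
    using Cons.prems commutator_derivation[OF A] cochain_swap[OF Cons.prems(1), of "commutator A B # As" Bs D D'] by simp
  ultimately show ?case
    by (simp only: append_Nil append_Cons lie_correction.simps minus_add_distrib minus_minus add_ac)
qed

lemma cochain_cochain_lie:
  assumes c: "cochain n c"
  shows "cochain n (cochain_lie A c)"
  unfolding cochain_def
proof (intro conjI ballI allI impI; (elim conjE)?)
  show "cochain_lie A c Ds \<in> Gam E" if "Ds \<in> tuples n (derivations E)" for Ds
    using that derivation_section[OF A cochain_value[OF c]] lie_correction_value[OF c]
    by (auto simp: cochain_lie_def tuples_def intro!: subspace_diff[OF subspace_Gam])
next
  fix As D D' Bs
  assume 1: "set As \<subseteq> derivations E" "set Bs \<subseteq> derivations E" "D \<in> derivations E" "D' \<in> derivations E"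
    "length As + length Bs + 1 = n"
  have "A (c (As @ D # Bs) + c (As @ D' # Bs)) = A (c (As @ D # Bs)) + A (c (As @ D' # Bs))"
    using 1 by (intro derivation_add[OF A] cochain_value[OF c]) auto
  then show "cochain_lie A c (As @ (D + D') # Bs) = cochain_lie A c (As @ D # Bs) + cochain_lie A c (As @ D' # Bs)"
    unfolding cochain_lie_def lie_correction_add[OF c 1] cochain_add[OF c 1] by (simp add: algebra_simps)
next
  fix As D f Bs
  assume 1: "set As \<subseteq> derivations E" "set Bs \<subseteq> derivations E" "D \<in> derivations E" "f \<in> C_inf E"
    "length As + length Bs + 1 = n"
  have "c (As @ D # Bs) \<in> Gam E" using 1 by (intro cochain_value[OF c]) auto
  then have "A (\<lambda>x. f x *\<^sub>R c (As @ D # Bs) x) = (\<lambda>x. X f x *\<^sub>R c (As @ D # Bs) x + f x *\<^sub>R A (c (As @ D # Bs)) x)"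
    using X 1 by (simp add: symbol_of_def)
  then show "cochain_lie A c (As @ func_scale f D # Bs) = (\<lambda>x. f x *\<^sub>R cochain_lie A c (As @ D # Bs) x)"
    unfolding cochain_lie_def lie_correction_scale[OF c 1] cochain_scale[OF c 1] by (simp add: fun_eq_iff algebra_simps)
next
  fix As D D' Bs
  assume 1: "set As \<subseteq> derivations E" "set Bs \<subseteq> derivations E" "D \<in> derivations E" "D' \<in> derivations E"
    "length As + length Bs + 2 = n"
  have "A (- c (As @ D' # D # Bs)) = - A (c (As @ D' # D # Bs))"
    using 1 by (intro derivation_minus[OF A] cochain_value[OF c]) auto
  then show "cochain_lie A c (As @ D # D' # Bs) = - cochain_lie A c (As @ D' # D # Bs)"
    unfolding cochain_lie_def lie_correction_swap[OF c 1] cochain_swap[OF c 1] by simp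
qed

end

end

subsection \<open>The Koszul formula defines a form\<close>

lemma self_negative: "v = - v \<Longrightarrow> v = 0" for v :: "'a::real_vector"
  using scaleR_2[of v] by (metis add.right_inverse scaleR_eq_0_iff zero_neq_numeral)

lemma alt_maps_value: "\<mu> \<in> alt_maps n S W \<Longrightarrow> set xs \<subseteq> S \<Longrightarrow> length xs = n \<Longrightarrow> \<mu> xs \<in> W"
  and alt_maps_outside: "\<mu> \<in> alt_maps n S W \<Longrightarrow> xs \<notin> tuples n S \<Longrightarrow> \<mu> xs = 0"
  and alt_maps_linear: "\<mu> \<in> alt_maps n S W \<Longrightarrow> set xs \<subseteq> S \<Longrightarrow> set ys \<subseteq> S \<Longrightarrow> length xs + 1 + length ys = n \<Longrightarrow>
    linear_map_on S (\<lambda>x. \<mu> (xs @ x # ys))"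
  and alt_maps_distinct: "\<mu> \<in> alt_maps n S W \<Longrightarrow> set xs \<subseteq> S \<Longrightarrow> length xs = n \<Longrightarrow> \<not> distinct xs \<Longrightarrow> \<mu> xs = 0"
  unfolding alt_maps_def tuples_def by blast+

lemma alt_maps_swap:
  assumes \<mu>: "\<mu> \<in> alt_maps n S W" and S: "subspace S"
    and "set xs \<subseteq> S" "set ys \<subseteq> S" "a \<in> S" "b \<in> S" "length xs + length ys + 2 = n"
  shows "\<mu> (xs @ a # b # ys) = - \<mu> (xs @ b # a # ys)"
proof -
  have z: "\<mu> (xs @ c # c # ys) = 0" if "c \<in> S" for c
    by (rule alt_maps_distinct[OF \<mu>]) (use assms that in auto)
  have first: "\<mu> (xs @ (a + b) # c # ys) = \<mu> (xs @ a # c # ys) + \<mu> (xs @ b # c # ys)" if "c \<in> S" for c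
    using linear_map_on_add[OF alt_maps_linear[OF \<mu>, of xs "c # ys"] S assms(5,6)] assms that by simp
  have second: "\<mu> (xs @ c # (a + b) # ys) = \<mu> (xs @ c # a # ys) + \<mu> (xs @ c # b # ys)" if "c \<in> S" for c
    using linear_map_on_add[OF alt_maps_linear[OF \<mu>, of "xs @ [c]" ys] S assms(5,6)] assms that by simp
  have "a + b \<in> S" using assms S by (simp add: subspace_add)
  then have "\<mu> (xs @ a # b # ys) + \<mu> (xs @ b # a # ys) = 0"
    using z[of "a + b"] first[of "a + b"] second[OF assms(5)] second[OF assms(6)] z[OF assms(5)] z[OF assms(6)] by simp
  then show ?thesis by (simp add: add_eq_0_iff2)
qed

context nonzero_vector_bundle
begin

lemma cochain_minus:
  assumes c: "cochain n c" and "set As \<subseteq> derivations E" "set Bs \<subseteq> derivations E" "D \<in> derivations E"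
    "length As + length Bs + 1 = n"
  shows "c (As @ (- D) # Bs) = - c (As @ D # Bs)"
proof -
  have minus: "- D = func_scale (\<lambda>x. - 1) D" by (simp add: func_scale_def fun_eq_iff)
  show ?thesis
    unfolding minus cochain_scale[OF c assms(2-4) smooth_fun_const[of "-1"] assms(5)] by (simp add: fun_eq_iff)
qed

lemma cochain_d_value:
  "cochain n c \<Longrightarrow> set Ds \<subseteq> derivations E \<Longrightarrow> length Ds = Suc n \<Longrightarrow> cochain_d Ds c \<in> Gam E"
proof (induction Ds arbitrary: n c)
  case (Cons A As)
  have A: "A \<in> derivations E" using Cons.prems by simp
  obtain X where X: "symbol_of A X" using A by (auto simp: derivations_iff)
  have "cochain_lie A c As \<in> Gam E"
    using cochain_value[OF cochain_cochain_lie[OF A X Cons.prems(1)]] Cons.prems by simp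
  moreover have "cochain_d As (\<lambda>Es. c (A # Es)) \<in> Gam E"
  proof (cases n)
    case 0
    then show ?thesis using Cons.prems subspace_0[OF subspace_Gam] by (simp add: zero_fun_def)
  next
    case (Suc n')
    then show ?thesis using Cons.prems by (intro Cons.IH[of n'] cochain_insert) auto
  qed
  ultimately show ?case unfolding cochain_d.simps by (rule subspace_diff[OF subspace_Gam])
qed simp

lemma cochain_d_minus:
  assumes "set Ds \<subseteq> derivations E"
    and "\<And>Es. set Es \<subseteq> derivations E \<Longrightarrow> length Es + 1 = length Ds \<Longrightarrow> c Es = - c' Es"
    and "\<And>Es. set Es \<subseteq> derivations E \<Longrightarrow> length Es + 1 = length Ds \<Longrightarrow> c' Es \<in> Gam E"
  shows "cochain_d Ds c = - cochain_d Ds c'"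
  using assms
proof (induction Ds arbitrary: c c')
  case (Cons A As)
  have A: "A \<in> derivations E" using Cons.prems by simp
  obtain X where X: "symbol_of A X" using A by (auto simp: derivations_iff)
  have "cochain_d As (\<lambda>Es. c (A # Es)) = - cochain_d As (\<lambda>Es. c' (A # Es))"
    using Cons.prems by (intro Cons.IH) auto
  moreover have "lie_correction A As c = - lie_correction A As c'"
    using Cons.prems by (intro lie_correction_minus[OF A X]) auto
  moreover have "A (c As) = - A (c' As)"
  proof -
    have "c As = - c' As" by (rule Cons.prems(2)) (use Cons.prems(1) in auto)
    moreover have "A (- c' As) = - A (c' As)"
      by (rule derivation_minus[OF A Cons.prems(3)]) (use Cons.prems(1) in auto)
    ultimately show ?thesis by (simp only:)
  qed
  ultimately show ?case by (simp only: cochain_d.simps cochain_lie_def) (simp add: algebra_simps)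
qed (simp add: zero_fun_def fun_eq_iff)

text \<open>Both sides are expanded by Cartan's formula twice; what remains is the antisymmetry of the
  commutator.\<close>

lemma cochain_d_swap_first:
  assumes c: "cochain (Suc n) c" and D: "D \<in> derivations E" "D' \<in> derivations E"
    and Ds: "set Ds \<subseteq> derivations E" "length Ds = n"
  shows "cochain_d (D # D' # Ds) c = - cochain_d (D' # D # Ds) c"
proof -
  have d: "cochain_d Ds (\<lambda>Es. c (D # D' # Es)) = - cochain_d Ds (\<lambda>Es. c (D' # D # Es))"
  proof (rule cochain_d_minus[OF Ds(1)])
    fix Es assume Es: "set Es \<subseteq> derivations E" "length Es + 1 = length Ds"
    show "c (D # D' # Es) = - c (D' # D # Es)"
      using cochain_swap[OF c, of "[]" Es D D'] D Es Ds by simp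
    show "c (D' # D # Es) \<in> Gam E"
      by (rule cochain_value[OF c]) (use D Es Ds in auto)
  qed
  have "c (commutator D' D # Ds) = - c (commutator D D' # Ds)"
    using cochain_minus[OF c, of "[]" Ds "commutator D D'"] D Ds commutator_derivation
    by (simp add: commutator_antisym[of D' D])
  with d show ?thesis
    unfolding cochain_d.simps cochain_lie_def lie_correction.simps by (simp add: algebra_simps)
qed

text \<open>Antisymmetry in the first two slots reduces the claims for the first slot to those for the
  second one.\<close>

lemma cochain_cochain_d:
  "cochain n c \<Longrightarrow> cochain (Suc n) (\<lambda>Ds. cochain_d Ds c)"
proof (induction n arbitrary: c)
  case (0 c)
  show ?case
    unfolding cochain_def
  proof (intro conjI ballI allI impI; (elim conjE)?)
    show "cochain_d Ds c \<in> Gam E" if "Ds \<in> tuples (Suc 0) (derivations E)" for Ds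
      using cochain_d_value[OF 0] that by (simp add: tuples_def)
  qed (auto simp: cochain_lie_def fun_eq_iff func_scale_def)
next
  case (Suc n c)
  note c = Suc.prems
  \<comment> \<open>In all slots but the first, the claims pass from the Lie derivative and from degree \<open>n\<close>.\<close>
  have rest: "cochain (Suc n) (\<lambda>Bs. cochain_d (A # Bs) c)" if A: "A \<in> derivations E" for A
  proof -
    obtain X where X: "symbol_of A X" using A by (auto simp: derivations_iff)
    note 1 = cochain_cochain_lie[OF A X c] and 2 = Suc.IH[OF cochain_insert[OF c A]]
    show ?thesis
      unfolding cochain_def
    proof (intro conjI ballI allI impI; (elim conjE)?)
      show "cochain_d (A # Ds) c \<in> Gam E" if "Ds \<in> tuples (Suc n) (derivations E)" for Ds
        using cochain_d_value[OF c, of "A # Ds"] that A by (simp add: tuples_def)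
    next
      fix As D D' Bs
      assume 3: "set As \<subseteq> derivations E" "set Bs \<subseteq> derivations E" "D \<in> derivations E" "D' \<in> derivations E"
        "length As + length Bs + 1 = Suc n"
      show "cochain_d (A # As @ (D + D') # Bs) c = cochain_d (A # As @ D # Bs) c + cochain_d (A # As @ D' # Bs) c"
        unfolding cochain_d.simps cochain_add[OF 1 3] cochain_add[OF 2 3] by (simp add: algebra_simps)
    next
      fix As D f Bs
      assume 3: "set As \<subseteq> derivations E" "set Bs \<subseteq> derivations E" "D \<in> derivations E" "f \<in> C_inf E"
        "length As + length Bs + 1 = Suc n"
      show "cochain_d (A # As @ func_scale f D # Bs) c = (\<lambda>x. f x *\<^sub>R cochain_d (A # As @ D # Bs) c x)"
        unfolding cochain_d.simps cochain_scale[OF 1 3] cochain_scale[OF 2 3] by (simp add: fun_eq_iff algebra_simps)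
    next
      fix As D D' Bs
      assume 3: "set As \<subseteq> derivations E" "set Bs \<subseteq> derivations E" "D \<in> derivations E" "D' \<in> derivations E"
        "length As + length Bs + 2 = Suc n"
      show "cochain_d (A # As @ D # D' # Bs) c = - cochain_d (A # As @ D' # D # Bs) c"
        unfolding cochain_d.simps cochain_swap[OF 1 3] cochain_swap[OF 2 3] by simp
    qed
  qed
  show ?case
    unfolding cochain_def
  proof (intro conjI ballI allI impI; (elim conjE)?)
    show "cochain_d Ds c \<in> Gam E" if "Ds \<in> tuples (Suc (Suc n)) (derivations E)" for Ds
      using cochain_d_value[OF c] that by (simp add: tuples_def)
  next
    fix As D D' Bs
    assume 3: "set As \<subseteq> derivations E" "set Bs \<subseteq> derivations E" "D \<in> derivations E" "D' \<in> derivations E"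
      "length As + length Bs + 1 = Suc (Suc n)"
    show "cochain_d (As @ (D + D') # Bs) c = cochain_d (As @ D # Bs) c + cochain_d (As @ D' # Bs) c"
    proof (cases As)
      case Nil
      then obtain B Bs' where B: "Bs = B # Bs'" using 3 by (cases Bs) auto
      have B': "B \<in> derivations E" "set Bs' \<subseteq> derivations E" "length Bs' = n" using 3 Nil B by auto
      note swap = cochain_d_swap_first[OF c _ _ B'(2,3)]
      have "cochain_d ((D + D') # B # Bs') c = - cochain_d (B # (D + D') # Bs') c"
        by (rule swap[OF subspace_add[OF subspace_derivations 3(3,4)] B'(1)])
      also have "cochain_d (B # (D + D') # Bs') c = cochain_d (B # D # Bs') c + cochain_d (B # D' # Bs') c"
        using cochain_add[OF rest[OF B'(1)], of "[]" Bs' D D'] 3 B' by simp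
      also have "\<dots> = - cochain_d (D # B # Bs') c + - cochain_d (D' # B # Bs') c"
        unfolding swap[OF B'(1) 3(3)] swap[OF B'(1) 3(4)] ..
      finally show ?thesis unfolding Nil B by (simp only: append_Nil minus_add_distrib minus_minus)
    next
      case (Cons A As')
      then show ?thesis using 3 cochain_add[OF rest, of A As' Bs D D'] by simp
    qed
  next
    fix As D f Bs
    assume 3: "set As \<subseteq> derivations E" "set Bs \<subseteq> derivations E" "D \<in> derivations E" "f \<in> C_inf E"
      "length As + length Bs + 1 = Suc (Suc n)"
    show "cochain_d (As @ func_scale f D # Bs) c = (\<lambda>x. f x *\<^sub>R cochain_d (As @ D # Bs) c x)"
    proof (cases As)
      case Nil
      then obtain B Bs' where B: "Bs = B # Bs'" using 3 by (cases Bs) auto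
      have B': "B \<in> derivations E" "set Bs' \<subseteq> derivations E" "length Bs' = n" using 3 Nil B by auto
      have "cochain_d (func_scale f D # B # Bs') c = - cochain_d (B # func_scale f D # Bs') c"
        by (rule cochain_d_swap_first[OF c func_scale_derivation[OF 3(4,3)] B'])
      also have "cochain_d (B # func_scale f D # Bs') c = (\<lambda>x. f x *\<^sub>R cochain_d (B # D # Bs') c x)"
        using cochain_scale[OF rest[OF B'(1)], of "[]" Bs' D f] 3 B' by simp
      also have "cochain_d (B # D # Bs') c = - cochain_d (D # B # Bs') c"
        by (rule cochain_d_swap_first[OF c B'(1) 3(3) B'(2,3)])
      finally have "cochain_d (func_scale f D # B # Bs') c = - (\<lambda>x. f x *\<^sub>R (- cochain_d (D # B # Bs') c) x)" .
      then show ?thesis unfolding Nil B append_Nil fun_eq_iff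
        by (simp only: fun_Compl_def uminus_apply scaleR_minus_right minus_minus) blast
    next
      case (Cons A As')
      then show ?thesis using 3 cochain_scale[OF rest, of A As' Bs D f] by simp
    qed
  next
    fix As D D' Bs
    assume 3: "set As \<subseteq> derivations E" "set Bs \<subseteq> derivations E" "D \<in> derivations E" "D' \<in> derivations E"
      "length As + length Bs + 2 = Suc (Suc n)"
    show "cochain_d (As @ D # D' # Bs) c = - cochain_d (As @ D' # D # Bs) c"
    proof (cases As)
      case Nil
      then show ?thesis using 3 cochain_d_swap_first[OF c 3(3,4,2)] by simp
    next
      case (Cons A As')
      then show ?thesis using 3 cochain_swap[OF rest, of A As' Bs D D'] by simp
    qed
  qed
qed

lemma omit_nth_simps [simp]: "omit_nth 0 (x # xs) = xs" "omit_nth (Suc i) (x # xs) = x # omit_nth i xs"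
  by (simp_all add: omit_nth_def)

lemma set_omit_nth: "set (omit_nth i xs) \<subseteq> set xs"
  unfolding omit_nth_def by (auto dest: in_set_takeD in_set_dropD)

lemma length_omit_nth: "i < length xs \<Longrightarrow> length (omit_nth i xs) = length xs - 1"
  by (simp add: omit_nth_def)

lemma lie_correction_sum:
  assumes "A \<in> derivations E"
  shows "cochain n c \<Longrightarrow> set Bs \<subseteq> derivations E \<Longrightarrow> length Bs = n \<Longrightarrow>
    lie_correction A Bs c = (\<Sum>j<n. (-1) ^ j *\<^sub>R c (commutator A (Bs ! j) # omit_nth j Bs))"
proof (induction Bs arbitrary: n c)
  case (Cons B Bs)
  then obtain n' where n: "n = Suc n'" by (cases n) auto
  have "lie_correction A Bs (\<lambda>Es. c (B # Es)) =
      (\<Sum>j<n'. (-1) ^ j *\<^sub>R c (B # commutator A (Bs ! j) # omit_nth j Bs))"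
    using Cons.prems n by (intro Cons.IH cochain_insert) auto
  also have "\<dots> = (\<Sum>j<n'. (-1) ^ Suc j *\<^sub>R c (commutator A (Bs ! j) # B # omit_nth j Bs))"
  proof (rule sum.cong[OF refl])
    fix j assume "j \<in> {..<n'}"
    then have j: "j < length Bs" using Cons.prems n by simp
    then have "Bs ! j \<in> derivations E" using Cons.prems nth_mem by auto
    then have "c (B # commutator A (Bs ! j) # omit_nth j Bs) = - c (commutator A (Bs ! j) # B # omit_nth j Bs)"
      using Cons.prems commutator_derivation[OF assms] set_omit_nth[of j Bs] length_omit_nth[OF j] j
      by (intro cochain_swap[OF Cons.prems(1), of "[]", simplified]) auto
    then show "(-1) ^ j *\<^sub>R c (B # commutator A (Bs ! j) # omit_nth j Bs) =
        (-1) ^ Suc j *\<^sub>R c (commutator A (Bs ! j) # B # omit_nth j Bs)" by simp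
  qed
  finally show ?case unfolding n sum.lessThan_Suc_shift lie_correction.simps by simp
qed (simp add: fun_eq_iff)

lemma apply_form_insertion: "apply_form (insertion D \<mu>) Ds = apply_form \<mu> (D # Ds)"
  by (simp add: apply_form_def insertion_def insert_at_def)

text \<open>The terms of the Koszul formula that do not involve the first argument form the Koszul formula of
  the contraction, with the opposite sign; the others form the Lie derivative.\<close>

lemma koszul_eq_cochain_d:
  "cochain n (apply_form \<mu>) \<Longrightarrow> set Ds \<subseteq> derivations E \<Longrightarrow> length Ds = Suc n \<Longrightarrow>
    koszul n \<mu> Ds = cochain_d Ds (apply_form \<mu>)"
proof (induction n arbitrary: \<mu> Ds)
  case (0 \<mu> Ds)
  then obtain D where "Ds = [D]" by (cases Ds) auto
  then show ?case by (simp add: koszul_def cochain_lie_def fun_eq_iff)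
next
  case (Suc n \<mu> Ds)
  let ?c = "apply_form \<mu>"
  obtain D Bs where Ds: "Ds = D # Bs" using Suc.prems by (cases Ds) auto
  have D: "D \<in> derivations E" "set Bs \<subseteq> derivations E" "length Bs = Suc n" using Suc.prems Ds by auto
  have cD: "cochain n (apply_form (insertion D \<mu>))"
    unfolding apply_form_insertion[abs_def] using cochain_insert[OF Suc.prems(1) D(1)] .
  have nth: "Bs ! j \<in> derivations E" if "j \<le> n" for j using that D nth_mem[of j Bs] by auto
  have first: "(\<Sum>i\<le>Suc n. (-1) ^ i *\<^sub>R (Ds ! i) (?c (omit_nth i Ds))) =
      D (?c Bs) - (\<Sum>i\<le>n. (-1) ^ i *\<^sub>R (Bs ! i) (?c (D # omit_nth i Bs)))"
    unfolding sum.atMost_Suc_shift Ds by (simp add: sum_negf)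
  have pair: "?c (commutator (Bs ! i) (Bs ! j) # D # omit_nth i (omit_nth j Bs)) =
      - ?c (D # commutator (Bs ! i) (Bs ! j) # omit_nth i (omit_nth j Bs))" if ij: "i < j" "j \<le> n" for i j
  proof -
    have "length (omit_nth i (omit_nth j Bs)) = n - 1"
      using ij D by (simp add: length_omit_nth)
    then show ?thesis
      using ij D nth commutator_derivation set_omit_nth[of i "omit_nth j Bs"] set_omit_nth[of j Bs]
      by (intro cochain_swap[OF Suc.prems(1), of "[]", simplified]) auto
  qed
  have second: "(\<Sum>j\<le>Suc n. \<Sum>i<j. (-1) ^ (i + j) *\<^sub>R
       ?c (commutator (Ds ! i) (Ds ! j) # omit_nth i (omit_nth j Ds))) =
      - lie_correction D Bs ?c - (\<Sum>j\<le>n. \<Sum>i<j. (-1) ^ (i + j) *\<^sub>R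
       ?c (D # commutator (Bs ! i) (Bs ! j) # omit_nth i (omit_nth j Bs)))"
  proof -
    have "(\<Sum>j\<le>Suc n. \<Sum>i<j. (-1) ^ (i + j) *\<^sub>R
       ?c (commutator (Ds ! i) (Ds ! j) # omit_nth i (omit_nth j Ds))) =
      (\<Sum>j\<le>n. (-1) ^ Suc j *\<^sub>R ?c (commutator D (Bs ! j) # omit_nth j Bs) + (\<Sum>i<j. (-1) ^ (i + j) *\<^sub>R
       ?c (commutator (Bs ! i) (Bs ! j) # D # omit_nth i (omit_nth j Bs))))"
      unfolding sum.atMost_Suc_shift sum.lessThan_Suc_shift Ds by simp
    also have "\<dots> = (\<Sum>j\<le>n. - ((-1) ^ j *\<^sub>R ?c (commutator D (Bs ! j) # omit_nth j Bs)) - (\<Sum>i<j. (-1) ^ (i + j) *\<^sub>R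
       ?c (D # commutator (Bs ! i) (Bs ! j) # omit_nth i (omit_nth j Bs))))"
      using pair by (intro sum.cong refl) (simp add: sum_negf)
    also have "\<dots> = - lie_correction D Bs ?c - (\<Sum>j\<le>n. \<Sum>i<j. (-1) ^ (i + j) *\<^sub>R
       ?c (D # commutator (Bs ! i) (Bs ! j) # omit_nth i (omit_nth j Bs)))"
      unfolding lie_correction_sum[OF D(1) Suc.prems(1) D(2,3)] by (simp add: sum_subtractf sum_negf lessThan_Suc_atMost)
    finally show ?thesis .
  qed
  have "koszul (Suc n) \<mu> Ds = cochain_lie D ?c Bs - koszul n (insertion D \<mu>) Bs"
    unfolding koszul_def first second by (simp add: apply_form_insertion cochain_lie_def algebra_simps)
  also have "koszul n (insertion D \<mu>) Bs = cochain_d Bs (\<lambda>Es. ?c (D # Es))"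
    using Suc.IH[OF cD D(2,3)] by (simp add: apply_form_insertion[abs_def])
  finally show ?case by (simp add: Ds)
qed

end

subsection \<open>Tensoriality\<close>

context nonzero_vector_bundle
begin

lemma cochain_sum:
  assumes c: "cochain n c" and "set As \<subseteq> derivations E" "set Bs \<subseteq> derivations E" "length As + length Bs + 1 = n"
    and "finite I" "\<And>i. i \<in> I \<Longrightarrow> G i \<in> derivations E" "\<And>i. i \<in> I \<Longrightarrow> f i \<in> C_inf E"
  shows "c (As @ (\<Sum>i\<in>I. func_scale (f i) (G i)) # Bs) x = (\<Sum>i\<in>I. f i x *\<^sub>R c (As @ G i # Bs) x)"
  using assms(5-7)
proof (induction I rule: finite_induct)
  case empty
  have zero: "(0 :: ('p \<Rightarrow> 'v) \<Rightarrow> 'p \<Rightarrow> 'v) = func_scale (\<lambda>x. 0) 0" by (simp add: func_scale_def fun_eq_iff)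
  have "c (As @ func_scale (\<lambda>x. 0) 0 # Bs) = (\<lambda>x. 0 *\<^sub>R c (As @ 0 # Bs) x)"
    by (rule cochain_scale[OF c assms(2,3) subspace_0[OF subspace_derivations] smooth_fun_const assms(4)])
  then have "c (As @ 0 # Bs) = (\<lambda>x. 0)" unfolding zero[symmetric] scaleR_zero_left .
  then show ?case unfolding sum.empty by (rule fun_cong)
next
  case (insert i I)
  have step: "c (As @ (func_scale (f i) (G i) + (\<Sum>i\<in>I. func_scale (f i) (G i))) # Bs) =
      c (As @ func_scale (f i) (G i) # Bs) + c (As @ (\<Sum>i\<in>I. func_scale (f i) (G i)) # Bs)"
  proof (rule cochain_add[OF c assms(2,3) _ _ assms(4)])
    show "func_scale (f i) (G i) \<in> derivations E"
      by (rule func_scale_derivation) (use insert.prems in auto)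
    show "(\<Sum>i\<in>I. func_scale (f i) (G i)) \<in> derivations E"
      by (intro subspace_sum[OF subspace_derivations] func_scale_derivation) (use insert.prems in auto)
  qed
  have "c (As @ func_scale (f i) (G i) # Bs) = (\<lambda>x. f i x *\<^sub>R c (As @ G i # Bs) x)"
    by (rule cochain_scale[OF c assms(2,3) _ _ assms(4)]) (use insert.prems in auto)
  moreover have "c (As @ (\<Sum>i\<in>I. func_scale (f i) (G i)) # Bs) x = (\<Sum>i\<in>I. f i x *\<^sub>R c (As @ G i # Bs) x)"
    by (rule insert.IH) (use insert.prems in auto)
  ultimately have "(c (As @ func_scale (f i) (G i) # Bs) + c (As @ (\<Sum>i\<in>I. func_scale (f i) (G i)) # Bs)) x =
      f i x *\<^sub>R c (As @ G i # Bs) x + (\<Sum>i\<in>I. f i x *\<^sub>R c (As @ G i # Bs) x)"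
    by simp
  then show ?case unfolding sum.insert[OF insert.hyps] step .
qed

text \<open>A derivation vanishing at \<open>x\<close> becomes, after multiplication with a bump function, a global
  combination of the frame with coefficients that vanish at \<open>x\<close>.\<close>

lemma cochain_zero_at:
  assumes c: "cochain n c" and As: "set As \<subseteq> derivations E" "set Bs \<subseteq> derivations E" "length As + length Bs + 1 = n"
    and D: "D \<in> derivations E" "at_pt D x = 0"
  shows "c (As @ D # Bs) x = 0"
proof -
  obtain N F W H e k r where "gauge_frame E N F W H e k r" and x: "x \<in> N"
    by (rule gauge_frame_exists)
  then interpret gauge_frame E N F W H e k r by simp
  obtain X where X: "symbol_of D X" using D(1) by (auto simp: derivations_iff)
  have Xv: "X \<in> vector_fields E" using X by (simp add: symbol_of_def)
  obtain h C N' where h: "h \<in> C_inf E" "C \<subseteq> N" "x \<in> N'" "\<And>y. y \<in> N' \<Longrightarrow> h y = 1" "\<And>y. y \<notin> C \<Longrightarrow> h y = 0"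
    using bump_function[OF N_open x] by metis
  let ?m = "mdim E"
  let ?I = "{..<?m} <+> {..<r} \<times> {..<r}"
  define G where "G = case_sum H (\<lambda>(j, l). matrix_unit e k j l)"
  define a where "a = case_sum (\<lambda>i y. X (F i) y) (\<lambda>(j, l) y. k l y (D (e j) y))"
  have G: "G s \<in> derivations E" if "s \<in> ?I" for s
    using that H_derivation matrix_unit_derivation by (auto simp: G_def)
  have a: "a s \<in> C_inf E" if "s \<in> ?I" for s
    using that vector_field_smooth[OF Xv F_smooth] k_smooth[OF _ derivation_section[OF D(1) e_section]]
    by (auto simp: a_def)
  have sum_I: "(\<Sum>s\<in>?I. g s) = (\<Sum>i<?m. g (Inl i)) + (\<Sum>j<r. \<Sum>l<r. g (Inr (j, l)))"
    for g :: "_ \<Rightarrow> ('p \<Rightarrow> 'v) \<Rightarrow> 'v"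
    by (simp add: sum.Plus sum.cartesian_product)
  have hD: "func_scale h D = (\<Sum>s\<in>?I. func_scale (\<lambda>y. h y * a s y) (G s))"
  proof (rule derivation_eqI)
    fix y
    show "at_pt (func_scale h D) y = at_pt (\<Sum>s\<in>?I. func_scale (\<lambda>y. h y * a s y) (G s)) y"
    proof (cases "y \<in> N")
      case True
      have "at_pt D y = (\<Sum>s\<in>?I. a s y *\<^sub>R at_pt (G s) y)"
        unfolding sum_I using gauge_expansion[OF True derivation_at[OF D(1)]]
        by (simp add: symbol_at_derivation[OF X] a_def G_def) (simp add: at_pt_def)
      then show ?thesis
        by (simp add: at_pt_sum at_pt_func_scale scaleR_sum_right)
    next
      case False
      then have "h y = 0" using h by blast
      then show ?thesis by (simp add: at_pt_sum at_pt_func_scale)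
    qed
  qed
  have "a s x = 0" if "s \<in> ?I" for s
  proof -
    have "at_pt X x = 0"
      using symbol_at_derivation[OF X, of x] D(2) linear_map_on_zero[OF symbol_at_linear subspace_gauge] by simp
    then have "X (F i) x = 0" for i by (simp add: at_pt_def fun_eq_iff)
    moreover have "k l x (D (e j) x) = 0" if "l < r" for j l
    proof -
      have "D (e j) x = 0" using D(2) by (simp add: at_pt_def fun_eq_iff)
      then show ?thesis using linear_map_on_zero[OF k_linear[OF that] fibre_subspace] by simp
    qed
    ultimately show ?thesis using that by (auto simp: a_def)
  qed
  then have "c (As @ (\<Sum>s\<in>?I. func_scale (\<lambda>y. h y * a s y) (G s)) # Bs) x = 0"
    by (subst cochain_sum[OF c As]) (use G a h(1) smooth_fun_mult in auto)
  moreover have "c (As @ func_scale h D # Bs) x = h x *\<^sub>R c (As @ D # Bs) x"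
    using cochain_scale[OF c As(1,2) D(1) h(1) As(3)] by simp
  ultimately show ?thesis using hD h by simp
qed

lemma cochain_diff:
  assumes c: "cochain n c" and "set As \<subseteq> derivations E" "set Bs \<subseteq> derivations E"
    "D \<in> derivations E" "D' \<in> derivations E" "length As + length Bs + 1 = n"
  shows "c (As @ (D - D') # Bs) = c (As @ D # Bs) - c (As @ D' # Bs)"
proof -
  have "D - D' \<in> derivations E" using assms by (simp add: subspace_diff[OF subspace_derivations])
  from cochain_add[OF c assms(2,3) this assms(5,6)] show ?thesis by (simp only: diff_add_cancel) simp
qed

text \<open>This is what makes a form out of its values on derivations.\<close>

lemma cochain_pointwise:
  assumes c: "cochain n c"
  shows "set As \<subseteq> derivations E \<Longrightarrow> set Ds \<subseteq> derivations E \<Longrightarrow> set Ds' \<subseteq> derivations E \<Longrightarrow>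
    length As + length Ds = n \<Longrightarrow> map (\<lambda>D. at_pt D x) Ds = map (\<lambda>D. at_pt D x) Ds' \<Longrightarrow> c (As @ Ds) x = c (As @ Ds') x"
proof (induction Ds arbitrary: As Ds')
  case (Cons D Ds As Ds')
  then obtain D' Es where Ds': "Ds' = D' # Es" by (cases Ds') auto
  have "at_pt (D - D') x = 0" using Cons.prems Ds' by (simp add: at_pt_def fun_eq_iff)
  then have "c (As @ (D - D') # Ds) x = 0"
    using Cons.prems Ds' subspace_diff[OF subspace_derivations] by (intro cochain_zero_at[OF c]) auto
  moreover have "c (As @ (D - D') # Ds) = c (As @ D # Ds) - c (As @ D' # Ds)"
    using Cons.prems Ds' by (intro cochain_diff[OF c]) auto
  ultimately have "c (As @ D # Ds) x = c (As @ D' # Ds) x" by simp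
  also have "\<dots> = c ((As @ [D']) @ Es) x"
    using Cons.prems Ds' Cons.IH[of "As @ [D']" Es] by simp
  finally show ?case by (simp add: Ds')
qed simp

lemma cochain_nondistinct:
  assumes c: "cochain n c" and "set Ds \<subseteq> derivations E" "length Ds = n" "\<not> distinct Ds"
  shows "c Ds = 0"
proof -
  have "c (As @ D # Bs @ D # Cs) = 0"
    if "set As \<subseteq> derivations E" "set Bs \<subseteq> derivations E" "set Cs \<subseteq> derivations E" "D \<in> derivations E"
      "length As + length Bs + length Cs + 2 = n" for As Bs Cs D
    using that
  proof (induction Bs arbitrary: As)
    case Nil
    have "c (As @ D # D # Cs) = - c (As @ D # D # Cs)"
      using Nil by (intro cochain_swap[OF c]) auto
    from self_negative[OF this] show ?case unfolding append_Nil .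
  next
    case (Cons B Bs)
    have "c (As @ D # B # Bs @ D # Cs) = - c (As @ B # D # Bs @ D # Cs)"
      using Cons.prems by (intro cochain_swap[OF c]) auto
    moreover have "c ((As @ [B]) @ D # Bs @ D # Cs) = 0"
      using Cons.prems by (intro Cons.IH) auto
    ultimately show ?case by simp
  qed
  moreover obtain As D Bs Cs where "Ds = As @ [D] @ Bs @ [D] @ Cs"
    using not_distinct_decomp[OF assms(4)] by metis
  ultimately show ?thesis using assms by simp
qed

definition extension :: "'p \<Rightarrow> (('p \<Rightarrow> 'v) \<Rightarrow> 'v) \<Rightarrow> ('p \<Rightarrow> 'v) \<Rightarrow> 'p \<Rightarrow> 'v"
  where "extension x \<delta> = (SOME D. D \<in> derivations E \<and> at_pt D x = \<delta>)"

lemma extension: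
  assumes "\<delta> \<in> gauge_fibre E x"
  shows "extension x \<delta> \<in> derivations E" "at_pt (extension x \<delta>) x = \<delta>"
proof -
  have "\<exists>D. D \<in> derivations E \<and> at_pt D x = \<delta>" using extend_gauge[OF assms] by metis
  from someI_ex[OF this] show "extension x \<delta> \<in> derivations E" "at_pt (extension x \<delta>) x = \<delta>"
    by (auto simp: extension_def)
qed

text \<open>The value on elements of \<open>\<DD>E\<close> at \<open>x\<close> is that on any extensions to derivations.\<close>

lemma cochain_form:
  assumes c: "cochain n c"
  obtains \<omega> where "\<omega> \<in> gforms_on E n UNIV"
    "\<And>Ds. set Ds \<subseteq> derivations E \<Longrightarrow> length Ds = n \<Longrightarrow> apply_form \<omega> Ds = c Ds"
proof
  define \<omega> where "\<omega> x \<delta>s = (if \<delta>s \<in> tuples n (gauge_fibre E x) then c (map (extension x) \<delta>s) x else 0)" for x \<delta>s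
  have ext: "set (map (extension x) \<delta>s) \<subseteq> derivations E" if "set \<delta>s \<subseteq> gauge_fibre E x" for x \<delta>s
    using that extension by auto
  have eq: "c (map (extension x) \<delta>s) x = c Ds x"
    if "set Ds \<subseteq> derivations E" "length Ds = n" "\<delta>s = map (\<lambda>D. at_pt D x) Ds" for x \<delta>s Ds
  proof -
    have "c ([] @ map (extension x) \<delta>s) x = c ([] @ Ds) x"
      using that extension derivation_at by (intro cochain_pointwise[OF c]) auto
    then show ?thesis by simp
  qed
  show app: "apply_form \<omega> Ds = c Ds" if "set Ds \<subseteq> derivations E" "length Ds = n" for Ds
  proof
    fix x
    have "map (\<lambda>D. at_pt D x) Ds \<in> tuples n (gauge_fibre E x)"
      using that derivation_at by (auto simp: tuples_def)
    then show "apply_form \<omega> Ds x = c Ds x"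
      using eq[OF that refl, of x] by (simp add: apply_form_def \<omega>_def)
  qed
  have "\<omega> x \<in> gform_fibre E n x" for x
    unfolding gform_fibre_def alt_maps_def
  proof (intro CollectI conjI allI ballI impI; (elim conjE)?)
    show "\<delta>s \<notin> tuples n (gauge_fibre E x) \<Longrightarrow> \<omega> x \<delta>s = 0" for \<delta>s by (simp add: \<omega>_def)
    show "\<omega> x \<delta>s \<in> fibre E x" if "\<delta>s \<in> tuples n (gauge_fibre E x)" for \<delta>s
    proof -
      have "c (map (extension x) \<delta>s) \<in> Gam E"
        using that ext by (intro cochain_value[OF c]) (auto simp: tuples_def)
      then show ?thesis using that section_in_fibre by (simp add: \<omega>_def)
    qed
    show "\<omega> x \<delta>s = 0" if "\<delta>s \<in> tuples n (gauge_fibre E x)" "\<not> distinct \<delta>s" for \<delta>s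
    proof -
      have "\<not> distinct (map (extension x) \<delta>s)" using that(2) distinct_map by blast
      then have "c (map (extension x) \<delta>s) = 0"
        using that ext by (intro cochain_nondistinct[OF c]) (auto simp: tuples_def)
      then show ?thesis by (simp add: \<omega>_def)
    qed
    fix \<alpha>s \<beta>s
    assume ab: "set \<alpha>s \<subseteq> gauge_fibre E x" "set \<beta>s \<subseteq> gauge_fibre E x" "length \<alpha>s + 1 + length \<beta>s = n"
    show "linear_map_on (gauge_fibre E x) (\<lambda>\<delta>. \<omega> x (\<alpha>s @ \<delta> # \<beta>s))"
      unfolding linear_map_on_def
    proof (intro ballI allI)
      fix \<delta> \<rho> and s t :: real
      assume d: "\<delta> \<in> gauge_fibre E x" "\<rho> \<in> gauge_fibre E x"
      let ?A = "map (extension x) \<alpha>s" and ?B = "map (extension x) \<beta>s"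
      let ?D = "extension x \<delta>" and ?R = "extension x \<rho>"
      have der: "set ?A \<subseteq> derivations E" "set ?B \<subseteq> derivations E" "?D \<in> derivations E" "?R \<in> derivations E"
        "length ?A + length ?B + 1 = n"
        using ab d ext extension by auto
      have const: "u *\<^sub>R G = func_scale (\<lambda>x. u) G" for u G by (simp add: func_scale_def fun_eq_iff)
      have "\<omega> x (\<alpha>s @ (s *\<^sub>R \<delta> + t *\<^sub>R \<rho>) # \<beta>s) = c (map (extension x) (\<alpha>s @ (s *\<^sub>R \<delta> + t *\<^sub>R \<rho>) # \<beta>s)) x"
        using ab gauge_combination[OF d] by (simp add: \<omega>_def tuples_def)
      also have "\<dots> = c (?A @ (s *\<^sub>R ?D + t *\<^sub>R ?R) # ?B) x"
        using der ab d extension subspace_derivations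
        by (intro eq) (auto simp: subspace_add subspace_scale at_pt_combination intro!: map_idI[symmetric])
      also have "\<dots> = s *\<^sub>R c (?A @ ?D # ?B) x + t *\<^sub>R c (?A @ ?R # ?B) x"
        using cochain_add[OF c der(1,2) _ _ der(5), of "s *\<^sub>R ?D" "t *\<^sub>R ?R"] der
          cochain_scale[OF c der(1-3) smooth_fun_const der(5), of s] cochain_scale[OF c der(1,2,4) smooth_fun_const der(5), of t]
          subspace_scale[OF subspace_derivations]
        unfolding const by simp
      also have "\<dots> = s *\<^sub>R \<omega> x (\<alpha>s @ \<delta> # \<beta>s) + t *\<^sub>R \<omega> x (\<alpha>s @ \<rho> # \<beta>s)"
        using ab d by (simp add: \<omega>_def tuples_def)
      finally show "\<omega> x (\<alpha>s @ (s *\<^sub>R \<delta> + t *\<^sub>R \<rho>) # \<beta>s) = s *\<^sub>R \<omega> x (\<alpha>s @ \<delta> # \<beta>s) + t *\<^sub>R \<omega> x (\<alpha>s @ \<rho> # \<beta>s)" .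
    qed
  qed
  then show "\<omega> \<in> gforms_on E n UNIV"
    using app cochain_value[OF c] by (auto simp: gforms_on_def tuples_def)
qed

lemma gforms_value: "\<mu> \<in> gforms_on E n W \<Longrightarrow> set Ds \<subseteq> derivations E \<Longrightarrow> length Ds = n \<Longrightarrow> apply_form \<mu> Ds \<in> sections_on E W"
  and gforms_alt: "\<mu> \<in> gforms_on E n W \<Longrightarrow> x \<in> W \<Longrightarrow> \<mu> x \<in> alt_maps n (gauge_fibre E x) (fibre E x)"
  by (auto simp: gforms_on_def tuples_def gform_fibre_def)

lemma gforms_cochain:
  assumes \<mu>: "\<mu> \<in> gforms_on E n UNIV"
  shows "cochain n (apply_form \<mu>)"
  unfolding cochain_def
proof (intro conjI ballI allI impI; (elim conjE)?)
  note alt = gforms_alt[OF \<mu> UNIV_I]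
  have sub: "set (map (\<lambda>D. at_pt D x) Ds) \<subseteq> gauge_fibre E x" if "set Ds \<subseteq> derivations E" for Ds x
    using that derivation_at by auto
  show "apply_form \<mu> Ds \<in> Gam E" if "Ds \<in> tuples n (derivations E)" for Ds
    using gforms_value[OF \<mu>] that by (simp add: tuples_def)
  {
    fix As D D' Bs
    assume 1: "set As \<subseteq> derivations E" "set Bs \<subseteq> derivations E" "D \<in> derivations E" "D' \<in> derivations E"
      "length As + length Bs + 1 = n"
    show "apply_form \<mu> (As @ (D + D') # Bs) = apply_form \<mu> (As @ D # Bs) + apply_form \<mu> (As @ D' # Bs)"
    proof
      fix x
      show "apply_form \<mu> (As @ (D + D') # Bs) x = (apply_form \<mu> (As @ D # Bs) + apply_form \<mu> (As @ D' # Bs)) x"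
        using linear_map_on_add[OF alt_maps_linear[OF alt sub[OF 1(1)] sub[OF 1(2)]] subspace_gauge
            derivation_at[OF 1(3)] derivation_at[OF 1(4)]] 1(5)
        by (simp add: apply_form_def at_pt_add)
    qed
  next
    fix As D f Bs
    assume 1: "set As \<subseteq> derivations E" "set Bs \<subseteq> derivations E" "D \<in> derivations E" "f \<in> C_inf E"
      "length As + length Bs + 1 = n"
    show "apply_form \<mu> (As @ func_scale f D # Bs) = (\<lambda>x. f x *\<^sub>R apply_form \<mu> (As @ D # Bs) x)"
    proof
      fix x
      show "apply_form \<mu> (As @ func_scale f D # Bs) x = f x *\<^sub>R apply_form \<mu> (As @ D # Bs) x"
        using linear_map_on_scale[OF alt_maps_linear[OF alt sub[OF 1(1)] sub[OF 1(2)]] subspace_gauge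
            derivation_at[OF 1(3)]] 1(5)
        by (simp add: apply_form_def at_pt_func_scale)
    qed
  next
    fix As D D' Bs
    assume 1: "set As \<subseteq> derivations E" "set Bs \<subseteq> derivations E" "D \<in> derivations E" "D' \<in> derivations E"
      "length As + length Bs + 2 = n"
    show "apply_form \<mu> (As @ D # D' # Bs) = - apply_form \<mu> (As @ D' # D # Bs)"
    proof
      fix x
      show "apply_form \<mu> (As @ D # D' # Bs) x = (- apply_form \<mu> (As @ D' # D # Bs)) x"
        using alt_maps_swap[OF alt subspace_gauge sub[OF 1(1)] sub[OF 1(2)] derivation_at[OF 1(3)] derivation_at[OF 1(4)]] 1(5)
        by (simp add: apply_form_def)
    qed
  }
qed

lemma gforms_eqI:
  assumes "\<omega> \<in> gforms_on E n UNIV" "\<omega>' \<in> gforms_on E n UNIV"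
    and "\<And>Ds. set Ds \<subseteq> derivations E \<Longrightarrow> length Ds = n \<Longrightarrow> apply_form \<omega> Ds = apply_form \<omega>' Ds"
  shows "\<omega> = \<omega>'"
proof (intro ext)
  fix x \<delta>s
  show "\<omega> x \<delta>s = \<omega>' x \<delta>s"
  proof (cases "\<delta>s \<in> tuples n (gauge_fibre E x)")
    case True
    then have d: "set \<delta>s \<subseteq> gauge_fibre E x" "length \<delta>s = n" by (auto simp: tuples_def)
    have "apply_form \<omega> (map (extension x) \<delta>s) = apply_form \<omega>' (map (extension x) \<delta>s)"
      using d extension by (intro assms(3)) auto
    then have "apply_form \<omega> (map (extension x) \<delta>s) x = apply_form \<omega>' (map (extension x) \<delta>s) x" by simp
    moreover have "map (\<lambda>D. at_pt D x) (map (extension x) \<delta>s) = \<delta>s"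
      using d extension by (auto intro!: map_idI)
    ultimately show ?thesis by (simp add: apply_form_def del: map_map)
  next
    case False
    then show ?thesis
      using alt_maps_outside[OF gforms_alt[OF assms(1)]] alt_maps_outside[OF gforms_alt[OF assms(2)]] by simp
  qed
qed

text \<open>Existence is the tensoriality of the Koszul formula; uniqueness holds because derivations at a
  point extend.\<close>

lemma dD:
  assumes \<mu>: "\<mu> \<in> gforms_on E n UNIV"
  shows "dD E n \<mu> \<in> gforms_on E (Suc n) UNIV"
    and "set Ds \<subseteq> derivations E \<Longrightarrow> length Ds = Suc n \<Longrightarrow> apply_form (dD E n \<mu>) Ds = cochain_d Ds (apply_form \<mu>)"
proof -
  note c = gforms_cochain[OF \<mu>]
  obtain \<omega> where \<omega>: "\<omega> \<in> gforms_on E (Suc n) UNIV"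
    "\<And>Ds. set Ds \<subseteq> derivations E \<Longrightarrow> length Ds = Suc n \<Longrightarrow> apply_form \<omega> Ds = cochain_d Ds (apply_form \<mu>)"
    using cochain_form[OF cochain_cochain_d[OF c]] by metis
  have "dD E n \<mu> = \<omega>"
    unfolding dD_def
  proof (rule the_equality)
    show "\<omega> \<in> gforms_on E (Suc n) UNIV \<and>
        (\<forall>Ds\<in>tuples (Suc n) (derivations E). apply_form \<omega> Ds = koszul n \<mu> Ds)"
      using \<omega> koszul_eq_cochain_d[OF c] by (simp add: tuples_def)
    fix \<omega>' assume "\<omega>' \<in> gforms_on E (Suc n) UNIV \<and>
        (\<forall>Ds\<in>tuples (Suc n) (derivations E). apply_form \<omega>' Ds = koszul n \<mu> Ds)"
    then show "\<omega>' = \<omega>"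
      using \<omega> koszul_eq_cochain_d[OF c] by (intro gforms_eqI) (auto simp: tuples_def)
  qed
  with \<omega> show "dD E n \<mu> \<in> gforms_on E (Suc n) UNIV"
    and "set Ds \<subseteq> derivations E \<Longrightarrow> length Ds = Suc n \<Longrightarrow> apply_form (dD E n \<mu>) Ds = cochain_d Ds (apply_form \<mu>)"
    by auto
qed

end

section \<open>Alternating maps of top degree\<close>

lemma alt_maps_zero_slot:
  assumes "\<mu> \<in> alt_maps n S W" "subspace S" "set xs \<subseteq> S" "set ys \<subseteq> S" "length xs + 1 + length ys = n"
  shows "\<mu> (xs @ 0 # ys) = 0"
  using linear_map_on_zero[OF alt_maps_linear[OF assms(1,3,4,5)] assms(2)] .

lemma alt_maps_insert:
  assumes \<mu>: "\<mu> \<in> alt_maps (Suc n) S W" and a: "a \<in> S"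
  shows "(\<lambda>xs. \<mu> (a # xs)) \<in> alt_maps n S W"
  unfolding alt_maps_def
proof (intro CollectI conjI allI ballI impI; (elim conjE)?)
  show "\<mu> (a # xs) = 0" if "xs \<notin> tuples n S" for xs
    using that by (intro alt_maps_outside[OF \<mu>]) (auto simp: tuples_def)
  show "\<mu> (a # xs) \<in> W" if "xs \<in> tuples n S" for xs
    using that a by (intro alt_maps_value[OF \<mu>]) (auto simp: tuples_def)
  show "\<mu> (a # xs) = 0" if "xs \<in> tuples n S" "\<not> distinct xs" for xs
    using that a by (intro alt_maps_distinct[OF \<mu>]) (auto simp: tuples_def)
  fix xs ys assume "set xs \<subseteq> S" "set ys \<subseteq> S" "length xs + 1 + length ys = n"
  then show "linear_map_on S (\<lambda>x. \<mu> (a # xs @ x # ys))"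
    using alt_maps_linear[OF \<mu>, of "a # xs" ys] a by simp
qed

lemma subspace_alt_maps:
  assumes W: "subspace W"
  shows "subspace (alt_maps n S W)"
proof (rule subspace_combinationI)
  show "0 \<in> alt_maps n S W"
    using subspace_0[OF W] by (auto simp: alt_maps_def linear_map_on_def)
  fix \<mu> \<nu> and a b :: real assume m: "\<mu> \<in> alt_maps n S W" "\<nu> \<in> alt_maps n S W"
  show "a *\<^sub>R \<mu> + b *\<^sub>R \<nu> \<in> alt_maps n S W"
    unfolding alt_maps_def
  proof (intro CollectI conjI allI ballI impI; (elim conjE)?)
    show "(a *\<^sub>R \<mu> + b *\<^sub>R \<nu>) xs = 0" if "xs \<notin> tuples n S" for xs
      using alt_maps_outside[OF m(1) that] alt_maps_outside[OF m(2) that] by simp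
    show "(a *\<^sub>R \<mu> + b *\<^sub>R \<nu>) xs \<in> W" if "xs \<in> tuples n S" for xs
      using that alt_maps_value[OF m(1)] alt_maps_value[OF m(2)] subspace_add[OF W] subspace_scale[OF W]
      by (simp add: tuples_def)
    show "(a *\<^sub>R \<mu> + b *\<^sub>R \<nu>) xs = 0" if "xs \<in> tuples n S" "\<not> distinct xs" for xs
      using that alt_maps_distinct[OF m(1)] alt_maps_distinct[OF m(2)] by (simp add: tuples_def)
    fix xs ys assume "set xs \<subseteq> S" "set ys \<subseteq> S" "length xs + 1 + length ys = n"
    then show "linear_map_on S (\<lambda>x. (a *\<^sub>R \<mu> + b *\<^sub>R \<nu>) (xs @ x # ys))"
      using alt_maps_linear[OF m(1)] alt_maps_linear[OF m(2)]
      by (simp add: linear_map_on_def algebra_simps)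
  qed
qed

context
  fixes \<mu> :: "'a::real_vector list \<Rightarrow> 'b::real_vector" and n S W
  assumes \<mu>: "\<mu> \<in> alt_maps n S W" and S: "subspace S"
begin

lemma alt_maps_move:
  "set ps \<subseteq> S \<Longrightarrow> set xs \<subseteq> S \<Longrightarrow> a \<in> S \<Longrightarrow> set ys \<subseteq> S \<Longrightarrow> length ps + length xs + 1 + length ys = n \<Longrightarrow>
    \<mu> (ps @ xs @ a # ys) = (-1) ^ length xs *\<^sub>R \<mu> (ps @ a # xs @ ys)"
proof (induction xs arbitrary: ps)
  case (Cons x xs)
  have "\<mu> ((ps @ [x]) @ xs @ a # ys) = (-1) ^ length xs *\<^sub>R \<mu> ((ps @ [x]) @ a # xs @ ys)"
    using Cons.prems by (intro Cons.IH) auto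
  moreover have "\<mu> (ps @ x # a # (xs @ ys)) = - \<mu> (ps @ a # x # (xs @ ys))"
    using Cons.prems by (intro alt_maps_swap[OF \<mu> S]) auto
  ultimately show ?case by simp
qed simp

text \<open>The arguments are replaced by elements of \<open>B\<close> from left to right, by linearity in one slot.\<close>

lemma alt_maps_zero_on_span:
  assumes B: "B \<subseteq> S" "S \<subseteq> span B" and zero: "\<And>xs. set xs \<subseteq> B \<Longrightarrow> length xs = n \<Longrightarrow> \<mu> xs = 0"
    and "set xs \<subseteq> S" "length xs = n"
  shows "\<mu> xs = 0"
proof -
  have "\<mu> (ys @ zs) = 0" if "set ys \<subseteq> B" "set zs \<subseteq> S" "length ys + length zs = n" for ys zs
    using that
  proof (induction zs arbitrary: ys)
    case (Cons z zs)
    have lin: "linear_map_on S (\<lambda>x. \<mu> (ys @ x # zs))"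
      using Cons.prems B by (intro alt_maps_linear[OF \<mu>]) auto
    let ?T = "{x \<in> S. \<mu> (ys @ x # zs) = 0}"
    have "subspace ?T"
      using linear_map_on_combination[OF lin S] linear_map_on_zero[OF lin S] S
      by (intro subspace_combinationI) (auto simp: subspace_0 subspace_add subspace_scale)
    moreover have "B \<subseteq> ?T"
    proof
      fix b assume b: "b \<in> B"
      have "\<mu> ((ys @ [b]) @ zs) = 0" using Cons.prems b by (intro Cons.IH) auto
      then show "b \<in> ?T" using b B by auto
    qed
    ultimately have "span B \<subseteq> ?T" by (rule span_minimal[rotated])
    then show ?case using B Cons.prems by auto
  qed (use zero in auto)
  from this[of "[]" xs] show ?thesis using assms by simp
qed

text \<open>The prefix \<open>ps\<close> collects the entries that are already in the order of \<open>ys\<close>.\<close>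

lemma alt_maps_zero_permuted:
  "set ps \<subseteq> S \<Longrightarrow> set xs \<subseteq> S \<Longrightarrow> length ps + length xs = n \<Longrightarrow> mset xs = mset ys \<Longrightarrow> \<mu> (ps @ xs) = 0 \<Longrightarrow> \<mu> (ps @ ys) = 0"
proof (induction ys arbitrary: ps xs)
  case (Cons y ys)
  have "y \<in> set xs" using Cons.prems(4) by (metis list.set_intros(1) set_mset_mset)
  then obtain us vs where xs: "xs = us @ y # vs" by (meson split_list)
  have "\<mu> (ps @ us @ y # vs) = (-1) ^ length us *\<^sub>R \<mu> (ps @ y # us @ vs)"
    using Cons.prems xs by (intro alt_maps_move) auto
  then have "\<mu> ((ps @ [y]) @ (us @ vs)) = 0" using Cons.prems(5) xs by simp
  moreover have "mset (us @ vs) = mset ys" using Cons.prems(4) xs by simp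
  ultimately have "\<mu> ((ps @ [y]) @ ys) = 0"
    using Cons.prems xs by (intro Cons.IH[of "ps @ [y]" "us @ vs"]) auto
  then show ?case by simp
qed simp

end

text \<open>A tuple of basis vectors of full length either has a repetition or is a permutation of the basis.\<close>

lemma alt_maps_zero_top:
  assumes \<mu>: "\<mu> \<in> alt_maps (length bs) S W" and S: "subspace S" and bs: "set bs \<subseteq> S" "S \<subseteq> span (set bs)"
    and "distinct bs" "\<mu> bs = 0"
  shows "\<mu> = 0"
proof
  fix xs
  have base: "\<mu> ys = 0" if ys: "set ys \<subseteq> set bs" "length ys = length bs" for ys
  proof (cases "distinct ys")
    case True
    then have "card (set ys) = card (set bs)" using assms(5) ys by (simp add: distinct_card)
    then have "set ys = set bs" using ys by (intro card_subset_eq) auto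
    then have "mset bs = mset ys" using True assms(5) by (metis set_eq_iff_mset_eq_distinct)
    then show ?thesis using alt_maps_zero_permuted[OF \<mu> S, of "[]" bs ys] assms by simp
  next
    case False
    then show ?thesis using ys bs by (intro alt_maps_distinct[OF \<mu>]) auto
  qed
  have "\<mu> xs = 0" if "xs \<in> tuples (length bs) S"
    by (rule alt_maps_zero_on_span[OF \<mu> S bs base]) (use that in \<open>simp_all add: tuples_def\<close>)
  then show "\<mu> xs = 0 xs" using alt_maps_outside[OF \<mu>] by (cases "xs \<in> tuples (length bs) S") auto
qed

text \<open>The form \<open>dF\<^sub>0 \<and> \<dots> \<and> dF\<^sub>m\<^sub>-\<^sub>1\<close>. As the \<open>F\<^sub>i\<close> are functions on the whole manifold, so is this
  form, and it restricts to a volume form where the \<open>F\<^sub>i\<close> are coordinates.\<close>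

definition det_form :: "('p::topological_space, 'z) mfd_scheme \<Rightarrow> (nat \<Rightarrow> 'p \<Rightarrow> real) \<Rightarrow> 'p \<Rightarrow> (('p \<Rightarrow> real) \<Rightarrow> real) list \<Rightarrow> real"
  where "det_form M F x Xs = (if Xs \<in> tuples (mdim M) (tangent_space M x)
    then \<Sum>p | p permutes {..<mdim M}. of_int (sign p) * (\<Prod>i<mdim M. (Xs ! i) (F (p i))) else 0)"

text \<open>Composition with the transposition of \<open>i\<close> and \<open>j\<close> changes the sign of every summand.\<close>

lemma det_sum_alternating:
  fixes X :: "nat \<Rightarrow> 'a \<Rightarrow> real"
  assumes "i < m" "j < m" "i \<noteq> j" "X i = X j"
  shows "(\<Sum>p | p permutes {..<m}. of_int (sign p) * (\<Prod>k<m. X k (F (p k)))) = 0"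
proof -
  let ?t = "Transposition.transpose i j" and ?f = "\<lambda>p. of_int (sign p) * (\<Prod>k<m. X k (F (p k)))"
  have t: "?t permutes {..<m}" using assms by (intro permutes_swap_id) auto
  have "?f (p \<circ> ?t) = - ?f p" if p: "p permutes {..<m}" for p
  proof -
    have "sign (p \<circ> ?t) = - sign p"
      using permutes_imp_permutation[OF finite_lessThan p] permutes_imp_permutation[OF finite_lessThan t] assms(3)
      by (simp add: sign_compose sign_swap_id)
    moreover have "(\<Prod>k<m. X k (F ((p \<circ> ?t) k))) = (\<Prod>k<m. X (?t k) (F ((p \<circ> ?t) (?t k))))"
      using prod.permute[OF t, of "\<lambda>k. X k (F ((p \<circ> ?t) k))"] by (simp add: o_def)
    moreover have "X (?t k) = X k" for k using assms(4) by (auto simp: Transposition.transpose_def)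
    ultimately show ?thesis by simp
  qed
  then have "(\<Sum>p | p permutes {..<m}. ?f (p \<circ> ?t)) = - (\<Sum>p | p permutes {..<m}. ?f p)"
    by (simp add: sum_negf)
  moreover have "(\<Sum>p | p permutes {..<m}. ?f p) = (\<Sum>p | p permutes {..<m}. ?f (p \<circ> ?t))"
    by (rule sum_permutations_compose_right[OF t])
  ultimately show ?thesis by simp
qed

context vector_bundle
begin

lemma det_form_alt:
  assumes "\<And>i. i < mdim E \<Longrightarrow> F i \<in> C_inf E"
  shows "det_form E F x \<in> alt_maps (mdim E) (tangent_space E x) UNIV"
  unfolding alt_maps_def
proof (intro CollectI conjI allI ballI impI UNIV_I; (elim conjE)?)
  let ?m = "mdim E" and ?T = "tangent_space E x"
  show "det_form E F x Xs = 0" if "Xs \<notin> tuples ?m ?T" for Xs using that by (simp add: det_form_def)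
  show "det_form E F x Xs = 0" if Xs: "Xs \<in> tuples ?m ?T" "\<not> distinct Xs" for Xs
  proof -
    have "length Xs = ?m" using Xs(1) by (simp add: tuples_def)
    then obtain i j where "i < ?m" "j < ?m" "i \<noteq> j" "Xs ! i = Xs ! j"
      using Xs(2) unfolding distinct_conv_nth by metis
    from det_sum_alternating[of i ?m j "\<lambda>i. Xs ! i", OF this] show ?thesis using Xs by (simp add: det_form_def)
  qed
  fix As Bs assume 1: "set As \<subseteq> ?T" "set Bs \<subseteq> ?T" "length As + 1 + length Bs = ?m"
  show "linear_map_on ?T (\<lambda>X. det_form E F x (As @ X # Bs))"
    unfolding linear_map_on_def
  proof (intro ballI allI)
    fix X Y and a b :: real assume XY: "X \<in> ?T" "Y \<in> ?T"
    let ?q = "length As"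
    let ?R = "\<lambda>p. \<Prod>i\<in>{..<?m} - {?q}. ((As @ undefined # Bs) ! i) (F (p i))"
    have split: "(\<Prod>i<?m. ((As @ Z # Bs) ! i) (F (p i))) = Z (F (p ?q)) * ?R p" for Z p
    proof -
      have "(\<Prod>i<?m. ((As @ Z # Bs) ! i) (F (p i))) = Z (F (p ?q)) * (\<Prod>i\<in>{..<?m} - {?q}. ((As @ Z # Bs) ! i) (F (p i)))"
        using 1(3) by (subst prod.remove[of _ ?q]) auto
      also have "(\<Prod>i\<in>{..<?m} - {?q}. ((As @ Z # Bs) ! i) (F (p i))) = ?R p"
        by (intro prod.cong refl) (auto simp: nth_append nth_Cons split: nat.split)
      finally show ?thesis .
    qed
    have in_tuples: "As @ Z # Bs \<in> tuples ?m ?T" if "Z \<in> ?T" for Z using that 1 by (auto simp: tuples_def)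
    have aXbY: "a *\<^sub>R X + b *\<^sub>R Y \<in> ?T"
      using XY by (intro subspace_add[OF subspace_tangent] subspace_scale[OF subspace_tangent])
    show "det_form E F x (As @ (a *\<^sub>R X + b *\<^sub>R Y) # Bs) = a *\<^sub>R det_form E F x (As @ X # Bs) + b *\<^sub>R det_form E F x (As @ Y # Bs)"
      unfolding det_form_def split if_P[OF in_tuples[OF aXbY]] if_P[OF in_tuples[OF XY(1)]] if_P[OF in_tuples[OF XY(2)]]
      by (simp add: sum_distrib_left sum.distrib[symmetric] algebra_simps)
  qed
qed

lemma det_form_smooth:
  assumes F: "\<And>i. i < mdim E \<Longrightarrow> F i \<in> C_inf E"
  shows "det_form E F \<in> diff_forms E (mdim E)"
  unfolding diff_forms_def
proof (intro CollectI conjI allI ballI det_form_alt F)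
  let ?m = "mdim E"
  fix Xs assume Xs: "Xs \<in> tuples ?m (vector_fields E)"
  then have "map (\<lambda>X. at_pt X x) Xs \<in> tuples ?m (tangent_space E x)" for x
    using vector_field_at by (auto simp: tuples_def)
  then have "det_form E F x (map (\<lambda>X. at_pt X x) Xs) =
      (\<Sum>p | p permutes {..<?m}. of_int (sign p) * (\<Prod>i<?m. (Xs ! i) (F (p i)) x))" for x
    using Xs by (simp add: det_form_def at_pt_def tuples_def)
  moreover have "(\<lambda>x. \<Sum>p | p permutes {..<?m}. of_int (sign p) * (\<Prod>i<?m. (Xs ! i) (F (p i)) x)) \<in> C_inf E"
  proof (intro smooth_fun_sum smooth_fun_mult[OF smooth_fun_const] smooth_fun_prod finite_lessThan)
    fix p i assume p: "p \<in> {p. p permutes {..<?m}}" and i: "i \<in> {..<?m}"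
    have "p i < ?m" using permutes_in_image[of p "{..<?m}" i] p i by simp
    moreover have "Xs ! i \<in> vector_fields E" using Xs i nth_mem[of i Xs] by (auto simp: tuples_def)
    ultimately show "(Xs ! i) (F (p i)) \<in> C_inf E" using vector_field_smooth F by blast
  qed
  ultimately show "(\<lambda>x. det_form E F x (map (\<lambda>X. at_pt X x) Xs)) \<in> C_inf E" by simp
qed

end

context gauge_frame
begin

definition tangent_basis :: "'p \<Rightarrow> (('p \<Rightarrow> real) \<Rightarrow> real) list"
  where "tangent_basis y = map (\<lambda>i. at_pt (W i) y) [0..<mdim E]"

definition horizontal_basis :: "'p \<Rightarrow> (('p \<Rightarrow> 'v) \<Rightarrow> 'v) list"
  where "horizontal_basis y = map (\<lambda>i. at_pt (H i) y) [0..<mdim E]"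

lemma tangent_basis_length: "length (tangent_basis y) = mdim E"
  and horizontal_basis_length: "length (horizontal_basis y) = mdim E"
  by (simp_all add: tangent_basis_def horizontal_basis_def)

lemma W_vector_field: "i < mdim E \<Longrightarrow> W i \<in> vector_fields E"
  using H_symbol by (simp add: symbol_of_def)

lemma tangent_basis_in: "set (tangent_basis y) \<subseteq> tangent_space E y"
  using vector_field_at[OF W_vector_field] by (auto simp: tangent_basis_def)

lemma horizontal_basis_in: "set (horizontal_basis y) \<subseteq> gauge_fibre E y"
  using derivation_at[OF H_derivation] by (auto simp: horizontal_basis_def)

lemma symbol_horizontal_basis: "map (symbol_at E y) (horizontal_basis y) = tangent_basis y"
  using symbol_at_derivation[OF H_symbol] by (auto simp: horizontal_basis_def tangent_basis_def)

context
  fixes y assumes y: "y \<in> N"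
begin

lemma tangent_basis_distinct: "distinct (tangent_basis y)"
proof -
  have "i = j" if "i < mdim E" "j < mdim E" "at_pt (W i) y = at_pt (W j) y" for i j
  proof -
    have "at_pt (W i) y (F i) = at_pt (W j) y (F i)" using that(3) by simp
    then show ?thesis using W_F[OF y that(1,1)] W_F[OF y that(2,1)] by (auto simp: at_pt_def split: if_splits)
  qed
  then show ?thesis by (auto simp: tangent_basis_def distinct_map inj_on_def)
qed

lemma tangent_basis_span: "tangent_space E y \<subseteq> span (set (tangent_basis y))"
proof
  fix X assume X: "X \<in> tangent_space E y"
  have expansion: "X = (\<Sum>i<mdim E. X (F i) *\<^sub>R at_pt (W i) y)"
  proof
    fix f
    show "X f = (\<Sum>i<mdim E. X (F i) *\<^sub>R at_pt (W i) y) f"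
    proof (cases "f \<in> C_inf E")
      case True
      then show ?thesis using tangent_expansion[OF y X True] by (simp add: sum_fun_apply at_pt_def)
    next
      case False
      then show ?thesis
        using tangent_outside[OF X] tangent_outside[OF vector_field_at[OF W_vector_field]] by (simp add: sum_fun_apply)
    qed
  qed
  have "at_pt (W i) y \<in> set (tangent_basis y)" if "i < mdim E" for i
    using that by (auto simp: tangent_basis_def)
  then have "(\<Sum>i<mdim E. X (F i) *\<^sub>R at_pt (W i) y) \<in> span (set (tangent_basis y))"
    by (intro span_sum span_scale span_base) auto
  then show "X \<in> span (set (tangent_basis y))" by (subst expansion)
qed

lemma top_form_eqI:
  assumes "\<eta> \<in> alt_maps (mdim E) (tangent_space E y) U" "\<theta> \<in> alt_maps (mdim E) (tangent_space E y) U"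
    "subspace U" "\<eta> (tangent_basis y) = \<theta> (tangent_basis y)"
  shows "\<eta> = \<theta>"
proof -
  have "\<eta> - \<theta> = 0"
    using assms subspace_diff[OF subspace_alt_maps[OF assms(3)] assms(1,2)]
    by (intro alt_maps_zero_top[OF _ subspace_tangent tangent_basis_in tangent_basis_span tangent_basis_distinct])
      (auto simp: tangent_basis_length)
  then show ?thesis by simp
qed

lemma det_form_basis: "det_form E F y (tangent_basis y) = 1"
proof -
  let ?m = "mdim E"
  have prod: "(\<Prod>i<?m. (tangent_basis y ! i) (F (p i))) = (if p = id then 1 else 0)" if p: "p permutes {..<?m}" for p
  proof (cases "p = id")
    case True
    then show ?thesis using W_F[OF y] by (simp add: tangent_basis_def at_pt_def)
  next
    case False
    then obtain i where i: "p i \<noteq> i" by (auto simp: fun_eq_iff)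
    then have im: "i < ?m" "p i < ?m"
      using p permutes_not_in[OF p, of i] permutes_in_image[OF p, of i] by auto
    then have "(tangent_basis y ! i) (F (p i)) = 0"
      using W_F[OF y im] i by (simp add: tangent_basis_def at_pt_def)
    then show ?thesis using False im by (auto intro!: prod_zero)
  qed
  have "tangent_basis y \<in> tuples ?m (tangent_space E y)"
    using tangent_basis_in by (simp add: tuples_def tangent_basis_length)
  then have "det_form E F y (tangent_basis y) = (\<Sum>p | p permutes {..<?m}. of_int (sign p) * (if p = id then 1 else 0))"
    using prod by (simp add: det_form_def)
  also have "\<dots> = (\<Sum>p | p permutes {..<?m}. if p = id then 1 else 0)"
    by (intro sum.cong) (auto simp: sign_id)
  finally show ?thesis by (simp add: sum.delta finite_permutations permutes_id)
qed

text \<open>Modulo the endomorphisms only \<open>m = dim M\<close> directions are left in the gauge algebroid.\<close>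

lemma zero_if_killed_by_endos:
  assumes \<mu>: "\<mu> \<in> alt_maps n (gauge_fibre E y) U" and n: "n > mdim E"
    and endo: "\<And>\<Phi> \<delta>s. \<Phi> \<in> endos E y \<Longrightarrow> set \<delta>s \<subseteq> gauge_fibre E y \<Longrightarrow> Suc (length \<delta>s) = n \<Longrightarrow> \<mu> (endo_incl E y \<Phi> # \<delta>s) = 0"
  shows "\<mu> = 0"
proof
  fix \<delta>s
  define V where "V = (\<lambda>(j, l). at_pt (matrix_unit e k j l) y) ` ({..<r} \<times> {..<r})"
  let ?B = "set (horizontal_basis y) \<union> V"
  have V: "\<exists>\<Phi>\<in>endos E y. v = endo_incl E y \<Phi>" if v: "v \<in> V" for v
  proof -
    obtain j l where jl: "j < r" "l < r" "v = at_pt (matrix_unit e k j l) y" using v by (auto simp: V_def)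
    moreover have "matrix_unit e k j l \<in> vertical"
      using jl matrix_unit_derivation matrix_unit_symbol by (simp add: vertical_def)
    ultimately show ?thesis using vertical_endo by metis
  qed
  have B: "?B \<subseteq> gauge_fibre E y"
    using horizontal_basis_in V endo_in_gauge by blast
  have span: "gauge_fibre E y \<subseteq> span ?B"
  proof
    fix \<delta> assume \<delta>: "\<delta> \<in> gauge_fibre E y"
    have "at_pt (H i) y \<in> ?B" if "i < mdim E" for i using that by (auto simp: horizontal_basis_def)
    moreover have "at_pt (matrix_unit e k j l) y \<in> ?B" if "j < r" "l < r" for j l using that by (auto simp: V_def)
    ultimately have "(\<Sum>i<mdim E. symbol_at E y \<delta> (F i) *\<^sub>R at_pt (H i) y) +
        (\<Sum>j<r. \<Sum>l<r. k l y (\<delta> (e j)) *\<^sub>R at_pt (matrix_unit e k j l) y) \<in> span ?B"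
      by (intro span_add span_sum span_scale span_base) auto
    then show "\<delta> \<in> span ?B" by (subst gauge_expansion[OF y \<delta>])
  qed
  have base: "\<mu> xs = 0" if xs: "set xs \<subseteq> ?B" "length xs = n" for xs
  proof (cases "set xs \<subseteq> set (horizontal_basis y)")
    case True
    have "card (set xs) \<le> card (set (horizontal_basis y))" using True by (intro card_mono) auto
    also have "\<dots> < n" using n card_length[of "horizontal_basis y"] by (simp add: horizontal_basis_length)
    finally have "\<not> distinct xs" using xs(2) distinct_card by fastforce
    then show ?thesis using xs B by (intro alt_maps_distinct[OF \<mu>]) auto
  next
    case False
    then obtain v where v: "v \<in> set xs" "v \<in> V" using xs by auto
    then obtain us vs where uv: "xs = us @ v # vs" by (meson split_list)
    obtain \<Phi> where \<Phi>: "\<Phi> \<in> endos E y" "v = endo_incl E y \<Phi>" using V v by blast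
    have "\<mu> ([] @ us @ v # vs) = (-1) ^ length us *\<^sub>R \<mu> ([] @ v # us @ vs)"
      using xs uv B by (intro alt_maps_move[OF \<mu> subspace_gauge]) auto
    moreover have "\<mu> (v # us @ vs) = 0"
      unfolding \<Phi>(2) using xs uv B by (intro endo \<Phi>(1)) auto
    ultimately show ?thesis using uv by simp
  qed
  have "\<mu> \<delta>s = 0" if "\<delta>s \<in> tuples n (gauge_fibre E y)"
    by (rule alt_maps_zero_on_span[OF \<mu> subspace_gauge B span base]) (use that in \<open>simp_all add: tuples_def\<close>)
  then show "\<mu> \<delta>s = 0 \<delta>s" using alt_maps_outside[OF \<mu>] by (cases "\<delta>s \<in> tuples n (gauge_fibre E y)") auto
qed

end

end

section \<open>The bundle of jets in top degree\<close>

context nonzero_vector_bundle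
begin

text \<open>\<open>\<eta>\<close> is the form \<open>\<lambda>\<^sub>\<mu>\<close> at the point \<open>x\<close>.\<close>

definition symbol_part :: "'p \<Rightarrow> ('p, 'v) gform \<Rightarrow> ((('p \<Rightarrow> real) \<Rightarrow> real) list \<Rightarrow> 'v) \<Rightarrow> bool"
  where "symbol_part x \<mu> \<eta> \<longleftrightarrow> \<eta> \<in> alt_maps (mdim E) (tangent_space E x) (fibre E x) \<and>
    (\<forall>\<Phi>\<in>endos E x. \<forall>\<delta>s\<in>tuples (mdim E) (gauge_fibre E x).
      \<mu> (endo_incl E x \<Phi> # \<delta>s) = \<Phi> (\<eta> (map (symbol_at E x) \<delta>s)))"

lemma jet_fibre_iff:
  "\<mu> \<in> jet_fibre E (Suc (mdim E)) x \<longleftrightarrow>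
    \<mu> \<in> alt_maps (Suc (mdim E)) (gauge_fibre E x) (fibre E x) \<and> (\<exists>\<eta>. symbol_part x \<mu> \<eta>)"
  unfolding jet_fibre_def symbol_part_def gform_fibre_def insert_at_def symbol_pullback_def tuples_def
  by auto

lemma symbol_partD:
  assumes "symbol_part x \<mu> \<eta>" "\<Phi> \<in> endos E x" "set \<delta>s \<subseteq> gauge_fibre E x" "length \<delta>s = mdim E"
  shows "\<mu> (endo_incl E x \<Phi> # \<delta>s) = \<Phi> (\<eta> (map (symbol_at E x) \<delta>s))"
  using assms by (auto simp: symbol_part_def tuples_def)

lemma symbol_part_alt: "symbol_part x \<mu> \<eta> \<Longrightarrow> \<eta> \<in> alt_maps (mdim E) (tangent_space E x) (fibre E x)"
  by (simp add: symbol_part_def)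

lemma endo_linear: "\<Phi> \<in> endos E x \<Longrightarrow> linear_map_on (fibre E x) \<Phi>"
  and endo_in_fibre: "\<Phi> \<in> endos E x \<Longrightarrow> v \<in> fibre E x \<Longrightarrow> \<Phi> v \<in> fibre E x"
  by (auto simp: endos_def)

lemma endo_zero: "\<Phi> \<in> endos E x \<Longrightarrow> \<Phi> 0 = 0"
  by (rule linear_map_on_zero[OF endo_linear fibre_subspace])

lemma symbols_tangent: "set \<delta>s \<subseteq> gauge_fibre E x \<Longrightarrow> set (map (symbol_at E x) \<delta>s) \<subseteq> tangent_space E x"
  using symbol_at_tangent by auto

lemma subspace_jet: "subspace (jet_fibre E (Suc (mdim E)) x)"
proof (rule subspace_combinationI)
  let ?A = "alt_maps (Suc (mdim E)) (gauge_fibre E x) (fibre E x)"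
  let ?B = "alt_maps (mdim E) (tangent_space E x) (fibre E x)"
  have "symbol_part x 0 0"
    using subspace_0[OF subspace_alt_maps[OF fibre_subspace]] endo_zero by (simp add: symbol_part_def)
  then show "0 \<in> jet_fibre E (Suc (mdim E)) x"
    unfolding jet_fibre_iff using subspace_0[OF subspace_alt_maps[OF fibre_subspace]] by blast
  fix \<mu> \<nu> and a b :: real
  assume m: "\<mu> \<in> jet_fibre E (Suc (mdim E)) x" "\<nu> \<in> jet_fibre E (Suc (mdim E)) x"
  obtain \<eta> \<theta> where p: "symbol_part x \<mu> \<eta>" "symbol_part x \<nu> \<theta>" using m by (auto simp: jet_fibre_iff)
  have "symbol_part x (a *\<^sub>R \<mu> + b *\<^sub>R \<nu>) (a *\<^sub>R \<eta> + b *\<^sub>R \<theta>)"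
    unfolding symbol_part_def
  proof (intro conjI ballI)
    show "a *\<^sub>R \<eta> + b *\<^sub>R \<theta> \<in> ?B"
      using symbol_part_alt[OF p(1)] symbol_part_alt[OF p(2)]
      by (intro subspace_add[OF subspace_alt_maps[OF fibre_subspace]] subspace_scale[OF subspace_alt_maps[OF fibre_subspace]])
    fix \<Phi> \<delta>s assume \<Phi>: "\<Phi> \<in> endos E x" and "\<delta>s \<in> tuples (mdim E) (gauge_fibre E x)"
    then have ds: "set \<delta>s \<subseteq> gauge_fibre E x" "length \<delta>s = mdim E" by (auto simp: tuples_def)
    let ?Xs = "map (symbol_at E x) \<delta>s"
    have "\<eta> ?Xs \<in> fibre E x" "\<theta> ?Xs \<in> fibre E x"
      using alt_maps_value[OF symbol_part_alt symbols_tangent] p ds by auto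
    then show "(a *\<^sub>R \<mu> + b *\<^sub>R \<nu>) (endo_incl E x \<Phi> # \<delta>s) = \<Phi> ((a *\<^sub>R \<eta> + b *\<^sub>R \<theta>) ?Xs)"
      using symbol_partD[OF p(1) \<Phi> ds] symbol_partD[OF p(2) \<Phi> ds]
        linear_map_on_combination[OF endo_linear[OF \<Phi>] fibre_subspace] by simp
  qed
  moreover have "a *\<^sub>R \<mu> + b *\<^sub>R \<nu> \<in> ?A"
    using m unfolding jet_fibre_iff
    by (intro subspace_add[OF subspace_alt_maps[OF fibre_subspace]] subspace_scale[OF subspace_alt_maps[OF fibre_subspace]]) auto
  ultimately show "a *\<^sub>R \<mu> + b *\<^sub>R \<nu> \<in> jet_fibre E (Suc (mdim E)) x"
    unfolding jet_fibre_iff by blast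
qed

lemma id_endo: "(\<lambda>v. v) \<in> endos E x"
  by (simp add: endos_def linear_map_on_def)

text \<open>The identity of \<open>E\<close> as a derivation; contraction with it recovers \<open>\<sigma>\<^sup>*\<lambda>\<^sub>\<mu>\<close> from \<open>\<mu>\<close>.\<close>

definition ident :: "('p \<Rightarrow> 'v) \<Rightarrow> 'p \<Rightarrow> 'v"
  where "ident u = (if u \<in> Gam E then u else 0)"

lemma at_pt_ident: "at_pt ident x = endo_incl E x (\<lambda>v. v)"
  by (simp add: at_pt_def ident_def endo_incl_def fun_eq_iff)

lemma ident_vertical: "ident \<in> vertical"
proof -
  have sym: "symbol_of ident (\<lambda>g x. 0)"
    unfolding symbol_of_def
  proof (intro conjI ballI vector_field_zero)
    fix f u assume "f \<in> C_inf E" "u \<in> Gam E"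
    then show "ident (\<lambda>y. f y *\<^sub>R u y) = (\<lambda>y. 0 *\<^sub>R u y + f y *\<^sub>R ident u y)"
      using sections_on_mult[of f UNIV u] by (simp add: ident_def)
  qed
  moreover have "linear_map_on (Gam E) ident"
    using subspace_add[OF subspace_Gam] subspace_scale[OF subspace_Gam]
    by (simp add: linear_map_on_def ident_def)
  moreover have "\<exists>X. symbol_of ident X" using sym by blast
  ultimately show ?thesis
    by (simp add: vertical_def derivations_iff ident_def)
qed

lemma lie_correction_vertical:
  assumes P: "P \<in> vertical"
  shows "set Ds \<subseteq> derivations E \<Longrightarrow> (\<And>As Q Bs. Q \<in> vertical \<Longrightarrow> set As \<subseteq> derivations E \<Longrightarrow> set Bs \<subseteq> derivations E \<Longrightarrow>
    length As + 1 + length Bs = length Ds \<Longrightarrow> c (As @ Q # Bs) = 0) \<Longrightarrow> lie_correction P Ds c = 0"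
proof (induction Ds arbitrary: c)
  case (Cons D Ds)
  have "lie_correction P Ds (\<lambda>Es. c (D # Es)) = 0"
  proof (rule Cons.IH)
    fix As Q Bs
    assume "Q \<in> vertical" "set As \<subseteq> derivations E" "set Bs \<subseteq> derivations E" "length As + 1 + length Bs = length Ds"
    then have "c ((D # As) @ Q # Bs) = 0" using Cons.prems(1) by (intro Cons.prems(2)) auto
    then show "c (D # As @ Q # Bs) = 0" by simp
  qed (use Cons.prems(1) in auto)
  moreover have "c ([] @ commutator P D # Ds) = 0"
    using Cons.prems(1) commutator_vertical[OF P] by (intro Cons.prems(2)) auto
  ultimately show ?case by simp
qed simp

lemma cochain_d_zero:
  assumes "set Ds \<subseteq> derivations E" "\<And>Es. set Es \<subseteq> derivations E \<Longrightarrow> length Es + 1 = length Ds \<Longrightarrow> c Es = 0"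
  shows "cochain_d Ds c = 0"
proof (rule self_negative, rule cochain_d_minus[OF assms(1)])
  fix Es assume "set Es \<subseteq> derivations E" "length Es + 1 = length Ds"
  from assms(2)[OF this] show "c Es = - c Es" "c Es \<in> Gam E" using subspace_0[OF subspace_Gam] by simp_all
qed

lemma symbol_of_vector_field: "symbol_of D X \<Longrightarrow> X \<in> vector_fields E"
  by (simp add: symbol_of_def)

definition pulled_back :: "'p \<Rightarrow> ('p, 'v) gform \<Rightarrow> ((('p \<Rightarrow> real) \<Rightarrow> real) list \<Rightarrow> 'v) \<Rightarrow> bool"
  where "pulled_back x \<mu> \<eta> \<longleftrightarrow> \<eta> \<in> alt_maps (mdim E) (tangent_space E x) (fibre E x) \<and>
    (\<forall>\<delta>s\<in>tuples (mdim E) (gauge_fibre E x). \<mu> \<delta>s = \<eta> (map (symbol_at E x) \<delta>s))"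

context
  fixes \<mu> assumes \<mu>: "\<mu> \<in> gforms_on E (mdim E) UNIV" and h: "\<And>x. \<exists>\<eta>. pulled_back x (\<mu> x) \<eta>"
begin

lemma pulled_back_vertical:
  assumes "Q \<in> vertical" "set As \<subseteq> derivations E" "set Bs \<subseteq> derivations E" "length As + 1 + length Bs = mdim E"
  shows "apply_form \<mu> (As @ Q # Bs) = 0"
proof
  fix x
  obtain \<eta> where \<eta>: "\<eta> \<in> alt_maps (mdim E) (tangent_space E x) (fibre E x)"
    "\<And>\<delta>s. \<delta>s \<in> tuples (mdim E) (gauge_fibre E x) \<Longrightarrow> \<mu> x \<delta>s = \<eta> (map (symbol_at E x) \<delta>s)"
    using h[of x] unfolding pulled_back_def by blast
  let ?s = "map (\<lambda>D. symbol_at E x (at_pt D x))"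
  have "apply_form \<mu> (As @ Q # Bs) x = \<eta> (?s As @ 0 # ?s Bs)"
    unfolding apply_form_def
    using assms derivation_at vertical_derivation symbol_at_vertical[OF assms(1), of x]
    by (subst \<eta>(2)) (auto simp: tuples_def o_def)
  also have "\<dots> = 0"
    using assms derivation_at symbol_at_tangent by (intro alt_maps_zero_slot[OF \<eta>(1) subspace_tangent]) auto
  finally show "apply_form \<mu> (As @ Q # Bs) x = 0 x" by simp
qed

text \<open>For a horizontal form \<open>\<mu> = \<sigma>\<^sup>*\<eta>\<close> all terms of Cartan's formula for \<open>\<iota>\<^sub>\<Phi> d\<mu>\<close> vanish except
  \<open>\<Phi> \<circ> \<mu>\<close>, because commutators with endomorphisms have symbol \<open>0\<close>.\<close>

lemma dD_pulled_back:
  assumes \<Phi>: "\<Phi> \<in> endos E x" and \<delta>s: "set \<delta>s \<subseteq> gauge_fibre E x" "length \<delta>s = mdim E"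
  shows "dD E (mdim E) \<mu> x (endo_incl E x \<Phi> # \<delta>s) = \<Phi> (\<mu> x \<delta>s)"
proof -
  let ?c = "apply_form \<mu>"
  obtain P where P: "P \<in> vertical" "at_pt P x = endo_incl E x \<Phi>" using extend_endo[OF \<Phi>] by blast
  define Ds where "Ds = map (extension x) \<delta>s"
  have Ds: "set Ds \<subseteq> derivations E" "length Ds = mdim E" "map (\<lambda>D. at_pt D x) Ds = \<delta>s"
    using \<delta>s extension by (auto simp: Ds_def intro!: map_idI)
  have "dD E (mdim E) \<mu> x (endo_incl E x \<Phi> # \<delta>s) = apply_form (dD E (mdim E) \<mu>) (P # Ds) x"
    using P Ds by (simp add: apply_form_def)
  also have "\<dots> = cochain_d (P # Ds) ?c x"
    using dD(2)[OF \<mu>, of "P # Ds"] Ds vertical_derivation[OF P(1)] by simp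
  also have "lie_correction P Ds ?c = 0"
    using Ds pulled_back_vertical by (intro lie_correction_vertical[OF P(1)]) auto
  then have "cochain_d (P # Ds) ?c = P (?c Ds) - cochain_d Ds (\<lambda>Es. ?c (P # Es))"
    by (simp add: cochain_lie_def)
  also have "cochain_d Ds (\<lambda>Es. ?c (P # Es)) = 0"
    using Ds pulled_back_vertical[OF P(1), of "[]"] by (intro cochain_d_zero) auto
  also have "(P (?c Ds) - 0) x = at_pt P x (?c Ds)" by (simp add: at_pt_def)
  also have "\<dots> = \<Phi> (?c Ds x)"
    using gforms_value[OF \<mu> Ds(1,2)] by (simp add: P(2) endo_incl_def)
  also have "?c Ds x = \<mu> x \<delta>s" by (simp add: apply_form_def Ds)
  finally show ?thesis .
qed

lemma dD_pulled_back_symbol_part: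
  assumes "pulled_back x (\<mu> x) \<eta>"
  shows "symbol_part x (dD E (mdim E) \<mu> x) \<eta>"
  using assms dD_pulled_back unfolding pulled_back_def symbol_part_def by (auto simp: tuples_def)

lemma dD_pulled_back_jet: "dD E (mdim E) \<mu> \<in> jet_sections_on E (Suc (mdim E)) UNIV"
proof -
  have "dD E (mdim E) \<mu> x \<in> jet_fibre E (Suc (mdim E)) x" for x
    unfolding jet_fibre_iff
    using gforms_alt[OF dD(1)[OF \<mu>], of x] h[of x] dD_pulled_back_symbol_part by blast
  then show ?thesis using dD(1)[OF \<mu>] by (simp add: jet_sections_on_def)
qed

end

lemma symbol_pullback_alt:
  assumes \<eta>: "\<eta> \<in> alt_maps n (tangent_space E x) W"
  shows "symbol_pullback E x \<eta> \<in> alt_maps n (gauge_fibre E x) W"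
  unfolding alt_maps_def
proof (intro CollectI conjI allI ballI impI; (elim conjE)?)
  let ?s = "map (symbol_at E x)"
  show "symbol_pullback E x \<eta> \<delta>s = 0" if "\<delta>s \<notin> tuples n (gauge_fibre E x)" for \<delta>s
    using that alt_maps_outside[OF \<eta>] by (auto simp: symbol_pullback_def tuples_def)
  show "symbol_pullback E x \<eta> \<delta>s \<in> W" if "\<delta>s \<in> tuples n (gauge_fibre E x)" for \<delta>s
    using that alt_maps_value[OF \<eta> symbols_tangent] by (auto simp: symbol_pullback_def tuples_def)
  show "symbol_pullback E x \<eta> \<delta>s = 0" if d: "\<delta>s \<in> tuples n (gauge_fibre E x)" "\<not> distinct \<delta>s" for \<delta>s
  proof -
    have "\<not> distinct (?s \<delta>s)" using d(2) distinct_map by blast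
    then show ?thesis
      using d alt_maps_distinct[OF \<eta> symbols_tangent] by (auto simp: symbol_pullback_def tuples_def)
  qed
  fix \<alpha>s \<beta>s assume 1: "set \<alpha>s \<subseteq> gauge_fibre E x" "set \<beta>s \<subseteq> gauge_fibre E x" "length \<alpha>s + 1 + length \<beta>s = n"
  show "linear_map_on (gauge_fibre E x) (\<lambda>\<delta>. symbol_pullback E x \<eta> (\<alpha>s @ \<delta> # \<beta>s))"
    unfolding linear_map_on_def
  proof (intro ballI allI)
    fix \<delta> \<rho> and a b :: real assume 2: "\<delta> \<in> gauge_fibre E x" "\<rho> \<in> gauge_fibre E x"
    have "linear_map_on (tangent_space E x) (\<lambda>X. \<eta> (?s \<alpha>s @ X # ?s \<beta>s))"
      using 1 symbols_tangent by (intro alt_maps_linear[OF \<eta>]) auto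
    from linear_map_on_combination[OF this subspace_tangent symbol_at_tangent[OF 2(1)] symbol_at_tangent[OF 2(2)], of a b]
    show "symbol_pullback E x \<eta> (\<alpha>s @ (a *\<^sub>R \<delta> + b *\<^sub>R \<rho>) # \<beta>s) =
        a *\<^sub>R symbol_pullback E x \<eta> (\<alpha>s @ \<delta> # \<beta>s) + b *\<^sub>R symbol_pullback E x \<eta> (\<alpha>s @ \<rho> # \<beta>s)"
      using 1 2 gauge_combination[OF 2] linear_map_on_combination[OF symbol_at_linear subspace_gauge 2]
      by (simp add: symbol_pullback_def)
  qed
qed

lemma alt_maps_tensor:
  assumes \<Omega>: "\<Omega> \<in> alt_maps n S (UNIV :: real set)" and W: "subspace W" "v \<in> W"
  shows "(\<lambda>xs. \<Omega> xs *\<^sub>R v) \<in> alt_maps n S W"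
  unfolding alt_maps_def
proof (intro CollectI conjI allI ballI impI; (elim conjE)?)
  show "\<Omega> xs *\<^sub>R v = 0" if "xs \<notin> tuples n S" for xs using alt_maps_outside[OF \<Omega> that] by simp
  show "\<Omega> xs *\<^sub>R v \<in> W" for xs using W by (simp add: subspace_scale)
  show "\<Omega> xs *\<^sub>R v = 0" if "xs \<in> tuples n S" "\<not> distinct xs" for xs
    using alt_maps_distinct[OF \<Omega>] that by (simp add: tuples_def)
  fix xs ys assume "set xs \<subseteq> S" "set ys \<subseteq> S" "length xs + 1 + length ys = n"
  from alt_maps_linear[OF \<Omega> this] show "linear_map_on S (\<lambda>x. \<Omega> (xs @ x # ys) *\<^sub>R v)"
    by (simp add: linear_map_on_def algebra_simps)
qed

lemma diff_form_alt: "\<Omega> \<in> diff_forms E n \<Longrightarrow> \<Omega> x \<in> alt_maps n (tangent_space E x) UNIV"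
  by (simp add: diff_forms_def)

context
  fixes \<Omega> u assumes \<Omega>: "\<Omega> \<in> diff_forms E (mdim E)" and u: "u \<in> Gam E"
begin

lemma tensor_pulled_back:
  "pulled_back x (symbol_pullback E x (\<lambda>Xs. \<Omega> x Xs *\<^sub>R u x)) (\<lambda>Xs. \<Omega> x Xs *\<^sub>R u x)"
  using alt_maps_tensor[OF diff_form_alt[OF \<Omega>] fibre_subspace section_in_fibre[OF u UNIV_I]]
  by (auto simp: pulled_back_def symbol_pullback_def tuples_def)

lemma tensor_gform: "(\<lambda>x. symbol_pullback E x (\<lambda>Xs. \<Omega> x Xs *\<^sub>R u x)) \<in> gforms_on E (mdim E) UNIV"
proof -
  let ?\<mu> = "\<lambda>x. symbol_pullback E x (\<lambda>Xs. \<Omega> x Xs *\<^sub>R u x)"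
  have "?\<mu> x \<in> gform_fibre E (mdim E) x" for x
    unfolding gform_fibre_def
    by (intro symbol_pullback_alt alt_maps_tensor diff_form_alt[OF \<Omega>] fibre_subspace section_in_fibre[OF u UNIV_I])
  moreover have "apply_form ?\<mu> Ds \<in> Gam E" if Ds: "Ds \<in> tuples (mdim E) (derivations E)" for Ds
  proof -
    define Xs where "Xs = map (\<lambda>D. SOME X. symbol_of D X) Ds"
    have sym: "symbol_of D (SOME X. symbol_of D X)" if "D \<in> set Ds" for D
    proof -
      have "D \<in> derivations E" using that Ds by (auto simp: tuples_def)
      then have "\<exists>X. symbol_of D X" by (simp add: derivations_iff)
      then show ?thesis by (rule someI_ex)
    qed
    have "Xs \<in> tuples (mdim E) (vector_fields E)"
      using symbol_of_vector_field[OF sym] Ds by (auto simp: Xs_def tuples_def)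
    then have sm: "(\<lambda>x. \<Omega> x (map (\<lambda>X. at_pt X x) Xs)) \<in> C_inf E"
      using \<Omega> by (simp add: diff_forms_def)
    have "apply_form ?\<mu> Ds = (\<lambda>x. \<Omega> x (map (\<lambda>X. at_pt X x) Xs) *\<^sub>R u x)"
    proof
      fix x
      have "map (symbol_at E x) (map (\<lambda>D. at_pt D x) Ds) = map (\<lambda>X. at_pt X x) Xs"
        using symbol_at_derivation[OF sym] by (simp add: Xs_def)
      moreover have "set (map (\<lambda>D. at_pt D x) Ds) \<subseteq> gauge_fibre E x"
        using Ds derivation_at by (auto simp: tuples_def)
      ultimately show "apply_form ?\<mu> Ds x = \<Omega> x (map (\<lambda>X. at_pt X x) Xs) *\<^sub>R u x"
        by (simp add: apply_form_def symbol_pullback_def del: map_map)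
    qed
    then show ?thesis using sections_on_mult[OF sm u] by simp
  qed
  ultimately show ?thesis by (simp add: gforms_on_def)
qed

lemma d_sigma_symbol_part: "symbol_part x (d_sigma E \<Omega> u x) (\<lambda>Xs. \<Omega> x Xs *\<^sub>R u x)"
  unfolding d_sigma_def
  using dD_pulled_back_symbol_part[OF tensor_gform _ tensor_pulled_back] tensor_pulled_back by blast

lemma d_sigma_jet: "d_sigma E \<Omega> u \<in> jet_sections_on E (Suc (mdim E)) UNIV"
  unfolding d_sigma_def using dD_pulled_back_jet[OF tensor_gform] tensor_pulled_back by blast

end

lemma jet_section_at: "\<mu> \<in> jet_sections_on E n W \<Longrightarrow> x \<in> W \<Longrightarrow> \<mu> x \<in> jet_fibre E n x"
  and jet_section_gform: "\<mu> \<in> jet_sections_on E n W \<Longrightarrow> \<mu> \<in> gforms_on E n W"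
  by (auto simp: jet_sections_on_def)

text \<open>In top degree \<open>d\<mu> = 0\<close> for every section of the jet bundle: a form of degree \<open>m + 2\<close> vanishes
  if it vanishes on pairs of endomorphisms, and on those \<open>d\<mu>\<close> is
  \<open>(P\<^sub>0 P\<^sub>1 - P\<^sub>1 P\<^sub>0 - [P\<^sub>0, P\<^sub>1]) \<circ> \<sigma>\<^sup>*\<lambda>\<^sub>\<mu>\<close>.\<close>

lemma jet_section_closed:
  assumes \<mu>: "\<mu> \<in> jet_sections_on E (Suc (mdim E)) UNIV"
  shows "dD E (Suc (mdim E)) \<mu> = (\<lambda>x. 0)"
proof
  fix y
  let ?m = "mdim E" and ?\<omega> = "dD E (Suc (mdim E)) \<mu>" and ?c = "apply_form \<mu>"
  note gf = jet_section_gform[OF \<mu>]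
  define \<kappa> where "\<kappa> Ds = ?c (ident # Ds)" for Ds
  have \<kappa>: "\<kappa> Ds \<in> Gam E" if "set Ds \<subseteq> derivations E" "length Ds = ?m" for Ds
    unfolding \<kappa>_def using that vertical_derivation[OF ident_vertical] by (intro gforms_value[OF gf]) auto
  have c_vertical: "?c (P # Ds) = P (\<kappa> Ds)"
    if P: "P \<in> vertical" and Ds: "set Ds \<subseteq> derivations E" "length Ds = ?m" for P Ds
  proof
    fix z
    obtain \<eta> where \<eta>: "symbol_part z (\<mu> z) \<eta>" using jet_section_at[OF \<mu> UNIV_I, of z] by (auto simp: jet_fibre_iff)
    obtain \<Phi> where \<Phi>: "\<Phi> \<in> endos E z" "at_pt P z = endo_incl E z \<Phi>" using vertical_endo[OF P] by blast
    let ?ds = "map (\<lambda>D. at_pt D z) Ds"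
    have ds: "set ?ds \<subseteq> gauge_fibre E z" "length ?ds = ?m" using Ds derivation_at by auto
    have "?c (P # Ds) z = \<Phi> (\<eta> (map (symbol_at E z) ?ds))"
      using symbol_partD[OF \<eta> \<Phi>(1) ds] by (simp add: apply_form_def \<Phi>)
    also have "\<eta> (map (symbol_at E z) ?ds) = \<kappa> Ds z"
      using symbol_partD[OF \<eta> id_endo ds] by (simp add: \<kappa>_def apply_form_def at_pt_ident)
    also have "\<Phi> (\<kappa> Ds z) = at_pt P z (\<kappa> Ds)" using \<kappa>[OF Ds] by (simp add: \<Phi> endo_incl_def)
    finally show "?c (P # Ds) z = P (\<kappa> Ds) z" by (simp add: at_pt_def)
  qed
  have c_vertical2: "?c (P # As @ Q # Bs) = 0"
    if P: "P \<in> vertical" "Q \<in> vertical" and Ds: "set As \<subseteq> derivations E" "set Bs \<subseteq> derivations E" "length As + 1 + length Bs = ?m"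
    for P Q As Bs
  proof
    fix z
    obtain \<eta> where \<eta>: "symbol_part z (\<mu> z) \<eta>" using jet_section_at[OF \<mu> UNIV_I, of z] by (auto simp: jet_fibre_iff)
    obtain \<Phi> where \<Phi>: "\<Phi> \<in> endos E z" "at_pt P z = endo_incl E z \<Phi>" using vertical_endo[OF P(1)] by blast
    let ?d = "map (\<lambda>D. at_pt D z)" and ?s = "map (\<lambda>D. symbol_at E z (at_pt D z))"
    have ds: "set (?d (As @ Q # Bs)) \<subseteq> gauge_fibre E z" "length (?d (As @ Q # Bs)) = ?m"
      using Ds derivation_at vertical_derivation[OF P(2)] by auto
    have "?c (P # As @ Q # Bs) z = \<Phi> (\<eta> (?s As @ 0 # ?s Bs))"
      using symbol_partD[OF \<eta> \<Phi>(1) ds] by (simp add: apply_form_def \<Phi> symbol_at_vertical[OF P(2)] o_def)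
    also have "\<eta> (?s As @ 0 # ?s Bs) = 0"
      using Ds derivation_at symbol_at_tangent
      by (intro alt_maps_zero_slot[OF symbol_part_alt[OF \<eta>] subspace_tangent]) auto
    finally show "?c (P # As @ Q # Bs) z = 0 z" using endo_zero[OF \<Phi>(1)] by simp
  qed
  have two: "?\<omega> y (endo_incl E y \<Phi> # endo_incl E y \<Psi> # \<delta>s) = 0"
    if \<Phi>: "\<Phi> \<in> endos E y" and \<Psi>: "\<Psi> \<in> endos E y" and \<delta>s: "set \<delta>s \<subseteq> gauge_fibre E y" "length \<delta>s = ?m" for \<Phi> \<Psi> \<delta>s
  proof -
    obtain P where P: "P \<in> vertical" "at_pt P y = endo_incl E y \<Phi>" using extend_endo[OF \<Phi>] by blast
    obtain Q where Q: "Q \<in> vertical" "at_pt Q y = endo_incl E y \<Psi>" using extend_endo[OF \<Psi>] by blast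
    define Ds where "Ds = map (extension y) \<delta>s"
    have Ds: "set Ds \<subseteq> derivations E" "length Ds = ?m" "map (\<lambda>D. at_pt D y) Ds = \<delta>s"
      using \<delta>s extension by (auto simp: Ds_def intro!: map_idI)
    note PQ = vertical_derivation[OF P(1)] vertical_derivation[OF Q(1)]
    have "?\<omega> y (endo_incl E y \<Phi> # endo_incl E y \<Psi> # \<delta>s) = apply_form ?\<omega> (P # Q # Ds) y"
      using P Q Ds by (simp add: apply_form_def)
    also have "apply_form ?\<omega> (P # Q # Ds) = cochain_d (P # Q # Ds) ?c"
      using dD(2)[OF gf, of "P # Q # Ds"] Ds PQ by simp
    also have "\<dots> = P (?c (Q # Ds)) - ?c (commutator P Q # Ds) - lie_correction P Ds (\<lambda>Es. ?c (Q # Es))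
        - (Q (?c (P # Ds)) - lie_correction Q Ds (\<lambda>Es. ?c (P # Es)) - cochain_d Ds (\<lambda>Es. ?c (P # Q # Es)))"
      by (simp add: cochain_lie_def algebra_simps)
    also have "lie_correction P Ds (\<lambda>Es. ?c (Q # Es)) = 0"
      using c_vertical2[OF Q(1)] Ds(2) by (intro lie_correction_vertical[OF P(1) Ds(1)]) simp
    also have "lie_correction Q Ds (\<lambda>Es. ?c (P # Es)) = 0"
      using c_vertical2[OF P(1)] Ds(2) by (intro lie_correction_vertical[OF Q(1) Ds(1)]) simp
    also have "cochain_d Ds (\<lambda>Es. ?c (P # Q # Es)) = 0"
    proof (rule cochain_d_zero[OF Ds(1)])
      fix Es assume "set Es \<subseteq> derivations E" "length Es + 1 = length Ds"
      then show "?c (P # Q # Es) = 0" using c_vertical2[OF P(1) Q(1), of "[]" Es] Ds by simp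
    qed
    also have "?c (commutator P Q # Ds) = commutator P Q (\<kappa> Ds)"
      by (rule c_vertical[OF commutator_vertical[OF P(1) PQ(2)] Ds(1,2)])
    finally show ?thesis
      using c_vertical[OF P(1) Ds(1,2)] c_vertical[OF Q(1) Ds(1,2)] by (simp add: commutator_def)
  qed
  obtain N F W H e k r where "gauge_frame E N F W H e k r" and y: "y \<in> N"
    by (rule gauge_frame_exists)
  then interpret gauge_frame E N F W H e k r by simp
  note alt = gforms_alt[OF dD(1)[OF gf] UNIV_I, of y]
  show "?\<omega> y = 0"
  proof (rule zero_if_killed_by_endos[OF y alt])
    fix \<Phi> \<delta>s assume \<Phi>: "\<Phi> \<in> endos E y" and "set \<delta>s \<subseteq> gauge_fibre E y" "Suc (length \<delta>s) = Suc (Suc ?m)"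
    have "(\<lambda>\<delta>s. ?\<omega> y (endo_incl E y \<Phi> # \<delta>s)) = 0"
      by (rule zero_if_killed_by_endos[OF y alt_maps_insert[OF alt endo_in_gauge[OF \<Phi>]]])
        (use two[OF \<Phi>] in auto)
    then show "?\<omega> y (endo_incl E y \<Phi> # \<delta>s) = 0" by (simp add: fun_eq_iff)
  qed simp
qed

end

section \<open>Jets as vectors of the fibre and the map \<open>B\<^sub>Z\<close>\<close>

context gauge_frame
begin

text \<open>Near a point, a jet of top degree is the same as a vector of \<open>E\<close>: its \<open>\<lambda>\<^sub>\<mu>\<close> is the volume form
  of the frame times the value of \<open>\<mu>\<close> on the identity and the horizontal derivations.\<close>

definition jet_value :: "'p \<Rightarrow> ('p, 'v) gform \<Rightarrow> 'v"
  where "jet_value y \<mu> = \<mu> (endo_incl E y (\<lambda>v. v) # horizontal_basis y)"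

definition vol :: "'p \<Rightarrow> (('p \<Rightarrow> real) \<Rightarrow> real) list \<Rightarrow> real"
  where "vol = det_form E F"

lemma vol_form: "vol \<in> diff_forms E (mdim E)"
  unfolding vol_def using det_form_smooth F_smooth by blast

lemma vol_alt: "vol y \<in> alt_maps (mdim E) (tangent_space E y) UNIV"
  using diff_form_alt[OF vol_form] .

lemma jet_value_combination: "jet_value y (a *\<^sub>R \<mu> + b *\<^sub>R \<nu>) = a *\<^sub>R jet_value y \<mu> + b *\<^sub>R jet_value y \<nu>"
  by (simp add: jet_value_def)

lemma jet_value_scale: "jet_value y (a *\<^sub>R \<mu>) = a *\<^sub>R jet_value y \<mu>"
  by (simp add: jet_value_def)

lemma jet_value_sum: "jet_value y (\<Sum>i\<in>A. \<mu> i) = (\<Sum>i\<in>A. jet_value y (\<mu> i))"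
  by (simp add: jet_value_def sum_fun_apply)

lemma jet_value_symbol_part:
  assumes "symbol_part y \<mu> \<eta>"
  shows "jet_value y \<mu> = \<eta> (tangent_basis y)"
  using symbol_partD[OF assms id_endo horizontal_basis_in horizontal_basis_length]
  by (simp add: jet_value_def symbol_horizontal_basis)

lemma jet_value_d_sigma:
  assumes "\<Omega> \<in> diff_forms E (mdim E)" "u \<in> Gam E"
  shows "jet_value y (d_sigma E \<Omega> u y) = \<Omega> y (tangent_basis y) *\<^sub>R u y"
  by (rule jet_value_symbol_part[OF d_sigma_symbol_part[OF assms]])

context
  fixes y assumes y: "y \<in> N"
begin

lemma vol_basis: "vol y (tangent_basis y) = 1"
  unfolding vol_def by (rule det_form_basis[OF y])

lemma jet_value_in_fibre: "\<mu> \<in> jet_fibre E (Suc (mdim E)) y \<Longrightarrow> jet_value y \<mu> \<in> fibre E y"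
  unfolding jet_value_def jet_fibre_iff
  using endo_in_gauge[OF id_endo, of y] horizontal_basis_in[of y] horizontal_basis_length
  by (intro alt_maps_value[of \<mu> "Suc (mdim E)"]) auto

text \<open>Both sides are top forms with the same value on the basis.\<close>

lemma jet_symbol_part:
  assumes \<mu>: "\<mu> \<in> jet_fibre E (Suc (mdim E)) y"
  shows "symbol_part y \<mu> (\<lambda>Xs. vol y Xs *\<^sub>R jet_value y \<mu>)"
proof -
  obtain \<eta> where \<eta>: "symbol_part y \<mu> \<eta>" using \<mu> by (auto simp: jet_fibre_iff)
  have "\<eta> = (\<lambda>Xs. vol y Xs *\<^sub>R jet_value y \<mu>)"
    by (rule top_form_eqI[OF y symbol_part_alt[OF \<eta>] alt_maps_tensor[OF vol_alt fibre_subspace jet_value_in_fibre[OF \<mu>]] fibre_subspace])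
      (simp add: vol_basis jet_value_symbol_part[OF \<eta>])
  with \<eta> show ?thesis by simp
qed

lemma jet_on_endo:
  assumes \<mu>: "\<mu> \<in> jet_fibre E (Suc (mdim E)) y" and \<Phi>: "\<Phi> \<in> endos E y"
    and \<delta>s: "set \<delta>s \<subseteq> gauge_fibre E y" "length \<delta>s = mdim E"
  shows "\<mu> (endo_incl E y \<Phi> # \<delta>s) = vol y (map (symbol_at E y) \<delta>s) *\<^sub>R \<Phi> (jet_value y \<mu>)"
  using symbol_partD[OF jet_symbol_part[OF \<mu>] \<Phi> \<delta>s]
    linear_map_on_scale[OF endo_linear[OF \<Phi>] fibre_subspace jet_value_in_fibre[OF \<mu>]] by simp

lemma jet_on_endo_basis:
  assumes "\<mu> \<in> jet_fibre E (Suc (mdim E)) y" "\<Phi> \<in> endos E y"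
  shows "\<mu> (endo_incl E y \<Phi> # horizontal_basis y) = \<Phi> (jet_value y \<mu>)"
  using jet_on_endo[OF assms horizontal_basis_in horizontal_basis_length]
  by (simp add: symbol_horizontal_basis vol_basis)

lemma jet_outside:
  "\<mu> \<in> jet_fibre E (Suc (mdim E)) y \<Longrightarrow> \<not> (set \<delta>s \<subseteq> gauge_fibre E y \<and> length \<delta>s = mdim E) \<Longrightarrow> \<mu> (\<delta> # \<delta>s) = 0"
  by (rule alt_maps_outside[of \<mu> "Suc (mdim E)"]) (auto simp: jet_fibre_iff tuples_def)

text \<open>Such a jet vanishes on endomorphisms, and its degree exceeds \<open>m\<close>.\<close>

lemma jet_zeroI:
  assumes \<mu>: "\<mu> \<in> jet_fibre E (Suc (mdim E)) y" and "jet_value y \<mu> = 0"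
  shows "\<mu> = 0"
proof (rule zero_if_killed_by_endos[OF y])
  show "\<mu> \<in> alt_maps (Suc (mdim E)) (gauge_fibre E y) (fibre E y)" using \<mu> by (simp add: jet_fibre_iff)
  show "\<mu> (endo_incl E y \<Phi> # \<delta>s) = 0"
    if "\<Phi> \<in> endos E y" "set \<delta>s \<subseteq> gauge_fibre E y" "Suc (length \<delta>s) = Suc (mdim E)" for \<Phi> \<delta>s
    using jet_on_endo[OF \<mu> that(1,2)] that assms(2) endo_zero[OF that(1)] by simp
qed simp

lemma jet_eqI:
  assumes "\<mu> \<in> jet_fibre E (Suc (mdim E)) y" "\<nu> \<in> jet_fibre E (Suc (mdim E)) y"
    "jet_value y \<mu> = jet_value y \<nu>"
  shows "\<mu> = \<nu>"
proof -
  have "\<mu> - \<nu> = 0"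
    using jet_value_combination[of y 1 \<mu> "-1" \<nu>] assms
    by (intro jet_zeroI subspace_diff[OF subspace_jet]) auto
  then show ?thesis by simp
qed

lemma d_sigma_in_jet: "\<Omega> \<in> diff_forms E (mdim E) \<Longrightarrow> u \<in> Gam E \<Longrightarrow> d_sigma E \<Omega> u y \<in> jet_fibre E (Suc (mdim E)) y"
  using jet_section_at[OF d_sigma_jet] by simp

lemma jet_value_vol: "u \<in> Gam E \<Longrightarrow> jet_value y (d_sigma E vol u y) = u y"
  by (simp add: jet_value_d_sigma[OF vol_form] vol_basis)

lemma jet_eq_d_sigma:
  assumes "\<mu> \<in> jet_fibre E (Suc (mdim E)) y" "u \<in> Gam E" "u y = jet_value y \<mu>"
  shows "\<mu> = d_sigma E vol u y"
  by (rule jet_eqI[OF assms(1) d_sigma_in_jet[OF vol_form assms(2)]]) (simp add: jet_value_vol assms)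

lemma top_covector_eq:
  assumes "\<Omega> \<in> top_covectors E y"
  shows "\<Omega> = \<Omega> (tangent_basis y) *\<^sub>R vol y"
  using assms subspace_scale[OF subspace_alt_maps[OF subspace_UNIV] vol_alt]
  by (intro top_form_eqI[OF y _ _ subspace_UNIV]) (auto simp: top_covectors_def vol_basis)

text \<open>Replacing the \<open>i\<close>th vector of the basis by \<open>X\<close> evaluates the volume form to the \<open>i\<close>th
  coordinate of \<open>X\<close>.\<close>

lemma vol_nondegenerate:
  assumes X: "X \<in> tangent_space E y"
    and zero: "\<And>Xs. set Xs \<subseteq> tangent_space E y \<Longrightarrow> Suc (length Xs) = mdim E \<Longrightarrow> vol y (X # Xs) = 0"
  shows "X = 0"
proof -
  let ?T = "tangent_space E y" and ?m = "mdim E"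
  have V: "at_pt (W i) y \<in> ?T" if "i < ?m" for i using vector_field_at[OF W_vector_field[OF that]] .
  have coord: "X (F i) = 0" if i: "i < ?m" for i
  proof -
    let ?V = "\<lambda>j. at_pt (W j) y"
    define us vs where "us = map ?V [0..<i]" and "vs = map ?V [Suc i..<?m]"
    have base: "tangent_basis y = us @ ?V i # vs"
      unfolding tangent_basis_def us_def vs_def
      using i upt_add_eq_append[of 0 i "?m - i"] upt_conv_Cons[of i ?m] by simp
    have uv: "set us \<subseteq> ?T" "set vs \<subseteq> ?T" "length us + 1 + length vs = ?m"
      using V i by (auto simp: us_def vs_def)
    have lin: "linear_map_on ?T (\<lambda>Z. vol y (us @ Z # vs))"
      using uv by (intro alt_maps_linear[OF vol_alt]) auto
    have dual: "vol y (us @ ?V j # vs) = (if j = i then 1 else 0)" if j: "j < ?m" for j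
    proof (cases "j = i")
      case True
      then show ?thesis using vol_basis base by simp
    next
      case False
      then have "?V j \<in> set us \<or> ?V j \<in> set vs" using j by (cases "j < i") (auto simp: us_def vs_def)
      then have "\<not> distinct (us @ ?V j # vs)" by auto
      then show ?thesis using False uv V[OF j] by (simp add: alt_maps_distinct[OF vol_alt])
    qed
    have "X = (\<Sum>j<?m. X (F j) *\<^sub>R ?V j)"
    proof
      fix f
      show "X f = (\<Sum>j<?m. X (F j) *\<^sub>R ?V j) f"
        using tangent_expansion[OF y X, of f] tangent_outside[OF X, of f] tangent_outside[OF V, of _ f]
        by (cases "f \<in> C_inf E") (simp_all add: sum_fun_apply at_pt_def)
    qed
    then have "vol y (us @ X # vs) = vol y (us @ (\<Sum>j<?m. X (F j) *\<^sub>R ?V j) # vs)"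
      by (rule arg_cong)
    also have "\<dots> = (\<Sum>j<?m. X (F j) *\<^sub>R vol y (us @ ?V j # vs))"
      using V by (intro linear_map_on_sum[OF lin subspace_tangent]) auto
    also have "\<dots> = (\<Sum>j<?m. if j = i then X (F j) else 0)" using dual by (intro sum.cong) auto
    also have "\<dots> = X (F i)" using i by simp
    finally have "X (F i) = vol y ([] @ us @ X # vs)" by simp
    also have "\<dots> = (-1) ^ length us *\<^sub>R vol y ([] @ X # us @ vs)"
      using uv X by (intro alt_maps_move[OF vol_alt subspace_tangent]) auto
    also have "vol y ([] @ X # us @ vs) = 0" using uv zero[of "us @ vs"] by simp
    finally show ?thesis by simp
  qed
  show ?thesis
  proof
    fix f
    show "X f = 0 f"
      using tangent_expansion[OF y X, of f] tangent_outside[OF X, of f] coord by (cases "f \<in> C_inf E") simp_all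
  qed
qed

text \<open>Exchanging the first two arguments inserts an endomorphism first, and then only symbols count.\<close>

lemma jet_on_identity:
  assumes \<mu>: "\<mu> \<in> jet_fibre E (Suc (mdim E)) y" and \<delta>: "\<delta> \<in> gauge_fibre E y"
    and \<delta>s: "set \<delta>s \<subseteq> gauge_fibre E y" "Suc (length \<delta>s) = mdim E"
  shows "\<mu> (\<delta> # endo_incl E y (\<lambda>v. v) # \<delta>s) =
    - (vol y (symbol_at E y \<delta> # map (symbol_at E y) \<delta>s) *\<^sub>R jet_value y \<mu>)"
proof -
  have "\<mu> ([] @ \<delta> # endo_incl E y (\<lambda>v. v) # \<delta>s) = - \<mu> ([] @ endo_incl E y (\<lambda>v. v) # \<delta> # \<delta>s)"
    using \<mu> \<delta> \<delta>s endo_in_gauge[OF id_endo]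
    by (intro alt_maps_swap[of \<mu> "Suc (mdim E)", OF _ subspace_gauge]) (auto simp: jet_fibre_iff)
  moreover have "\<mu> (endo_incl E y (\<lambda>v. v) # \<delta> # \<delta>s) = vol y (map (symbol_at E y) (\<delta> # \<delta>s)) *\<^sub>R jet_value y \<mu>"
    using \<delta> \<delta>s by (intro jet_on_endo[OF \<mu> id_endo]) auto
  ultimately show ?thesis by simp
qed

lemma lift_tangents:
  assumes "set Xs \<subseteq> tangent_space E y"
  obtains \<delta>s where "set \<delta>s \<subseteq> gauge_fibre E y" "length \<delta>s = length Xs" "map (symbol_at E y) \<delta>s = Xs"
proof -
  have "\<exists>\<delta>\<in>gauge_fibre E y. symbol_at E y \<delta> = X" if X: "X \<in> tangent_space E y" for X
  proof
    let ?\<delta> = "\<Sum>i<mdim E. X (F i) *\<^sub>R at_pt (H i) y"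
    have H: "at_pt (H i) y \<in> gauge_fibre E y" if "i < mdim E" for i
      using derivation_at[OF H_derivation[OF that]] .
    then show "?\<delta> \<in> gauge_fibre E y"
      by (intro subspace_sum[OF subspace_gauge] subspace_scale[OF subspace_gauge]) auto
    have "symbol_at E y ?\<delta> = (\<Sum>i<mdim E. X (F i) *\<^sub>R symbol_at E y (at_pt (H i) y))"
      using H by (intro linear_map_on_sum[OF symbol_at_linear subspace_gauge]) auto
    also have "\<dots> = X"
    proof
      fix f
      show "(\<Sum>i<mdim E. X (F i) *\<^sub>R symbol_at E y (at_pt (H i) y)) f = X f"
        using tangent_expansion[OF y X, of f] tangent_outside[OF X, of f]
          tangent_outside[OF vector_field_at[OF W_vector_field], of _ f]
        by (cases "f \<in> C_inf E") (simp_all add: sum_fun_apply symbol_at_derivation[OF H_symbol], simp_all add: at_pt_def)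
    qed
    finally show "symbol_at E y ?\<delta> = X" .
  qed
  then obtain g where g: "\<And>X. X \<in> tangent_space E y \<Longrightarrow> g X \<in> gauge_fibre E y \<and> symbol_at E y (g X) = X" by metis
  show thesis
    using assms g by (intro that[of "map g Xs"]) (auto intro!: map_idI)
qed

text \<open>Inserting the identity of \<open>E\<close> next shows that the symbol of \<open>\<delta>\<close> annihilates the volume form. So
  \<open>\<delta>\<close> is an endomorphism, and a jet with value \<open>v\<close> detects its value on \<open>v\<close>.\<close>

lemma gauge_zero_if_jets_vanish:
  assumes \<delta>: "\<delta> \<in> gauge_fibre E y"
    and zero: "\<And>\<mu> \<delta>s. \<mu> \<in> jet_fibre E (Suc (mdim E)) y \<Longrightarrow> \<mu> (\<delta> # \<delta>s) = 0"
  shows "\<delta> = 0"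
proof -
  obtain v where v: "v \<in> fibre E y" "v \<noteq> 0" by (rule nonzero_vector)
  have "symbol_at E y \<delta> = 0"
  proof (rule vol_nondegenerate[OF symbol_at_tangent[OF \<delta>]])
    fix Xs assume Xs: "set Xs \<subseteq> tangent_space E y" "Suc (length Xs) = mdim E"
    obtain \<delta>s where ds: "set \<delta>s \<subseteq> gauge_fibre E y" "length \<delta>s = length Xs" "map (symbol_at E y) \<delta>s = Xs"
      by (rule lift_tangents[OF Xs(1)])
    obtain u where u: "u \<in> Gam E" "u y = v" using extend_to_section[OF v(1)] by blast
    let ?\<mu> = "d_sigma E vol u y"
    have "vol y (symbol_at E y \<delta> # Xs) *\<^sub>R jet_value y ?\<mu> = 0"
      using jet_on_identity[OF d_sigma_in_jet[OF vol_form u(1)] \<delta> ds(1)] ds Xs(2)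
        zero[OF d_sigma_in_jet[OF vol_form u(1)]] by simp
    then show "vol y (symbol_at E y \<delta> # Xs) = 0" using jet_value_vol[OF u(1)] u(2) v(2) by simp
  qed
  then obtain \<Phi> where \<Phi>: "\<Phi> \<in> endos E y" "\<delta> = endo_incl E y \<Phi>" using symbol_zero_endo[OF \<delta>] by blast
  show ?thesis
  proof
    fix u
    show "\<delta> u = 0 u"
    proof (cases "u \<in> Gam E")
      case True
      have "\<Phi> (jet_value y (d_sigma E vol u y)) = 0"
        using jet_on_endo_basis[OF d_sigma_in_jet[OF vol_form True] \<Phi>(1)]
          zero[OF d_sigma_in_jet[OF vol_form True]] \<Phi>(2) by simp
      then show ?thesis using True by (simp add: \<Phi>(2) endo_incl_def jet_value_vol[OF True])
    qed (simp add: \<Phi>(2) endo_incl_def)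
  qed
qed

end

end

context nonzero_vector_bundle
begin

lemma endo_incl_cong: "(\<And>v. v \<in> fibre E x \<Longrightarrow> \<Phi> v = \<Psi> v) \<Longrightarrow> endo_incl E x \<Phi> = endo_incl E x \<Psi>"
  using section_in_fibre by (auto simp: endo_incl_def fun_eq_iff)

lemma endo_incl_combination:
  "endo_incl E x (\<lambda>v. a *\<^sub>R \<Phi> v + b *\<^sub>R \<Psi> v) = a *\<^sub>R endo_incl E x \<Phi> + b *\<^sub>R endo_incl E x \<Psi>"
  by (simp add: endo_incl_def fun_eq_iff)

lemma diff_form_top: "\<Omega> \<in> diff_forms E (mdim E) \<Longrightarrow> \<Omega> x \<in> top_covectors E x"
  using diff_form_alt by (simp add: top_covectors_def)

context
  fixes Z assumes Z: "Z \<in> volume_sections E"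
begin

lemma volume_linear: "linear_map_on (top_covectors E x) (Z x)"
  and volume_skew: "\<Omega> \<in> top_covectors E x \<Longrightarrow> skew_bilinear_on (fibre E x) (Z x \<Omega>)"
  using Z unfolding volume_sections_def by auto

lemma volume_smooth: "\<Omega> \<in> diff_forms E (mdim E) \<Longrightarrow> u \<in> Gam E \<Longrightarrow> v \<in> Gam E \<Longrightarrow>
    (\<lambda>x. Z x (\<Omega> x) (u x) (v x)) \<in> Gam E"
  using Z unfolding volume_sections_def by auto

lemma volume_endo: "\<Omega> \<in> top_covectors E x \<Longrightarrow> a \<in> fibre E x \<Longrightarrow> Z x \<Omega> a \<in> endos E x"
  using volume_skew unfolding skew_bilinear_on_def endos_def by blast

lemma volume_linear_left: "\<Omega> \<in> top_covectors E x \<Longrightarrow> b \<in> fibre E x \<Longrightarrow> linear_map_on (fibre E x) (\<lambda>a. Z x \<Omega> a b)"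
  and volume_antisym: "\<Omega> \<in> top_covectors E x \<Longrightarrow> a \<in> fibre E x \<Longrightarrow> b \<in> fibre E x \<Longrightarrow> Z x \<Omega> a b = - Z x \<Omega> b a"
  using volume_skew unfolding skew_bilinear_on_def by blast+

end

end

context gauge_frame
begin

text \<open>The formula is the only candidate since every jet is of the form \<open>d(\<sigma>\<^sup>*(vol \<otimes> u))\<close>, and it has the
  defining property for every form \<open>\<Omega>\<close> since \<open>\<Omega>\<close> is a multiple of \<open>vol\<close> at the point and \<open>Z\<close> is linear.\<close>

lemma B_map_eq:
  assumes Z: "Z \<in> volume_sections E" and y: "y \<in> N"
  shows "B_map E Z y = (\<lambda>\<mu>. if \<mu> \<in> jet_fibre E (Suc (mdim E)) y
    then endo_incl E y (Z y (vol y) (jet_value y \<mu>)) else 0)" (is "_ = ?B")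
    and B_map_linear_frame: "linear_map_on (jet_fibre E (Suc (mdim E)) y) (B_map E Z y)"
    and B_map_d_sigma_frame: "\<Omega> \<in> diff_forms E (mdim E) \<Longrightarrow> u \<in> Gam E \<Longrightarrow>
      B_map E Z y (d_sigma E \<Omega> u y) = endo_incl E y (Z y (\<Omega> y) (u y))"
proof -
  let ?J = "jet_fibre E (Suc (mdim E)) y" and ?Z = "Z y (vol y)"
  have top: "vol y \<in> top_covectors E y" by (rule diff_form_top[OF vol_form])
  note val = jet_value_in_fibre[OF y]
  have in_gauge: "?B \<mu> \<in> gauge_fibre E y" if "\<mu> \<in> ?J" for \<mu>
    using that endo_in_gauge[OF volume_endo[OF Z top val]] by simp
  have lin: "linear_map_on ?J ?B"
    unfolding linear_map_on_def
  proof (intro ballI allI)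
    fix \<mu> \<nu> and a b :: real assume m: "\<mu> \<in> ?J" "\<nu> \<in> ?J"
    have "a *\<^sub>R \<mu> + b *\<^sub>R \<nu> \<in> ?J" using m by (intro subspace_add[OF subspace_jet] subspace_scale[OF subspace_jet])
    moreover have "endo_incl E y (?Z (jet_value y (a *\<^sub>R \<mu> + b *\<^sub>R \<nu>))) =
        endo_incl E y (\<lambda>v. a *\<^sub>R ?Z (jet_value y \<mu>) v + b *\<^sub>R ?Z (jet_value y \<nu>) v)"
      using linear_map_on_combination[OF volume_linear_left[OF Z top] fibre_subspace val[OF m(1)] val[OF m(2)]]
      by (intro endo_incl_cong) (simp add: jet_value_combination)
    ultimately show "?B (a *\<^sub>R \<mu> + b *\<^sub>R \<nu>) = a *\<^sub>R ?B \<mu> + b *\<^sub>R ?B \<nu>"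
      using m by (simp add: endo_incl_combination)
  qed
  have dsig: "?B (d_sigma E \<Omega> u y) = endo_incl E y (Z y (\<Omega> y) (u y))"
    if \<Omega>: "\<Omega> \<in> diff_forms E (mdim E)" and u: "u \<in> Gam E" for \<Omega> u
  proof -
    let ?t = "\<Omega> y (tangent_basis y)"
    have uy: "u y \<in> fibre E y" using section_in_fibre[OF u] by simp
    have "\<Omega> y = ?t *\<^sub>R vol y" by (rule top_covector_eq[OF y diff_form_top[OF \<Omega>]])
    then have "Z y (\<Omega> y) = Z y (?t *\<^sub>R vol y)" by (rule arg_cong)
    also have "\<dots> = ?t *\<^sub>R ?Z"
      by (rule linear_map_on_scale[OF volume_linear[OF Z] _ top])
        (simp add: top_covectors_def subspace_alt_maps[OF subspace_UNIV])
    finally have ZO: "Z y (\<Omega> y) = ?t *\<^sub>R ?Z" .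
    have "endo_incl E y (?Z (?t *\<^sub>R u y)) = endo_incl E y (Z y (\<Omega> y) (u y))"
      unfolding ZO using linear_map_on_scale[OF volume_linear_left[OF Z top] fibre_subspace uy]
      by (intro endo_incl_cong) simp
    then show ?thesis
      using d_sigma_in_jet[OF y \<Omega> u] by (simp add: jet_value_d_sigma[OF \<Omega> u])
  qed
  have uniq: "b = ?B" if b: "\<forall>\<mu>. \<mu> \<notin> ?J \<longrightarrow> b \<mu> = 0"
    "\<forall>\<Omega>\<in>diff_forms E (mdim E). \<forall>u\<in>Gam E. b (d_sigma E \<Omega> u y) = endo_incl E y (Z y (\<Omega> y) (u y))" for b
  proof
    fix \<mu>
    show "b \<mu> = ?B \<mu>"
    proof (cases "\<mu> \<in> ?J")
      case True
      obtain u where u: "u \<in> Gam E" "u y = jet_value y \<mu>" using extend_to_section[OF val[OF True]] by blast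
      have "b (d_sigma E vol u y) = endo_incl E y (?Z (u y))" using b(2) vol_form u(1) by blast
      then show ?thesis using True u jet_eq_d_sigma[OF y True u] by simp
    qed (use b in simp)
  qed
  show B: "B_map E Z y = ?B"
    unfolding B_map_def Suc_eq_plus1[symmetric]
  proof (rule the_equality, intro conjI allI impI ballI)
    show "linear_map_on ?J ?B" by (rule lin)
    show "?B \<mu> = 0" if "\<mu> \<notin> ?J" for \<mu> using that by simp
    show "?B \<mu> \<in> gauge_fibre E y" if "\<mu> \<in> ?J" for \<mu> using that by (rule in_gauge)
    show "?B (d_sigma E \<Omega> u y) = endo_incl E y (Z y (\<Omega> y) (u y))"
      if "\<Omega> \<in> diff_forms E (mdim E)" "u \<in> Gam E" for \<Omega> u using that by (rule dsig)
  qed (rule uniq, blast+)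
  show "linear_map_on ?J (B_map E Z y)" unfolding B by (rule lin)
  show "B_map E Z y (d_sigma E \<Omega> u y) = endo_incl E y (Z y (\<Omega> y) (u y))"
    if "\<Omega> \<in> diff_forms E (mdim E)" "u \<in> Gam E"
    unfolding B by (rule dsig[OF that])
qed

end

context nonzero_vector_bundle
begin

context
  fixes Z assumes Z: "Z \<in> volume_sections E"
begin

lemma B_map_endo:
    "\<mu> \<in> jet_fibre E (Suc (mdim E)) x \<Longrightarrow> \<exists>\<Phi>\<in>endos E x. B_map E Z x \<mu> = endo_incl E x \<Phi>"
  and B_map_linear: "linear_map_on (jet_fibre E (Suc (mdim E)) x) (B_map E Z x)"
  and B_map_d_sigma: "\<Omega> \<in> diff_forms E (mdim E) \<Longrightarrow> u \<in> Gam E \<Longrightarrow>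
    B_map E Z x (d_sigma E \<Omega> u x) = endo_incl E x (Z x (\<Omega> x) (u x))"
proof -
  obtain N F W H e k r where "gauge_frame E N F W H e k r" and x: "x \<in> N"
    by (rule gauge_frame_exists)
  then interpret gauge_frame E N F W H e k r by simp
  show "\<exists>\<Phi>\<in>endos E x. B_map E Z x \<mu> = endo_incl E x \<Phi>" if "\<mu> \<in> jet_fibre E (Suc (mdim E)) x"
    using volume_endo[OF Z diff_form_top[OF vol_form] jet_value_in_fibre[OF x that]] that
    by (auto simp: B_map_eq[OF Z x])
  show "linear_map_on (jet_fibre E (Suc (mdim E)) x) (B_map E Z x)"
    by (rule B_map_linear_frame[OF Z x])
  show "B_map E Z x (d_sigma E \<Omega> u x) = endo_incl E x (Z x (\<Omega> x) (u x))"
    if "\<Omega> \<in> diff_forms E (mdim E)" "u \<in> Gam E"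
    by (rule B_map_d_sigma_frame[OF Z x that])
qed

lemma B_map_in_gauge: "\<mu> \<in> jet_fibre E (Suc (mdim E)) x \<Longrightarrow> B_map E Z x \<mu> \<in> gauge_fibre E x"
  using B_map_endo endo_in_gauge by metis

end

end

section \<open>Graphs of volumes with values in brackets\<close>

lemma is_basis_by_coordinates:
  assumes V: "subspace V" "set vs \<subseteq> V"
    and f: "\<And>j. j < length vs \<Longrightarrow> linear_map_on V (f j)"
      "\<And>i j. i < length vs \<Longrightarrow> j < length vs \<Longrightarrow> f j (vs ! i) = (if i = j then 1 else (0::real))"
      "\<And>v. v \<in> V \<Longrightarrow> v = (\<Sum>j<length vs. f j v *\<^sub>R vs ! j)"
  shows "is_basis vs V"
proof -
  have dist: "distinct vs"
    unfolding distinct_conv_nth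
  proof (intro allI impI notI)
    fix i j assume ij: "i < length vs" "j < length vs" "i \<noteq> j" "vs ! i = vs ! j"
    then show False using f(2)[OF ij(1,1)] f(2)[OF ij(2,1)] by simp
  qed
  have bij: "bij_betw (\<lambda>i. vs ! i) {..<length vs} (set vs)"
    using dist by (auto simp: bij_betw_def inj_on_nth set_conv_nth)
  have "independent (set vs)"
  proof (rule independent_if_scalars_zero)
    fix g v assume g: "(\<Sum>v\<in>set vs. g v *\<^sub>R v) = 0" and v: "v \<in> set vs"
    obtain j where j: "j < length vs" "v = vs ! j" using v by (auto simp: in_set_conv_nth)
    have "(\<Sum>v\<in>set vs. g v *\<^sub>R v) = (\<Sum>i<length vs. g (vs ! i) *\<^sub>R vs ! i)"
      using sum.reindex_bij_betw[OF bij, of "\<lambda>v. g v *\<^sub>R v"] by simp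
    then have "f j (\<Sum>i<length vs. g (vs ! i) *\<^sub>R vs ! i) = 0"
      using g linear_map_on_zero[OF f(1)[OF j(1)] V(1)] by simp
    moreover have "f j (\<Sum>i<length vs. g (vs ! i) *\<^sub>R vs ! i) = (\<Sum>i<length vs. g (vs ! i) *\<^sub>R f j (vs ! i))"
      using V(2) by (intro linear_map_on_sum[OF f(1)[OF j(1)] V(1)]) auto
    moreover have "\<dots> = (\<Sum>i<length vs. if i = j then g (vs ! i) else 0)"
      using f(2)[OF _ j(1)] by (intro sum.cong) auto
    ultimately show "g v = 0" using j by simp
  qed simp
  moreover have "span (set vs) = V"
  proof
    show "span (set vs) \<subseteq> V" using V by (intro span_minimal)
    show "V \<subseteq> span (set vs)"
    proof
      fix v assume "v \<in> V"
      have "(\<Sum>j<length vs. f j v *\<^sub>R vs ! j) \<in> span (set vs)"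
        by (intro span_sum span_scale span_base) auto
      then show "v \<in> span (set vs)" by (subst f(3)[OF \<open>v \<in> V\<close>])
    qed
  qed
  ultimately show ?thesis using dist by (simp add: is_basis_def)
qed

context nonzero_vector_bundle
begin

lemma gforms_on_subset: "\<mu> \<in> gforms_on E n W \<Longrightarrow> W' \<subseteq> W \<Longrightarrow> \<mu> \<in> gforms_on E n W'"
  using sections_on_subset by (auto simp: gforms_on_def)

lemma jet_sections_on_subset: "\<mu> \<in> jet_sections_on E n W \<Longrightarrow> W' \<subseteq> W \<Longrightarrow> \<mu> \<in> jet_sections_on E n W'"
  using gforms_on_subset by (auto simp: jet_sections_on_def)

lemma omni_pairing_apply:
  "omni_pairing (\<delta>, \<mu>) (\<rho>, \<nu>) \<delta>s = (1 / 2) *\<^sub>R (\<nu> (\<delta> # \<delta>s) + \<mu> (\<rho> # \<delta>s))"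
  by (simp add: omni_pairing_def insert_at_def)

lemma isotropicD:
  assumes "isotropic L" "(\<delta>, \<mu>) \<in> L x" "(\<rho>, \<nu>) \<in> L x"
  shows "\<nu> (\<delta> # \<delta>s) + \<mu> (\<rho> # \<delta>s) = 0"
proof -
  have "omni_pairing (\<delta>, \<mu>) (\<rho>, \<nu>) = 0" using assms unfolding isotropic_def by blast
  then have "omni_pairing (\<delta>, \<mu>) (\<rho>, \<nu>) \<delta>s = 0" by simp
  then show ?thesis unfolding omni_pairing_apply by simp
qed

context
  fixes Z assumes Z: "Z \<in> volume_sections E"
begin

lemma graph_iff: "(\<delta>, \<mu>) \<in> graph_of E Z x \<longleftrightarrow> \<mu> \<in> jet_fibre E (Suc (mdim E)) x \<and> \<delta> = B_map E Z x \<mu>"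
  by (auto simp: graph_of_def)

lemma graph_subspace: "subspace (graph_of E Z x)"
proof (rule subspace_combinationI)
  let ?J = "jet_fibre E (Suc (mdim E)) x"
  show "0 \<in> graph_of E Z x"
    using subspace_0[OF subspace_jet] linear_map_on_zero[OF B_map_linear[OF Z] subspace_jet]
    by (simp add: zero_prod_def graph_iff)
  fix p q :: "('p, 'v) omni" and a b :: real assume "p \<in> graph_of E Z x" "q \<in> graph_of E Z x"
  then obtain \<mu> \<nu> where m: "\<mu> \<in> ?J" "\<nu> \<in> ?J" "p = (B_map E Z x \<mu>, \<mu>)" "q = (B_map E Z x \<nu>, \<nu>)"
    by (auto simp: graph_of_def)
  then show "a *\<^sub>R p + b *\<^sub>R q \<in> graph_of E Z x"
    using linear_map_on_combination[OF B_map_linear[OF Z] subspace_jet m(1,2), of a b]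
      subspace_add[OF subspace_jet subspace_scale[OF subspace_jet m(1)] subspace_scale[OF subspace_jet m(2)]]
    by (simp add: graph_iff)
qed

lemma graph_subset: "graph_of E Z x \<subseteq> omni_fibre E (Suc (mdim E)) x"
  using B_map_in_gauge[OF Z] by (auto simp: graph_of_def omni_fibre_def)

text \<open>The jets \<open>d(\<sigma>\<^sup>*(vol \<otimes> e\<^sub>j))\<close> of a frame \<open>e\<^sub>j\<close> of \<open>E\<close> give a frame of the graph.\<close>

lemma graph_subbundle: "subbundle E (Suc (mdim E)) (graph_of E Z)"
  unfolding subbundle_def
proof (intro conjI allI graph_subspace graph_subset)
  fix p
  obtain N F W H e k r where "gauge_frame E N F W H e k r" and p: "p \<in> N"
    by (rule gauge_frame_exists)
  then interpret gauge_frame E N F W H e k r by simp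
  let ?n = "Suc (mdim E)"
  define w where "w j x = (B_map E Z x (d_sigma E vol (e j) x), d_sigma E vol (e j) x)" for j x
  have w_section: "w j \<in> omni_sections_on E ?n N" if j: "j < r" for j
  proof -
    note ej = e_section[OF j]
    have "d_sigma E vol (e j) \<in> jet_sections_on E ?n N"
      using jet_sections_on_subset[OF d_sigma_jet[OF vol_form ej]] by simp
    moreover have "(\<lambda>x. B_map E Z x (d_sigma E vol (e j) x)) \<in> gauge_sections_on E N"
      unfolding gauge_sections_on_def
    proof (intro CollectI conjI ballI)
      show "B_map E Z x (d_sigma E vol (e j) x) \<in> gauge_fibre E x" if "x \<in> N" for x
        by (rule B_map_in_gauge[OF Z d_sigma_in_jet[OF that vol_form ej]])
      fix u assume u: "u \<in> Gam E"
      have "(\<lambda>x. B_map E Z x (d_sigma E vol (e j) x) u) = (\<lambda>x. Z x (vol x) (e j x) (u x))"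
        using u by (simp add: B_map_d_sigma[OF Z vol_form ej] endo_incl_def)
      then show "(\<lambda>x. B_map E Z x (d_sigma E vol (e j) x) u) \<in> sections_on E N"
        using sections_on_subset[OF volume_smooth[OF Z vol_form ej u]] by simp
    qed
    ultimately show ?thesis by (simp add: omni_sections_on_def w_def)
  qed
  have basis: "is_basis (map (\<lambda>s. s x) (map w [0..<r])) (graph_of E Z x)" if x: "x \<in> N" for x
  proof (rule is_basis_by_coordinates[where f="\<lambda>j q. k j x (jet_value x (snd q))"])
    let ?J = "jet_fibre E ?n x" and ?ws = "map (\<lambda>s. s x) (map w [0..<r])"
    have ds: "d_sigma E vol (e j) x \<in> ?J" if "j < r" for j
      by (rule d_sigma_in_jet[OF x vol_form e_section[OF that]])
    have nth: "?ws ! j = w j x" if "j < r" for j using that by simp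
    show "subspace (graph_of E Z x)" by (rule graph_subspace)
    show "set ?ws \<subseteq> graph_of E Z x" using ds by (auto simp: w_def graph_iff)
    show "linear_map_on (graph_of E Z x) (\<lambda>q. k j x (jet_value x (snd q)))" if "j < length ?ws" for j
      unfolding linear_map_on_def
      using that jet_value_in_fibre[OF x]
      by (auto simp: graph_of_def jet_value_combination linear_map_on_combination[OF k_linear fibre_subspace])
    show "k j x (jet_value x (snd (?ws ! i))) = (if i = j then 1 else 0)"
      if "i < length ?ws" "j < length ?ws" for i j
      using that by (simp add: w_def jet_value_vol[OF x e_section] k_e[OF x])
    fix q assume "q \<in> graph_of E Z x"
    then obtain \<mu> where \<mu>: "\<mu> \<in> ?J" "q = (B_map E Z x \<mu>, \<mu>)" by (auto simp: graph_of_def)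
    let ?c = "\<lambda>j. k j x (jet_value x \<mu>)"
    have sum: "\<mu> = (\<Sum>j<r. ?c j *\<^sub>R d_sigma E vol (e j) x)"
    proof (rule jet_eqI[OF x \<mu>(1)])
      show "(\<Sum>j<r. ?c j *\<^sub>R d_sigma E vol (e j) x) \<in> ?J"
        using ds by (intro subspace_sum[OF subspace_jet] subspace_scale[OF subspace_jet]) auto
      show "jet_value x \<mu> = jet_value x (\<Sum>j<r. ?c j *\<^sub>R d_sigma E vol (e j) x)"
        using e_expansion[OF x jet_value_in_fibre[OF x \<mu>(1)]]
        by (simp add: jet_value_sum jet_value_scale jet_value_vol[OF x e_section])
    qed
    have "B_map E Z x \<mu> = B_map E Z x (\<Sum>j<r. ?c j *\<^sub>R d_sigma E vol (e j) x)" by (rule arg_cong[OF sum])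
    also have "\<dots> = (\<Sum>j<r. ?c j *\<^sub>R B_map E Z x (d_sigma E vol (e j) x))"
      using ds by (intro linear_map_on_sum[OF B_map_linear[OF Z] subspace_jet]) auto
    finally have "q = (\<Sum>j<r. ?c j *\<^sub>R w j x)"
      using sum \<mu>(2) by (simp add: w_def prod_eq_iff fst_sum snd_sum)
    moreover have "snd q = \<mu>" using \<mu>(2) by simp
    then have "(\<Sum>j<length ?ws. k j x (jet_value x (snd q)) *\<^sub>R ?ws ! j) = (\<Sum>j<r. ?c j *\<^sub>R w j x)"
      by (intro sum.cong) auto
    ultimately show "q = (\<Sum>j<length ?ws. k j x (jet_value x (snd q)) *\<^sub>R ?ws ! j)"
      by (rule trans[OF _ sym])
  qed
  show "\<exists>U es. open U \<and> p \<in> U \<and> set es \<subseteq> omni_sections_on E ?n U \<and>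
      (\<forall>x\<in>U. is_basis (map (\<lambda>s. s x) es) (graph_of E Z x))"
    using N_open p w_section basis by (intro exI[of _ N] exI[of _ "map w [0..<r]"]) auto
qed

text \<open>The pairing over vectors \<open>a\<close> and \<open>b\<close> is a multiple of \<open>ab + ba\<close>.\<close>

lemma graph_isotropic: "isotropic (graph_of E Z)"
  unfolding isotropic_def
proof (intro allI ballI)
  fix x p q assume "p \<in> graph_of E Z x" "q \<in> graph_of E Z x"
  then obtain \<mu> \<nu> where m: "\<mu> \<in> jet_fibre E (Suc (mdim E)) x" "\<nu> \<in> jet_fibre E (Suc (mdim E)) x"
    "p = (B_map E Z x \<mu>, \<mu>)" "q = (B_map E Z x \<nu>, \<nu>)"
    by (auto simp: graph_of_def)
  obtain N F W H e k r where "gauge_frame E N F W H e k r" and x: "x \<in> N"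
    by (rule gauge_frame_exists)
  then interpret gauge_frame E N F W H e k r by simp
  note top = diff_form_top[OF vol_form, of x] and val = jet_value_in_fibre[OF x]
  show "omni_pairing p q = 0"
  proof
    fix \<delta>s
    have "\<nu> (B_map E Z x \<mu> # \<delta>s) + \<mu> (B_map E Z x \<nu> # \<delta>s) = 0"
    proof (cases "set \<delta>s \<subseteq> gauge_fibre E x \<and> length \<delta>s = mdim E")
      case True
      let ?t = "vol x (map (symbol_at E x) \<delta>s)"
      have "\<nu> (B_map E Z x \<mu> # \<delta>s) = ?t *\<^sub>R Z x (vol x) (jet_value x \<mu>) (jet_value x \<nu>)"
        "\<mu> (B_map E Z x \<nu> # \<delta>s) = ?t *\<^sub>R Z x (vol x) (jet_value x \<nu>) (jet_value x \<mu>)"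
        using True m jet_on_endo[OF x m(2) volume_endo[OF Z top val[OF m(1)]]]
          jet_on_endo[OF x m(1) volume_endo[OF Z top val[OF m(2)]]]
        by (simp_all add: B_map_eq[OF Z x])
      then show ?thesis
        using volume_antisym[OF Z top val[OF m(1)] val[OF m(2)]] by simp
    next
      case False
      then show ?thesis using jet_outside[OF x m(1)] jet_outside[OF x m(2)] by simp
    qed
    then show "omni_pairing p q \<delta>s = 0 \<delta>s" by (simp add: m omni_pairing_apply)
  qed
qed

text \<open>An element of a larger isotropic subbundle differs from one of the graph by an element of
  \<open>\<DD>E\<close> that is orthogonal to all jets, hence \<open>0\<close>.\<close>

lemma graph_maximal: "maximal_isotropic E (Suc (mdim E)) (graph_of E Z)"
  unfolding maximal_isotropic_def
proof (intro conjI allI impI graph_subbundle graph_isotropic)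
  fix L' assume "subbundle E (Suc (mdim E)) L' \<and> isotropic L' \<and> (\<forall>x. graph_of E Z x \<subseteq> L' x)"
  then have L': "\<And>x. subspace (L' x)" "\<And>x. L' x \<subseteq> omni_fibre E (Suc (mdim E)) x" "isotropic L'"
    "\<And>x. graph_of E Z x \<subseteq> L' x"
    unfolding subbundle_def by blast+
  have "L' x \<subseteq> graph_of E Z x" for x
  proof
    fix q assume q: "q \<in> L' x"
    obtain \<delta> \<nu> where q': "q = (\<delta>, \<nu>)" by (cases q)
    have \<delta>: "\<delta> \<in> gauge_fibre E x" and \<nu>: "\<nu> \<in> jet_fibre E (Suc (mdim E)) x"
      using q L'(2)[of x] by (auto simp: q' omni_fibre_def)
    let ?\<delta> = "\<delta> - B_map E Z x \<nu>"
    have "(B_map E Z x \<nu>, \<nu>) \<in> L' x" using L'(4)[of x] \<nu> by (auto simp: graph_iff)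
    then have diff: "(?\<delta>, 0) \<in> L' x"
      using subspace_diff[OF L'(1), of q x "(B_map E Z x \<nu>, \<nu>)"] q by (simp add: q')
    have "\<mu> (?\<delta> # \<delta>s) = 0" if \<mu>: "\<mu> \<in> jet_fibre E (Suc (mdim E)) x" for \<mu> \<delta>s
    proof -
      have "(B_map E Z x \<mu>, \<mu>) \<in> L' x" using L'(4)[of x] \<mu> by (auto simp: graph_iff)
      from isotropicD[OF L'(3) diff this, of \<delta>s] show ?thesis by simp
    qed
    moreover obtain N F W H e k r where "gauge_frame E N F W H e k r" and x: "x \<in> N"
      by (rule gauge_frame_exists)
    then interpret gauge_frame E N F W H e k r by simp
    have "?\<delta> \<in> gauge_fibre E x"
      using \<delta> B_map_in_gauge[OF Z \<nu>] by (rule subspace_diff[OF subspace_gauge])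
    ultimately have "?\<delta> = 0" using gauge_zero_if_jets_vanish[OF x] by blast
    then show "q \<in> graph_of E Z x" using \<nu> by (simp add: q' graph_iff)
  qed
  then show "L' = graph_of E Z" using L'(4) by (intro ext equalityI)
qed

end

end

section \<open>Isotropic subbundles projecting isomorphically\<close>

context nonzero_vector_bundle
begin

text \<open>At a point, the subbundle is the graph of a linear map \<open>b\<close>. Isotropy on the identity of \<open>E\<close>
  kills the symbol of \<open>b(\<mu>)\<close>, so \<open>b(\<mu>)\<close> is an endomorphism, and isotropy on horizontal vectors is the
  skew symmetry of the bracket that it defines.\<close>

lemma volume_at_point:
  assumes b: "linear_map_on (jet_fibre E (Suc (mdim E)) x) b"
    and gauge: "\<And>\<mu>. \<mu> \<in> jet_fibre E (Suc (mdim E)) x \<Longrightarrow> b \<mu> \<in> gauge_fibre E x"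
    and iso: "\<And>\<mu> \<nu> \<delta>s. \<mu> \<in> jet_fibre E (Suc (mdim E)) x \<Longrightarrow> \<nu> \<in> jet_fibre E (Suc (mdim E)) x \<Longrightarrow>
      \<nu> (b \<mu> # \<delta>s) + \<mu> (b \<nu> # \<delta>s) = 0"
  obtains Z where "linear_map_on (top_covectors E x) Z"
    "\<And>\<Omega>. \<Omega> \<in> top_covectors E x \<Longrightarrow> skew_bilinear_on (fibre E x) (Z \<Omega>)"
    "\<And>\<Omega> a c. \<Omega> \<notin> top_covectors E x \<or> a \<notin> fibre E x \<or> c \<notin> fibre E x \<Longrightarrow> Z \<Omega> a c = 0"
    "\<And>\<Omega> u v. \<Omega> \<in> diff_forms E (mdim E) \<Longrightarrow> u \<in> Gam E \<Longrightarrow> v \<in> Gam E \<Longrightarrow>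
      Z (\<Omega> x) (u x) (v x) = b (d_sigma E \<Omega> u x) v"
proof -
  obtain N F W H e k r where "gauge_frame E N F W H e k r" and x: "x \<in> N"
    by (rule gauge_frame_exists)
  then interpret gauge_frame E N F W H e k r by simp
  let ?J = "jet_fibre E (Suc (mdim E)) x" and ?V = "fibre E x" and ?T = "top_covectors E x"
  note val = jet_value_in_fibre[OF x]
  have symbol: "symbol_at E x (b \<mu>) = 0" if \<mu>: "\<mu> \<in> ?J" for \<mu>
  proof (cases "jet_value x \<mu> = 0")
    case True
    then have "\<mu> = 0" by (rule jet_zeroI[OF x \<mu>])
    then show ?thesis
      using linear_map_on_zero[OF b subspace_jet] linear_map_on_zero[OF symbol_at_linear subspace_gauge] by simp
  next
    case False
    show ?thesis
    proof (rule vol_nondegenerate[OF x symbol_at_tangent[OF gauge[OF \<mu>]]])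
      fix Xs assume Xs: "set Xs \<subseteq> tangent_space E x" "Suc (length Xs) = mdim E"
      obtain \<delta>s where ds: "set \<delta>s \<subseteq> gauge_fibre E x" "length \<delta>s = length Xs" "map (symbol_at E x) \<delta>s = Xs"
        by (rule lift_tangents[OF x Xs(1)])
      let ?t = "vol x (symbol_at E x (b \<mu>) # Xs)"
      have "\<mu> (b \<mu> # endo_incl E x (\<lambda>v. v) # \<delta>s) = - (?t *\<^sub>R jet_value x \<mu>)"
        using jet_on_identity[OF x \<mu> gauge[OF \<mu>] ds(1)] ds Xs(2) by simp
      \<comment> \<open>The pairing of \<open>b(\<mu>) + \<mu>\<close> with itself.\<close>
      with iso[OF \<mu> \<mu>, of "endo_incl E x (\<lambda>v. v) # \<delta>s"]
      have "- (?t *\<^sub>R jet_value x \<mu>) = - (- (?t *\<^sub>R jet_value x \<mu>))" by (simp add: add_eq_0_iff2)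
      from self_negative[OF this] show "?t = 0" using False by simp
    qed
  qed
  have endo: "\<exists>\<Phi>. \<Phi> \<in> endos E x \<and> b \<mu> = endo_incl E x \<Phi>" if "\<mu> \<in> ?J" for \<mu>
    using symbol_zero_endo[OF gauge[OF that] symbol[OF that]] by metis
  define \<Phi> where "\<Phi> \<mu> = (SOME \<Phi>. \<Phi> \<in> endos E x \<and> b \<mu> = endo_incl E x \<Phi>)" for \<mu>
  have \<Phi>: "\<Phi> \<mu> \<in> endos E x" "b \<mu> = endo_incl E x (\<Phi> \<mu>)" if "\<mu> \<in> ?J" for \<mu>
    using someI_ex[OF endo[OF that]] by (auto simp: \<Phi>_def)
  have b_apply: "b \<mu> v = \<Phi> \<mu> (v x)" if "\<mu> \<in> ?J" "v \<in> Gam E" for \<mu> v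
    using \<Phi>(2)[OF that(1)] that(2) by (simp add: endo_incl_def)
  have \<Phi>_combination: "\<Phi> (s *\<^sub>R \<mu> + t *\<^sub>R \<nu>) c = s *\<^sub>R \<Phi> \<mu> c + t *\<^sub>R \<Phi> \<nu> c"
    if m: "\<mu> \<in> ?J" "\<nu> \<in> ?J" and c: "c \<in> ?V" for s t \<mu> \<nu> c
  proof -
    obtain v where v: "v \<in> Gam E" "v x = c" using extend_to_section[OF c] by blast
    have "s *\<^sub>R \<mu> + t *\<^sub>R \<nu> \<in> ?J" using m by (intro subspace_add[OF subspace_jet] subspace_scale[OF subspace_jet])
    then show ?thesis
      using linear_map_on_combination[OF b subspace_jet m, of s t] b_apply[OF _ v(1)] m v(2)
      by (metis plus_fun_apply scaleR_fun_apply)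
  qed
  define jet where "jet a = d_sigma E vol (SOME u. u \<in> Gam E \<and> u x = a) x" for a
  have jet: "jet a \<in> ?J" "jet_value x (jet a) = a" if a: "a \<in> ?V" for a
  proof -
    have "\<exists>u. u \<in> Gam E \<and> u x = a" using extend_to_section[OF a] by metis
    from someI_ex[OF this] show "jet a \<in> ?J" "jet_value x (jet a) = a"
      using d_sigma_in_jet[OF x vol_form] jet_value_vol[OF x] by (auto simp: jet_def)
  qed
  have jet_combination: "jet (s *\<^sub>R a + t *\<^sub>R c) = s *\<^sub>R jet a + t *\<^sub>R jet c" if "a \<in> ?V" "c \<in> ?V" for s t a c
    using that jet subspace_add[OF fibre_subspace subspace_scale[OF fibre_subspace] subspace_scale[OF fibre_subspace]]
    by (intro jet_eqI[OF x] subspace_add[OF subspace_jet] subspace_scale[OF subspace_jet])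
      (simp_all add: jet_value_combination)
  define Z where "Z \<Omega> a c = (if \<Omega> \<in> ?T \<and> a \<in> ?V \<and> c \<in> ?V then \<Omega> (tangent_basis x) *\<^sub>R \<Phi> (jet a) c else 0)" for \<Omega> a c
  have Vcomb: "s *\<^sub>R a + t *\<^sub>R c \<in> ?V" if "a \<in> ?V" "c \<in> ?V" for s t a c
    using that by (intro subspace_add[OF fibre_subspace] subspace_scale[OF fibre_subspace])
  have sub_T: "subspace ?T" by (simp add: top_covectors_def subspace_alt_maps[OF subspace_UNIV])
  show thesis
  proof (rule that[of Z])
    show "linear_map_on ?T Z"
      unfolding linear_map_on_def
      using subspace_add[OF sub_T subspace_scale[OF sub_T] subspace_scale[OF sub_T]]
      by (auto simp: Z_def fun_eq_iff algebra_simps)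
    show "Z \<Omega> a c = 0" if "\<Omega> \<notin> ?T \<or> a \<notin> ?V \<or> c \<notin> ?V" for \<Omega> a c using that by (auto simp: Z_def)
    show "skew_bilinear_on ?V (Z \<Omega>)" if \<Omega>: "\<Omega> \<in> ?T" for \<Omega>
      unfolding skew_bilinear_on_def
    proof (intro conjI ballI)
      fix a assume a: "a \<in> ?V"
      note Ja = jet[OF a]
      show "linear_map_on ?V (Z \<Omega> a)"
        unfolding linear_map_on_def
        using \<Omega> a Vcomb linear_map_on_combination[OF endo_linear[OF \<Phi>(1)[OF Ja(1)]] fibre_subspace]
        by (simp add: Z_def algebra_simps)
      show "linear_map_on ?V (\<lambda>c. Z \<Omega> c a)"
        unfolding linear_map_on_def
        using \<Omega> a Vcomb jet \<Phi>_combination[OF jet(1) jet(1) a]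
        by (simp add: Z_def jet_combination algebra_simps)
      fix c assume c: "c \<in> ?V"
      note Jc = jet[OF c]
      show "Z \<Omega> a c \<in> ?V"
        using \<Omega> a c endo_in_fibre[OF \<Phi>(1)[OF Ja(1)] c] by (simp add: Z_def subspace_scale[OF fibre_subspace])
      have "\<Phi> (jet a) c + \<Phi> (jet c) a = 0"
        using iso[OF Ja(1) Jc(1), of "horizontal_basis x"] \<Phi>[OF Ja(1)] \<Phi>[OF Jc(1)]
          jet_on_endo_basis[OF x Jc(1) \<Phi>(1)[OF Ja(1)]] jet_on_endo_basis[OF x Ja(1) \<Phi>(1)[OF Jc(1)]] Ja(2) Jc(2)
        by simp
      then have "\<Phi> (jet a) c = - \<Phi> (jet c) a" by (simp add: add_eq_0_iff2)
      then show "Z \<Omega> a c = - Z \<Omega> c a" using \<Omega> a c by (simp add: Z_def)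
    qed
    fix \<Omega> u v assume \<Omega>: "\<Omega> \<in> diff_forms E (mdim E)" and u: "u \<in> Gam E" and v: "v \<in> Gam E"
    let ?t = "\<Omega> x (tangent_basis x)"
    have uv: "u x \<in> ?V" "v x \<in> ?V" using section_in_fibre u v by auto
    have "d_sigma E \<Omega> u x = ?t *\<^sub>R jet (u x)"
      using jet[OF uv(1)] d_sigma_in_jet[OF x \<Omega> u]
      by (intro jet_eqI[OF x] subspace_scale[OF subspace_jet]) (simp_all add: jet_value_d_sigma[OF \<Omega> u] jet_value_scale)
    then have "b (d_sigma E \<Omega> u x) = ?t *\<^sub>R b (jet (u x))"
      using linear_map_on_scale[OF b subspace_jet jet(1)[OF uv(1)]] by simp
    then show "Z (\<Omega> x) (u x) (v x) = b (d_sigma E \<Omega> u x) v"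
      using uv diff_form_top[OF \<Omega>] b_apply[OF jet(1)[OF uv(1)] v] by (simp add: Z_def)
  qed
qed

text \<open>Smoothness of the volume is where the inverse of the projection has to be smooth.\<close>

lemma isotropic_graph:
  assumes L: "subbundle E (Suc (mdim E)) L" "isotropic L" "projects_isomorphically E (Suc (mdim E)) L"
  shows "\<exists>Z\<in>volume_sections E. L = graph_of E Z"
proof -
  let ?J = "jet_fibre E (Suc (mdim E))"
  have sub: "subspace (L x)" and omni: "L x \<subseteq> omni_fibre E (Suc (mdim E)) x" for x
    using L(1) by (auto simp: subbundle_def)
  have bij: "bij_betw snd (L x) (?J x)" for x using L(3) by (simp add: projects_isomorphically_def)
  define b where "b x \<mu> = fst (inv_into (L x) snd \<mu>)" for x \<mu>
  have inv: "inv_into (L x) snd \<mu> = (b x \<mu>, \<mu>)" "(b x \<mu>, \<mu>) \<in> L x" if "\<mu> \<in> ?J x" for x \<mu>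
  proof -
    have "\<mu> \<in> snd ` L x" using that bij[of x] by (simp add: bij_betw_def)
    then have "inv_into (L x) snd \<mu> \<in> L x" "snd (inv_into (L x) snd \<mu>) = \<mu>"
      by (rule inv_into_into, rule f_inv_into_f)
    moreover from this(2) show "inv_into (L x) snd \<mu> = (b x \<mu>, \<mu>)"
      by (simp add: b_def prod_eq_iff)
    ultimately show "(b x \<mu>, \<mu>) \<in> L x" by simp
  qed
  have unique: "\<delta> = b x \<mu>" if "(\<delta>, \<mu>) \<in> L x" for x \<delta> \<mu>
  proof -
    have \<mu>: "\<mu> \<in> ?J x" using that omni[of x] by (auto simp: omni_fibre_def)
    have "inj_on snd (L x)" using bij[of x] by (simp add: bij_betw_def)
    from inj_onD[OF this _ that inv(2)[OF \<mu>]] show ?thesis by simp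
  qed
  have gauge: "b x \<mu> \<in> gauge_fibre E x" if "\<mu> \<in> ?J x" for x \<mu>
    using inv(2)[OF that] omni[of x] by (auto simp: omni_fibre_def)
  have lin: "linear_map_on (?J x) (b x)" for x
    unfolding linear_map_on_def
  proof (intro ballI allI)
    fix \<mu> \<nu> and s t :: real assume m: "\<mu> \<in> ?J x" "\<nu> \<in> ?J x"
    have "s *\<^sub>R (b x \<mu>, \<mu>) + t *\<^sub>R (b x \<nu>, \<nu>) \<in> L x"
      using inv(2)[OF m(1)] inv(2)[OF m(2)] by (intro subspace_add[OF sub] subspace_scale[OF sub])
    then have "(s *\<^sub>R b x \<mu> + t *\<^sub>R b x \<nu>, s *\<^sub>R \<mu> + t *\<^sub>R \<nu>) \<in> L x" by simp
    from unique[OF this] show "b x (s *\<^sub>R \<mu> + t *\<^sub>R \<nu>) = s *\<^sub>R b x \<mu> + t *\<^sub>R b x \<nu>" by simp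
  qed
  define P where "P x Z \<longleftrightarrow> linear_map_on (top_covectors E x) Z \<and>
    (\<forall>\<Omega>\<in>top_covectors E x. skew_bilinear_on (fibre E x) (Z \<Omega>)) \<and>
    (\<forall>\<Omega> a c. \<Omega> \<notin> top_covectors E x \<or> a \<notin> fibre E x \<or> c \<notin> fibre E x \<longrightarrow> Z \<Omega> a c = 0) \<and>
    (\<forall>\<Omega>\<in>diff_forms E (mdim E). \<forall>u\<in>Gam E. \<forall>v\<in>Gam E. Z (\<Omega> x) (u x) (v x) = b x (d_sigma E \<Omega> u x) v)" for x Z
  have "\<exists>Z. P x Z" for x
  proof -
    have iso: "\<nu> (b x \<mu> # \<delta>s) + \<mu> (b x \<nu> # \<delta>s) = 0" if "\<mu> \<in> ?J x" "\<nu> \<in> ?J x" for \<mu> \<nu> \<delta>s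
      by (rule isotropicD[OF L(2) inv(2)[OF that(1)] inv(2)[OF that(2)]])
    show ?thesis
    proof (rule volume_at_point[of x "b x"])
      show "linear_map_on (?J x) (b x)" by (rule lin)
      show "b x \<mu> \<in> gauge_fibre E x" if "\<mu> \<in> ?J x" for \<mu> by (rule gauge[OF that])
      show "\<nu> (b x \<mu> # \<delta>s) + \<mu> (b x \<nu> # \<delta>s) = 0" if "\<mu> \<in> ?J x" "\<nu> \<in> ?J x" for \<mu> \<nu> \<delta>s
        by (rule iso[OF that])
      fix Z
      assume "linear_map_on (top_covectors E x) Z"
        "\<And>\<Omega>. \<Omega> \<in> top_covectors E x \<Longrightarrow> skew_bilinear_on (fibre E x) (Z \<Omega>)"
        "\<And>\<Omega> a c. \<Omega> \<notin> top_covectors E x \<or> a \<notin> fibre E x \<or> c \<notin> fibre E x \<Longrightarrow> Z \<Omega> a c = 0"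
        "\<And>\<Omega> u v. \<Omega> \<in> diff_forms E (mdim E) \<Longrightarrow> u \<in> Gam E \<Longrightarrow> v \<in> Gam E \<Longrightarrow>
          Z (\<Omega> x) (u x) (v x) = b x (d_sigma E \<Omega> u x) v"
      then have "P x Z" unfolding P_def by blast
      then show ?thesis by blast
    qed
  qed
  then have "\<forall>x. \<exists>Z. P x Z" by blast
  from choice[OF this] obtain Z where "\<forall>x. P x (Z x)" ..
  then have PZ: "P x (Z x)" for x by (rule spec)
  have ZO: "Z x (\<Omega> x) (u x) (v x) = b x (d_sigma E \<Omega> u x) v"
    if "\<Omega> \<in> diff_forms E (mdim E)" "u \<in> Gam E" "v \<in> Gam E" for x \<Omega> u v
    using PZ[of x] that by (simp add: P_def)
  have smooth: "(\<lambda>x. Z x (\<Omega> x) (u x) (v x)) \<in> Gam E"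
    if \<Omega>: "\<Omega> \<in> diff_forms E (mdim E)" and u: "u \<in> Gam E" and v: "v \<in> Gam E" for \<Omega> u v
  proof -
    have jet: "d_sigma E \<Omega> u \<in> jet_sections_on E (Suc (mdim E)) UNIV" by (rule d_sigma_jet[OF \<Omega> u])
    then have "(\<lambda>x. inv_into (L x) snd (d_sigma E \<Omega> u x)) \<in> omni_sections_on E (Suc (mdim E)) UNIV"
      using L(3) unfolding projects_isomorphically_def by blast
    then have "(\<lambda>x. b x (d_sigma E \<Omega> u x)) \<in> gauge_sections_on E UNIV"
      by (simp add: omni_sections_on_def b_def)
    then show ?thesis
      using v ZO[OF \<Omega> u v] by (simp add: gauge_sections_on_def)
  qed
  have Z: "Z \<in> volume_sections E"
    unfolding volume_sections_def using PZ smooth by (auto simp: P_def)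
  have B: "B_map E Z x \<mu> = b x \<mu>" if \<mu>: "\<mu> \<in> ?J x" for x \<mu>
  proof -
    obtain N F W H e k r where "gauge_frame E N F W H e k r" and x: "x \<in> N"
      by (rule gauge_frame_exists)
    then interpret gauge_frame E N F W H e k r by simp
    obtain u where u: "u \<in> Gam E" "u x = jet_value x \<mu>"
      using extend_to_section[OF jet_value_in_fibre[OF x \<mu>]] by blast
    have eq: "\<mu> = d_sigma E vol u x" by (rule jet_eq_d_sigma[OF x \<mu> u])
    show ?thesis
    proof
      fix v
      show "B_map E Z x \<mu> v = b x \<mu> v"
      proof (cases "v \<in> Gam E")
        case True
        then show ?thesis
          using ZO[OF vol_form u(1) True, of x] unfolding eq by (simp add: B_map_d_sigma[OF Z vol_form u(1)] endo_incl_def)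
      next
        case False
        then show ?thesis
          using gauge_outside[OF gauge[OF \<mu>]] gauge_outside[OF B_map_in_gauge[OF Z \<mu>]] by simp
      qed
    qed
  qed
  have "L x = graph_of E Z x" for x
  proof (intro set_eqI iffI)
    fix q assume q: "q \<in> L x"
    obtain \<delta> \<mu> where q': "q = (\<delta>, \<mu>)" by (cases q)
    then have \<mu>: "\<mu> \<in> ?J x" using q omni[of x] by (auto simp: omni_fibre_def)
    with q q' unique[of \<delta> \<mu> x] show "q \<in> graph_of E Z x" by (simp add: graph_iff[OF Z] B)
  next
    fix q assume "q \<in> graph_of E Z x"
    then show "q \<in> L x" using inv(2) B by (cases q) (auto simp: graph_iff[OF Z])
  qed
  with Z show ?thesis by blast
qed


section \<open>Involutivity and the Jacobi identity\<close>

context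
  fixes Z assumes Z: "Z \<in> volume_sections E"
begin

lemma graph_section_iff: "(D, \<mu>) \<in> subbundle_sections E (Suc (mdim E)) (graph_of E Z) \<longleftrightarrow>
    D \<in> derivations E \<and> \<mu> \<in> jet_sections_on E (Suc (mdim E)) UNIV \<and> (\<forall>x. at_pt D x = B_map E Z x (\<mu> x))"
  using jet_section_at[of \<mu> "Suc (mdim E)" UNIV] by (auto simp: subbundle_sections_def graph_iff[OF Z])

text \<open>As sections of the jet bundle are closed, only \<open>[D, R] + d \<iota>\<^sub>D \<nu>\<close> is left of the bracket. At
  a point where \<open>\<mu>\<close> and \<open>\<nu>\<close> correspond to the vectors \<open>a\<close> and \<open>b\<close>, the form \<open>d \<iota>\<^sub>D \<nu>\<close> corresponds to
  the product \<open>ab\<close>, and \<open>[D, R]\<close> is the commutator of the multiplications with \<open>a\<close> and \<open>b\<close>.\<close>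

lemma graph_bracket:
  assumes s: "(D, \<mu>) \<in> subbundle_sections E (Suc (mdim E)) (graph_of E Z)"
    "(R, \<nu>) \<in> subbundle_sections E (Suc (mdim E)) (graph_of E Z)"
  obtains \<xi> where "omni_bracket E (Suc (mdim E)) (D, \<mu>) (R, \<nu>) = (commutator D R, \<xi>)"
    "\<xi> \<in> jet_sections_on E (Suc (mdim E)) UNIV"
    "\<And>N F W H e k r x. gauge_frame E N F W H e k r \<Longrightarrow> x \<in> N \<Longrightarrow>
      at_pt (commutator D R) x = B_map E Z x (\<xi> x) \<longleftrightarrow>
      (\<forall>c\<in>fibre E x. let br = Z x (det_form E F x);
          a = gauge_frame.jet_value E H x (\<mu> x); b = gauge_frame.jet_value E H x (\<nu> x)
        in br a (br b c) - br b (br a c) = br (br a b) c)"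
proof
  let ?m = "mdim E" and ?\<xi> = "dD E (mdim E) (insertion D \<nu>)"
  have D: "D \<in> derivations E" "\<mu> \<in> jet_sections_on E (Suc ?m) UNIV" "\<And>x. at_pt D x = B_map E Z x (\<mu> x)"
    and R: "R \<in> derivations E" "\<nu> \<in> jet_sections_on E (Suc ?m) UNIV" "\<And>x. at_pt R x = B_map E Z x (\<nu> x)"
    using s by (auto simp: graph_section_iff)
  note gf = jet_section_gform[OF R(2)]
  show "omni_bracket E (Suc ?m) (D, \<mu>) (R, \<nu>) = (commutator D R, ?\<xi>)"
    by (simp add: omni_bracket_def lie_deriv_def jet_section_closed[OF D(2)] jet_section_closed[OF R(2)]
        insertion_def insert_at_def fun_eq_iff)
  have ins: "insertion D \<nu> x = (\<lambda>\<delta>s. \<nu> x (at_pt D x # \<delta>s))" for x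
    by (simp add: insertion_def insert_at_def fun_eq_iff)
  have gform: "insertion D \<nu> \<in> gforms_on E ?m UNIV"
  proof -
    have "insertion D \<nu> x \<in> gform_fibre E ?m x" for x
      unfolding ins gform_fibre_def by (rule alt_maps_insert[OF gforms_alt[OF gf UNIV_I] derivation_at[OF D(1)]])
    moreover have "apply_form (insertion D \<nu>) Ds \<in> Gam E" if "Ds \<in> tuples ?m (derivations E)" for Ds
      unfolding apply_form_insertion using that D(1) by (intro gforms_value[OF gf]) (auto simp: tuples_def)
    ultimately show ?thesis by (simp add: gforms_on_def)
  qed
  have pb: "pulled_back x (insertion D \<nu> x)
      (\<lambda>Xs. det_form E F x Xs *\<^sub>R Z x (det_form E F x) (gauge_frame.jet_value E H x (\<mu> x)) (gauge_frame.jet_value E H x (\<nu> x)))"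
    if frame: "gauge_frame E N F W H e k r" and x: "x \<in> N" for N F W H e k r x
  proof -
    interpret gauge_frame E N F W H e k r by (rule frame)
    let ?a = "jet_value x (\<mu> x)" and ?b = "jet_value x (\<nu> x)"
    note \<mu> = jet_section_at[OF D(2) UNIV_I, of x] and \<nu> = jet_section_at[OF R(2) UNIV_I, of x]
    note endo = volume_endo[OF Z diff_form_top[OF vol_form] jet_value_in_fibre[OF x \<mu>]]
    have "Z x (vol x) ?a ?b \<in> fibre E x" by (rule endo_in_fibre[OF endo jet_value_in_fibre[OF x \<nu>]])
    moreover have "insertion D \<nu> x \<delta>s = vol x (map (symbol_at E x) \<delta>s) *\<^sub>R Z x (vol x) ?a ?b"
      if "\<delta>s \<in> tuples ?m (gauge_fibre E x)" for \<delta>s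
      using jet_on_endo[OF x \<nu> endo, of \<delta>s] that \<mu>
      by (simp add: ins D(3) B_map_eq[OF Z x] tuples_def)
    ultimately have "pulled_back x (insertion D \<nu> x) (\<lambda>Xs. vol x Xs *\<^sub>R Z x (vol x) ?a ?b)"
      unfolding pulled_back_def using alt_maps_tensor[OF vol_alt fibre_subspace] by blast
    then show ?thesis by (simp add: vol_def)
  qed
  have pb_ex: "\<exists>\<eta>. pulled_back x (insertion D \<nu> x) \<eta>" for x
    using gauge_frame_exists[of x] pb by metis
  show jet: "?\<xi> \<in> jet_sections_on E (Suc ?m) UNIV"
    by (rule dD_pulled_back_jet[OF gform pb_ex])
  fix N F W H e k r x assume frame: "gauge_frame E N F W H e k r" and x: "x \<in> N"
  interpret gauge_frame E N F W H e k r by (rule frame)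
  let ?a = "jet_value x (\<mu> x)" and ?b = "jet_value x (\<nu> x)" and ?br = "Z x (vol x)"
  note \<mu> = jet_section_at[OF D(2) UNIV_I, of x] and \<nu> = jet_section_at[OF R(2) UNIV_I, of x]
    and \<xi> = jet_section_at[OF jet UNIV_I, of x]
  have val: "jet_value x (?\<xi> x) = ?br ?a ?b"
    using jet_value_symbol_part[OF dD_pulled_back_symbol_part[OF gform pb_ex pb[OF frame x]]] vol_basis[OF x]
    by (simp add: vol_def)
  have Du: "D u x = ?br ?a (u x)" "R u x = ?br ?b (u x)" if "u \<in> Gam E" for u
  proof -
    have "at_pt D x u = ?br ?a (u x)" "at_pt R x u = ?br ?b (u x)"
      using that \<mu> \<nu> by (simp_all add: D(3) R(3) B_map_eq[OF Z x] endo_incl_def)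
    then show "D u x = ?br ?a (u x)" "R u x = ?br ?b (u x)" by (simp_all add: at_pt_def)
  qed
  have "at_pt (commutator D R) x = B_map E Z x (?\<xi> x) \<longleftrightarrow>
    (\<forall>u\<in>Gam E. at_pt (commutator D R) x u = B_map E Z x (?\<xi> x) u)"
    using gauge_outside[OF derivation_at[OF commutator_derivation[OF D(1) R(1)]], of _ x]
      gauge_outside[OF B_map_in_gauge[OF Z \<xi>]] by (auto simp: fun_eq_iff)
  also have "\<dots> \<longleftrightarrow> (\<forall>u\<in>Gam E. ?br ?a (?br ?b (u x)) - ?br ?b (?br ?a (u x)) = ?br (?br ?a ?b) (u x))"
  proof (intro ball_cong refl)
    fix u assume u: "u \<in> Gam E"
    have "at_pt (commutator D R) x u = ?br ?a (?br ?b (u x)) - ?br ?b (?br ?a (u x))"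
      using Du[OF u] Du(1)[OF derivation_section[OF R(1) u]] Du(2)[OF derivation_section[OF D(1) u]]
      by (simp add: at_pt_def commutator_def)
    moreover have "B_map E Z x (?\<xi> x) u = ?br (?br ?a ?b) (u x)"
      using u \<xi> by (simp add: B_map_eq[OF Z x] endo_incl_def val)
    ultimately show "(at_pt (commutator D R) x u = B_map E Z x (?\<xi> x) u) =
        (?br ?a (?br ?b (u x)) - ?br ?b (?br ?a (u x)) = ?br (?br ?a ?b) (u x))" by simp
  qed
  also have "\<dots> \<longleftrightarrow> (\<forall>c\<in>fibre E x. ?br ?a (?br ?b c) - ?br ?b (?br ?a c) = ?br (?br ?a ?b) c)"
  proof (intro iffI ballI)
    fix c assume *: "\<forall>u\<in>Gam E. ?br ?a (?br ?b (u x)) - ?br ?b (?br ?a (u x)) = ?br (?br ?a ?b) (u x)"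
      and c: "c \<in> fibre E x"
    obtain u where u: "u \<in> Gam E" "u x = c" using extend_to_section[OF c] by blast
    show "?br ?a (?br ?b c) - ?br ?b (?br ?a c) = ?br (?br ?a ?b) c"
      using bspec[OF * u(1)] unfolding u(2) .
  next
    fix u assume *: "\<forall>c\<in>fibre E x. ?br ?a (?br ?b c) - ?br ?b (?br ?a c) = ?br (?br ?a ?b) c"
      and u: "u \<in> Gam E"
    show "?br ?a (?br ?b (u x)) - ?br ?b (?br ?a (u x)) = ?br (?br ?a ?b) (u x)"
      by (rule bspec[OF * section_in_fibre[OF u UNIV_I]])
  qed
  finally show "at_pt (commutator D R) x = B_map E Z x (?\<xi> x) \<longleftrightarrow>
      (\<forall>c\<in>fibre E x. let br = Z x (det_form E F x); a = ?a; b = ?b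
        in br a (br b c) - br b (br a c) = br (br a b) c)"
    by (simp add: vol_def Let_def)
qed

text \<open>The form of the Jacobi identity that the bracket of sections produces.\<close>

lemma jacobi_as_derivation:
  assumes "\<Omega> \<in> top_covectors E x" "a \<in> fibre E x" "b \<in> fibre E x" "c \<in> fibre E x"
  defines "br \<equiv> Z x \<Omega>"
  shows "br a (br b c) + br b (br c a) + br c (br a b) = 0 \<longleftrightarrow> br a (br b c) - br b (br a c) = br (br a b) c"
proof -
  have V: "br u v \<in> fibre E x" if "u \<in> fibre E x" "v \<in> fibre E x" for u v
    using endo_in_fibre[OF volume_endo[OF Z assms(1) that(1)] that(2)] by (simp add: br_def)
  have "br b (br c a) = br b (- br a c)"
    using volume_antisym[OF Z assms(1,4,2)] by (simp add: br_def)
  also have "\<dots> = - br b (br a c)"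
    using linear_map_on_minus[OF endo_linear[OF volume_endo[OF Z assms(1,3)]] fibre_subspace V[OF assms(2,4)]]
    by (simp add: br_def)
  finally have "br b (br c a) = - br b (br a c)" .
  moreover have "br c (br a b) = - br (br a b) c"
    using volume_antisym[OF Z assms(1,4) V[OF assms(2,3)]] by (simp add: br_def)
  ultimately show ?thesis by (simp add: algebra_simps)
qed

text \<open>These sections realise every pair of vectors at a point, which is how involutivity yields the
  Jacobi identity at that point.\<close>

lemma multiplication_section:
  assumes \<Omega>: "\<Omega> \<in> diff_forms E (mdim E)" and u: "u \<in> Gam E"
  defines "D \<equiv> \<lambda>v. if v \<in> Gam E then (\<lambda>x. Z x (\<Omega> x) (u x) (v x)) else 0"
  shows "(D, d_sigma E \<Omega> u) \<in> subbundle_sections E (Suc (mdim E)) (graph_of E Z)"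
proof -
  note lin = endo_linear[OF volume_endo[OF Z diff_form_top[OF \<Omega>] section_in_fibre[OF u UNIV_I]]]
  have sym: "symbol_of D (\<lambda>g x. 0)"
    unfolding symbol_of_def
  proof (intro conjI ballI vector_field_zero)
    fix f v assume "f \<in> C_inf E" "v \<in> Gam E"
    then show "D (\<lambda>y. f y *\<^sub>R v y) = (\<lambda>y. 0 *\<^sub>R v y + f y *\<^sub>R D v y)"
      using sections_on_mult[of f UNIV v] linear_map_on_scale[OF lin fibre_subspace section_in_fibre]
      by (simp add: D_def)
  qed
  then have "\<exists>X. symbol_of D X" by blast
  moreover have "linear_map_on (Gam E) D"
    unfolding linear_map_on_def
  proof (intro ballI allI ext)
    fix v w and a b :: real and x assume vw: "v \<in> Gam E" "w \<in> Gam E"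
    have "a *\<^sub>R v + b *\<^sub>R w \<in> Gam E" using vw by (intro subspace_add[OF subspace_Gam] subspace_scale[OF subspace_Gam])
    then show "D (a *\<^sub>R v + b *\<^sub>R w) x = (a *\<^sub>R D v + b *\<^sub>R D w) x"
      using vw linear_map_on_combination[OF lin fibre_subspace section_in_fibre[OF vw(1) UNIV_I] section_in_fibre[OF vw(2) UNIV_I]]
      by (simp add: D_def)
  qed
  ultimately have "D \<in> derivations E"
    using volume_smooth[OF Z \<Omega> u] by (simp add: derivations_iff D_def)
  moreover have "at_pt D x = B_map E Z x (d_sigma E \<Omega> u x)" for x
    by (simp add: B_map_d_sigma[OF Z \<Omega> u]) (simp add: at_pt_def D_def endo_incl_def fun_eq_iff)
  ultimately show ?thesis
    using d_sigma_jet[OF \<Omega> u] by (simp add: graph_section_iff)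
qed

lemma involutive_iff: "involutive E (Suc (mdim E)) (graph_of E Z) \<longleftrightarrow> volume_lie E Z"
proof
  let ?S = "subbundle_sections E (Suc (mdim E)) (graph_of E Z)"
  assume inv: "involutive E (Suc (mdim E)) (graph_of E Z)"
  show "volume_lie E Z"
    unfolding volume_lie_def lie_bracket_on_def
  proof (intro ballI allI conjI)
    fix \<Omega> x assume \<Omega>: "\<Omega> \<in> diff_forms E (mdim E)"
    note top = diff_form_top[OF \<Omega>, of x]
    show "skew_bilinear_on (fibre E x) (Z x (\<Omega> x))" by (rule volume_skew[OF Z top])
    fix a b c assume abc: "a \<in> fibre E x" "b \<in> fibre E x" "c \<in> fibre E x"
    obtain N F W H e k r where frame: "gauge_frame E N F W H e k r" and x: "x \<in> N"
      by (rule gauge_frame_exists)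
    interpret gauge_frame E N F W H e k r by (rule frame)
    note topv = diff_form_top[OF vol_form, of x]
    obtain u where u: "u \<in> Gam E" "u x = a" using extend_to_section[OF abc(1)] by blast
    obtain v where v: "v \<in> Gam E" "v x = b" using extend_to_section[OF abc(2)] by blast
    obtain D where D: "(D, d_sigma E vol u) \<in> ?S" using multiplication_section[OF vol_form u(1)] by blast
    obtain R where R: "(R, d_sigma E vol v) \<in> ?S" using multiplication_section[OF vol_form v(1)] by blast
    obtain \<xi> where \<xi>: "omni_bracket E (Suc (mdim E)) (D, d_sigma E vol u) (R, d_sigma E vol v) = (commutator D R, \<xi>)"
      "at_pt (commutator D R) x = B_map E Z x (\<xi> x) \<longleftrightarrow>
        (\<forall>c\<in>fibre E x. let br = Z x (det_form E F x); a = jet_value x (d_sigma E vol u x); b = jet_value x (d_sigma E vol v x)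
          in br a (br b c) - br b (br a c) = br (br a b) c)"
      using graph_bracket[OF D R] frame x by metis
    have "(commutator D R, \<xi>) \<in> ?S" using inv D R \<xi>(1) unfolding involutive_def by metis
    then have "at_pt (commutator D R) x = B_map E Z x (\<xi> x)" by (simp add: graph_section_iff)
    then have "Z x (vol x) a (Z x (vol x) b c) - Z x (vol x) b (Z x (vol x) a c) = Z x (vol x) (Z x (vol x) a b) c"
      using \<xi>(2) abc(3) jet_value_vol[OF x u(1)] jet_value_vol[OF x v(1)] u v by (simp add: Let_def vol_def)
    then have jac: "Z x (vol x) a (Z x (vol x) b c) + Z x (vol x) b (Z x (vol x) c a) + Z x (vol x) c (Z x (vol x) a b) = 0"
      using jacobi_as_derivation[OF topv abc] by simp
    \<comment> \<open>At \<open>x\<close> the form \<open>\<Omega>\<close> is a multiple of the volume form, and the Jacobi identity is homogeneous.\<close>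
    let ?t = "\<Omega> x (tangent_basis x)"
    have "Z x (\<Omega> x) = Z x (?t *\<^sub>R vol x)" by (rule arg_cong[OF top_covector_eq[OF x top]])
    also have "\<dots> = ?t *\<^sub>R Z x (vol x)"
      by (rule linear_map_on_scale[OF volume_linear[OF Z] _ topv]) (simp add: top_covectors_def subspace_alt_maps[OF subspace_UNIV])
    finally have ZO: "Z x (\<Omega> x) p q = ?t *\<^sub>R Z x (vol x) p q" for p q by simp
    have nested: "Z x (\<Omega> x) p (Z x (\<Omega> x) q s) = (?t * ?t) *\<^sub>R Z x (vol x) p (Z x (vol x) q s)"
      if "p \<in> fibre E x" "q \<in> fibre E x" "s \<in> fibre E x" for p q s
      unfolding ZO using linear_map_on_scale[OF endo_linear[OF volume_endo[OF Z topv that(1)]] fibre_subspace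
          endo_in_fibre[OF volume_endo[OF Z topv that(2)] that(3)]] by simp
    show "Z x (\<Omega> x) a (Z x (\<Omega> x) b c) + Z x (\<Omega> x) b (Z x (\<Omega> x) c a) + Z x (\<Omega> x) c (Z x (\<Omega> x) a b) = 0"
      using jac abc by (simp add: nested flip: scaleR_add_right)
  qed
next
  let ?S = "subbundle_sections E (Suc (mdim E)) (graph_of E Z)"
  assume lie: "volume_lie E Z"
  show "involutive E (Suc (mdim E)) (graph_of E Z)"
    unfolding involutive_def
  proof (intro ballI)
    fix p q assume pq: "p \<in> ?S" "q \<in> ?S"
    obtain D \<mu> R \<nu> where p: "p = (D, \<mu>)" and q: "q = (R, \<nu>)" by (cases p, cases q)
    have s: "(D, \<mu>) \<in> ?S" "(R, \<nu>) \<in> ?S" using pq p q by auto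
    obtain \<xi> where \<xi>: "omni_bracket E (Suc (mdim E)) (D, \<mu>) (R, \<nu>) = (commutator D R, \<xi>)"
      "\<xi> \<in> jet_sections_on E (Suc (mdim E)) UNIV"
      and eq: "\<And>N F W H e k r x. gauge_frame E N F W H e k r \<Longrightarrow> x \<in> N \<Longrightarrow>
        at_pt (commutator D R) x = B_map E Z x (\<xi> x) \<longleftrightarrow>
        (\<forall>c\<in>fibre E x. let br = Z x (det_form E F x);
            a = gauge_frame.jet_value E H x (\<mu> x); b = gauge_frame.jet_value E H x (\<nu> x)
          in br a (br b c) - br b (br a c) = br (br a b) c)"
      by (rule graph_bracket[OF s]) (rule that)
    have "at_pt (commutator D R) x = B_map E Z x (\<xi> x)" for x
    proof -
      obtain N F W H e k r where frame: "gauge_frame E N F W H e k r" and x: "x \<in> N"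
        by (rule gauge_frame_exists)
      interpret gauge_frame E N F W H e k r by (rule frame)
      have m: "\<mu> x \<in> jet_fibre E (Suc (mdim E)) x" "\<nu> x \<in> jet_fibre E (Suc (mdim E)) x"
        using s jet_section_at by (auto simp: graph_section_iff)
      have "lie_bracket_on (fibre E x) (Z x (vol x))" using lie vol_form by (simp add: volume_lie_def)
      then show ?thesis
        unfolding eq[OF frame x]
        using jacobi_as_derivation[OF diff_form_top[OF vol_form] jet_value_in_fibre[OF x m(1)] jet_value_in_fibre[OF x m(2)]]
          jet_value_in_fibre[OF x m(1)] jet_value_in_fibre[OF x m(2)]
        by (simp add: lie_bracket_on_def Let_def vol_def)
    qed
    then show "omni_bracket E (Suc (mdim E)) p q \<in> ?S"
      using s \<xi> commutator_derivation by (simp add: p q graph_section_iff)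
  qed
qed

end

end

theorem theorem3p8:
  fixes E :: "('p::{t2_space,second_countable_topology}, 'v::real_vector) vbundle"
    and m n :: nat
  assumes "smooth_vector_bundle E"
    and "\<forall>x. fibre E x \<noteq> {0}"
    and "m = mdim E" and "n = m + 1"
  shows "(\<forall>Z\<in>volume_sections E. maximal_isotropic E n (graph_of E Z)) \<and>
    (\<forall>L. subbundle E n L \<and> isotropic L \<and> projects_isomorphically E n L
       \<longrightarrow> (\<exists>Z\<in>volume_sections E. L = graph_of E Z)) \<and>
    (\<forall>Z\<in>volume_sections E.
       (involutive E n (graph_of E Z) \<longleftrightarrow> volume_lie E Z) \<and>
       (higher_dirac_jacobi E n (graph_of E Z) \<longleftrightarrow> volume_lie E Z))"
proof -
  interpret nonzero_vector_bundle E
    by unfold_locales (use assms in auto)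
  have n: "n = Suc (mdim E)" using assms by simp
  show ?thesis
    unfolding n higher_dirac_jacobi_def
    using graph_maximal isotropic_graph involutive_iff by blast
qed

end
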